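(* Let $W$ be a random variable with values in $(0,1)$ and nondegenerate law (no density is assumed), and let $T_n$ be the product of cycle lengths of the random permutation $\Pi_n$ derived from $W$. Put $$b_n=\mu^{-1}\bigg(2^{-1}\log^2 n-\int_0^{\log n}\int_0^z \mathbb{P}\{|\log (1-W)|>x\}\,dx\,dz\bigg).$$ (a) If $\sigma^2<\infty$ then, with $a_n=((3\mu^3)^{-1}\sigma^2\log^3 n)^{1/2}$, the limiting distribution (as $n\to\infty$) of $(\log T_n-b_n)/a_n$ is standard normal. (b) If $\sigma^2=\infty$ and $$\int_0^x y^2\, \mathbb{P}\{|\log W|\in dy\} \sim \ell(x), \quad x\to \infty,$$ for some $\ell$ slowly varying at $\infty$, then, with $a_n=(3\mu^3)^{-1/2} c_{\lfloor\log n\rfloor}\log n$, where $(c_n)$ is any positive sequence satisfying $\lim_{n\to\infty} n\ell(c_n)/c_n^2=1$, the limiting distribution of $(\log T_n-b_n)/a_n$ is standard normal. (c) If $$\mathbb{P}\{|\log W|>x \} \sim x^{-\alpha}\ell(x), \quad x\to \infty,$$ for some $\ell$ slowly varying at $\infty$ and $\alpha\in (1,2)$ then, with $a_n=((\alpha+1)\mu^{\alpha+1})^{-1/\alpha} c_{\lfloor\log n\rfloor}\log n$, where $(c_n)$ is any positive sequence satisfying $\lim_{n\to\infty} n\ell(c_n)/c_n^\alpha=1$, the limiting distribution of $(\log T_n-b_n)/a_n$ is the $\alpha$-stable law with characteristic function $$u\mapsto \exp\{-|u|^\alpha \Gamma(1-\alpha)(\cos(\pi\alpha/2)+i\sin(\pi\alpha/2)\,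 \mathrm{sgn}(u))\}, \quad u\in\mathbb{R}.$$
   Context: Let $W$ be a random variable with values in $(0,1)$ (the stick-breaking factor), let $W_1,W_2,\dots$ be independent copies of $W$, and set $Q_0:=1$, $Q_j:=\prod_{i=1}^j W_i$ for $j\in\mathbb{N}$. The intervals $(Q_{j+1},Q_j]$, $j\ge 0$, partition $(0,1]$. Let $U_1,\dots,U_n$ be a sample of independent uniform $[0,1]$ variables, independent of $(Q_j)$. The random permutation $\Pi_n$ of $[n]:=\{1,\dots,n\}$ is defined as follows: $(i_1\ \dots\ i_\ell)$ is a cycle of $\Pi_n$ if $U_{i_1}<\dots<U_{i_\ell}$, these points all fall in the same interval $(Q_{j+1},Q_j]$, and no other points among $U_1,\dots,U_n$ fall in this interval. Let $K_{n,r}$ be the number of cycles of $\Pi_n$ of length $r$ (equivalently, the number of intervals $(Q_{j+1},Q_j]$, $j\ge0$, containing exactly $r$ of the points $U_1,\dots,U_n$). The product of the cycle lengths of $\Pi_n$ is $T_n:=\prod_{r=1}^n r^{K_{n,r}}$. Notation: $\mu:=\mathbb{E}|\log W|$, $\sigma^2:=\mathrm{Var}(\log W)$ (possibly infinite). A function $\ell:(0,\infty)\to(0,\infty)$ is slowly varying at $\infty$ if $\lim_{x\to\infty}\ell(\lambda x)/\ell(x)=1$ for all $\lambda>0$. The notation $g(x)\sim h(x)$ means $g(x)/h(x)\to1$.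
   Formalization: In (b) and (c) the sequence c_n is additionally required to tend to infinity; without this the claim fails, e.g. if ℓ(x)=x^{α+1} for x<1 (α=2 in (b)), then c_n=1/n satisfies the norming relation but gives a wrong normalization. *)

theory Defs
  imports "HOL-Probability.Probability" "HOL-Combinatorics.Combinatorics"
begin

section \<open>The permutation built from stick-breaking factors and sample points\<close>

text \<open>Factors \<open>w\<close> and sample points \<open>u\<close> are indexed from 1, as the elements of \<open>[n] = {1..n}\<close>.\<close>

definition stick_Q :: "(nat \<Rightarrow> real) \<Rightarrow> nat \<Rightarrow> real" where
  "stick_Q w j = (\<Prod>i = 1..j. w i)"

definition stick_interval :: "(nat \<Rightarrow> real) \<Rightarrow> nat \<Rightarrow> real set" where
  "stick_interval w j = {stick_Q w (Suc j) <.. stick_Q w j}"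

definition stick_cycles :: "(nat \<Rightarrow> real) \<Rightarrow> (nat \<Rightarrow> real) \<Rightarrow> nat \<Rightarrow> nat list set" where
  "stick_cycles w u n =
     {is. is \<noteq> [] \<and> sorted_wrt (\<lambda>i k. u i < u k) is \<and>
          (\<exists>j. set is = {i \<in> {1..n}. u i \<in> stick_interval w j})}"

text \<open>
  When all \<open>w i\<close> lie in \<open>(0,1)\<close>, the list chosen by \<open>THE\<close> is unique.  The convention that an index
  in no list is a fixed point concerns only \<open>i > n\<close> and an event of probability zero (ties
  among the \<open>u i\<close>, points outside \<open>(0,1]\<close>, products not tending to 0).
\<close>

definition stick_perm :: "(nat \<Rightarrow> real) \<Rightarrow> (nat \<Rightarrow> real) \<Rightarrow> nat \<Rightarrow> nat \<Rightarrow> nat" where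
  "stick_perm w u n i =
     (if \<exists>is \<in> stick_cycles w u n. i \<in> set is
      then cycle_of_list (THE is. is \<in> stick_cycles w u n \<and> i \<in> set is) i
      else i)"

text \<open>Number of cycles of length \<open>r\<close> of a permutation of \<open>[n]\<close>, fixed points being cycles of length 1.\<close>

definition num_cycles :: "(nat \<Rightarrow> nat) \<Rightarrow> nat \<Rightarrow> nat \<Rightarrow> nat" where
  "num_cycles p n r = card {C \<in> orbit p ` {1..n}. card C = r}"

definition cycle_length_prod :: "(nat \<Rightarrow> nat) \<Rightarrow> nat \<Rightarrow> nat" where
  "cycle_length_prod p n = (\<Prod>r = 1..n. r ^ num_cycles p n r)"


section \<open>Moments and the centering sequence\<close>

definition mean_abs_log :: "'a measure \<Rightarrow> ('a \<Rightarrow> real) \<Rightarrow> real" where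
  "mean_abs_log M W = (\<integral>\<omega>. \<bar>ln (W \<omega>)\<bar> \<partial>M)"

text \<open>
  The variance as an extended number.  If \<open>ln W\<close> is not integrable, its Bochner integral
  is 0 by convention and the value is \<open>\<infinity>\<close>, as it should be.
\<close>

definition var_log :: "'a measure \<Rightarrow> ('a \<Rightarrow> real) \<Rightarrow> ennreal" where
  "var_log M W = (\<integral>\<^sup>+\<omega>. ennreal ((ln (W \<omega>) - (\<integral>\<omega>'. ln (W \<omega>') \<partial>M))\<^sup>2) \<partial>M)"

definition centering :: "'a measure \<Rightarrow> ('a \<Rightarrow> real) \<Rightarrow> nat \<Rightarrow> real" where
  "centering M W n =
     ((ln (real n))\<^sup>2 / 2
       - (LBINT z:{0..ln (real n)}. LBINT x:{0..z}.
            measure M {\<omega> \<in> space M. \<bar>ln (1 - W \<omega>)\<bar> > x}))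
     / mean_abs_log M W"


section \<open>Slow variation\<close>

definition slowly_varying :: "(real \<Rightarrow> real) \<Rightarrow> bool" where
  "slowly_varying l \<longleftrightarrow>
     (\<forall>x>0. l x > 0) \<and> (\<forall>c>0. ((\<lambda>x. l (c * x) / l x) \<longlongrightarrow> 1) at_top)"

end

theory Submission
  imports Defs "HOL-Real_Asymp.Real_Asymp"
begin

text \<open>
  Write \<open>\<xi>\<^sub>j = \<bar>ln W\<^sub>j\<bar>\<close>, \<open>\<eta>\<^sub>j = \<bar>ln (1 - W\<^sub>j)\<bar>\<close>, \<open>t = ln n\<close>, and let \<open>S\<^sub>j\<close> be the random walk with steps \<open>\<xi>\<close>.  The
  cycle lengths are the numbers of sample points in the boxes, and given the sticks the expected
  number of points in the \<open>j\<close>-th box is \<open>exp (t - S\<^sub>j - \<eta>\<^sub>j)\<close>.  Binomial concentration gives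
  \<open>ln T\<^sub>n = \<Sum>\<^sub>j max 0 (t - S\<^sub>j - \<eta>\<^sub>j)\<close> up to an \<open>L\<^sup>1\<close> error of order \<open>t\<close>, which is negligible.  Replacing \<open>\<eta>\<^sub>j\<close> by
  conditional means produces the double integral in the centering, and by the law of large numbers
  the rest is \<open>\<Sum> (t - S\<^sub>j)\<close> over \<open>j < m\<close> with \<open>m = t / \<mu>\<close>, that is, a constant minus \<open>\<Sum> (S\<^sub>j - j \<mu>)\<close>.
  The last sum is a sum of independent centered variables with linearly growing weights, so its
  characteristic function is a product \<open>\<Prod>\<^sub>k \<phi> (u k / (t d))\<close> over \<open>k < m\<close>.  If \<open>1 - \<phi>\<close> is asymptotic to a constant
  times a regularly varying function \<open>g\<close> of index \<open>\<alpha>\<close> and \<open>t g (1 / d)\<close> tends to 1, the logarithm of this product is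
  a Riemann sum for a multiple of the integral of \<open>(u x) powr \<alpha>\<close>.
\<close>

section \<open>Cycles and boxes\<close>

text \<open>The normalization is a constant times \<open>t d\<close> with \<open>d\<close> tending
  to infinity, so an error of bounded mean in each of the O(t) relevant boxes is harmless. Three
  obstacles shape the rest. First, \<open>\<xi>\<^sub>j\<close> and \<open>\<eta>\<^sub>j\<close>
  stem from the same factor and may be dependent, and \<open>\<eta>\<^sub>j\<close> may have no
  moments. It is, however, independent of \<open>S\<^sub>j\<close>, and it exceeds any level tending
  to infinity with vanishing probability; cutting it off at such a level replaces a moment bound.
  Second, the steps may have infinite variance, so \<open>S\<^sub>j - j \<mu>\<close> is controlled
  in mean only, by truncating the steps at the level \<open>d\<close>. Third, the number of partial
  sums below \<open>t\<close> is random. The summands near the end of the range are only of order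
  \<open>d\<close>, so a law of large numbers for that number is precise enough. The three regimes
  enter through the function \<open>g\<close> alone: s^2, E min(1, (s \<xi>)^2) and P(\<xi> > 1/s)
  for s > 0. The stable law is not constructed beforehand: it arises as a weak limit along a
  subsequence and is recognized by its characteristic function.\<close>

definition stick_box :: "(nat \<Rightarrow> real) \<Rightarrow> (nat \<Rightarrow> real) \<Rightarrow> nat \<Rightarrow> nat \<Rightarrow> nat set" where
  "stick_box w u n j = {i \<in> {1..n}. u i \<in> stick_interval w j}"

lemma stick_box_subset: "stick_box w u n j \<subseteq> {1..n}"
  by (auto simp: stick_box_def)

lemma finite_stick_box [simp]: "finite (stick_box w u n j)"
  by (rule finite_subset[OF stick_box_subset]) simp

text \<open>The k-th iterate of a cycle shifts positions in the list by k modulo its length, so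
  every entry is reached from every other. Agreement of \<open>p\<close> with the cycle on the
  entries is enough because the entries are never left.\<close>

lemma orbit_eq_set_of_cycle:
  assumes "distinct cs" "x \<in> set cs" "\<And>y. y \<in> set cs \<Longrightarrow> p y = cycle_of_list cs y"
  shows "orbit p x = set cs"
proof -
  have fp: "(p ^^ k) y = (cycle_of_list cs ^^ k) y \<and> (p ^^ k) y \<in> set cs" if "y \<in> set cs" for k y
  proof (induction k)
    case (Suc k)
    have "cycle_of_list cs z \<in> set cs" if "z \<in> set cs" for z
      using cycle_is_surj[OF assms(1)] that by blast
    then show ?case using Suc assms(3) by auto
  qed (use that in auto)
  show ?thesis
  proof (intro equalityI subsetI)
    fix y assume "y \<in> orbit p x"
    then show "y \<in> set cs" using fp[OF assms(2)] unfolding orbit_altdef by blast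
  next
    fix y assume "y \<in> set cs"
    then obtain b where b: "b < length cs" "y = cs ! b" by (auto simp: in_set_conv_nth)
    obtain a where a: "a < length cs" "x = cs ! a" using assms(2) by (auto simp: in_set_conv_nth)
    \<comment> \<open>The full extra turn keeps the exponent a natural number and makes it positive,
      as orbits consist of iterates with positive exponents.\<close>
    define k where "k = length cs + b - a"
    have "(cycle_of_list cs ^^ k) x = map (cycle_of_list cs ^^ k) cs ! a" using a by simp
    also have "\<dots> = rotate k cs ! a" using cyclic_rotation[OF assms(1)] by simp
    also have "\<dots> = cs ! ((k + a) mod length cs)" using a by (simp add: nth_rotate add.commute)
    also have "(k + a) mod length cs = b" using a b by (simp add: k_def)
    finally have "(p ^^ k) x = y" using fp[OF assms(2)] b by simp
    moreover have "k > 0" using a by (simp add: k_def)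
    ultimately show "y \<in> orbit p x" by (auto simp: orbit_altdef)
  qed
qed

lemma sorted_wrt_key_distinct:
  assumes "sorted_wrt (\<lambda>i k. u i < (u k :: real)) is"
  shows "distinct is"
  using assms by (induction "is") auto

text \<open>For distinct sample values a box has exactly one increasing arrangement. This is what
  makes the \<open>THE\<close> in \<open>stick_perm\<close> meaningful.\<close>

lemma ex1_sorted_wrt_key:
  fixes u :: "'a :: linorder \<Rightarrow> real"
  assumes "finite B" "inj_on u B"
  shows "\<exists>!is. sorted_wrt (\<lambda>i k. u i < u k) is \<and> set is = B"
proof (rule ex_ex1I)
  let ?l = "sort_key u (sorted_list_of_set B)"
  have d: "distinct ?l" "set ?l = B" using assms by auto
  have "sorted (map u ?l)" by simp
  moreover have "distinct (map u ?l)" using d assms by (simp add: distinct_map)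
  ultimately have "sorted_wrt (<) (map u ?l)" by (simp add: strict_sorted_iff)
  then have "sorted_wrt (\<lambda>i k. u i < u k) ?l" by (simp add: sorted_wrt_map)
  then show "\<exists>is. sorted_wrt (\<lambda>i k. u i < u k) is \<and> set is = B" using d by blast
next
  fix xs ys
  assume x: "sorted_wrt (\<lambda>i k. u i < u k) xs \<and> set xs = B"
    and y: "sorted_wrt (\<lambda>i k. u i < u k) ys \<and> set ys = B"
  then have "map u xs = map u ys"
    by (intro strict_sorted_equal) (auto simp: sorted_wrt_map)
  then show "xs = ys" using x y assms(2) map_inj_on[of u xs ys] by auto
qed

lemma stick_Q_Suc: "stick_Q w (Suc j) = stick_Q w j * w (Suc j)"
  by (simp add: stick_Q_def)

lemma stick_Q_0 [simp]: "stick_Q w 0 = 1"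
  by (simp add: stick_Q_def)

context
  fixes w u :: "nat \<Rightarrow> real" and n :: nat
  assumes w: "\<And>i. i \<ge> 1 \<Longrightarrow> 0 < w i \<and> w i < 1"
begin

lemma stick_Q_pos: "stick_Q w j > 0"
  unfolding stick_Q_def using w by (intro prod_pos) auto

lemma stick_Q_antimono: "j \<le> k \<Longrightarrow> stick_Q w k \<le> stick_Q w j"
proof (induction k rule: dec_induct)
  case (step k)
  have "stick_Q w (Suc k) \<le> stick_Q w k * 1" unfolding stick_Q_Suc
    using stick_Q_pos[of k] w[of "Suc k"] by (intro mult_left_mono) auto
  then show ?case using step by simp
qed simp

lemma stick_interval_disjoint:
  assumes "x \<in> stick_interval w j" "x \<in> stick_interval w k" shows "j = k"
  using assms stick_Q_antimono[of "Suc j" k] stick_Q_antimono[of "Suc k" j]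
  unfolding stick_interval_def by (cases j k rule: linorder_cases) auto

lemma inj_on_stick_box: "inj_on (stick_box w u n) {j. stick_box w u n j \<noteq> {}}"
proof (rule inj_onI)
  fix j k assume "j \<in> {j. stick_box w u n j \<noteq> {}}" "stick_box w u n j = stick_box w u n k"
  then obtain i where "i \<in> stick_box w u n j" "i \<in> stick_box w u n k" by auto
  then show "j = k" using stick_interval_disjoint by (auto simp: stick_box_def)
qed

text \<open>Different indices give different nonempty boxes, and all of them are subsets of the
  finite set of sample indices.\<close>

lemma finite_nonempty_boxes: "finite {j. stick_box w u n j \<noteq> {}}"
proof (rule finite_imageD[OF _ inj_on_stick_box])
  show "finite (stick_box w u n ` {j. stick_box w u n j \<noteq> {}})"
    by (rule finite_subset[of _ "Pow {1..n}"]) (use stick_box_subset in blast, simp)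
qed

context
  assumes inj: "inj_on u {1..n}"
begin

lemma orbit_stick_perm:
  assumes "i \<in> stick_box w u n j"
  shows "orbit (stick_perm w u n) i = stick_box w u n j"
proof -
  let ?B = "stick_box w u n j"
  have "inj_on u ?B" using inj stick_box_subset by (rule inj_on_subset)
  from ex1_sorted_wrt_key[OF finite_stick_box this]
  obtain cs where cs: "sorted_wrt (\<lambda>i k. u i < u k) cs" "set cs = ?B"
    and uni: "\<And>is. sorted_wrt (\<lambda>i k. u i < u k) is \<Longrightarrow> set is = ?B \<Longrightarrow> is = cs" by blast
  have p: "stick_perm w u n y = cycle_of_list cs y" if y: "y \<in> set cs" for y
  proof -
    have yj: "u y \<in> stick_interval w j" using y cs by (auto simp: stick_box_def)
    have "cs \<in> stick_cycles w u n" using cs y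
      unfolding stick_cycles_def stick_box_def by auto
    \<comment> \<open>A competing list through \<open>y\<close> also fills a whole box. Disjointness
      of the intervals makes it the same box, and a box has one increasing arrangement.\<close>
    moreover have "is = cs" if "is \<in> stick_cycles w u n" "y \<in> set is" for "is"
    proof -
      from that obtain k where k: "set is = stick_box w u n k" "sorted_wrt (\<lambda>i k. u i < u k) is"
        unfolding stick_cycles_def stick_box_def by auto
      with that have "u y \<in> stick_interval w k" by (auto simp: stick_box_def)
      then have "k = j" using stick_interval_disjoint yj by blast
      then show ?thesis using k uni by simp
    qed
    ultimately have "(THE is. is \<in> stick_cycles w u n \<and> y \<in> set is) = cs"
      using y by (intro the_equality) blast+
    then show ?thesis using \<open>cs \<in> stick_cycles w u n\<close> y by (auto simp: stick_perm_def)
  qed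
  show ?thesis
    using orbit_eq_set_of_cycle[OF sorted_wrt_key_distinct[OF cs(1)] _ p] assms cs by simp
qed

lemma orbit_stick_perm_outside:
  assumes "\<And>j. i \<notin> stick_box w u n j"
  shows "orbit (stick_perm w u n) i = {i}"
proof -
  have "\<not> (\<exists>is \<in> stick_cycles w u n. i \<in> set is)"
  proof
    assume "\<exists>is \<in> stick_cycles w u n. i \<in> set is"
    then obtain "is" j where "i \<in> set is" "set is = stick_box w u n j"
      unfolding stick_cycles_def stick_box_def by auto
    then show False using assms by simp
  qed
  then have p: "stick_perm w u n i = i" by (simp add: stick_perm_def)
  have "(stick_perm w u n ^^ k) i = i" for k by (induction k) (use p in auto)
  then show ?thesis by (auto simp: orbit_altdef)
qed

text \<open>Grouping cycles by length turns the defining product into a product over orbits. An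
  orbit is a box or a fixed point outside all boxes, and a fixed point contributes ln 1 = 0.\<close>

lemma ln_cycle_length_prod:
  "ln (real (cycle_length_prod (stick_perm w u n) n))
     = (\<Sum>j | stick_box w u n j \<noteq> {}. ln (real (card (stick_box w u n j))))"
proof -
  let ?O = "orbit (stick_perm w u n) ` {1..n}"
  let ?I = "{j. stick_box w u n j \<noteq> {}}"
  have O_cases: "(\<exists>j\<in>?I. C = stick_box w u n j) \<or> (\<exists>i\<in>{1..n}. C = {i})" if "C \<in> ?O" for C
  proof -
    from that obtain i where i: "i \<in> {1..n}" "C = orbit (stick_perm w u n) i" by auto
    show ?thesis
    proof (cases "\<exists>j. i \<in> stick_box w u n j")
      case True then show ?thesis using orbit_stick_perm i by auto
    next
      case False then show ?thesis using orbit_stick_perm_outside i by auto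
    qed
  qed
  have boxO: "stick_box w u n ` ?I \<subseteq> ?O"
  proof
    fix C assume "C \<in> stick_box w u n ` ?I"
    then obtain i j where "i \<in> stick_box w u n j" "C = stick_box w u n j" by auto
    then show "C \<in> ?O"
      using orbit_stick_perm[of i j] stick_box_subset[of w u n j] by blast
  qed
  have sub: "C \<subseteq> {1..n}" "C \<noteq> {}" if "C \<in> ?O" for C
    using O_cases[OF that] stick_box_subset[of w u n] by auto
  have fin: "finite C" "card C \<in> {1..n}" if "C \<in> ?O" for C
  proof -
    show "finite C" using finite_subset[OF sub(1)[OF that]] by simp
    then have "card C > 0" using sub(2)[OF that] by (simp add: card_gt_0_iff)
    moreover have "card C \<le> card {1..n}" by (rule card_mono[OF _ sub(1)[OF that]]) simp
    ultimately show "card C \<in> {1..n}" by simp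
  qed
  have "cycle_length_prod (stick_perm w u n) n
      = (\<Prod>r = 1..n. \<Prod>C\<in>{C \<in> ?O. card C = r}. card C)"
    unfolding cycle_length_prod_def num_cycles_def by (intro prod.cong) auto
  also have "\<dots> = (\<Prod>C\<in>?O. card C)"
    using fin by (intro prod.group) auto
  finally have "ln (real (cycle_length_prod (stick_perm w u n) n)) = ln (\<Prod>C\<in>?O. real (card C))"
    by (simp only: of_nat_prod)
  also have "\<dots> = (\<Sum>C\<in>?O. ln (real (card C)))"
    using fin(2) by (intro ln_prod) force+
  also have "\<dots> = (\<Sum>C\<in>stick_box w u n ` ?I. ln (real (card C)))"
    using boxO O_cases by (intro sum.mono_neutral_right) fastforce+
  also have "\<dots> = (\<Sum>j\<in>?I. ln (real (card (stick_box w u n j))))"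
    by (simp add: sum.reindex[OF inj_on_stick_box])
  finally show ?thesis .
qed

text \<open>Empty boxes contribute \<open>ln 0 = 0\<close> to the sum over \<open>j < J\<close>.\<close>

lemma ln_cycle_length_prod_truncate:
  "\<bar>ln (real (cycle_length_prod (stick_perm w u n) n))
      - (\<Sum>j<J. ln (real (card (stick_box w u n j))))\<bar>
   \<le> real (card {i \<in> {1..n}. u i \<le> stick_Q w J})"
proof -
  let ?I = "{j. stick_box w u n j \<noteq> {}}" and ?l = "\<lambda>j. ln (real (card (stick_box w u n j)))"
  have l0: "?l j \<ge> 0 \<and> ?l j \<le> real (card (stick_box w u n j))" for j
  proof (cases "card (stick_box w u n j) = 0")
    case False
    then have "real (card (stick_box w u n j)) \<ge> 1" by linarith
    then show ?thesis using ln_le_minus_one[of "real (card (stick_box w u n j))"] by auto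
  qed simp
  have "(\<Sum>j<J. ?l j) = (\<Sum>j\<in>?I \<inter> {..<J}. ?l j)"
    by (intro sum.mono_neutral_right) auto
  moreover have "(\<Sum>j\<in>?I. ?l j) = (\<Sum>j\<in>?I \<inter> {..<J}. ?l j) + (\<Sum>j\<in>?I - {..<J}. ?l j)"
    using finite_nonempty_boxes by (subst sum.union_disjoint[symmetric]) (auto intro!: sum.cong)
  ultimately have e: "ln (real (cycle_length_prod (stick_perm w u n) n)) - (\<Sum>j<J. ?l j)
      = (\<Sum>j\<in>?I - {..<J}. ?l j)"
    unfolding ln_cycle_length_prod by simp
  have "(\<Sum>j\<in>?I - {..<J}. ?l j) \<le> (\<Sum>j\<in>?I - {..<J}. real (card (stick_box w u n j)))"
    using l0 by (intro sum_mono) blast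
  \<comment> \<open>The boxes from index \<open>J\<close> on are disjoint and lie at or below
    \<open>stick_Q w J\<close>, so after the crude bound ln k \<le> k each point below that level is
    counted at most once.\<close>
  also have "\<dots> = real (card (\<Union>j\<in>?I - {..<J}. stick_box w u n j))"
    using finite_nonempty_boxes stick_interval_disjoint
    by (subst card_UN_disjoint) (auto simp: stick_box_def)
  also have "\<dots> \<le> real (card {i \<in> {1..n}. u i \<le> stick_Q w J})"
  proof -
    have "(\<Union>j\<in>?I - {..<J}. stick_box w u n j) \<subseteq> {i \<in> {1..n}. u i \<le> stick_Q w J}"
      using stick_Q_antimono[of J] unfolding stick_box_def stick_interval_def
      by (fastforce simp: not_less)
    then show ?thesis by (intro of_nat_mono card_mono) auto
  qed
  finally show ?thesis unfolding e using sum_nonneg[of "?I - {..<J}" ?l] l0 by auto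
qed

end

end

section \<open>Measurability of the product of cycle lengths\<close>

lemma cycle_length_prod_stick_perm_cong:
  assumes "{(i, k) \<in> {1..n} \<times> {1..n}. u i < u k} = {(i, k) \<in> {1..n} \<times> {1..n}. u' i < u' k}"
    and "range (stick_box w u n) = range (stick_box w' u' n)"
  shows "cycle_length_prod (stick_perm w u n) n = cycle_length_prod (stick_perm w' u' n) n"
proof -
  have "is \<in> stick_cycles w u n \<longleftrightarrow> is \<noteq> [] \<and> set is \<subseteq> {1..n} \<and>
      sorted_wrt (\<lambda>i k. (i, k) \<in> {(i, k) \<in> {1..n} \<times> {1..n}. u i < u k}) is \<and> set is \<in> range (stick_box w u n)" for "is" w u
  proof -
    have a: "(\<exists>j. set is = {i \<in> {1..n}. u i \<in> stick_interval w j}) \<longleftrightarrow> set is \<in> range (stick_box w u n)"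
      by (auto simp: stick_box_def[abs_def])
    have "sorted_wrt (\<lambda>i k. u i < u k) is \<longleftrightarrow>
        sorted_wrt (\<lambda>i k. (i, k) \<in> {(i, k) \<in> {1..n} \<times> {1..n}. u i < u k}) is" if "set is \<subseteq> {1..n}"
      using that by (induction "is") (auto simp: subset_iff)
    moreover have "set is \<subseteq> {1..n}" if "set is \<in> range (stick_box w u n)"
      using that stick_box_subset by blast
    ultimately show ?thesis unfolding stick_cycles_def mem_Collect_eq a by blast
  qed
  then have "stick_cycles w u n = stick_cycles w' u' n"
    by (intro set_eqI) (simp only: assms)
  then have "stick_perm w u n = stick_perm w' u' n" by (intro ext) (simp add: stick_perm_def)
  then show ?thesis by simp
qed

text \<open>The choice operator in \<open>stick_perm\<close> blocks a direct derivation. Instead,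
  the product is factored through the finite-valued datum \<open>D\<close>: the order of the sample
  values and the collection of boxes. The event that \<open>D\<close> takes a given value is a
  countable Boolean combination of inequalities between random variables.\<close>

lemma measurable_cycle_length_prod:
  assumes Ws [measurable]: "\<And>i. i \<ge> 1 \<Longrightarrow> Ws i \<in> borel_measurable M"
    and U [measurable]: "\<And>i. i \<ge> 1 \<Longrightarrow> U i \<in> borel_measurable M"
  shows "(\<lambda>\<omega>. real (cycle_length_prod (stick_perm (\<lambda>i. Ws i \<omega>) (\<lambda>i. U i \<omega>) n) n)) \<in> borel_measurable M"
proof -
  define D where "D \<omega> = ({(i, k) \<in> {1..n} \<times> {1..n}. U i \<omega> < U k \<omega>},
     range (stick_box (\<lambda>i. Ws i \<omega>) (\<lambda>i. U i \<omega>) n))" for \<omega>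
  let ?T = "\<lambda>\<omega>. real (cycle_length_prod (stick_perm (\<lambda>i. Ws i \<omega>) (\<lambda>i. U i \<omega>) n) n)"
  let ?F = "Pow ({1..n} \<times> {1..n}) \<times> Pow (Pow {1..n})"
  have [measurable]: "(\<lambda>\<omega>. stick_Q (\<lambda>i. Ws i \<omega>) j) \<in> borel_measurable M" for j
    unfolding stick_Q_def by measurable
  have D_meas: "D \<in> measurable M (count_space ?F)"
  proof (subst measurable_count_space_eq2, simp, intro conjI ballI)
    show "D \<in> space M \<rightarrow> ?F" unfolding D_def using stick_box_subset by blast
  next
    fix a assume "a \<in> ?F"
    then obtain R S where a: "a = (R, S)" "R \<subseteq> {1..n} \<times> {1..n}" "S \<subseteq> Pow {1..n}" by auto
    have R: "{(i, k) \<in> {1..n} \<times> {1..n}. U i \<omega> < U k \<omega>} = R \<longleftrightarrow>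
       (\<forall>i\<in>{1..n}. \<forall>k\<in>{1..n}. U i \<omega> < U k \<omega> \<longleftrightarrow> (i, k) \<in> R)" for \<omega>
      using a by auto
    have B: "stick_box (\<lambda>i. Ws i \<omega>) (\<lambda>i. U i \<omega>) n j = B \<longleftrightarrow>
       (\<forall>i\<in>{1..n}. (stick_Q (\<lambda>i. Ws i \<omega>) (Suc j) < U i \<omega> \<and> U i \<omega> \<le> stick_Q (\<lambda>i. Ws i \<omega>) j) \<longleftrightarrow> i \<in> B)"
      if "B \<subseteq> {1..n}" for B j \<omega>
      using that by (auto simp: stick_box_def stick_interval_def)
    have "range (stick_box (\<lambda>i. Ws i \<omega>) (\<lambda>i. U i \<omega>) n) = S \<longleftrightarrow>
       (\<forall>B\<in>Pow {1..n}. (\<exists>j. stick_box (\<lambda>i. Ws i \<omega>) (\<lambda>i. U i \<omega>) n j = B) \<longleftrightarrow> B \<in> S)" for \<omega>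
    proof -
      have "range (stick_box (\<lambda>i. Ws i \<omega>) (\<lambda>i. U i \<omega>) n) \<subseteq> Pow {1..n}" using stick_box_subset by blast
      then have "range (stick_box (\<lambda>i. Ws i \<omega>) (\<lambda>i. U i \<omega>) n) = S \<longleftrightarrow>
          (\<forall>B\<in>Pow {1..n}. B \<in> range (stick_box (\<lambda>i. Ws i \<omega>) (\<lambda>i. U i \<omega>) n) \<longleftrightarrow> B \<in> S)"
        using a(3) by blast
      then show ?thesis by (simp only: image_iff bex_UNIV) (simp only: eq_commute)
    qed
    then have S: "range (stick_box (\<lambda>i. Ws i \<omega>) (\<lambda>i. U i \<omega>) n) = S \<longleftrightarrow>
       (\<forall>B\<in>Pow {1..n}. (\<exists>j. \<forall>i\<in>{1..n}. (stick_Q (\<lambda>i. Ws i \<omega>) (Suc j) < U i \<omega> \<and> U i \<omega> \<le> stick_Q (\<lambda>i. Ws i \<omega>) j) \<longleftrightarrow> i \<in> B) \<longleftrightarrow> B \<in> S)" for \<omega>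
      using B by auto
    have "D -` {a} \<inter> space M = {\<omega> \<in> space M.
       (\<forall>i\<in>{1..n}. \<forall>k\<in>{1..n}. U i \<omega> < U k \<omega> \<longleftrightarrow> (i, k) \<in> R) \<and>
       (\<forall>B\<in>Pow {1..n}. (\<exists>j. \<forall>i\<in>{1..n}. (stick_Q (\<lambda>i. Ws i \<omega>) (Suc j) < U i \<omega> \<and> U i \<omega> \<le> stick_Q (\<lambda>i. Ws i \<omega>) j) \<longleftrightarrow> i \<in> B) \<longleftrightarrow> B \<in> S)}"
      unfolding D_def a(1) vimage_def Int_def using R S by auto
    also have "\<dots> \<in> sets M" by measurable
    finally show "D -` {a} \<inter> space M \<in> sets M" .
  qed
  \<comment> \<open>The product is constant on each fibre of \<open>D\<close>, so any representative
    of the fibre yields its value.\<close>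
  have "?T = (\<lambda>d. ?T (SOME \<omega>. D \<omega> = d)) \<circ> D"
  proof
    fix \<omega>
    have "D (SOME \<omega>'. D \<omega>' = D \<omega>) = D \<omega>" by (rule someI[of _ \<omega>]) simp
    then show "?T \<omega> = ((\<lambda>d. ?T (SOME \<omega>. D \<omega> = d)) \<circ> D) \<omega>"
      unfolding o_def D_def by (intro arg_cong[where f = real] cycle_length_prod_stick_perm_cong[symmetric]) auto
  qed
  also have "\<dots> \<in> borel_measurable M"
    using D_meas by (rule measurable_comp) simp
  finally show ?thesis .
qed

section \<open>Products of characteristic functions with linear weights\<close>

lemma integrable_mono_Icc:
  fixes h :: "real \<Rightarrow> real"
  assumes "mono h"
  shows "integrable lborel (\<lambda>x. indicator {a..b} x * h x)"
proof -
  have [measurable]: "h \<in> borel_measurable borel" using assms by (rule borel_measurable_mono)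
  show ?thesis
  proof (rule Bochner_Integration.integrable_bound)
    show "integrable lborel (\<lambda>x. indicator {a..b} x * max \<bar>h a\<bar> \<bar>h b\<bar>)"
      by (intro integrable_mult_left integrable_real_indicator) (auto simp: emeasure_lborel_Icc_eq)
    show "AE x in lborel. norm (indicator {a..b} x * h x) \<le> norm (indicator {a..b} x * max \<bar>h a\<bar> \<bar>h b\<bar>)"
    proof (rule AE_I2)
      fix x
      have "\<bar>h x\<bar> \<le> max \<bar>h a\<bar> \<bar>h b\<bar>" if "x \<in> {a..b}"
        using that monoD[OF assms, of a x] monoD[OF assms, of x b] by auto
      then show "norm (indicator {a..b} x * h x) \<le> norm (indicator {a..b} x * max \<bar>h a\<bar> \<bar>h b\<bar>)"
        by (auto simp: indicator_def)
    qed
  qed simp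
qed

lemma integral_mono_Icc_bounds:
  fixes h :: "real \<Rightarrow> real"
  assumes h: "mono h" and "a \<le> b"
  shows "(b - a) * h a \<le> (LINT x|lborel. indicator {a..b} x * h x)"
    and "(LINT x|lborel. indicator {a..b} x * h x) \<le> (b - a) * h b"
proof -
  have i: "integrable lborel (\<lambda>x. indicator {a..b} x * c)" for c :: real
    by (intro integrable_mult_left integrable_real_indicator) (auto simp: emeasure_lborel_Icc_eq)
  have c: "(LINT x|lborel. indicator {a..b} x * c) = (b - a) * c" for c :: real
    using \<open>a \<le> b\<close> by simp
  show "(b - a) * h a \<le> (LINT x|lborel. indicator {a..b} x * h x)"
    unfolding c[symmetric] using monoD[OF h]
    by (intro integral_mono i integrable_mono_Icc h) (auto simp: indicator_def)
  show "(LINT x|lborel. indicator {a..b} x * h x) \<le> (b - a) * h b"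
    unfolding c[symmetric] using monoD[OF h]
    by (intro integral_mono i integrable_mono_Icc h) (auto simp: indicator_def)
qed

lemma integral_mono_Icc_split:
  fixes h :: "real \<Rightarrow> real"
  assumes h: "mono h" and "a \<le> b" "b \<le> c"
  shows "(LINT x|lborel. indicator {a..c} x * h x)
    = (LINT x|lborel. indicator {a..b} x * h x) + (LINT x|lborel. indicator {b..c} x * h x)"
proof -
  have [measurable]: "h \<in> borel_measurable borel" using h by (rule borel_measurable_mono)
  have "(LINT x|lborel. indicator {a..c} x * h x)
      = (LINT x|lborel. indicator {a..b} x * h x + indicator {b..c} x * h x)"
  proof (rule integral_cong_AE)
    show "AE x in lborel. indicator {a..c} x * h x = indicator {a..b} x * h x + indicator {b..c} x * h x"
      using AE_lborel_singleton[of b] by eventually_elim (use assms in \<open>auto simp: indicator_def\<close>)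
  qed measurable
  also have "\<dots> = (LINT x|lborel. indicator {a..b} x * h x) + (LINT x|lborel. indicator {b..c} x * h x)"
    by (intro Bochner_Integration.integral_add integrable_mono_Icc h)
  finally show ?thesis .
qed

text \<open>The upper error is a single boundary term because it telescopes: in passing to
  \<open>Suc m\<close> the old term h(m) is absorbed by the integral over [m, m + 1], and h(m + 1)
  takes its place.\<close>

lemma sum_mono_integral_bounds:
  fixes h :: "real \<Rightarrow> real"
  assumes h: "mono h" and nonneg: "\<And>x. h x \<ge> 0"
  shows "(LINT x|lborel. indicator {0..real m} x * h x) \<le> (\<Sum>k=1..m. h (real k)) \<and>
    (\<Sum>k=1..m. h (real k)) \<le> (LINT x|lborel. indicator {0..real m} x * h x) + h (real m)"
proof (induction m)
  case 0
  have "(LINT x|lborel. indicator {0..real 0} x * h x) = 0"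
    using integral_mono_Icc_bounds[OF h, of 0 0] by simp
  then show ?case using nonneg[of 0] by simp
next
  case (Suc m)
  show ?case
    using Suc integral_mono_Icc_bounds[OF h, of "real m" "real (Suc m)"]
      integral_mono_Icc_split[OF h, of 0 "real m" "real (Suc m)"] nonneg[of "real (Suc m)"]
    by (simp add: algebra_simps)
qed

text \<open>Monotonicity of \<open>F n\<close> replaces the sum by an integral up to one boundary
  value divided by \<open>t n\<close>. For the integral, dominated convergence needs the limit of
  \<open>F n\<close> at each point only.\<close>

lemma tendsto_riemann_sum_powr:
  fixes F :: "nat \<Rightarrow> real \<Rightarrow> real" and t :: "nat \<Rightarrow> real" and m :: "nat \<Rightarrow> nat"
  assumes F: "\<And>n. mono (F n)" and nonneg: "\<And>n x. F n x \<ge> 0"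
    and lim: "\<And>x. x > 0 \<Longrightarrow> (\<lambda>n. F n x) \<longlonglongrightarrow> c * x powr \<alpha>"
    and t: "filterlim t at_top sequentially" and m: "(\<lambda>n. real (m n) / t n) \<longlonglongrightarrow> \<rho>"
    and pos: "\<alpha> > 0" "\<rho> > 0"
  shows "(\<lambda>n. (\<Sum>k=1..m n. F n (real k / t n)) / t n) \<longlonglongrightarrow> c * \<rho> powr (\<alpha> + 1) / (\<alpha> + 1)"
proof -
  have [measurable]: "F n \<in> borel_measurable borel" for n using F by (rule borel_measurable_mono)
  define A where "A n = (LINT x|lborel. indicator {0..real (m n) / t n} x * F n x)" for n
  have tpos: "eventually (\<lambda>n. t n > 0) sequentially"
    using t by (simp add: filterlim_at_top_dense)
  have mle: "eventually (\<lambda>n. real (m n) / t n < \<rho> + 1) sequentially"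
    using m by (rule order_tendstoD) simp
  \<comment> \<open>Eventually a bound for \<open>F n\<close> on the whole range of summation: the
    endpoint \<open>m n / t n\<close> falls below \<rho> + 1, and there \<open>F n\<close> is less
    than its limit plus 1.\<close>
  define B where "B = c * (\<rho> + 1) powr \<alpha> + 1"
  have Fle: "eventually (\<lambda>n. F n (\<rho> + 1) < B) sequentially"
    using lim[of "\<rho> + 1"] pos by (intro order_tendstoD) (auto simp: B_def)
  have c: "c \<ge> 0"
    using lim[of 1] by (intro LIMSEQ_le_const[of "\<lambda>n. F n 1" c]) (auto simp: nonneg)
  have integrable_lim: "integrable lborel (\<lambda>x. indicator {0..\<rho>} x * (c * x powr \<alpha>))"
  proof (rule Bochner_Integration.integrable_bound)
    show "integrable lborel (\<lambda>x. indicator {0..\<rho>} x * (c * \<rho> powr \<alpha>))"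
      by (intro integrable_mult_left integrable_real_indicator) (auto simp: emeasure_lborel_Icc_eq)
    show "AE x in lborel. norm (indicator {0..\<rho>} x * (c * x powr \<alpha>)) \<le> norm (indicator {0..\<rho>} x * (c * \<rho> powr \<alpha>))"
      using c pos by (intro AE_I2) (auto simp: indicator_def intro!: mult_left_mono powr_mono2)
  qed measurable
  have A: "A \<longlonglongrightarrow> (LINT x|lborel. indicator {0..\<rho>} x * (c * x powr \<alpha>))"
  proof -
    \<comment> \<open>Capping the range at \<rho> + 1 and the values at \<open>B\<close> gives an
      integrable majorant valid for every \<open>n\<close>; eventually the caps change
      nothing.\<close>
    define A' where "A' n = (LINT x|lborel. indicator {0..min (\<rho> + 1) (real (m n) / t n)} x * min B (F n x))" for n
    have B: "B \<ge> 0" using c by (simp add: B_def)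
    have "A' \<longlonglongrightarrow> (LINT x|lborel. indicator {0..\<rho>} x * (c * x powr \<alpha>))"
      unfolding A'_def
    proof (rule integral_dominated_convergence[where w = "\<lambda>x. indicator {0..\<rho> + 1} x * B"])
      show "integrable lborel (\<lambda>x. indicator {0..\<rho> + 1} x * B)"
        by (intro integrable_mult_left integrable_real_indicator) (auto simp: emeasure_lborel_Icc_eq)
      show "AE x in lborel. norm (indicator {0..min (\<rho> + 1) (real (m n) / t n)} x * min B (F n x)) \<le> indicator {0..\<rho> + 1} x * B" for n
        using B nonneg by (intro AE_I2) (auto simp: indicator_def)
      show "AE x in lborel. (\<lambda>n. indicator {0..min (\<rho> + 1) (real (m n) / t n)} x * min B (F n x))
          \<longlonglongrightarrow> indicator {0..\<rho>} x * (c * x powr \<alpha>)"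
        \<comment> \<open>Two points are set aside: at 0 no limit of \<open>F n\<close> is assumed,
          and at \<rho> the indicator need not converge.\<close>
        using AE_lborel_singleton[of \<rho>] AE_lborel_singleton[of 0]
      proof eventually_elim
        case (elim x)
        consider "x < 0" | "x > \<rho>" | "0 < x" "x < \<rho>" using elim by linarith
        then show ?case
        proof cases
          case 2
          have "eventually (\<lambda>n. real (m n) / t n < x) sequentially" using m 2 by (rule order_tendstoD)
          then have "eventually (\<lambda>n. indicator {0..min (\<rho> + 1) (real (m n) / t n)} x * min B (F n x) = 0) sequentially"
            by eventually_elim (auto simp: indicator_def)
          then show ?thesis using 2 by (simp add: tendsto_eventually)
        next
          case 3
          have "c * x powr \<alpha> \<le> c * (\<rho> + 1) powr \<alpha>"
            using 3 pos c by (intro mult_left_mono powr_mono2) auto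
          then have "min B (c * x powr \<alpha>) = c * x powr \<alpha>" by (simp add: B_def)
          then have "(\<lambda>n. min B (F n x)) \<longlonglongrightarrow> c * x powr \<alpha>"
            using tendsto_min[OF tendsto_const[of B] lim[of x]] 3 by simp
          moreover have "eventually (\<lambda>n. x < real (m n) / t n) sequentially" using m 3(2) by (rule order_tendstoD)
          then have "eventually (\<lambda>n. indicator {0..min (\<rho> + 1) (real (m n) / t n)} x * min B (F n x) = min B (F n x)) sequentially"
            by eventually_elim (use 3 in \<open>auto simp: indicator_def\<close>)
          ultimately have "(\<lambda>n. indicator {0..min (\<rho> + 1) (real (m n) / t n)} x * min B (F n x)) \<longlonglongrightarrow> c * x powr \<alpha>"
            by (rule Lim_transform_eventually[OF _ eventually_mono]) auto
          then show ?thesis using 3 by simp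
        qed simp
      qed
    qed measurable
    moreover have "eventually (\<lambda>n. A' n = A n) sequentially" using mle Fle
    proof eventually_elim
      case (elim n)
      have "F n x \<le> B" if "x \<le> real (m n) / t n" for x
        using monoD[OF F, of x "\<rho> + 1" n] that elim by simp
      then show ?case unfolding A'_def A_def using elim
        by (intro Bochner_Integration.integral_cong) (auto simp: indicator_def)
    qed
    ultimately show ?thesis by (simp add: tendsto_cong)
  qed
  have ind: "(\<lambda>x. indicator {0..\<rho>} x * (c * x powr \<alpha>)) = (\<lambda>x. if x \<in> {0..\<rho>} then c * x powr \<alpha> else 0)"
    by (auto simp: indicator_def fun_eq_iff)
  have "((\<lambda>x. indicator {0..\<rho>} x * (c * x powr \<alpha>)) has_integral (c * (\<rho> powr (\<alpha> + 1) / (\<alpha> + 1)))) UNIV"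
    unfolding ind has_integral_restrict_UNIV using pos
    by (intro has_integral_mult_right has_integral_powr_from_0) auto
  then have eq: "(LINT x|lborel. indicator {0..\<rho>} x * (c * x powr \<alpha>)) = c * \<rho> powr (\<alpha> + 1) / (\<alpha> + 1)"
    using has_integral_unique[OF has_integral_integral_lborel[OF integrable_lim]] by simp
  have b: "eventually (\<lambda>n. A n \<le> (\<Sum>k=1..m n. F n (real k / t n)) / t n \<and>
       (\<Sum>k=1..m n. F n (real k / t n)) / t n \<le> A n + B / t n) sequentially"
    using tpos mle Fle
  proof eventually_elim
    case (elim n)
    have h: "mono (\<lambda>x. F n (x / t n))" using elim by (intro monoI monoD[OF F] divide_right_mono) auto
    have "(LINT x|lborel. indicator {0..real (m n)} x * F n (x / t n))
        = \<bar>t n\<bar> *\<^sub>R (LINT x|lborel. indicator {0..real (m n)} (0 + t n * x) * F n ((0 + t n * x) / t n))"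
      using elim by (intro lborel_integral_real_affine) auto
    also have "(LINT x|lborel. indicator {0..real (m n)} (0 + t n * x) * F n ((0 + t n * x) / t n)) = A n"
      unfolding A_def using elim
      by (intro Bochner_Integration.integral_cong) (auto simp: indicator_def field_simps zero_le_mult_iff)
    finally have "(LINT x|lborel. indicator {0..real (m n)} x * F n (x / t n)) = t n * A n"
      using elim by simp
    moreover have "F n (real (m n) / t n) \<le> B" using monoD[OF F, of "real (m n) / t n" "\<rho> + 1" n] elim by simp
    ultimately show ?case using sum_mono_integral_bounds[OF h nonneg, of "m n"] elim by (auto simp: field_simps)
  qed
  have "(\<lambda>n. A n + B / t n) \<longlonglongrightarrow> c * \<rho> powr (\<alpha> + 1) / (\<alpha> + 1) + 0"
    using A unfolding eq by (intro tendsto_add tendsto_divide_0[OF tendsto_const] filterlim_at_top_imp_at_infinity t)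
  then have "(\<lambda>n. A n + B / t n) \<longlonglongrightarrow> c * \<rho> powr (\<alpha> + 1) / (\<alpha> + 1)" by simp
  from tendsto_sandwich[OF eventually_mono[OF b] eventually_mono[OF b] A[unfolded eq] this]
  show ?thesis by simp
qed

section \<open>Limits of products of characteristic functions\<close>

lemma norm_exp_diff_le:
  fixes z :: complex
  assumes "norm z \<le> 1"
  shows "norm (exp z - 1 - z) \<le> 3 * norm z ^ 2"
proof -
  have "norm (exp z - (\<Sum>k\<le>1. z ^ k / fact k)) \<le> exp \<bar>Re z\<bar> * norm z ^ Suc 1 / fact 1"
    by (rule Taylor_exp)
  moreover have "\<bar>Re z\<bar> \<le> 1" using abs_Re_le_cmod[of z] assms by linarith
  then have "exp \<bar>Re z\<bar> \<le> 3" using exp_le by (meson exp_le_cancel_iff order_trans)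
  then have "exp \<bar>Re z\<bar> * norm z ^ 2 \<le> 3 * norm z ^ 2" by (intro mult_right_mono) auto
  ultimately show ?thesis by (simp add: numeral_2_eq_2 algebra_simps)
qed

text \<open>
  The scaled sequence \<open>t n * g (u x / d n)\<close> converges to \<open>(u x) powr \<alpha>\<close>; since \<open>g\<close> is monotone, no
  uniform convergence theorem for regularly varying functions is needed to pass to the limit in
  the sums.
\<close>

lemma tendsto_prod_char_linear_weights:
  fixes \<phi> :: "real \<Rightarrow> complex" and g :: "real \<Rightarrow> real" and t d :: "nat \<Rightarrow> real" and m :: "nat \<Rightarrow> nat"
  assumes g: "mono g" "\<And>s. g s \<ge> 0" "\<And>s. s > 0 \<Longrightarrow> g s > 0"
    and rv: "\<And>c. c > 0 \<Longrightarrow> ((\<lambda>s. g (c * s) / g s) \<longlongrightarrow> c powr \<alpha>) (at_right 0)"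
    and \<phi>: "\<And>s. norm (\<phi> s) \<le> 1" "((\<lambda>s. (\<phi> s - 1) / of_real (g s)) \<longlongrightarrow> - \<kappa>) (at_right 0)"
    and t: "filterlim t at_top sequentially" and d: "filterlim d at_top sequentially"
    and norming: "(\<lambda>n. t n * g (1 / d n)) \<longlonglongrightarrow> 1"
    and m: "(\<lambda>n. real (m n) / t n) \<longlonglongrightarrow> \<rho>"
    and pos: "\<alpha> > 0" "\<rho> > 0" "u > 0"
  shows "(\<lambda>n. \<Prod>k=1..m n. \<phi> (u * real k / (t n * d n)))
    \<longlonglongrightarrow> exp (- \<kappa> * of_real (u powr \<alpha> * \<rho> powr (\<alpha> + 1) / (\<alpha> + 1)))"
proof -
  \<comment> \<open>The two maxima make \<open>F n\<close> monotone and nonnegative for all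
    \<open>n\<close>, not just eventually; for large \<open>n\<close> they equal \<open>t n\<close>
    and \<open>d n\<close>.\<close>
  define F where "F n x = max 0 (t n) * g (u * x / max 1 (d n))" for n x
  define s where "s n k = u * real k / (t n * d n)" for n k
  define L where "L = u powr \<alpha> * \<rho> powr (\<alpha> + 1) / (\<alpha> + 1)"
  have tpos: "eventually (\<lambda>n. t n > 0) sequentially" and dpos: "eventually (\<lambda>n. d n > 1) sequentially"
    using t d by (auto simp: filterlim_at_top_dense)
  have inv_d: "filterlim (\<lambda>n. 1 / d n) (at_right 0) sequentially"
    using filterlim_compose[OF filterlim_inverse_at_right_top d] by (simp add: inverse_eq_divide)
  have F_mono: "mono (F n)" for n
    unfolding F_def using pos
    by (intro monoI mult_left_mono monoD[OF g(1)] divide_right_mono) auto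
  have F_lim: "(\<lambda>n. F n x) \<longlonglongrightarrow> u powr \<alpha> * x powr \<alpha>" if "x > 0" for x
  proof -
    have "(\<lambda>n. t n * g (1 / d n) * (g ((u * x) * (1 / d n)) / g (1 / d n))) \<longlonglongrightarrow> 1 * (u * x) powr \<alpha>"
      using that pos by (intro tendsto_mult norming filterlim_compose[OF rv inv_d]) auto
    moreover have "eventually (\<lambda>n. t n * g (1 / d n) * (g ((u * x) * (1 / d n)) / g (1 / d n)) = F n x) sequentially"
      using tpos dpos
    proof eventually_elim
      case (elim n)
      have "g (1 / d n) \<noteq> 0" using g(3)[of "1 / d n"] elim by simp
      then show ?case using elim by (simp add: F_def)
    qed
    ultimately show ?thesis using that pos by (simp add: tendsto_cong powr_mult)
  qed
  have R: "(\<lambda>n. (\<Sum>k=1..m n. F n (real k / t n)) / t n) \<longlonglongrightarrow> u powr \<alpha> * \<rho> powr (\<alpha> + 1) / (\<alpha> + 1)"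
    by (rule tendsto_riemann_sum_powr[OF F_mono _ F_lim t m]) (use pos g in \<open>auto simp: F_def\<close>)
  have "eventually (\<lambda>n. (\<Sum>k=1..m n. F n (real k / t n)) / t n = (\<Sum>k=1..m n. g (s n k))) sequentially"
    using tpos dpos
    by eventually_elim (auto simp: F_def s_def sum_divide_distrib intro!: sum.cong)
  then have G: "(\<lambda>n. \<Sum>k=1..m n. g (s n k)) \<longlonglongrightarrow> L"
    using R by (simp add: tendsto_cong L_def)
  define Y where "Y n = u * (\<rho> + 1) / d n" for n
  have s_le: "eventually (\<lambda>n. \<forall>k\<in>{1..m n}. 0 < s n k \<and> s n k \<le> Y n) sequentially"
    using tpos dpos order_tendstoD(2)[OF m, of "\<rho> + 1", simplified]
  proof eventually_elim
    case (elim n)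
    show ?case
    proof
      fix k assume k: "k \<in> {1..m n}"
      have "real k / t n \<le> real (m n) / t n" using k elim by (intro divide_right_mono) auto
      then have "u * (real k / t n) / d n \<le> u * (\<rho> + 1) / d n"
        using elim pos by (intro divide_right_mono mult_left_mono) auto
      then show "0 < s n k \<and> s n k \<le> Y n" using k elim pos by (auto simp: s_def Y_def)
    qed
  qed
  have Y0: "Y \<longlonglongrightarrow> 0" unfolding Y_def
    by (intro tendsto_divide_0[OF tendsto_const] filterlim_at_top_imp_at_infinity d)
  \<comment> \<open>Every argument in the product is at most \<open>Y n\<close>, so this is uniform
    smallness of the factors' distance to 1. It holds because \<open>t n * g (Y n)\<close> converges
    while \<open>t n\<close> tends to infinity.\<close>
  have gY: "(\<lambda>n. g (Y n)) \<longlonglongrightarrow> 0"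
  proof -
    have "(\<lambda>n. F n (\<rho> + 1) / t n) \<longlonglongrightarrow> 0"
      using F_lim[of "\<rho> + 1"] pos
      by (intro real_tendsto_divide_at_top[OF _ t]) auto
    moreover have "eventually (\<lambda>n. F n (\<rho> + 1) / t n = g (Y n)) sequentially"
      using tpos dpos by eventually_elim (auto simp: F_def Y_def)
    ultimately show ?thesis by (simp add: tendsto_cong)
  qed
  have small: "eventually (\<lambda>n. \<forall>k\<in>{1..m n}. norm (\<phi> (s n k) - 1 + \<kappa> * of_real (g (s n k))) \<le> \<epsilon> * g (s n k)) sequentially"
    if "\<epsilon> > 0" for \<epsilon>
  proof -
    have "eventually (\<lambda>s. dist ((\<phi> s - 1) / of_real (g s)) (- \<kappa>) < \<epsilon>) (at_right 0)"
      using \<phi>(2) that by (rule tendstoD)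
    then obtain \<delta> where \<delta>: "\<delta> > 0" "\<And>s. 0 < s \<Longrightarrow> s < \<delta> \<Longrightarrow> norm ((\<phi> s - 1) / of_real (g s) + \<kappa>) < \<epsilon>"
      by (auto simp: eventually_at_right_field dist_norm)
    show ?thesis using s_le order_tendstoD(2)[OF Y0 \<delta>(1)]
    proof eventually_elim
      case (elim n)
      show ?case
      proof
        fix k assume "k \<in> {1..m n}"
        then have sk: "0 < s n k" "s n k < \<delta>" using elim by force+
        have "norm (\<phi> (s n k) - 1 + \<kappa> * of_real (g (s n k)))
            = norm ((\<phi> (s n k) - 1) / of_real (g (s n k)) + \<kappa>) * g (s n k)"
          using g(3)[OF sk(1)] by (simp add: divide_simps flip: norm_mult) (simp add: norm_divide norm_mult)
        also have "\<dots> \<le> \<epsilon> * g (s n k)" using \<delta>(2)[OF sk] g(2) by (intro mult_right_mono) auto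
        finally show "norm (\<phi> (s n k) - 1 + \<kappa> * of_real (g (s n k))) \<le> \<epsilon> * g (s n k)" .
      qed
    qed
  qed
  have sum_lim: "(\<lambda>n. \<Sum>k=1..m n. \<phi> (s n k) - 1) \<longlonglongrightarrow> - \<kappa> * of_real L"
  proof -
    have "(\<lambda>n. (\<Sum>k=1..m n. \<phi> (s n k) - 1 + \<kappa> * of_real (g (s n k)))) \<longlonglongrightarrow> 0"
    proof (rule tendstoI)
      fix e :: real assume "e > 0"
      define \<epsilon> where "\<epsilon> = e / (\<bar>L\<bar> + 1)"
      have "\<epsilon> > 0" using \<open>e > 0\<close> by (simp add: \<epsilon>_def)
      have "eventually (\<lambda>n. (\<Sum>k=1..m n. g (s n k)) < \<bar>L\<bar> + 1) sequentially"
        using G by (rule order_tendstoD) auto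
      then show "eventually (\<lambda>n. dist (\<Sum>k=1..m n. \<phi> (s n k) - 1 + \<kappa> * of_real (g (s n k))) 0 < e) sequentially"
        using small[OF \<open>\<epsilon> > 0\<close>]
      proof eventually_elim
        case (elim n)
        have "norm (\<Sum>k=1..m n. \<phi> (s n k) - 1 + \<kappa> * of_real (g (s n k))) \<le> (\<Sum>k=1..m n. \<epsilon> * g (s n k))"
          using elim by (intro sum_norm_le) auto
        also have "\<dots> = \<epsilon> * (\<Sum>k=1..m n. g (s n k))" by (simp add: sum_distrib_left)
        also have "\<dots> < \<epsilon> * (\<bar>L\<bar> + 1)" using elim \<open>\<epsilon> > 0\<close> by simp
        finally show ?case by (simp add: \<epsilon>_def)
      qed
    qed
    from tendsto_diff[OF this tendsto_mult[OF tendsto_const[of \<kappa>] tendsto_of_real[OF G]]]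
    show ?thesis by (simp add: sum.distrib sum_distrib_left algebra_simps sum_subtractf)
  qed
  \<comment> \<open>The total error of replacing each factor \<phi> by exp (\<phi> - 1). Each
    |\<phi> - 1| is at most \<open>C\<close> times g, with \<open>C\<close> from the bound
    \<open>small\<close> at 1, so one factor g can be pulled out as \<open>g (Y n)\<close>, which
    vanishes, while the sum of the other converges.\<close>
  have sq: "(\<lambda>n. \<Sum>k=1..m n. 3 * norm (\<phi> (s n k) - 1) ^ 2) \<longlonglongrightarrow> 0"
  proof -
    define C where "C = norm \<kappa> + 1"
    have 1:  "(\<lambda>n. 3 * C ^ 2 * g (Y n) * (\<Sum>k=1..m n. g (s n k))) \<longlonglongrightarrow> 0"
      using tendsto_mult[OF tendsto_mult[OF tendsto_const gY] G] by simp
    have 2: "eventually (\<lambda>n. (\<Sum>k=1..m n. 3 * norm (\<phi> (s n k) - 1) ^ 2) \<le> 3 * C ^ 2 * g (Y n) * (\<Sum>k=1..m n. g (s n k))) sequentially"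
      using small[OF zero_less_one] s_le
    proof eventually_elim
      case (elim n)
      have "3 * norm (\<phi> (s n k) - 1) ^ 2 \<le> 3 * C ^ 2 * g (Y n) * g (s n k)" if k: "k \<in> {1..m n}" for k
      proof -
        have "norm (\<phi> (s n k) - 1) \<le> norm (\<phi> (s n k) - 1 + \<kappa> * of_real (g (s n k))) + norm (\<kappa> * of_real (g (s n k)))"
          using norm_triangle_ineq4[of "\<phi> (s n k) - 1 + \<kappa> * of_real (g (s n k))" "\<kappa> * of_real (g (s n k))"] by simp
        also have "\<dots> \<le> 1 * g (s n k) + norm \<kappa> * g (s n k)"
          using elim k g(2) by (intro add_mono) (auto simp: norm_mult)
        finally have "norm (\<phi> (s n k) - 1) \<le> C * g (s n k)" by (simp add: C_def algebra_simps)
        then have "norm (\<phi> (s n k) - 1) ^ 2 \<le> (C * g (s n k)) ^ 2" by (intro power_mono) auto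
        also have "\<dots> = C ^ 2 * g (s n k) * g (s n k)" by (simp add: power2_eq_square)
        also have "\<dots> \<le> C ^ 2 * g (Y n) * g (s n k)"
          using monoD[OF g(1)] elim k g(2) by (intro mult_right_mono mult_left_mono) auto
        finally show ?thesis by simp
      qed
      then show ?case unfolding sum_distrib_left by (intro sum_mono) auto
    qed
    show ?thesis
      by (rule tendsto_sandwich[OF always_eventually 2 tendsto_const 1]) (auto intro!: sum_nonneg)
  qed
  have le1: "eventually (\<lambda>n. \<forall>k\<in>{1..m n}. norm (\<phi> (s n k) - 1) \<le> 1) sequentially"
    using order_tendstoD(2)[OF sq zero_less_one]
  proof eventually_elim
    case (elim n)
    show ?case
    proof
      fix k assume "k \<in> {1..m n}"
      then have "3 * norm (\<phi> (s n k) - 1) ^ 2 \<le> (\<Sum>k=1..m n. 3 * norm (\<phi> (s n k) - 1) ^ 2)"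
        by (intro member_le_sum) auto
      then have "norm (\<phi> (s n k) - 1) ^ 2 \<le> 1" using elim zero_le_power2[of "norm (\<phi> (s n k) - 1)"] by linarith
      then show "norm (\<phi> (s n k) - 1) \<le> 1" by (simp add: power2_le_iff_abs_le abs_square_le_1)
    qed
  qed
  \<comment> \<open>Both kinds of factors lie in the unit disc, the exponentials since Re \<phi>
    \<le> 1. Hence the products differ by at most the sum of the differences of the factors.\<close>
  have "(\<lambda>n. (\<Prod>k=1..m n. \<phi> (s n k)) - (\<Prod>k=1..m n. exp (\<phi> (s n k) - 1))) \<longlonglongrightarrow> 0"
  proof (rule Lim_null_comparison[OF _ sq])
    show "eventually (\<lambda>n. norm ((\<Prod>k=1..m n. \<phi> (s n k)) - (\<Prod>k=1..m n. exp (\<phi> (s n k) - 1)))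
        \<le> (\<Sum>k=1..m n. 3 * norm (\<phi> (s n k) - 1) ^ 2)) sequentially"
      using le1
    proof eventually_elim
      case (elim n)
      have e1: "norm (exp (\<phi> x - 1)) \<le> 1" for x
        using complex_Re_le_cmod[of "\<phi> x"] \<phi>(1)[of x] by (simp add: norm_exp_eq_Re)
      have "norm ((\<Prod>k=1..m n. \<phi> (s n k)) - (\<Prod>k=1..m n. exp (\<phi> (s n k) - 1)))
          \<le> (\<Sum>k=1..m n. norm (\<phi> (s n k) - exp (\<phi> (s n k) - 1)))"
        by (intro norm_prod_diff \<phi> e1)
      also have "\<dots> \<le> (\<Sum>k=1..m n. 3 * norm (\<phi> (s n k) - 1) ^ 2)"
      proof (rule sum_mono)
        fix k assume "k \<in> {1..m n}"
        then have "norm (exp (\<phi> (s n k) - 1) - 1 - (\<phi> (s n k) - 1)) \<le> 3 * norm (\<phi> (s n k) - 1) ^ 2"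
          using elim by (intro norm_exp_diff_le) auto
        then show "norm (\<phi> (s n k) - exp (\<phi> (s n k) - 1)) \<le> 3 * norm (\<phi> (s n k) - 1) ^ 2"
          by (simp add: norm_minus_commute)
      qed
      finally show ?case .
    qed
  qed
  from tendsto_add[OF this tendsto_exp[OF sum_lim]]
  show ?thesis by (simp add: exp_sum s_def L_def)
qed

section \<open>Gamma integrals\<close>

text \<open>Euler's integral after scaling. Read from right to left it writes
  \<open>y powr - a\<close> as a mixture of exponentials, which lets Tonelli's theorem remove power
  weights below.\<close>

lemma nn_integral_Gamma:
  fixes a y :: real
  assumes "a > 0" "y > 0"
  shows "(\<integral>\<^sup>+x. ennreal (x powr (a - 1) * exp (- (y * x))) * indicator {0..} x \<partial>lborel) = ennreal (Gamma a * y powr - a)"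
proof -
  let ?I = "\<integral>\<^sup>+x. ennreal (x powr (a - 1) * exp (- (y * x))) * indicator {0..} x \<partial>lborel"
  have "ennreal (Gamma a) = (\<integral>\<^sup>+x. ennreal (x powr (a - 1) / exp x) * indicator {0..} x \<partial>lborel)"
    by (rule nn_integral_has_integral_lebesgue'[symmetric]) (use Gamma_integral_real[OF assms(1)] in auto)
  also have "\<dots> = \<bar>y\<bar> * (\<integral>\<^sup>+x. ennreal ((0 + y * x) powr (a - 1) / exp (0 + y * x)) * indicator {0..} (0 + y * x) \<partial>lborel)"
    using assms by (intro nn_integral_real_affine) auto
  also have "(\<integral>\<^sup>+x. ennreal ((0 + y * x) powr (a - 1) / exp (0 + y * x)) * indicator {0..} (0 + y * x) \<partial>lborel)
      = (\<integral>\<^sup>+x. ennreal (y powr (a - 1)) * (ennreal (x powr (a - 1) * exp (- (y * x))) * indicator {0..} x) \<partial>lborel)"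
    using assms
    by (intro nn_integral_cong)
      (auto simp: indicator_def powr_mult zero_le_mult_iff exp_minus divide_simps ennreal_mult'[symmetric])
  also have "\<dots> = ennreal (y powr (a - 1)) * ?I" by (rule nn_integral_cmult) auto
  also have "ennreal \<bar>y\<bar> * (ennreal (y powr (a - 1)) * ?I) = ennreal (y powr a) * ?I"
    using assms by (simp add: ennreal_mult'[symmetric] mult.assoc[symmetric] powr_mult_base)
  finally have *: "ennreal (Gamma a) = ennreal (y powr a) * ?I" .
  have "?I = ennreal (y powr - a) * (ennreal (y powr a) * ?I)"
    using assms by (simp add: mult.assoc[symmetric] ennreal_mult'[symmetric] powr_add[symmetric])
  also have "\<dots> = ennreal (Gamma a * y powr - a)"
    unfolding *[symmetric] using Gamma_real_pos[OF assms(1)] by (subst ennreal_mult'[symmetric]) (auto simp: mult.commute)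
  finally show ?thesis .
qed

lemma Gamma_reflection_real:
  fixes x :: real
  shows "Gamma x * Gamma (1 - x) = pi / sin (pi * x)"
proof -
  have "complex_of_real (Gamma x * Gamma (1 - x)) = complex_of_real (pi / sin (pi * x))"
    using Gamma_reflection_complex[of "of_real x"]
    by (simp flip: sin_of_real Gamma_complex_of_real)
  then show ?thesis by (simp only: of_real_eq_iff)
qed

lemma nn_integral_exp_Ici:
  fixes c :: real
  assumes "c > 0"
  shows "(\<integral>\<^sup>+v. ennreal (exp (- (v * c))) * indicator {0..} v \<partial>lborel) = ennreal (1 / c)"
proof -
  have "((\<lambda>v. - exp (- (v * c)) / c) \<longlongrightarrow> - 0 / c) at_top"
    using assms filterlim_tendsto_pos_mult_at_top[OF tendsto_const assms filterlim_ident]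
    by (intro tendsto_intros filterlim_compose[OF exp_at_bot]) (auto simp: filterlim_uminus_at_bot mult.commute)
  then have "(\<integral>\<^sup>+v. ennreal (exp (- (v * c))) * indicator {0..} v \<partial>lborel) = ennreal (- 0 / c - (- exp (- (0 * c)) / c))"
    using assms by (intro nn_integral_FTC_atLeast) (auto intro!: derivative_eq_intros)
  then show ?thesis by simp
qed

text \<open>A Beta integral: with 1 / (1 + x) written as the integral of exp (- v (1 + x)) over v,
  exchanging the integrals leaves \<Gamma>(a) \<Gamma>(1 - a), and the reflection formula
  applies.\<close>

lemma nn_integral_powr_div_one_plus:
  fixes a :: real
  assumes "0 < a" "a < 1"
  shows "(\<integral>\<^sup>+x. ennreal (x powr (a - 1) / (1 + x)) * indicator {0..} x \<partial>lborel) = ennreal (pi / sin (pi * a))"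
proof -
  let ?f = "\<lambda>x v :: real. ennreal (x powr (a - 1) * exp (- (v * x))) * indicator {0..} x * (ennreal (exp (- v)) * indicator {0..} v)"
  have "(\<integral>\<^sup>+x. ennreal (x powr (a - 1) / (1 + x)) * indicator {0..} x \<partial>lborel) = (\<integral>\<^sup>+x. \<integral>\<^sup>+v. ?f x v \<partial>lborel \<partial>lborel)"
  proof (rule nn_integral_cong)
    fix x :: real
    show "ennreal (x powr (a - 1) / (1 + x)) * indicator {0..} x = (\<integral>\<^sup>+v. ?f x v \<partial>lborel)"
    proof (cases "x \<ge> 0")
      case True
      have "(\<integral>\<^sup>+v. ?f x v \<partial>lborel) = (\<integral>\<^sup>+v. ennreal (x powr (a - 1)) * (ennreal (exp (- (v * (1 + x)))) * indicator {0..} v) \<partial>lborel)"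
        using True by (intro nn_integral_cong)
          (auto simp: indicator_def ennreal_mult'[symmetric] algebra_simps exp_add[symmetric])
      also have "\<dots> = ennreal (x powr (a - 1)) * ennreal (1 / (1 + x))"
        using True by (subst nn_integral_cmult) (auto simp: nn_integral_exp_Ici)
      finally show ?thesis using True by (simp add: ennreal_mult'[symmetric])
    qed simp
  qed
  also have "\<dots> = (\<integral>\<^sup>+v. \<integral>\<^sup>+x. ?f x v \<partial>lborel \<partial>lborel)"
    by (rule lborel_pair.Fubini'[symmetric]) measurable
  also have "\<dots> = (\<integral>\<^sup>+v. ennreal (Gamma a) * (ennreal (v powr ((1 - a) - 1) * exp (- (1 * v))) * indicator {0..} v) \<partial>lborel)"
  proof (rule nn_integral_cong_AE)
    show "AE v in lborel. (\<integral>\<^sup>+x. ?f x v \<partial>lborel) = ennreal (Gamma a) * (ennreal (v powr ((1 - a) - 1) * exp (- (1 * v))) * indicator {0..} v)"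
      using AE_lborel_singleton[of 0]
    proof eventually_elim
      case (elim v)
      have *: "(\<integral>\<^sup>+x. ?f x v \<partial>lborel) = (\<integral>\<^sup>+x. ennreal (x powr (a - 1) * exp (- (v * x))) * indicator {0..} x \<partial>lborel) * (ennreal (exp (- v)) * indicator {0..} v)"
        by (rule nn_integral_multc) auto
      show ?case
      proof (cases "v > 0")
        case True
        then show ?thesis unfolding * nn_integral_Gamma[OF assms(1) True]
          using Gamma_real_pos[OF assms(1)] by (simp add: ennreal_mult'[symmetric] mult_ac)
      next
        case False
        then show ?thesis unfolding * using elim by simp
      qed
    qed
  qed
  also have "\<dots> = ennreal (Gamma a) * ennreal (Gamma (1 - a) * 1 powr - (1 - a))"
    using assms by (subst nn_integral_cmult) (auto simp: nn_integral_Gamma[of "1 - a" 1, simplified])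
  also have "\<dots> = ennreal (Gamma a * Gamma (1 - a))"
    using assms by (simp add: ennreal_mult'[symmetric])
  finally show ?thesis using Gamma_reflection_real[of a] by simp
qed

text \<open>The substitution is made on the bounded interval from 0 to n, and monotone convergence
  extends it to the half-line.\<close>

lemma nn_integral_substitution_square:
  fixes f :: "real \<Rightarrow> real"
  assumes [measurable]: "f \<in> borel_measurable borel"
  shows "(\<integral>\<^sup>+x. ennreal (f x) * indicator {0..} x \<partial>lborel) = (\<integral>\<^sup>+x. ennreal (f (x\<^sup>2) * (2 * x)) * indicator {0..} x \<partial>lborel)"
proof (rule LIMSEQ_unique)
  show "(\<lambda>n. \<integral>\<^sup>+x. ennreal (f x) * indicator {0..(real n)\<^sup>2} x \<partial>lborel) \<longlonglongrightarrow> (\<integral>\<^sup>+x. ennreal (f x) * indicator {0..} x \<partial>lborel)"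
  proof (rule nn_integral_LIMSEQ)
    show "incseq (\<lambda>n x. ennreal (f x) * indicator {0..(real n)\<^sup>2} x)"
      by (auto simp: incseq_def le_fun_def indicator_def intro: order_trans[OF _ power_mono])
    fix x :: real
    have "eventually (\<lambda>n. ennreal (f x) * indicator {0..(real n)\<^sup>2} x = ennreal (f x) * indicator {0..} x) sequentially"
    proof (rule eventually_sequentiallyI)
      fix n assume "nat \<lceil>max x 1\<rceil> \<le> n"
      then have "max x 1 \<le> real n" by linarith
      then have "x \<le> real n" "1 \<le> real n" by auto
      then have "x \<le> (real n)\<^sup>2" by (smt (verit) power2_eq_square mult_left_mono mult_cancel_left1)
      then show "ennreal (f x) * indicator {0..(real n)\<^sup>2} x = ennreal (f x) * indicator {0..} x" by (auto simp: indicator_def)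
    qed
    then show "(\<lambda>n. ennreal (f x) * indicator {0..(real n)\<^sup>2} x) \<longlonglongrightarrow> ennreal (f x) * indicator {0..} x" by (rule tendsto_eventually)
  qed auto
  have "(\<integral>\<^sup>+x. ennreal (f x) * indicator {0..(real n)\<^sup>2} x \<partial>lborel) = (\<integral>\<^sup>+x. ennreal (f (x\<^sup>2) * (2 * x)) * indicator {0..real n} x \<partial>lborel)" for n
  proof -
    have "(\<integral>\<^sup>+x. ennreal (f x * indicator {0\<^sup>2..(real n)\<^sup>2} x) \<partial>lborel) = (\<integral>\<^sup>+x. ennreal (f (x\<^sup>2) * (2 * x) * indicator {0..real n} x) \<partial>lborel)"
      by (rule nn_integral_substitution)
        (auto simp: set_borel_measurable_def intro!: derivative_eq_intros continuous_intros)
    moreover have "ennreal (c * indicator A x) = ennreal c * indicator A x" for c and A :: "real set" and x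
      by (simp add: indicator_def)
    ultimately show ?thesis by simp
  qed
  moreover have "(\<lambda>n. \<integral>\<^sup>+x. ennreal (f (x\<^sup>2) * (2 * x)) * indicator {0..real n} x \<partial>lborel)
      \<longlonglongrightarrow> (\<integral>\<^sup>+x. ennreal (f (x\<^sup>2) * (2 * x)) * indicator {0..} x \<partial>lborel)"
  proof (rule nn_integral_LIMSEQ)
    show "incseq (\<lambda>n x. ennreal (f (x\<^sup>2) * (2 * x)) * indicator {0..real n} x)"
      by (auto simp: incseq_def le_fun_def indicator_def)
    fix x :: real
    have "eventually (\<lambda>n. ennreal (f (x\<^sup>2) * (2 * x)) * indicator {0..real n} x = ennreal (f (x\<^sup>2) * (2 * x)) * indicator {0..} x) sequentially"
      using eventually_ge_at_top[of "nat \<lceil>x\<rceil>"]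
    proof eventually_elim
      case (elim n)
      then have "x \<le> real n" by linarith
      then show ?case by (auto simp: indicator_def)
    qed
    then show "(\<lambda>n. ennreal (f (x\<^sup>2) * (2 * x)) * indicator {0..real n} x) \<longlonglongrightarrow> ennreal (f (x\<^sup>2) * (2 * x)) * indicator {0..} x"
      by (rule tendsto_eventually)
  qed auto
  ultimately show "(\<lambda>n. \<integral>\<^sup>+x. ennreal (f x) * indicator {0..(real n)\<^sup>2} x \<partial>lborel)
      \<longlonglongrightarrow> (\<integral>\<^sup>+x. ennreal (f (x\<^sup>2) * (2 * x)) * indicator {0..} x \<partial>lborel)"
    by simp
qed

text \<open>Substituting the square reduces this to the Beta integral with parameter a / 2.\<close>

lemma nn_integral_powr_div_one_plus_square:
  fixes a :: real
  assumes "0 < a" "a < 2"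
  shows "(\<integral>\<^sup>+x. ennreal (x powr (a - 1) / (1 + x\<^sup>2)) * indicator {0..} x \<partial>lborel) = ennreal (pi / (2 * sin (pi * a / 2)))"
proof -
  have "ennreal (pi / sin (pi * (a / 2))) = (\<integral>\<^sup>+x. ennreal ((x\<^sup>2) powr (a / 2 - 1) / (1 + x\<^sup>2) * (2 * x)) * indicator {0..} x \<partial>lborel)"
    using assms nn_integral_substitution_square[of "\<lambda>x. x powr (a / 2 - 1) / (1 + x)"]
    by (subst nn_integral_powr_div_one_plus[symmetric]) auto
  also have "\<dots> = (\<integral>\<^sup>+x. ennreal 2 * (ennreal (x powr (a - 1) / (1 + x\<^sup>2)) * indicator {0..} x) \<partial>lborel)"
  proof (intro nn_integral_cong)
    fix x :: real
    have "(x\<^sup>2) powr (a / 2 - 1) * (2 * x) = 2 * x powr (a - 1)" if "x > 0"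
    proof -
      have "(x\<^sup>2) powr (a / 2 - 1) = x powr (a - 2)" using that by (simp add: powr_powr flip: powr_numeral)
      moreover have "x powr (a - 2) * x = x powr (a - 1)" using that powr_mult_base[of x "a - 2"] by (simp add: mult.commute)
      ultimately show ?thesis by simp
    qed
    then show "ennreal ((x\<^sup>2) powr (a / 2 - 1) / (1 + x\<^sup>2) * (2 * x)) * indicator {0..} x
        = ennreal 2 * (ennreal (x powr (a - 1) / (1 + x\<^sup>2)) * indicator {0..} x)"
      by (cases "x > 0") (auto simp: indicator_def ennreal_mult'[symmetric] simp del: ennreal_numeral)
  qed
  also have "\<dots> = ennreal 2 * (\<integral>\<^sup>+x. ennreal (x powr (a - 1) / (1 + x\<^sup>2)) * indicator {0..} x \<partial>lborel)" (is "_ = _ * ?I")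
    by (rule nn_integral_cmult) auto
  finally have *: "ennreal (pi / sin (pi * (a / 2))) = ennreal 2 * ?I" .
  have "ennreal (1 / 2) * ennreal 2 = 1" by (subst ennreal_mult'[symmetric]) auto
  then have "?I = ennreal (1 / 2) * (ennreal 2 * ?I)"
    by (simp only: mult.assoc[symmetric] mult_1)
  also have "\<dots> = ennreal (pi / (2 * sin (pi * a / 2)))"
    unfolding *[symmetric] by (subst ennreal_mult'[symmetric]) auto
  finally show ?thesis .
qed

lemma nn_integral_exp_one_minus_cos:
  fixes x :: real
  assumes "x > 0"
  shows "(\<integral>\<^sup>+y. ennreal ((1 - cos y) * exp (- (x * y))) * indicator {0..} y \<partial>lborel) = ennreal (1 / (x * (1 + x\<^sup>2)))"
proof -
  \<comment> \<open>The antiderivative: the first term belongs to exp (- x y), the second to exp (-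
    x y) cos y.\<close>
  define F where "F y = - exp (- (x * y)) / x - exp (- (x * y)) * (sin y - x * cos y) / (1 + x\<^sup>2)" for y
  have nz: "1 + x\<^sup>2 \<noteq> 0" using zero_le_power2[of x] by linarith
  have e: "((\<lambda>y. exp (- (x * y))) \<longlongrightarrow> 0) at_top"
    using filterlim_tendsto_pos_mult_at_top[OF tendsto_const assms filterlim_ident]
    by (intro filterlim_compose[OF exp_at_bot]) (auto simp: filterlim_uminus_at_bot)
  have "((\<lambda>y. exp (- (x * y)) * (sin y - x * cos y)) \<longlongrightarrow> 0) at_top"
  proof (rule tendsto_0_le[OF e, of _ "1 + x"])
    show "eventually (\<lambda>y. norm (exp (- (x * y)) * (sin y - x * cos y)) \<le> norm (exp (- (x * y))) * (1 + x)) at_top"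
    proof (rule always_eventually, rule allI)
      fix y
      have "\<bar>sin y - x * cos y\<bar> \<le> \<bar>sin y\<bar> + \<bar>x\<bar> * \<bar>cos y\<bar>" using abs_triangle_ineq4[of "sin y" "x * cos y"] by (simp add: abs_mult)
      also have "\<dots> \<le> 1 + x * 1" using assms by (intro add_mono mult_mono) auto
      finally show "norm (exp (- (x * y)) * (sin y - x * cos y)) \<le> norm (exp (- (x * y))) * (1 + x)"
        by (simp add: abs_mult)
    qed
  qed
  from tendsto_diff[OF tendsto_divide[OF tendsto_minus[OF e] tendsto_const[of x]] tendsto_divide[OF this tendsto_const[of "1 + x\<^sup>2"]]]
  have F_lim: "(F \<longlongrightarrow> 0) at_top" using assms nz by (simp add: F_def[abs_def])
  have "(\<integral>\<^sup>+y. ennreal ((1 - cos y) * exp (- (x * y))) * indicator {0..} y \<partial>lborel) = ennreal (0 - F 0)"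
  proof (rule nn_integral_FTC_atLeast[OF _ _ _ F_lim])
    fix y
    have "(F has_real_derivative (- (exp (- (x * y)) * - x) / x - (exp (- (x * y)) * - x * (sin y - x * cos y) + exp (- (x * y)) * (cos y + x * sin y)) / (1 + x\<^sup>2))) (at y)"
      unfolding F_def using assms nz by (auto intro!: derivative_eq_intros)
    also have "(- (exp (- (x * y)) * - x) / x - (exp (- (x * y)) * - x * (sin y - x * cos y) + exp (- (x * y)) * (cos y + x * sin y)) / (1 + x\<^sup>2))
       = (1 - cos y) * exp (- (x * y))"
      using assms nz by (simp add: divide_simps) (simp add: algebra_simps power2_eq_square)
    finally show "DERIV F y :> (1 - cos y) * exp (- (x * y))" .
  qed auto
  also have "0 - F 0 = 1 / (x * (1 + x\<^sup>2))"
    using assms nz by (simp add: F_def divide_simps) (simp add: algebra_simps power2_eq_square)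
  finally show ?thesis .
qed

text \<open>After multiplication by \<Gamma>(\<beta>) the power of y becomes a Gamma integral over
  x. Exchanging leaves the Laplace transform 1 / (x (1 + x^2)) of 1 - cos, and then an integral of
  the preceding kind with parameter \<beta> - 1, which lies between 0 and 2.\<close>

lemma nn_integral_one_minus_cos_powr:
  fixes \<beta> :: real
  assumes "1 < \<beta>" "\<beta> < 3"
  shows "(\<integral>\<^sup>+y. ennreal ((1 - cos y) * y powr - \<beta>) * indicator {0..} y \<partial>lborel)
    = ennreal (pi / (2 * sin (pi * (\<beta> - 1) / 2)) / Gamma \<beta>)"
proof -
  let ?f = "\<lambda>y x :: real. ennreal ((1 - cos y)) * indicator {0..} y * (ennreal (x powr (\<beta> - 1) * exp (- (y * x))) * indicator {0..} x)"
  have G: "Gamma \<beta> > 0" using assms by simp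
  let ?I = "\<integral>\<^sup>+y. ennreal ((1 - cos y) * y powr - \<beta>) * indicator {0..} y \<partial>lborel"
  have "ennreal (Gamma \<beta>) * ?I = (\<integral>\<^sup>+y. ennreal (Gamma \<beta>) * (ennreal ((1 - cos y) * y powr - \<beta>) * indicator {0..} y) \<partial>lborel)"
    by (rule nn_integral_cmult[symmetric]) auto
  also have "\<dots> = (\<integral>\<^sup>+y. \<integral>\<^sup>+x. ?f y x \<partial>lborel \<partial>lborel)"
  proof (rule nn_integral_cong_AE)
    show "AE y in lborel. ennreal (Gamma \<beta>) * (ennreal ((1 - cos y) * y powr - \<beta>) * indicator {0..} y) = (\<integral>\<^sup>+x. ?f y x \<partial>lborel)"
      using AE_lborel_singleton[of 0]
    proof eventually_elim
      case (elim y)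
      have *: "(\<integral>\<^sup>+x. ?f y x \<partial>lborel) = (ennreal (1 - cos y) * indicator {0..} y) * (\<integral>\<^sup>+x. ennreal (x powr (\<beta> - 1) * exp (- (y * x))) * indicator {0..} x \<partial>lborel)"
        by (rule nn_integral_cmult) auto
      show ?case
      proof (cases "y > 0")
        case True
        have "\<beta> > 0" using assms by simp
        then show ?thesis unfolding * nn_integral_Gamma[OF \<open>\<beta> > 0\<close> True]
          using G True by (simp add: ennreal_mult'[symmetric] mult_ac)
      next
        case False
        then show ?thesis unfolding * using elim by simp
      qed
    qed
  qed
  also have "\<dots> = (\<integral>\<^sup>+x. \<integral>\<^sup>+y. ?f y x \<partial>lborel \<partial>lborel)"
    by (rule lborel_pair.Fubini'[symmetric]) measurable
  also have "\<dots> = (\<integral>\<^sup>+x. ennreal (x powr ((\<beta> - 1) - 1) / (1 + x\<^sup>2)) * indicator {0..} x \<partial>lborel)"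
  proof (rule nn_integral_cong_AE)
    show "AE x in lborel. (\<integral>\<^sup>+y. ?f y x \<partial>lborel) = ennreal (x powr ((\<beta> - 1) - 1) / (1 + x\<^sup>2)) * indicator {0..} x"
      using AE_lborel_singleton[of 0]
    proof eventually_elim
      case (elim x)
      show ?case
      proof (cases "x > 0")
        case True
        have "(\<integral>\<^sup>+y. ?f y x \<partial>lborel) = (\<integral>\<^sup>+y. ennreal (x powr (\<beta> - 1)) * (ennreal ((1 - cos y) * exp (- (x * y))) * indicator {0..} y) \<partial>lborel)"
          using True by (intro nn_integral_cong) (auto simp: ennreal_mult'[symmetric] indicator_def mult_ac)
        also have "\<dots> = ennreal (x powr (\<beta> - 1)) * ennreal (1 / (x * (1 + x\<^sup>2)))"
          using True by (subst nn_integral_cmult) (auto simp: nn_integral_exp_one_minus_cos)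
        also have "\<dots> = ennreal (x powr ((\<beta> - 1) - 1) / (1 + x\<^sup>2))"
          using True powr_mult_base[of x "\<beta> - 2", symmetric] by (simp add: ennreal_mult'[symmetric] power2_eq_square)
        finally show ?thesis using True by simp
      qed (use elim in \<open>auto simp: indicator_def\<close>)
    qed
  qed
  also have "\<dots> = ennreal (pi / (2 * sin (pi * (\<beta> - 1) / 2)))"
    using assms by (intro nn_integral_powr_div_one_plus_square) auto
  finally have *: "ennreal (Gamma \<beta>) * ?I = ennreal (pi / (2 * sin (pi * (\<beta> - 1) / 2)))" .
  have "?I = ennreal (1 / Gamma \<beta>) * (ennreal (Gamma \<beta>) * ?I)"
    using G by (simp add: mult.assoc[symmetric] ennreal_mult'[symmetric])
  also have "\<dots> = ennreal (pi / (2 * sin (pi * (\<beta> - 1) / 2)) / Gamma \<beta>)"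
    unfolding * using G by (subst ennreal_mult'[symmetric]) (auto simp: mult_ac)
  finally show ?thesis .
qed

lemma has_bochner_integral_one_minus_cos_powr:
  fixes \<beta> :: real
  assumes "1 < \<beta>" "\<beta> < 3"
  shows "has_bochner_integral lborel (\<lambda>y. indicator {0..} y * ((1 - cos y) * y powr - \<beta>))
    (pi / (2 * sin (pi * (\<beta> - 1) / 2)) / Gamma \<beta>)"
proof (rule has_bochner_integral_nn_integral)
  have "sin (pi * (\<beta> - 1) / 2) > 0" using assms by (intro sin_gt_zero) auto
  then show "0 \<le> pi / (2 * sin (pi * (\<beta> - 1) / 2)) / Gamma \<beta>" using assms by auto
  show "(\<integral>\<^sup>+y. ennreal (indicator {0..} y * ((1 - cos y) * y powr - \<beta>)) \<partial>lborel) = ennreal (pi / (2 * sin (pi * (\<beta> - 1) / 2)) / Gamma \<beta>)"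
    unfolding nn_integral_one_minus_cos_powr[OF assms, symmetric]
    by (intro nn_integral_cong) (auto simp: indicator_def)
qed (auto simp: indicator_def)

lemma integrable_powr_near_0:
  fixes a :: real
  assumes "a > -1"
  shows "integrable lborel (\<lambda>x. indicator {0..1} x * x powr a)"
proof -
  have "(\<integral>\<^sup>+x. ennreal (x powr a) * indicator {0..1} x \<partial>lborel) = ennreal (1 powr (a + 1) / (a + 1))"
    using has_integral_powr_from_0[OF assms, of 1] by (intro nn_integral_has_integral_lebesgue') auto
  also have "(\<integral>\<^sup>+x. ennreal (x powr a) * indicator {0..1} x \<partial>lborel) = (\<integral>\<^sup>+x. ennreal (indicator {0..1} x * x powr a) \<partial>lborel)"
    by (intro nn_integral_cong) (auto simp: indicator_def)
  finally show ?thesis by (intro integrableI_nonneg) auto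
qed

lemma integrable_powr_at_top:
  fixes a :: real
  assumes "a < -1"
  shows "integrable lborel (\<lambda>x. indicator {1..} x * x powr a)"
proof -
  have "(\<integral>\<^sup>+x. ennreal (x powr a) * indicator {1..} x \<partial>lborel) = ennreal (- (1 powr (a + 1)) / (a + 1))"
    using has_integral_powr_to_inf[OF assms, of 1] by (intro nn_integral_has_integral_lebesgue') auto
  also have "(\<integral>\<^sup>+x. ennreal (x powr a) * indicator {1..} x \<partial>lborel) = (\<integral>\<^sup>+x. ennreal (indicator {1..} x * x powr a) \<partial>lborel)"
    by (intro nn_integral_cong) (auto simp: indicator_def)
  finally show ?thesis by (intro integrableI_nonneg) auto
qed

text \<open>Integration by parts: the derivative of (1 - cos y) y^(-\<alpha>) is the difference of
  \<open>h\<close> and \<open>f\<close>. The boundary terms vanish, at 0 like y^(2 - \<alpha>) and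
  at infinity like y^(-\<alpha>), so the sine integral equals the one of \<open>f\<close>, known
  from the exponent \<alpha> + 1.\<close>

lemma has_bochner_integral_sin_powr:
  fixes \<alpha> :: real
  assumes "1 < \<alpha>" "\<alpha> < 2"
  shows "has_bochner_integral lborel (\<lambda>y. indicator {0..} y * (sin y * y powr - \<alpha>)) (Gamma (1 - \<alpha>) * cos (pi * \<alpha> / 2))"
proof -
  define f where "f y = \<alpha> * ((1 - cos y) * y powr - (\<alpha> + 1))" for y :: real
  define h where "h y = sin y * y powr - \<alpha>" for y :: real
  define F where "F y = (1 - cos y) * y powr - \<alpha>" for y :: real
  have cosb: "1 - cos y \<le> y\<^sup>2 / 2" for y :: real
  proof -
    have "1 - cos y = 2 * \<bar>sin (y / 2)\<bar>\<^sup>2" using cos_double_sin[of "y / 2"] by simp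
    also have "\<dots> \<le> 2 * \<bar>y / 2\<bar>\<^sup>2" using abs_sin_x_le_abs_x[of "y / 2"] by (intro mult_left_mono power_mono) auto
    finally show ?thesis by (simp add: power2_eq_square)
  qed
  have J: "has_bochner_integral lborel (\<lambda>y. indicator {0..} y * f y)
      (\<alpha> * (pi / (2 * sin (pi * (\<alpha> + 1 - 1) / 2)) / Gamma (\<alpha> + 1)))"
    using has_bochner_integral_mult_right[OF has_bochner_integral_one_minus_cos_powr[of "\<alpha> + 1"], of \<alpha>] assms
    by (simp add: f_def[abs_def] mult_ac)
  have h_int: "integrable lborel (\<lambda>y. indicator {0..} y * h y)"
  proof (rule Bochner_Integration.integrable_bound)
    show "integrable lborel (\<lambda>x. indicator {0..1} x * x powr (1 - \<alpha>) + indicator {1..} x * x powr - \<alpha>)"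
      using assms by (intro Bochner_Integration.integrable_add integrable_powr_near_0 integrable_powr_at_top) auto
    show "AE x in lborel. norm (indicator {0..} x * h x)
        \<le> norm (indicator {0..1} x * x powr (1 - \<alpha>) + indicator {1..} x * x powr - \<alpha>)"
    proof (rule AE_I2)
      fix x :: real
      consider "x \<le> 0" | "0 < x" "x < 1" | "x \<ge> 1" by linarith
      then show "norm (indicator {0..} x * h x) \<le> norm (indicator {0..1} x * x powr (1 - \<alpha>) + indicator {1..} x * x powr - \<alpha>)"
      proof cases
        case 2
        have "\<bar>h x\<bar> \<le> x * x powr - \<alpha>" unfolding h_def abs_mult using 2 abs_sin_x_le_abs_x[of x]
          by (intro mult_mono) auto
        then show ?thesis using 2 powr_mult_base[of x "- \<alpha>"] by (simp add: indicator_def)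
      next
        case 3
        have "\<bar>h x\<bar> \<le> 1 * x powr - \<alpha>" unfolding h_def abs_mult
          by (intro mult_mono) auto
        then show ?thesis using 3 by (cases "x = 1") (auto simp: indicator_def h_def intro: order_trans[OF abs_sin_le_one])
      qed (auto simp: indicator_def h_def)
    qed
  qed (simp add: h_def)
  have hf_int: "set_integrable lborel (einterval 0 \<infinity>) (\<lambda>y. h y - f y)"
  proof -
    have "integrable lborel (\<lambda>y. indicator {0..} y * h y - indicator {0..} y * f y)"
      using h_int J by (intro Bochner_Integration.integrable_diff) (auto simp: has_bochner_integral_iff)
    then have "set_integrable lborel {0..} (\<lambda>y. h y - f y)"
      by (simp add: set_integrable_def algebra_simps)
    then show ?thesis by (rule set_integrable_subset) (auto simp: einterval_def)
  qed
  have "(LBINT y=0..\<infinity>. h y - f y) = 0 - 0"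
  proof (rule interval_integral_FTC_integrable[OF _ _ _ hf_int])
    fix y :: real assume "0 < ereal y"
    then have y: "y > 0" by simp
    have "(F has_real_derivative (sin y * y powr - \<alpha> + (1 - cos y) * (- \<alpha> * y powr (- \<alpha> - 1)))) (at y)"
      unfolding F_def using y by (auto intro!: derivative_eq_intros)
    also have "sin y * y powr - \<alpha> + (1 - cos y) * (- \<alpha> * y powr (- \<alpha> - 1)) = h y - f y"
    proof -
      have e: "- (\<alpha> + 1) = - \<alpha> - 1" by simp
      show ?thesis unfolding h_def f_def e by (simp add: left_diff_distrib right_diff_distrib mult_ac)
    qed
    finally show "(F has_vector_derivative (h y - f y)) (at y)"
      by (simp add: has_real_derivative_iff_has_vector_derivative)
    show "isCont (\<lambda>y. h y - f y) y" unfolding h_def f_def using y by (auto intro!: continuous_intros)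
  next
    have "(F \<longlongrightarrow> 0) (at_right 0)"
    proof (rule Lim_null_comparison)
      show "eventually (\<lambda>y. norm (F y) \<le> y powr (2 - \<alpha>)) (at_right 0)"
        using eventually_at_right_less[of 0]
      proof eventually_elim
        case (elim y)
        have "1 - cos y \<le> y\<^sup>2" using cosb[of y] zero_le_power2[of y] by linarith
        then have "(1 - cos y) * y powr - \<alpha> \<le> y\<^sup>2 * y powr - \<alpha>"
          by (intro mult_right_mono) auto
        also have "y\<^sup>2 * y powr - \<alpha> = y powr (2 - \<alpha>)" using elim powr_add[of y 2 "- \<alpha>"] by simp
        finally show ?case by (simp add: F_def abs_mult)
      qed
      have "((\<lambda>y. y powr (2 - \<alpha>)) \<longlongrightarrow> 0 powr (2 - \<alpha>)) (at_right 0)"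
        using assms by (intro tendsto_powr') (auto simp: eventually_at_right_less intro!: tendsto_intros eventually_mono[OF eventually_at_right_less[of 0]])
      then show "((\<lambda>y. y powr (2 - \<alpha>)) \<longlongrightarrow> 0) (at_right 0)" by simp
    qed
    then show "((F \<circ> real_of_ereal) \<longlongrightarrow> 0) (at_right 0)"
      by (simp add: zero_ereal_def ereal_tendsto_simps)
    have "(F \<longlongrightarrow> 0) at_top"
    proof (rule tendsto_0_le[where K = 2])
      show "((\<lambda>y. y powr - \<alpha>) \<longlongrightarrow> 0) at_top" using assms by (intro tendsto_neg_powr filterlim_ident) auto
      have "\<bar>1 - cos y\<bar> \<le> 2" for y :: real using cos_ge_minus_one[of y] cos_le_one[of y] by linarith
      then show "eventually (\<lambda>y. norm (F y) \<le> norm (y powr - \<alpha>) * 2) at_top"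
        by (intro always_eventually) (auto simp: F_def abs_mult mult.commute[of _ 2] intro!: mult_right_mono)
    qed
    then show "((F \<circ> real_of_ereal) \<longlongrightarrow> 0) (at_left \<infinity>)"
      by (simp add: ereal_tendsto_simps)
  qed simp
  then have "(LINT y|lborel. indicator {0<..} y *\<^sub>R (h y - f y)) = 0"
    by (simp add: interval_lebesgue_integral_0_infty set_lebesgue_integral_def)
  also have "(LINT y|lborel. indicator {0<..} y *\<^sub>R (h y - f y)) = (LINT y|lborel. indicator {0..} y * h y - indicator {0..} y * f y)"
    by (rule Bochner_Integration.integral_cong) (auto simp: indicator_def h_def f_def)
  also have "\<dots> = (LINT y|lborel. indicator {0..} y * h y) - (LINT y|lborel. indicator {0..} y * f y)"
    using h_int J by (intro Bochner_Integration.integral_diff) (auto simp: has_bochner_integral_iff)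
  finally have "(LINT y|lborel. indicator {0..} y * h y) = \<alpha> * (pi / (2 * sin (pi * \<alpha> / 2)) / Gamma (\<alpha> + 1))"
    using J by (simp add: has_bochner_integral_iff)
  \<comment> \<open>Reflection expresses \<Gamma>(1 - \<alpha>) through \<Gamma>(\<alpha>) and sin
    (\<pi> \<alpha>); the double-angle formula splits the sine, and its cosine factor is nonzero for
    \<alpha> strictly between 1 and 2.\<close>
  also have "\<dots> = Gamma (1 - \<alpha>) * cos (pi * \<alpha> / 2)"
  proof -
    have "sin (pi * \<alpha> / 2) > 0" using assms by (intro sin_gt_zero) auto
    moreover have "cos (pi * \<alpha> / 2) \<noteq> 0"
    proof -
      have "pi * \<alpha> / 2 - pi / 2 > 0" "pi * \<alpha> / 2 - pi / 2 < pi" using assms by (auto simp: field_simps)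
      then have "sin (pi * \<alpha> / 2 - pi / 2) > 0" by (intro sin_gt_zero)
      then show ?thesis by (simp add: sin_diff)
    qed
    moreover have "sin (pi * \<alpha>) = 2 * sin (pi * \<alpha> / 2) * cos (pi * \<alpha> / 2)" using sin_double[of "pi * \<alpha> / 2"] by simp
    moreover have "Gamma \<alpha> > 0" using assms by simp
    moreover have "Gamma (\<alpha> + 1) = \<alpha> * Gamma \<alpha>" using assms by (intro Gamma_plus1) (auto simp: nonpos_Ints_def)
    moreover have "Gamma (1 - \<alpha>) = pi / sin (pi * \<alpha>) / Gamma \<alpha>"
      using Gamma_reflection_real[of \<alpha>] \<open>Gamma \<alpha> > 0\<close>
      by (metis nonzero_mult_div_cancel_left less_irrefl)
    ultimately show ?thesis using assms by (auto simp add: divide_simps mult_ac split: if_splits)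
  qed
  finally show ?thesis using h_int by (simp add: has_bochner_integral_iff h_def)
qed

text \<open>The earlier value rewritten by reflection into the form of the stable exponent; here the
  shift by \<pi>/2 turns the sine in the denominator into minus the cosine.\<close>

lemma has_bochner_integral_one_minus_cos_powr':
  fixes \<alpha> :: real
  assumes "1 < \<alpha>" "\<alpha> < 2"
  shows "has_bochner_integral lborel (\<lambda>y. indicator {0..} y * ((1 - cos y) * y powr - \<alpha>)) (- Gamma (1 - \<alpha>) * sin (pi * \<alpha> / 2))"
proof -
  have "sin (pi * \<alpha> / 2) > 0" using assms by (intro sin_gt_zero) auto
  moreover have "cos (pi * \<alpha> / 2) < 0"
  proof -
    have "pi * \<alpha> / 2 - pi / 2 > 0" "pi * \<alpha> / 2 - pi / 2 < pi" using assms by (auto simp: field_simps)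
    then have "sin (pi * \<alpha> / 2 - pi / 2) > 0" by (intro sin_gt_zero)
    then show ?thesis by (simp add: sin_diff)
  qed
  moreover have "sin (pi * \<alpha>) = 2 * sin (pi * \<alpha> / 2) * cos (pi * \<alpha> / 2)" using sin_double[of "pi * \<alpha> / 2"] by simp
  moreover have "Gamma \<alpha> > 0" using assms by simp
  moreover have "Gamma (1 - \<alpha>) = pi / sin (pi * \<alpha>) / Gamma \<alpha>"
    using Gamma_reflection_real[of \<alpha>] \<open>Gamma \<alpha> > 0\<close>
      by (metis nonzero_mult_div_cancel_left less_irrefl)
  moreover have "sin (pi * (\<alpha> - 1) / 2) = - cos (pi * \<alpha> / 2)"
    using sin_diff[of "pi * \<alpha> / 2" "pi / 2"] by (simp add: algebra_simps diff_divide_distrib)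
  ultimately have "pi / (2 * sin (pi * (\<alpha> - 1) / 2)) / Gamma \<alpha> = - Gamma (1 - \<alpha>) * sin (pi * \<alpha> / 2)"
    by (simp add: divide_simps)
  then show ?thesis using has_bochner_integral_one_minus_cos_powr[of \<alpha>] assms by simp
qed

section \<open>Sequences vanishing in probability\<close>

text \<open>In the induction the mixed term vanishes because the new summand is independent of the
  sum of the others and both are centered.\<close>

lemma (in prob_space) expectation_square_sum_indep:
  fixes X :: "'i \<Rightarrow> 'a \<Rightarrow> real"
  assumes "finite I" "indep_vars (\<lambda>_. borel) X I"
    and "\<And>i. i \<in> I \<Longrightarrow> integrable M (\<lambda>\<omega>. (X i \<omega>)\<^sup>2)" "\<And>i. i \<in> I \<Longrightarrow> expectation (X i) = 0"
  shows "integrable M (\<lambda>\<omega>. (\<Sum>i\<in>I. X i \<omega>)\<^sup>2) \<and> expectation (\<lambda>\<omega>. (\<Sum>i\<in>I. X i \<omega>)\<^sup>2) = (\<Sum>i\<in>I. expectation (\<lambda>\<omega>. (X i \<omega>)\<^sup>2))"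
  using assms
proof (induction I rule: finite_induct)
  case (insert i I)
  let ?S = "\<lambda>\<omega>. \<Sum>i\<in>I. X i \<omega>"
  have IH: "integrable M (\<lambda>\<omega>. (?S \<omega>)\<^sup>2)" "expectation (\<lambda>\<omega>. (?S \<omega>)\<^sup>2) = (\<Sum>i\<in>I. expectation (\<lambda>\<omega>. (X i \<omega>)\<^sup>2))"
    using insert.IH insert.prems indep_vars_subset[OF insert.prems(1), of I] by auto
  have [measurable]: "X k \<in> borel_measurable M" if "k \<in> insert i I" for k
    using insert.prems(1) that by (auto simp: indep_vars_def)
  have int: "integrable M (X k)" if "k \<in> insert i I" for k
    using insert.prems(2)[OF that] that by (intro square_integrable_imp_integrable[OF _ insert.prems(2)]) auto
  have S: "integrable M ?S" "expectation ?S = 0"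
    using int insert.prems(3) by (auto simp: Bochner_Integration.integral_sum)
  have ind: "indep_var borel (X i) borel ?S"
    using insert by (intro indep_vars_sum) auto
  have XS: "integrable M (\<lambda>\<omega>. X i \<omega> * ?S \<omega>)" "expectation (\<lambda>\<omega>. X i \<omega> * ?S \<omega>) = 0"
    using indep_var_integrable[OF ind] indep_var_lebesgue_integral[OF ind] int S by auto
  have eq: "(\<Sum>k\<in>insert i I. X k \<omega>)\<^sup>2 = (X i \<omega>)\<^sup>2 + 2 * (X i \<omega> * ?S \<omega>) + (?S \<omega>)\<^sup>2" for \<omega>
    using insert.hyps by (simp add: power2_sum algebra_simps)
  show ?case unfolding eq using insert.prems(2)[of i] IH XS insert.hyps
    by (auto simp: Bochner_Integration.integral_add)
qed simp

lemma (in prob_space) expectation_abs_le_sqrt: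
  fixes X :: "'a \<Rightarrow> real"
  assumes [measurable]: "X \<in> borel_measurable M" and "integrable M (\<lambda>\<omega>. (X \<omega>)\<^sup>2)"
  shows "expectation (\<lambda>\<omega>. \<bar>X \<omega>\<bar>) \<le> sqrt (expectation (\<lambda>\<omega>. (X \<omega>)\<^sup>2))"
proof -
  have i: "integrable M X" using assms by (rule square_integrable_imp_integrable)
  have "0 \<le> variance (\<lambda>\<omega>. \<bar>X \<omega>\<bar>)" by simp
  also have "\<dots> = expectation (\<lambda>\<omega>. (X \<omega>)\<^sup>2) - (expectation (\<lambda>\<omega>. \<bar>X \<omega>\<bar>))\<^sup>2"
    using assms i by (subst variance_eq) auto
  finally show ?thesis by (intro real_le_rsqrt) simp
qed

text \<open>Convergence to 0 in probability. Measurability of every member is included so that it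
  need not be carried along separately.\<close>

definition prob_vanish :: "'a measure \<Rightarrow> (nat \<Rightarrow> 'a \<Rightarrow> real) \<Rightarrow> bool" where
  "prob_vanish M D \<longleftrightarrow> (\<forall>n. D n \<in> borel_measurable M) \<and>
     (\<forall>\<epsilon>>0. (\<lambda>n. measure M {\<omega> \<in> space M. \<epsilon> < \<bar>D n \<omega>\<bar>}) \<longlonglongrightarrow> 0)"

lemma prob_vanish_measurable [measurable_dest]: "prob_vanish M D \<Longrightarrow> D n \<in> borel_measurable M"
  by (auto simp: prob_vanish_def)

context prob_space
begin

text \<open>Domination may fail on events of vanishing probability. This is how the truncation at
  \<open>J n\<close> is handled, where the walk has passed the level \<open>t n\<close> with high
  probability only.\<close>

lemma prob_vanish_dominated:
  assumes D: "prob_vanish M D" and A: "\<And>n. A n \<in> events" "(\<lambda>n. prob (A n)) \<longlonglongrightarrow> 0"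
    and E: "\<And>n. E n \<in> borel_measurable M"
    and le: "eventually (\<lambda>n. AE \<omega> in M. \<omega> \<notin> A n \<longrightarrow> \<bar>E n \<omega>\<bar> \<le> \<bar>D n \<omega>\<bar>) sequentially"
  shows "prob_vanish M E"
  unfolding prob_vanish_def
proof (intro conjI allI impI)
  fix \<epsilon> :: real assume \<epsilon>: "\<epsilon> > 0"
  note [measurable] = prob_vanish_measurable[OF D] E A(1)
  have "(\<lambda>n. prob {\<omega> \<in> space M. \<epsilon> < \<bar>D n \<omega>\<bar>} + prob (A n)) \<longlonglongrightarrow> 0 + 0"
    using D \<epsilon> by (intro tendsto_add A(2)) (auto simp: prob_vanish_def)
  then have lim: "(\<lambda>n. prob {\<omega> \<in> space M. \<epsilon> < \<bar>D n \<omega>\<bar>} + prob (A n)) \<longlonglongrightarrow> 0" by simp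
  have "eventually (\<lambda>n. prob {\<omega> \<in> space M. \<epsilon> < \<bar>E n \<omega>\<bar>} \<le> prob {\<omega> \<in> space M. \<epsilon> < \<bar>D n \<omega>\<bar>} + prob (A n)) sequentially"
    using le
  proof eventually_elim
    case (elim n)
    have "prob {\<omega> \<in> space M. \<epsilon> < \<bar>E n \<omega>\<bar>} \<le> prob ({\<omega> \<in> space M. \<epsilon> < \<bar>D n \<omega>\<bar>} \<union> A n)"
      by (rule finite_measure_mono_AE) (use elim in auto)
    also have "\<dots> \<le> prob {\<omega> \<in> space M. \<epsilon> < \<bar>D n \<omega>\<bar>} + prob (A n)"
      by (rule measure_Un_le) measurable
    finally show ?case .
  qed
  then show "(\<lambda>n. prob {\<omega> \<in> space M. \<epsilon> < \<bar>E n \<omega>\<bar>}) \<longlonglongrightarrow> 0"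
    by (intro tendsto_sandwich[OF _ _ tendsto_const lim]) auto
qed (rule E)

lemma prob_vanish_mono:
  assumes "prob_vanish M D" "\<And>n. E n \<in> borel_measurable M"
    and "eventually (\<lambda>n. AE \<omega> in M. \<bar>E n \<omega>\<bar> \<le> \<bar>D n \<omega>\<bar>) sequentially"
  shows "prob_vanish M E"
  using assms by (intro prob_vanish_dominated[of D "\<lambda>_. {}" E]) auto

lemma prob_vanish_add:
  assumes D: "prob_vanish M D" and E: "prob_vanish M E"
  shows "prob_vanish M (\<lambda>n \<omega>. D n \<omega> + E n \<omega>)"
  unfolding prob_vanish_def
proof (intro conjI allI impI)
  note [measurable] = prob_vanish_measurable[OF D] prob_vanish_measurable[OF E]
  fix \<epsilon> :: real assume \<epsilon>: "\<epsilon> > 0"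
  have "(\<lambda>n. prob {\<omega> \<in> space M. \<epsilon> / 2 < \<bar>D n \<omega>\<bar>} + prob {\<omega> \<in> space M. \<epsilon> / 2 < \<bar>E n \<omega>\<bar>}) \<longlonglongrightarrow> 0 + 0"
    using D E half_gt_zero[OF \<epsilon>] unfolding prob_vanish_def by (intro tendsto_add) blast+
  then have lim: "(\<lambda>n. prob {\<omega> \<in> space M. \<epsilon> / 2 < \<bar>D n \<omega>\<bar>} + prob {\<omega> \<in> space M. \<epsilon> / 2 < \<bar>E n \<omega>\<bar>}) \<longlonglongrightarrow> 0" by simp
  have "prob {\<omega> \<in> space M. \<epsilon> < \<bar>D n \<omega> + E n \<omega>\<bar>} \<le> prob {\<omega> \<in> space M. \<epsilon> / 2 < \<bar>D n \<omega>\<bar>} + prob {\<omega> \<in> space M. \<epsilon> / 2 < \<bar>E n \<omega>\<bar>}" for n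
  proof -
    have "prob {\<omega> \<in> space M. \<epsilon> < \<bar>D n \<omega> + E n \<omega>\<bar>} \<le> prob ({\<omega> \<in> space M. \<epsilon> / 2 < \<bar>D n \<omega>\<bar>} \<union> {\<omega> \<in> space M. \<epsilon> / 2 < \<bar>E n \<omega>\<bar>})"
      by (rule finite_measure_mono) auto
    also have "\<dots> \<le> prob {\<omega> \<in> space M. \<epsilon> / 2 < \<bar>D n \<omega>\<bar>} + prob {\<omega> \<in> space M. \<epsilon> / 2 < \<bar>E n \<omega>\<bar>}"
      by (rule measure_Un_le) measurable
    finally show ?thesis .
  qed
  then show "(\<lambda>n. prob {\<omega> \<in> space M. \<epsilon> < \<bar>D n \<omega> + E n \<omega>\<bar>}) \<longlonglongrightarrow> 0"
    by (intro tendsto_sandwich[OF _ _ tendsto_const lim]) auto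
qed (use prob_vanish_measurable[OF D] prob_vanish_measurable[OF E] in measurable)

lemma prob_vanish_minus: "prob_vanish M D \<Longrightarrow> prob_vanish M (\<lambda>n \<omega>. - D n \<omega>)"
  by (auto simp: prob_vanish_def)

lemma prob_vanish_L1:
  assumes m: "\<And>n. D n \<in> borel_measurable M"
    and b: "eventually (\<lambda>n. integrable M (D n) \<and> expectation (\<lambda>\<omega>. \<bar>D n \<omega>\<bar>) \<le> e n) sequentially" and e: "e \<longlonglongrightarrow> 0"
  shows "prob_vanish M D"
  unfolding prob_vanish_def
proof (intro conjI allI impI)
  fix \<epsilon> :: real assume \<epsilon>: "\<epsilon> > 0"
  note [measurable] = m
  have lim: "(\<lambda>n. e n / \<epsilon>) \<longlonglongrightarrow> 0" using tendsto_divide[OF e tendsto_const[of \<epsilon>]] \<epsilon> by simp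
  have "eventually (\<lambda>n. prob {\<omega> \<in> space M. \<epsilon> < \<bar>D n \<omega>\<bar>} \<le> e n / \<epsilon>) sequentially" using b
  proof eventually_elim
    case (elim n)
    have "prob {\<omega> \<in> space M. \<epsilon> < \<bar>D n \<omega>\<bar>} \<le> prob {\<omega> \<in> space M. \<epsilon> \<le> \<bar>D n \<omega>\<bar>}"
      by (rule finite_measure_mono) auto
    also have "\<dots> \<le> expectation (\<lambda>\<omega>. \<bar>D n \<omega>\<bar>) / \<epsilon>"
      using elim \<epsilon> by (intro integral_Markov_inequality_measure[where A = "{}"]) auto
    also have "\<dots> \<le> e n / \<epsilon>" using elim \<epsilon> by (intro divide_right_mono) auto
    finally show ?case .
  qed
  then show "(\<lambda>n. prob {\<omega> \<in> space M. \<epsilon> < \<bar>D n \<omega>\<bar>}) \<longlonglongrightarrow> 0"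
    by (intro tendsto_sandwich[OF _ _ tendsto_const lim]) auto
qed (rule m)

lemma prob_vanish_const:
  assumes "e \<longlonglongrightarrow> 0" shows "prob_vanish M (\<lambda>n \<omega>. e n)"
  using assms by (intro prob_vanish_L1[where e = "\<lambda>n. \<bar>e n\<bar>"]) (auto simp: prob_space intro: tendsto_rabs_zero)

text \<open>Boundedness in mean makes the second factor tight, and a tight factor cannot undo
  convergence to 0 in probability.\<close>

lemma prob_vanish_mult:
  assumes D: "prob_vanish M D" and m: "\<And>n. Y n \<in> borel_measurable M"
    and b: "eventually (\<lambda>n. integrable M (Y n) \<and> expectation (\<lambda>\<omega>. \<bar>Y n \<omega>\<bar>) \<le> K) sequentially"
  shows "prob_vanish M (\<lambda>n \<omega>. D n \<omega> * Y n \<omega>)"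
  unfolding prob_vanish_def
proof (intro conjI allI impI)
  note [measurable] = prob_vanish_measurable[OF D] m
  fix \<epsilon> :: real assume \<epsilon>: "\<epsilon> > 0"
  show "(\<lambda>n. prob {\<omega> \<in> space M. \<epsilon> < \<bar>D n \<omega> * Y n \<omega>\<bar>}) \<longlonglongrightarrow> 0"
  proof (rule LIMSEQ_I)
    fix r :: real assume r: "r > 0"
    \<comment> \<open>Chosen so that Markov's bound |K| / B for the event |Y n| \<ge> B is below r /
      2.\<close>
    define B where "B = 2 * (\<bar>K\<bar> + 1) / r"
    have B: "B > 0" "\<bar>K\<bar> / B < r / 2" using r by (auto simp: B_def field_simps)
    have "(\<lambda>n. prob {\<omega> \<in> space M. \<epsilon> / B < \<bar>D n \<omega>\<bar>}) \<longlonglongrightarrow> 0"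
      using D \<epsilon> B by (auto simp: prob_vanish_def)
    then have "eventually (\<lambda>n. prob {\<omega> \<in> space M. \<epsilon> / B < \<bar>D n \<omega>\<bar>} < r / 2) sequentially"
      using r by (intro order_tendstoD) auto
    then have "eventually (\<lambda>n. norm (prob {\<omega> \<in> space M. \<epsilon> < \<bar>D n \<omega> * Y n \<omega>\<bar>} - 0) < r) sequentially"
      using b
    proof eventually_elim
      case (elim n)
      have "prob {\<omega> \<in> space M. \<epsilon> < \<bar>D n \<omega> * Y n \<omega>\<bar>} \<le> prob ({\<omega> \<in> space M. \<epsilon> / B < \<bar>D n \<omega>\<bar>} \<union> {\<omega> \<in> space M. B \<le> \<bar>Y n \<omega>\<bar>})"
      proof (rule finite_measure_mono)
        have "\<bar>D n \<omega> * Y n \<omega>\<bar> \<le> \<epsilon>" if "\<bar>D n \<omega>\<bar> \<le> \<epsilon> / B" "\<bar>Y n \<omega>\<bar> \<le> B" for \<omega>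
          using mult_mono[OF that] B \<epsilon> by (simp add: abs_mult)
        then show "{\<omega> \<in> space M. \<epsilon> < \<bar>D n \<omega> * Y n \<omega>\<bar>} \<subseteq> {\<omega> \<in> space M. \<epsilon> / B < \<bar>D n \<omega>\<bar>} \<union> {\<omega> \<in> space M. B \<le> \<bar>Y n \<omega>\<bar>}"
          by (force simp: not_less not_le)
      qed measurable
      also have "\<dots> \<le> prob {\<omega> \<in> space M. \<epsilon> / B < \<bar>D n \<omega>\<bar>} + prob {\<omega> \<in> space M. B \<le> \<bar>Y n \<omega>\<bar>}"
        by (rule measure_Un_le) measurable
      also have "prob {\<omega> \<in> space M. B \<le> \<bar>Y n \<omega>\<bar>} \<le> expectation (\<lambda>\<omega>. \<bar>Y n \<omega>\<bar>) / B"
        using elim B by (intro integral_Markov_inequality_measure[where A = "{}"]) auto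
      also have "\<dots> \<le> \<bar>K\<bar> / B" using elim B by (intro divide_right_mono) auto
      finally have "prob {\<omega> \<in> space M. \<epsilon> < \<bar>D n \<omega> * Y n \<omega>\<bar>} \<le> prob {\<omega> \<in> space M. \<epsilon> / B < \<bar>D n \<omega>\<bar>} + \<bar>K\<bar> / B" by simp
      then have "prob {\<omega> \<in> space M. \<epsilon> < \<bar>D n \<omega> * Y n \<omega>\<bar>} < r" using elim(1) B(2) by linarith
      then show ?case by simp
    qed
    then show "\<exists>N. \<forall>n\<ge>N. norm (prob {\<omega> \<in> space M. \<epsilon> < \<bar>D n \<omega> * Y n \<omega>\<bar>} - 0) < r"
      by (simp add: eventually_sequentially)
  qed
qed (use prob_vanish_measurable[OF D] m in measurable)

lemma prob_vanish_L2:
  assumes m: "\<And>n. D n \<in> borel_measurable M"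
    and b: "eventually (\<lambda>n. integrable M (\<lambda>\<omega>. (D n \<omega>)\<^sup>2) \<and> expectation (\<lambda>\<omega>. (D n \<omega>)\<^sup>2) \<le> e n) sequentially" and e: "e \<longlonglongrightarrow> 0"
  shows "prob_vanish M D"
proof (rule prob_vanish_L1[OF m])
  show "eventually (\<lambda>n. integrable M (D n) \<and> expectation (\<lambda>\<omega>. \<bar>D n \<omega>\<bar>) \<le> sqrt (e n)) sequentially"
    using b
  proof eventually_elim
    case (elim n)
    then show ?case using expectation_abs_le_sqrt[OF m] square_integrable_imp_integrable[OF m]
      by (meson order_trans real_sqrt_le_mono)
  qed
  show "(\<lambda>n. sqrt (e n)) \<longlonglongrightarrow> 0" using tendsto_real_sqrt[OF e] by simp
qed

text \<open>Slutsky's principle for characteristic functions: the integrands differ by at most |u|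
  \<delta> where the variables are \<delta>-close, and by at most 2 on the remaining event of small
  probability.\<close>

lemma char_diff_tendsto_0:
  assumes X: "\<And>n. X n \<in> borel_measurable M" and Y: "\<And>n. Y n \<in> borel_measurable M"
    and D: "prob_vanish M (\<lambda>n \<omega>. X n \<omega> - Y n \<omega>)"
  shows "(\<lambda>n. char (distr M borel (X n)) u - char (distr M borel (Y n)) u) \<longlonglongrightarrow> 0"
proof (rule LIMSEQ_I)
  note [measurable] = X Y
  fix r :: real assume r: "r > 0"
  \<comment> \<open>This makes |u| \<delta> less than r / 2; the exceptional event, of probability
    below r / 4, contributes the other half.\<close>
  define \<delta> where "\<delta> = r / (3 * (\<bar>u\<bar> + 1))"
  have \<delta>: "\<delta> > 0" "\<bar>u\<bar> * \<delta> < r / 2" using r by (auto simp: \<delta>_def field_simps) (smt (verit) mult_pos_pos mult_nonneg_nonneg)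
  have "(\<lambda>n. prob {\<omega> \<in> space M. \<delta> < \<bar>X n \<omega> - Y n \<omega>\<bar>}) \<longlonglongrightarrow> 0"
    using D \<delta> by (auto simp: prob_vanish_def)
  then have "eventually (\<lambda>n. prob {\<omega> \<in> space M. \<delta> < \<bar>X n \<omega> - Y n \<omega>\<bar>} < r / 4) sequentially"
    using r by (intro order_tendstoD) auto
  then have "eventually (\<lambda>n. norm (char (distr M borel (X n)) u - char (distr M borel (Y n)) u - 0) < r) sequentially"
  proof eventually_elim
    case (elim n)
    let ?A = "{\<omega> \<in> space M. \<delta> < \<bar>X n \<omega> - Y n \<omega>\<bar>}"
    have iA: "integrable M (indicator ?A :: 'a \<Rightarrow> real)"
      by (rule integrable_const_bound[where B = 1]) (auto simp: indicator_def)
    have i: "integrable M (\<lambda>\<omega>. iexp (u * Z \<omega>))" if [measurable]: "Z \<in> borel_measurable M" for Z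
      by (rule integrable_const_bound[where B = 1]) auto
    have "char (distr M borel (X n)) u - char (distr M borel (Y n)) u = (CLINT \<omega>|M. iexp (u * X n \<omega>) - iexp (u * Y n \<omega>))"
      unfolding char_def
      by (subst (1 2) integral_distr) (use Bochner_Integration.integral_diff[OF i[OF X[of n]] i[OF Y[of n]]] in auto)
    also have "norm \<dots> \<le> (LINT \<omega>|M. norm (iexp (u * X n \<omega>) - iexp (u * Y n \<omega>)))"
      by (rule integral_norm_bound)
    also have "\<dots> \<le> (LINT \<omega>|M. \<bar>u\<bar> * \<delta> + 2 * indicator ?A \<omega>)"
    proof (rule integral_mono)
      show "integrable M (\<lambda>\<omega>. cmod (iexp (u * X n \<omega>) - iexp (u * Y n \<omega>)))"
        by (intro integrable_norm Bochner_Integration.integrable_diff i) auto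
      show "integrable M (\<lambda>\<omega>. \<bar>u\<bar> * \<delta> + 2 * indicator ?A \<omega>)"
        using \<delta> by (intro integrable_const_bound[where B = "\<bar>u\<bar> * \<delta> + 2"]) (auto simp: indicator_def)
      fix \<omega> assume w: "\<omega> \<in> space M"
      show "cmod (iexp (u * X n \<omega>) - iexp (u * Y n \<omega>)) \<le> \<bar>u\<bar> * \<delta> + 2 * indicator ?A \<omega>"
      proof (cases "\<omega> \<in> ?A")
        case True
        have "cmod (iexp (u * X n \<omega>) - iexp (u * Y n \<omega>)) \<le> 1 + 1"
          by (rule order_trans[OF norm_triangle_ineq4]) auto
        also have "\<dots> \<le> \<bar>u\<bar> * \<delta> + 2" using \<delta> by simp
        finally show ?thesis using True by simp
      next
        case False
        have "iexp (u * X n \<omega>) - iexp (u * Y n \<omega>) = iexp (u * Y n \<omega>) * (iexp (u * (X n \<omega> - Y n \<omega>)) - 1)"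
          by (simp add: algebra_simps flip: exp_add)
        then have "cmod (iexp (u * X n \<omega>) - iexp (u * Y n \<omega>)) = cmod (iexp (u * (X n \<omega> - Y n \<omega>)) - 1)"
          by (simp add: norm_mult)
        also have "\<dots> \<le> \<bar>u * (X n \<omega> - Y n \<omega>)\<bar>"
          using iexp_approx1[of "u * (X n \<omega> - Y n \<omega>)" 0] by simp
        also have "\<dots> \<le> \<bar>u\<bar> * \<delta>" using False w unfolding abs_mult by (intro mult_left_mono) auto
        finally show ?thesis using False by simp
      qed
    qed
    also have "\<dots> = \<bar>u\<bar> * \<delta> + 2 * prob ?A"
      by (subst Bochner_Integration.integral_add) (auto simp: prob_space iA)
    finally show ?case using elim \<delta> by simp
  qed
  then show "\<exists>N. \<forall>n\<ge>N. norm (char (distr M borel (X n)) u - char (distr M borel (Y n)) u - 0) < r"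
    by (simp add: eventually_sequentially)
qed

end

section \<open>Truncated moments and characteristic functions\<close>

locale nonneg_rv = prob_space +
  fixes X :: "'a \<Rightarrow> real"
  assumes X_measurable [measurable]: "X \<in> borel_measurable M"
    and X_nonneg: "\<And>\<omega>. X \<omega> \<ge> 0"
begin

definition tail :: "real \<Rightarrow> real" where "tail x = prob {\<omega> \<in> space M. X \<omega> > x}"

definition trunc_sq :: "real \<Rightarrow> real" where "trunc_sq x = expectation (\<lambda>\<omega>. (X \<omega>)\<^sup>2 * indicator {..x} (X \<omega>))"

definition tail_exp :: "real \<Rightarrow> real" where "tail_exp x = expectation (\<lambda>\<omega>. X \<omega> * indicator {x<..} (X \<omega>))"

text \<open>For integrable \<open>X\<close>, the characteristic function minus its first-order
  expansion at 0. What is left reflects the tail of \<open>X\<close>, and its order at 0 selects the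
  norming.\<close>

definition \<psi> :: "real \<Rightarrow> complex" where "\<psi> s = (CLINT \<omega>|M. iexp (s * X \<omega>) - 1 - \<i> * (s * X \<omega>))"

lemma tail_nonneg: "tail x \<ge> 0" and tail_le_1: "tail x \<le> 1"
  by (auto simp: tail_def)

lemma tail_antimono: "x \<le> y \<Longrightarrow> tail y \<le> tail x"
  unfolding tail_def by (intro finite_measure_mono) auto

lemma tail_eq: "tail x = expectation (\<lambda>\<omega>. indicator {x<..} (X \<omega>))"
proof -
  have "expectation (\<lambda>\<omega>. indicator {x<..} (X \<omega>)) = expectation (indicator {\<omega> \<in> space M. X \<omega> > x} :: 'a \<Rightarrow> real)"
    by (intro Bochner_Integration.integral_cong) (auto simp: indicator_def)
  moreover have "{\<omega> \<in> space M. X \<omega> > x} \<inter> space M = {\<omega> \<in> space M. X \<omega> > x}" by auto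
  ultimately show ?thesis unfolding tail_def by (metis Bochner_Integration.integral_indicator)
qed

lemma trunc_sq_integrable: "integrable M (\<lambda>\<omega>. (X \<omega>)\<^sup>2 * indicator {..x} (X \<omega>))"
proof (rule integrable_const_bound[where B = "x\<^sup>2"])
  show "AE \<omega> in M. norm ((X \<omega>)\<^sup>2 * indicator {..x} (X \<omega>)) \<le> x\<^sup>2"
    using X_nonneg by (intro AE_I2) (auto simp: indicator_def intro: power_mono)
qed auto

lemma trunc_sq_nonneg: "trunc_sq x \<ge> 0"
  unfolding trunc_sq_def by (intro integral_nonneg_AE) auto

lemma trunc_sq_mono: "x \<le> y \<Longrightarrow> trunc_sq x \<le> trunc_sq y"
  unfolding trunc_sq_def by (intro integral_mono trunc_sq_integrable) (auto simp: indicator_def)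

lemma trunc_sq_diff:
  assumes "x \<le> y"
  shows "integrable M (\<lambda>\<omega>. (X \<omega>)\<^sup>2 * indicator {x<..y} (X \<omega>))"
    and "expectation (\<lambda>\<omega>. (X \<omega>)\<^sup>2 * indicator {x<..y} (X \<omega>)) = trunc_sq y - trunc_sq x"
proof -
  have eq: "(X \<omega>)\<^sup>2 * indicator {x<..y} (X \<omega>) = (X \<omega>)\<^sup>2 * indicator {..y} (X \<omega>) - (X \<omega>)\<^sup>2 * indicator {..x} (X \<omega>)" for \<omega>
    using assms by (auto simp: indicator_def)
  show "integrable M (\<lambda>\<omega>. (X \<omega>)\<^sup>2 * indicator {x<..y} (X \<omega>))"
    "expectation (\<lambda>\<omega>. (X \<omega>)\<^sup>2 * indicator {x<..y} (X \<omega>)) = trunc_sq y - trunc_sq x"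
    unfolding eq trunc_sq_def using trunc_sq_integrable
    by (auto simp: Bochner_Integration.integral_diff)
qed

lemma trunc_sq_at_top:
  assumes "\<not> integrable M (\<lambda>\<omega>. (X \<omega>)\<^sup>2)"
  shows "filterlim trunc_sq at_top at_top"
proof -
  have "\<exists>x. trunc_sq x > B" for B
  proof (rule ccontr)
    assume "\<not> ?thesis"
    then have le: "trunc_sq x \<le> B" for x by (meson not_less)
    have "integrable M (\<lambda>\<omega>. (X \<omega>)\<^sup>2)"
    proof (rule integrableI_nonneg)
      have "(\<integral>\<^sup>+\<omega>. ennreal ((X \<omega>)\<^sup>2) \<partial>M) = (SUP n. \<integral>\<^sup>+\<omega>. ennreal ((X \<omega>)\<^sup>2 * indicator {..real n} (X \<omega>)) \<partial>M)"
      proof (subst nn_integral_monotone_convergence_SUP[symmetric])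
        show "incseq (\<lambda>n \<omega>. ennreal ((X \<omega>)\<^sup>2 * indicator {..real n} (X \<omega>)))"
          by (auto simp: incseq_def le_fun_def indicator_def)
        show "(\<integral>\<^sup>+\<omega>. ennreal ((X \<omega>)\<^sup>2) \<partial>M) = (\<integral>\<^sup>+\<omega>. (SUP n. ennreal ((X \<omega>)\<^sup>2 * indicator {..real n} (X \<omega>))) \<partial>M)"
        proof (rule nn_integral_cong)
          fix \<omega>
          obtain n where "X \<omega> \<le> real n" using real_arch_simple by blast
          then show "ennreal ((X \<omega>)\<^sup>2) = (SUP n. ennreal ((X \<omega>)\<^sup>2 * indicator {..real n} (X \<omega>)))"
            by (intro antisym SUP_least SUP_upper2[of n]) (auto simp: indicator_def)
        qed
      qed auto
      also have "\<dots> = (SUP n. ennreal (trunc_sq (real n)))"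
        unfolding trunc_sq_def by (intro SUP_cong refl nn_integral_eq_integral trunc_sq_integrable) auto
      also have "\<dots> \<le> ennreal B" by (intro SUP_least ennreal_leI le)
      also have "\<dots> < \<infinity>" by simp
      finally show "(\<integral>\<^sup>+\<omega>. ennreal ((X \<omega>)\<^sup>2) \<partial>M) < \<infinity>" .
    qed auto
    then show False using assms by simp
  qed
  then show ?thesis unfolding filterlim_at_top_dense
    by (meson eventually_at_top_linorderI trunc_sq_mono less_le_trans)
qed

lemma sq_tail_le: "x \<ge> 0 \<Longrightarrow> integrable M X \<Longrightarrow> x * tail x \<le> tail_exp x"
proof -
  assume x: "x \<ge> 0" and i: "integrable M X"
  have "x * tail x = expectation (\<lambda>\<omega>. x * indicator {x<..} (X \<omega>))" by (simp add: tail_eq)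
  also have "\<dots> \<le> tail_exp x" unfolding tail_exp_def using x X_nonneg
  proof (intro integral_mono)
    show "integrable M (\<lambda>\<omega>. x * indicator {x<..} (X \<omega>))"
      using x by (intro integrable_const_bound[where B = x]) (auto simp: indicator_def)
    show "integrable M (\<lambda>\<omega>. X \<omega> * indicator {x<..} (X \<omega>))"
      by (rule Bochner_Integration.integrable_bound[OF i]) (auto simp: indicator_def)
  qed (auto simp: indicator_def)
  finally show ?thesis .
qed

text \<open>Tonelli's theorem on the region below the graph of \<open>X\<close>. The weight
  \<open>h\<close> allows truncated expectations to be expressed through the tail as well.\<close>

lemma nn_layer_cake:
  fixes h :: "real \<Rightarrow> ennreal"
  assumes [measurable]: "h \<in> borel_measurable borel"
  shows "(\<integral>\<^sup>+\<omega>. \<integral>\<^sup>+y. h y * indicator {0..<X \<omega>} y \<partial>lborel \<partial>M) = (\<integral>\<^sup>+y. h y * (ennreal (tail y) * indicator {0..} y) \<partial>lborel)"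
proof -
  interpret P: pair_sigma_finite M lborel ..
  have "(\<integral>\<^sup>+\<omega>. \<integral>\<^sup>+y. h y * indicator {0..<X \<omega>} y \<partial>lborel \<partial>M) = (\<integral>\<^sup>+\<omega>. \<integral>\<^sup>+y. (if 0 \<le> y \<and> y < X \<omega> then h y else 0) \<partial>lborel \<partial>M)"
    by (intro nn_integral_cong) (auto simp: indicator_def)
  also have "\<dots> = (\<integral>\<^sup>+y. \<integral>\<^sup>+\<omega>. (if 0 \<le> y \<and> y < X \<omega> then h y else 0) \<partial>M \<partial>lborel)"
    by (rule P.Fubini'[symmetric]) measurable
  also have "\<dots> = (\<integral>\<^sup>+y. h y * (ennreal (tail y) * indicator {0..} y) \<partial>lborel)"
  proof (intro nn_integral_cong)
    fix y :: real
    have "(\<integral>\<^sup>+\<omega>. (if 0 \<le> y \<and> y < X \<omega> then h y else 0) \<partial>M) = (\<integral>\<^sup>+\<omega>. (h y * indicator {0..} y) * indicator {\<omega> \<in> space M. X \<omega> > y} \<omega> \<partial>M)"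
      by (intro nn_integral_cong) (auto simp: indicator_def)
    also have "\<dots> = (h y * indicator {0..} y) * ennreal (tail y)"
      by (subst nn_integral_cmult) (auto simp: tail_def emeasure_eq_measure)
    finally show "(\<integral>\<^sup>+\<omega>. (if 0 \<le> y \<and> y < X \<omega> then h y else 0) \<partial>M) = h y * (ennreal (tail y) * indicator {0..} y)"
      by (simp add: mult_ac)
  qed
  finally show ?thesis .
qed

lemma nn_integral_X_eq_tail: "(\<integral>\<^sup>+\<omega>. ennreal (X \<omega>) \<partial>M) = (\<integral>\<^sup>+y. ennreal (tail y) * indicator {0..} y \<partial>lborel)"
proof -
  have "(\<integral>\<^sup>+\<omega>. ennreal (X \<omega>) \<partial>M) = (\<integral>\<^sup>+\<omega>. \<integral>\<^sup>+y. 1 * indicator {0..<X \<omega>} y \<partial>lborel \<partial>M)"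
    using X_nonneg by (intro nn_integral_cong) simp
  also have "\<dots> = (\<integral>\<^sup>+y. 1 * (ennreal (tail y) * indicator {0..} y) \<partial>lborel)"
    by (rule nn_layer_cake) simp
  finally show ?thesis by simp
qed

lemma tail_measurable [measurable]: "tail \<in> borel_measurable borel"
proof -
  have "(\<lambda>x. - tail x) \<in> borel_measurable borel"
    by (intro borel_measurable_mono monoI) (simp add: tail_antimono)
  then show ?thesis by simp
qed

text \<open>Applied to |ln (1 - W)|, this identifies the inner integral of \<open>centering\<close>
  as a truncated mean.\<close>

lemma expectation_min_eq_tail:
  assumes z: "z \<ge> 0"
  shows "expectation (\<lambda>\<omega>. min (X \<omega>) z) = (LINT x|lborel. indicator {0..z} x * tail x)"
proof -
  have i1: "integrable M (\<lambda>\<omega>. min (X \<omega>) z)"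
    using X_nonneg z by (intro integrable_const_bound[where B = z]) (auto intro!: AE_I2 simp: min_def)
  have i2: "integrable lborel (\<lambda>x. indicator {0..z} x * tail x)"
  proof (rule Bochner_Integration.integrable_bound)
    show "integrable lborel (indicator {0..z} :: real \<Rightarrow> real)" by (intro integrable_real_indicator) (auto simp: emeasure_lborel_Icc_eq)
    show "AE x in lborel. norm (indicator {0..z} x * tail x) \<le> norm (indicator {0..z} x :: real)"
      using tail_nonneg tail_le_1 by (intro AE_I2) (auto simp: indicator_def)
  qed measurable
  have "ennreal (expectation (\<lambda>\<omega>. min (X \<omega>) z)) = (\<integral>\<^sup>+\<omega>. ennreal (min (X \<omega>) z) \<partial>M)"
    using X_nonneg z by (intro nn_integral_eq_integral[symmetric] i1) auto
  also have "\<dots> = (\<integral>\<^sup>+\<omega>. \<integral>\<^sup>+y. indicator {0..<z} y * indicator {0..<X \<omega>} y \<partial>lborel \<partial>M)"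
  proof (intro nn_integral_cong)
    fix \<omega>
    have "(\<integral>\<^sup>+y. indicator {0..<z} y * indicator {0..<X \<omega>} y \<partial>lborel) = (\<integral>\<^sup>+y. indicator {0..<min (X \<omega>) z} y \<partial>lborel)"
      by (intro nn_integral_cong) (auto simp: indicator_def)
    then show "ennreal (min (X \<omega>) z) = (\<integral>\<^sup>+y. indicator {0..<z} y * indicator {0..<X \<omega>} y \<partial>lborel)"
      using X_nonneg[of \<omega>] z by simp
  qed
  also have "\<dots> = (\<integral>\<^sup>+y. indicator {0..<z} y * (ennreal (tail y) * indicator {0..} y) \<partial>lborel)"
    by (rule nn_layer_cake) simp
  also have "\<dots> = (\<integral>\<^sup>+x. ennreal (indicator {0..z} x * tail x) \<partial>lborel)"
  proof (rule nn_integral_cong_AE)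
    show "AE y in lborel. indicator {0..<z} y * (ennreal (tail y) * indicator {0..} y) = ennreal (indicator {0..z} y * tail y)"
      using AE_lborel_singleton[of z] by eventually_elim (auto simp: indicator_def)
  qed
  also have "\<dots> = ennreal (LINT x|lborel. indicator {0..z} x * tail x)"
    using tail_nonneg by (intro nn_integral_eq_integral i2) auto
  finally show ?thesis
    using X_nonneg z tail_nonneg by (subst (asm) ennreal_inj) (auto intro!: integral_nonneg_AE)
qed

text \<open>
  Replacing \<open>X\<close> by \<open>X - E X\<close> multiplies the characteristic function by a phase; the resulting error is
  of order \<open>s\<^sup>2\<close>.
\<close>

lemma char_centered_asymp:
  assumes i: "integrable M X"
    and lim: "((\<lambda>s. \<psi> s / of_real (g s)) \<longlongrightarrow> - \<kappa>) (at_right 0)"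
    and sq: "((\<lambda>s. s\<^sup>2 / g s) \<longlongrightarrow> 0) (at_right 0)"
  shows "((\<lambda>s. (char (distr M borel (\<lambda>\<omega>. X \<omega> - expectation X)) s - 1) / of_real (g s)) \<longlongrightarrow> - \<kappa>) (at_right 0)"
proof -
  define \<mu> where "\<mu> = expectation X"
  have iX: "integrable M (\<lambda>\<omega>. iexp (s * X \<omega>))" for s
    by (rule integrable_const_bound[where B = 1]) auto
  \<comment> \<open>The linear terms of the phase and of the first-order expansion cancel. The two
    groups beside \<psi> are then each of order s^2.\<close>
  have eq: "char (distr M borel (\<lambda>\<omega>. X \<omega> - \<mu>)) s - 1
      = iexp (- (s * \<mu>)) * \<psi> s + ((iexp (- (s * \<mu>)) - 1 - \<i> * of_real (- (s * \<mu>))) + \<i> * (s * \<mu>) * (iexp (- (s * \<mu>)) - 1))" for s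
  proof -
    have "char (distr M borel (\<lambda>\<omega>. X \<omega> - \<mu>)) s = (CLINT \<omega>|M. iexp (- (s * \<mu>)) * iexp (s * X \<omega>))"
      unfolding char_def by (subst integral_distr) (auto simp: algebra_simps simp flip: exp_add)
    also have "\<dots> = iexp (- (s * \<mu>)) * (CLINT \<omega>|M. iexp (s * X \<omega>))" by simp
    finally have 1: "char (distr M borel (\<lambda>\<omega>. X \<omega> - \<mu>)) s = iexp (- (s * \<mu>)) * (CLINT \<omega>|M. iexp (s * X \<omega>))" .
    have "\<psi> s = (CLINT \<omega>|M. iexp (s * X \<omega>)) - (CLINT \<omega>|M. 1) - (CLINT \<omega>|M. \<i> * (s * X \<omega>))"
      unfolding \<psi>_def using iX[of s] i
      by (subst Bochner_Integration.integral_diff, simp, simp, subst Bochner_Integration.integral_diff) auto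
    also have "(CLINT \<omega>|M. \<i> * (s * X \<omega>)) = \<i> * (s * \<mu>)"
      using i by (simp add: \<mu>_def)
    finally have "(CLINT \<omega>|M. iexp (s * X \<omega>)) = \<psi> s + 1 + \<i> * (s * \<mu>)" by (simp add: prob_space)
    then show ?thesis unfolding 1 by (simp add: algebra_simps)
  qed
  have e1: "norm ((iexp (- (s * \<mu>)) - 1 - \<i> * of_real (- (s * \<mu>))) + \<i> * (s * \<mu>) * (iexp (- (s * \<mu>)) - 1)) \<le> 2 * \<mu>\<^sup>2 * s\<^sup>2" for s
  proof -
    have "norm (iexp (- (s * \<mu>)) - 1 - \<i> * of_real (- (s * \<mu>))) \<le> \<bar>- (s * \<mu>)\<bar>\<^sup>2 / 2"
      using iexp_approx1[of "- (s * \<mu>)" 1] by (simp add: numeral_2_eq_2 algebra_simps)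
    moreover have "norm (iexp (- (s * \<mu>)) - 1) \<le> \<bar>- (s * \<mu>)\<bar>"
      using iexp_approx1[of "- (s * \<mu>)" 0] by simp
    then have "norm (\<i> * (s * \<mu>) * (iexp (- (s * \<mu>)) - 1)) \<le> \<bar>s * \<mu>\<bar> * \<bar>s * \<mu>\<bar>"
      unfolding norm_mult by (intro mult_mono) (auto simp: abs_mult norm_mult)
    ultimately have "norm ((iexp (- (s * \<mu>)) - 1 - \<i> * of_real (- (s * \<mu>))) + \<i> * (s * \<mu>) * (iexp (- (s * \<mu>)) - 1))
        \<le> \<bar>- (s * \<mu>)\<bar>\<^sup>2 / 2 + \<bar>s * \<mu>\<bar> * \<bar>s * \<mu>\<bar>"
      by (intro order_trans[OF norm_triangle_ineq] add_mono)
    also have "\<dots> = (3 / 2) * (\<mu>\<^sup>2 * s\<^sup>2)" by (simp add: power2_eq_square abs_mult_self_eq algebra_simps flip: abs_mult)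
    also have "\<dots> \<le> 2 * (\<mu>\<^sup>2 * s\<^sup>2)" by (intro mult_right_mono) auto
    finally show ?thesis by simp
  qed
  have "((\<lambda>s. ((iexp (- (s * \<mu>)) - 1 - \<i> * of_real (- (s * \<mu>))) + \<i> * (s * \<mu>) * (iexp (- (s * \<mu>)) - 1)) / of_real (g s)) \<longlongrightarrow> 0) (at_right 0)"
  proof (rule tendsto_0_le[OF sq, of _ "2 * \<mu>\<^sup>2"], intro always_eventually allI)
    fix s
    show "norm (((iexp (- (s * \<mu>)) - 1 - \<i> * of_real (- (s * \<mu>))) + \<i> * (s * \<mu>) * (iexp (- (s * \<mu>)) - 1)) / of_real (g s)) \<le> norm (s\<^sup>2 / g s) * (2 * \<mu>\<^sup>2)"
      using divide_right_mono[OF e1[of s], of "\<bar>g s\<bar>"] unfolding norm_divide by (simp add: abs_divide mult_ac)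
  qed
  moreover have "((\<lambda>s. iexp (- (s * \<mu>)) * (\<psi> s / of_real (g s))) \<longlongrightarrow> iexp (- (0 * \<mu>)) * (- \<kappa>)) (at_right 0)"
    by (intro tendsto_mult lim) (auto intro!: tendsto_eq_intros)
  ultimately have "((\<lambda>s. iexp (- (s * \<mu>)) * (\<psi> s / of_real (g s)) + ((iexp (- (s * \<mu>)) - 1 - \<i> * of_real (- (s * \<mu>))) + \<i> * (s * \<mu>) * (iexp (- (s * \<mu>)) - 1)) / of_real (g s)) \<longlongrightarrow> - \<kappa> + 0) (at_right 0)"
    by (intro tendsto_add) auto
  then show ?thesis unfolding \<mu>_def[symmetric] eq by (simp add: add_divide_distrib)
qed

text \<open>Dyadic decomposition of the event \<open>X > x\<close>.\<close>

lemma nn_integral_tail_exp_le: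
  assumes x: "x > 0" and \<epsilon>: "0 < \<epsilon>" "\<epsilon> \<le> 1 / 2"
    and growth: "\<And>y. y \<ge> x \<Longrightarrow> trunc_sq (2 * y) \<le> (1 + \<epsilon>) * trunc_sq y"
  shows "(\<integral>\<^sup>+\<omega>. ennreal (X \<omega> * indicator {x<..} (X \<omega>)) \<partial>M) \<le> ennreal (4 * \<epsilon> * trunc_sq x / x)"
proof -
  \<comment> \<open>On the k-th shell \<open>X\<close> exceeds \<open>2 ^ k * x\<close>, so
    \<open>X\<close> is at most its square divided by that number; this trades a first moment for
    increments of \<open>trunc_sq\<close>.\<close>
  let ?h = "\<lambda>k \<omega>. (X \<omega>)\<^sup>2 * indicator {2 ^ k * x<..2 ^ Suc k * x} (X \<omega>) / (2 ^ k * x)"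
  have pw: "ennreal (X \<omega> * indicator {x<..} (X \<omega>)) \<le> (\<Sum>k. ennreal (?h k \<omega>))" for \<omega>
  proof (cases "X \<omega> > x")
    case True
    define k where "k = (LEAST k. X \<omega> \<le> 2 ^ Suc k * x)"
    have "\<exists>k. X \<omega> \<le> 2 ^ Suc k * x"
    proof -
      obtain n where "X \<omega> / x < 2 ^ n" using real_arch_pow[of 2 "X \<omega> / x"] by auto
      moreover have "(2::real) ^ n \<le> 2 ^ Suc n" by simp
      ultimately have "X \<omega> / x \<le> 2 ^ Suc n" by linarith
      then have "X \<omega> \<le> 2 ^ Suc n * x" using x by (simp add: pos_divide_le_eq)
      then show ?thesis by blast
    qed
    then have k1: "X \<omega> \<le> 2 ^ Suc k * x" unfolding k_def by (rule LeastI_ex)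
    have k2: "2 ^ k * x < X \<omega>"
    proof (cases k)
      case (Suc l)
      then have "\<not> X \<omega> \<le> 2 ^ Suc l * x" using not_less_Least[of l "\<lambda>k. X \<omega> \<le> 2 ^ Suc k * x"] by (simp add: k_def)
      then show ?thesis using Suc by simp
    qed (use True in simp)
    have "X \<omega> * (2 ^ k * x) \<le> X \<omega> * X \<omega>" using k2 X_nonneg by (intro mult_left_mono) auto
    then have "X \<omega> \<le> (X \<omega>)\<^sup>2 / (2 ^ k * x)" using x by (simp add: field_simps power2_eq_square)
    then have "ennreal (X \<omega> * indicator {x<..} (X \<omega>)) \<le> ennreal (?h k \<omega>)"
      using True k1 k2 by (intro ennreal_leI) simp
    also have "\<dots> \<le> (\<Sum>k. ennreal (?h k \<omega>))"
      using sum_le_suminf[of "\<lambda>k. ennreal (?h k \<omega>)" "{k}"] by simp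
    finally show ?thesis .
  qed simp
  have V: "trunc_sq (2 ^ k * x) \<le> (1 + \<epsilon>) ^ k * trunc_sq x" for k
  proof (induction k)
    case (Suc k)
    have "1 * x \<le> 2 ^ k * x" using x by (intro mult_right_mono) auto
    then have "trunc_sq (2 * (2 ^ k * x)) \<le> (1 + \<epsilon>) * trunc_sq (2 ^ k * x)" by (intro growth) simp
    also have "\<dots> \<le> (1 + \<epsilon>) * ((1 + \<epsilon>) ^ k * trunc_sq x)" using \<epsilon> Suc by (intro mult_left_mono) auto
    finally show ?case by (simp add: mult_ac)
  qed simp
  \<comment> \<open>On a shell \<open>trunc_sq\<close> increases by at most \<epsilon> times its
    value, which itself has grown by at most (1 + \<epsilon>)^k. Dividing by 2^k leaves the ratio (1
    + \<epsilon>) / 2 \<le> 3 / 4, whose geometric series sums to the factor 4.\<close>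
  have each: "(\<integral>\<^sup>+\<omega>. ennreal (?h k \<omega>) \<partial>M) \<le> ennreal (\<epsilon> * trunc_sq x / x * (3 / 4) ^ k)" for k
  proof -
    have kx: "2 ^ k * x > 0" using x by simp
    have "1 * x \<le> 2 ^ k * x" using x by (intro mult_right_mono) auto
    then have g: "trunc_sq (2 ^ Suc k * x) \<le> (1 + \<epsilon>) * trunc_sq (2 ^ k * x)"
      using growth[of "2 ^ k * x"] by (simp add: mult_ac)
    have int: "integrable M (?h k)" by (intro integrable_divide trunc_sq_diff(1)) (use x in auto)
    have "(\<integral>\<^sup>+\<omega>. ennreal (?h k \<omega>) \<partial>M) = ennreal (expectation (?h k))"
      using x by (intro nn_integral_eq_integral int) auto
    also have "expectation (?h k) = (trunc_sq (2 ^ Suc k * x) - trunc_sq (2 ^ k * x)) / (2 ^ k * x)"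
      using x by (subst trunc_sq_diff(2)[symmetric]) auto
    also have "\<dots> \<le> \<epsilon> * trunc_sq (2 ^ k * x) / (2 ^ k * x)"
      using g kx by (intro divide_right_mono) (auto simp: algebra_simps)
    also have "\<dots> \<le> \<epsilon> * ((1 + \<epsilon>) ^ k * trunc_sq x) / (2 ^ k * x)"
      using V[of k] \<epsilon> kx by (intro divide_right_mono mult_left_mono) auto
    also have "\<dots> = \<epsilon> * trunc_sq x / x * ((1 + \<epsilon>) / 2) ^ k" by (simp add: power_divide mult_ac)
    also have "\<dots> \<le> \<epsilon> * trunc_sq x / x * (3 / 4) ^ k"
      using \<epsilon> x trunc_sq_nonneg by (intro mult_left_mono power_mono) auto
    finally show ?thesis by (simp add: ennreal_leI)
  qed
  have "(\<integral>\<^sup>+\<omega>. ennreal (X \<omega> * indicator {x<..} (X \<omega>)) \<partial>M) \<le> (\<integral>\<^sup>+\<omega>. (\<Sum>k. ennreal (?h k \<omega>)) \<partial>M)"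
    by (intro nn_integral_mono pw)
  also have "\<dots> = (\<Sum>k. \<integral>\<^sup>+\<omega>. ennreal (?h k \<omega>) \<partial>M)"
    by (intro nn_integral_suminf) measurable
  also have "\<dots> \<le> (\<Sum>k. ennreal (\<epsilon> * trunc_sq x / x * (3 / 4) ^ k))"
    by (intro suminf_le each) auto
  also have "\<dots> = ennreal (\<Sum>k. \<epsilon> * trunc_sq x / x * (3 / 4) ^ k)"
    using \<epsilon> x trunc_sq_nonneg by (intro suminf_ennreal2) (auto intro!: summable_mult summable_geometric)
  also have "(\<Sum>k. \<epsilon> * trunc_sq x / x * (3 / 4) ^ k) = \<epsilon> * trunc_sq x / x * 4"
    by (subst suminf_mult) (auto simp: suminf_geometric)
  finally show ?thesis by (simp add: mult_ac)
qed

end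

section \<open>Infinite variance with slowly varying truncated second moment\<close>

locale slow_trunc_sq = nonneg_rv +
  assumes slow: "\<And>c. c > 0 \<Longrightarrow> ((\<lambda>x. trunc_sq (c * x) / trunc_sq x) \<longlongrightarrow> 1) at_top"
    and inf_square: "\<not> integrable M (\<lambda>\<omega>. (X \<omega>)\<^sup>2)"
begin

lemma trunc_sq_gt: "eventually (\<lambda>x. trunc_sq x > B) at_top"
  using trunc_sq_at_top[OF inf_square] by (simp add: filterlim_at_top_dense)

lemma trunc_sq_growth:
  assumes "\<epsilon> > 0"
  shows "\<exists>x0>0. trunc_sq x0 > 0 \<and> (\<forall>x\<ge>x0. trunc_sq (2 * x) \<le> (1 + \<epsilon>) * trunc_sq x)"
proof -
  have "eventually (\<lambda>x. trunc_sq (2 * x) / trunc_sq x < 1 + \<epsilon>) at_top"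
    using slow[of 2] assms by (intro order_tendstoD) auto
  then have "eventually (\<lambda>x. x > 0 \<and> trunc_sq x > 0 \<and> trunc_sq (2 * x) \<le> (1 + \<epsilon>) * trunc_sq x) at_top"
    using trunc_sq_gt[of 0] eventually_gt_at_top[of 0]
    by eventually_elim (auto simp: pos_divide_less_eq)
  then obtain x0 where "\<And>x. x \<ge> x0 \<Longrightarrow> x > 0 \<and> trunc_sq x > 0 \<and> trunc_sq (2 * x) \<le> (1 + \<epsilon>) * trunc_sq x"
    by (auto simp: eventually_at_top_linorder)
  then show ?thesis by (intro exI[of _ x0]) auto
qed

text \<open>Slow variation of the truncated second moment alone forces a finite mean: eventually
  doubling the level multiplies \<open>trunc_sq\<close> by at most 3 / 2, and the dyadic bound
  applies.\<close>

lemma integrable_X: "integrable M X"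
proof -
  obtain x0 where x0: "x0 > 0" "\<And>x. x \<ge> x0 \<Longrightarrow> trunc_sq (2 * x) \<le> (1 + 1/2) * trunc_sq x"
    using trunc_sq_growth[of "1 / 2"] by auto
  have "(\<integral>\<^sup>+\<omega>. ennreal (X \<omega> * indicator {x0<..} (X \<omega>)) \<partial>M) \<le> ennreal (4 * (1/2) * trunc_sq x0 / x0)"
    using x0 by (intro nn_integral_tail_exp_le) auto
  also have "\<dots> < \<infinity>" by simp
  finally have i: "integrable M (\<lambda>\<omega>. X \<omega> * indicator {x0<..} (X \<omega>))"
    using X_nonneg by (intro integrableI_nonneg) auto
  have "integrable M (\<lambda>\<omega>. x0 + X \<omega> * indicator {x0<..} (X \<omega>))" using i by simp
  then show ?thesis
    by (rule Bochner_Integration.integrable_bound) (use X_nonneg x0 in \<open>auto simp: indicator_def intro!: AE_I2\<close>)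
qed

lemma tail_exp_integrable: "integrable M (\<lambda>\<omega>. X \<omega> * indicator {x<..} (X \<omega>))"
  by (rule Bochner_Integration.integrable_bound[OF integrable_X]) (auto simp: indicator_def)

lemma tail_exp_nonneg: "tail_exp x \<ge> 0"
  unfolding tail_exp_def using X_nonneg by (intro integral_nonneg_AE) auto

text \<open>A case of Karamata's theorem. The growth rate \<epsilon> in the dyadic bound may be
  taken arbitrarily small, and the bound is 4 \<epsilon> times
  \<open>trunc_sq x / x\<close>.\<close>

lemma tail_exp_small: "((\<lambda>x. x * tail_exp x / trunc_sq x) \<longlongrightarrow> 0) at_top"
proof (rule tendstoI)
  fix e :: real assume e: "e > 0"
  define \<epsilon> where "\<epsilon> = min (1 / 2) (e / 5)"
  have \<epsilon>: "0 < \<epsilon>" "\<epsilon> \<le> 1 / 2" "4 * \<epsilon> < e" using e by (auto simp: \<epsilon>_def min_def)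
  obtain x0 where x0: "x0 > 0" "\<And>x. x \<ge> x0 \<Longrightarrow> trunc_sq (2 * x) \<le> (1 + \<epsilon>) * trunc_sq x"
    using trunc_sq_growth[OF \<epsilon>(1)] by auto
  show "eventually (\<lambda>x. dist (x * tail_exp x / trunc_sq x) 0 < e) at_top"
    using eventually_ge_at_top[of x0] trunc_sq_gt[of 0]
  proof eventually_elim
    case (elim x)
    have x: "x > 0" using elim x0 by simp
    have "ennreal (tail_exp x) = (\<integral>\<^sup>+\<omega>. ennreal (X \<omega> * indicator {x<..} (X \<omega>)) \<partial>M)"
      unfolding tail_exp_def using X_nonneg by (intro nn_integral_eq_integral[symmetric] tail_exp_integrable) auto
    also have "\<dots> \<le> ennreal (4 * \<epsilon> * trunc_sq x / x)"
      using x \<epsilon> x0 elim by (intro nn_integral_tail_exp_le) auto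
    finally have "tail_exp x \<le> 4 * \<epsilon> * trunc_sq x / x"
      using \<epsilon> x elim by (subst (asm) ennreal_le_iff) auto
    then have "x * tail_exp x \<le> 4 * \<epsilon> * trunc_sq x" using x by (simp add: field_simps)
    then have "x * tail_exp x / trunc_sq x \<le> 4 * \<epsilon>" using elim by (simp add: pos_divide_le_eq)
    moreover have "x * tail_exp x / trunc_sq x \<ge> 0" using x elim tail_exp_nonneg by simp
    ultimately show ?case using \<epsilon> by simp
  qed
qed

text \<open>
  \<open>g s\<close> is asymptotic to \<open>s\<^sup>2 * trunc_sq (1 / s)\<close> as \<open>s\<close> tends to 0, but unlike the latter it is monotone.
\<close>

definition g :: "real \<Rightarrow> real" where "g s = expectation (\<lambda>\<omega>. min 1 ((max 0 s * X \<omega>)\<^sup>2))"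

lemma g_integrable: "integrable M (\<lambda>\<omega>. min 1 ((max 0 s * X \<omega>)\<^sup>2))"
  by (rule integrable_const_bound[where B = 1]) auto

lemma g_mono: "mono g"
  unfolding g_def using X_nonneg
  by (intro monoI integral_mono g_integrable min.mono power_mono mult_right_mono) auto

lemma g_nonneg: "g s \<ge> 0"
  unfolding g_def by (intro integral_nonneg_AE) auto

lemma g_inverse:
  assumes "x > 0"
  shows "x\<^sup>2 * g (1 / x) = trunc_sq x + x\<^sup>2 * tail x"
proof -
  have "x\<^sup>2 * min 1 ((1 / x * X \<omega>)\<^sup>2) = (X \<omega>)\<^sup>2 * indicator {..x} (X \<omega>) + x\<^sup>2 * indicator {x<..} (X \<omega>)" for \<omega>
  proof (cases "X \<omega> \<le> x")
    case True
    then have "(1 / x * X \<omega>)\<^sup>2 \<le> 1" using assms X_nonneg[of \<omega>] by (intro power_le_one) auto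
    then show ?thesis using True assms by (simp add: power_mult_distrib power_divide)
  next
    case False
    then have "(1 / x * X \<omega>)\<^sup>2 \<ge> 1" using assms by (intro one_le_power) auto
    then show ?thesis using False by simp
  qed
  then have "x\<^sup>2 * g (1 / x) = expectation (\<lambda>\<omega>. (X \<omega>)\<^sup>2 * indicator {..x} (X \<omega>) + x\<^sup>2 * indicator {x<..} (X \<omega>))"
    unfolding g_def using assms by (simp flip: integral_mult_right_zero)
  also have "\<dots> = trunc_sq x + x\<^sup>2 * tail x"
    unfolding tail_eq trunc_sq_def
    by (subst Bochner_Integration.integral_add[OF trunc_sq_integrable])
      (auto intro!: integrable_mult_right integrable_const_bound[where B = 1] simp: indicator_def)
  finally show ?thesis .
qed

text \<open>The two differ by x^2 P(X > x), which is at most \<open>x * tail_exp x\<close> and hence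
  negligible against \<open>trunc_sq x\<close>.\<close>

lemma g_trunc_sq: "((\<lambda>x. x\<^sup>2 * g (1 / x) / trunc_sq x) \<longlongrightarrow> 1) at_top"
proof -
  have "((\<lambda>x. x\<^sup>2 * tail x / trunc_sq x) \<longlongrightarrow> 0) at_top"
  proof (rule Lim_null_comparison[OF _ tail_exp_small])
    show "eventually (\<lambda>x. norm (x\<^sup>2 * tail x / trunc_sq x) \<le> x * tail_exp x / trunc_sq x) at_top"
      using eventually_gt_at_top[of 0] trunc_sq_gt[of 0]
    proof eventually_elim
      case (elim x)
      have "x * (x * tail x) \<le> x * tail_exp x" using elim sq_tail_le[OF _ integrable_X, of x] by (intro mult_left_mono) auto
      then show ?case using elim tail_nonneg by (auto simp: power2_eq_square mult.assoc intro!: divide_right_mono)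
    qed
  qed
  then have "((\<lambda>x. 1 + x\<^sup>2 * tail x / trunc_sq x) \<longlongrightarrow> 1 + 0) at_top" by (intro tendsto_intros)
  moreover have "eventually (\<lambda>x. 1 + x\<^sup>2 * tail x / trunc_sq x = x\<^sup>2 * g (1 / x) / trunc_sq x) at_top"
    using eventually_gt_at_top[of 0] trunc_sq_gt[of 0]
    by eventually_elim (simp add: g_inverse add_divide_distrib)
  ultimately show ?thesis by (simp add: tendsto_cong)
qed

lemma g_pos: "s > 0 \<Longrightarrow> g s > 0"
proof -
  assume s: "s > 0"
  have "eventually (\<lambda>x. x > 1 / s \<and> trunc_sq x > 0) at_top"
    using eventually_gt_at_top trunc_sq_gt by (rule eventually_conj)
  then obtain x where x: "x > 1 / s" "trunc_sq x > 0" by (auto simp: eventually_at_top_linorder)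
  have "x > 0" using x s by (meson divide_pos_pos less_trans zero_less_one)
  then have "x\<^sup>2 * g (1 / x) > 0" using g_inverse[of x] x tail_nonneg[of x] by (simp add: add_pos_nonneg)
  then have "g (1 / x) > 0" using \<open>x > 0\<close> by (simp add: zero_less_mult_iff)
  moreover have "1 / x \<le> s" using x s \<open>x > 0\<close> by (simp add: field_simps)
  ultimately show ?thesis using monoD[OF g_mono, of "1 / x" s] by simp
qed

lemma g_regular:
  assumes c: "c > 0"
  shows "((\<lambda>s. g (c * s) / g s) \<longlongrightarrow> c powr 2) (at_right 0)"
proof -
  define G where "G x = x\<^sup>2 * g (1 / x)" for x
  have inv: "filterlim (\<lambda>x. inverse c * x) at_top at_top"
    using c by (intro filterlim_tendsto_pos_mult_at_top[OF tendsto_const] filterlim_ident) auto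
  have "((\<lambda>x. G (inverse c * x) / trunc_sq (inverse c * x) * (trunc_sq (inverse c * x) / trunc_sq x) / (G x / trunc_sq x) * c\<^sup>2) \<longlongrightarrow> 1 * 1 / 1 * c\<^sup>2) at_top"
    using filterlim_compose[OF g_trunc_sq inv] g_trunc_sq slow[of "inverse c"] c unfolding G_def
    by (intro tendsto_intros) auto
  moreover have "eventually (\<lambda>x. G (inverse c * x) / trunc_sq (inverse c * x) * (trunc_sq (inverse c * x) / trunc_sq x) / (G x / trunc_sq x) * c\<^sup>2
      = g (c * inverse x) / g (inverse x)) at_top"
    using eventually_gt_at_top[of 0] trunc_sq_gt[of 0] eventually_compose_filterlim[OF trunc_sq_gt[of 0] inv]
  proof eventually_elim
    case (elim x)
    have "g (1 / x) > 0" using elim by (intro g_pos) auto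
    then show ?case using elim c by (simp add: G_def field_simps power2_eq_square)
  qed
  ultimately have "((\<lambda>x. g (c * inverse x) / g (inverse x)) \<longlongrightarrow> c\<^sup>2) at_top" by (simp add: tendsto_cong)
  then show ?thesis using c by (simp add: filterlim_at_right_to_top)
qed

lemma trunc_sq_le_g: "x > 0 \<Longrightarrow> trunc_sq x \<le> x\<^sup>2 * g (1 / x)"
  using g_inverse[of x] tail_nonneg[of x] by simp

lemma tail_exp_le_g: "eventually (\<lambda>x. tail_exp x \<le> x * g (1 / x)) at_top"
proof -
  have "eventually (\<lambda>x. x * tail_exp x / trunc_sq x < 1) at_top"
    using tail_exp_small by (rule order_tendstoD) simp
  then show ?thesis using eventually_gt_at_top[of 0] trunc_sq_gt[of 0]
  proof eventually_elim
    case (elim x)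
    have "x * tail_exp x \<le> trunc_sq x" using elim by (simp add: pos_divide_less_eq)
    also have "\<dots> \<le> x * (x * g (1 / x))" using trunc_sq_le_g[of x] elim by (simp add: power2_eq_square mult.assoc)
    finally show ?case using elim by simp
  qed
qed

text \<open>Since min(1, y^2) \<le> y for y \<ge> 0, the variable x min(1, (X / x)^2) is dominated
  by the integrable \<open>X\<close>, and it tends to 0 at each point.\<close>

lemma g_small: "((\<lambda>x. x * g (1 / x)) \<longlongrightarrow> 0) at_top"
proof -
  have "((\<lambda>x. expectation (\<lambda>\<omega>. max 0 x * min 1 ((max 0 (1 / x) * X \<omega>)\<^sup>2))) \<longlongrightarrow> expectation (\<lambda>\<omega>. 0)) at_top"
  proof (rule integral_dominated_convergence_at_top[where w = X])
    show "eventually (\<lambda>x. AE \<omega> in M. norm (max 0 x * min 1 ((max 0 (1 / x) * X \<omega>)\<^sup>2)) \<le> X \<omega>) at_top"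
      using eventually_gt_at_top[of 0]
    proof eventually_elim
      case (elim x)
      show ?case
      proof (rule AE_I2)
        fix \<omega>
        have "min 1 (y\<^sup>2) \<le> y" if "y \<ge> 0" for y :: real
        proof (cases "y \<le> 1")
          case True
          then have "y\<^sup>2 \<le> y" using that by (simp add: power2_eq_square mult_left_le)
          then show ?thesis by simp
        qed auto
        from mult_left_mono[OF this[of "1 / x * X \<omega>"], of x]
        show "norm (max 0 x * min 1 ((max 0 (1 / x) * X \<omega>)\<^sup>2)) \<le> X \<omega>" using elim X_nonneg[of \<omega>] by simp
      qed
    qed
    show "AE \<omega> in M. ((\<lambda>x. max 0 x * min 1 ((max 0 (1 / x) * X \<omega>)\<^sup>2)) \<longlongrightarrow> 0) at_top"
    proof (rule AE_I2)
      fix \<omega>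
      have "((\<lambda>x. (X \<omega>)\<^sup>2 / x) \<longlongrightarrow> 0) at_top"
        by (intro tendsto_divide_0[OF tendsto_const] filterlim_at_top_imp_at_infinity filterlim_ident)
      then show "((\<lambda>x. max 0 x * min 1 ((max 0 (1 / x) * X \<omega>)\<^sup>2)) \<longlongrightarrow> 0) at_top"
      proof (rule Lim_null_comparison[rotated])
        show "eventually (\<lambda>x. norm (max 0 x * min 1 ((max 0 (1 / x) * X \<omega>)\<^sup>2)) \<le> (X \<omega>)\<^sup>2 / x) at_top"
          using eventually_gt_at_top[of 0]
        proof eventually_elim
          case (elim x)
          have "x * min 1 ((1 / x * X \<omega>)\<^sup>2) \<le> x * (1 / x * X \<omega>)\<^sup>2" using elim by (intro mult_left_mono) auto
          also have "\<dots> = (X \<omega>)\<^sup>2 / x" using elim by (simp add: power_mult_distrib power2_eq_square)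
          finally show ?case using elim by simp
        qed
      qed
    qed
  qed (use integrable_X in auto)
  then have "((\<lambda>x. max 0 x * g (1 / x)) \<longlongrightarrow> 0) at_top" by (simp add: g_def)
  moreover have "eventually (\<lambda>x. max 0 x * g (1 / x) = x * g (1 / x)) at_top"
    using eventually_gt_at_top[of 0] by eventually_elim simp
  ultimately show ?thesis by (simp add: tendsto_cong)
qed

text \<open>The infinite second moment enters here: the quotient at s = 1 / x is at most 1 /
  \<open>trunc_sq x\<close>. As a result, centering \<open>X\<close> does not affect the asymptotics
  at 0.\<close>

lemma square_over_g: "((\<lambda>s. s\<^sup>2 / g s) \<longlongrightarrow> 0) (at_right 0)"
proof -
  have "((\<lambda>x. 1 / trunc_sq x) \<longlongrightarrow> 0) at_top"
    by (intro tendsto_divide_0[OF tendsto_const] filterlim_at_top_imp_at_infinity trunc_sq_at_top inf_square)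
  then have "((\<lambda>x. (inverse x)\<^sup>2 / g (inverse x)) \<longlongrightarrow> 0) at_top"
  proof (rule Lim_null_comparison[rotated])
    show "eventually (\<lambda>x. norm ((inverse x)\<^sup>2 / g (inverse x)) \<le> 1 / trunc_sq x) at_top"
      using eventually_gt_at_top[of 0] trunc_sq_gt[of 0]
    proof eventually_elim
      case (elim x)
      have gp: "g (1 / x) > 0" using elim by (intro g_pos) auto
      have "1 / (x\<^sup>2 * g (1 / x)) \<le> 1 / trunc_sq x" using trunc_sq_le_g[of x] elim by (intro divide_left_mono) auto
      then show ?case using elim gp by (simp add: field_simps)
    qed
  qed
  then show ?thesis by (simp add: filterlim_at_right_to_top)
qed

text \<open>Where X / x \<le> \<delta>, the Taylor remainder y^3 / 6 is at most \<delta> y^2 / 6;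
  beyond \<delta>, the linear bound 2 y is used. This splits the error into a part with
  \<open>trunc_sq\<close> and a part with \<open>tail_exp\<close>.\<close>

lemma \<psi>_approx:
  assumes "x > 0" "\<delta> > 0"
  shows "norm (\<psi> (1 / x) + of_real (trunc_sq (\<delta> * x) / (2 * x\<^sup>2))) \<le> \<delta> / 6 * trunc_sq (\<delta> * x) / x\<^sup>2 + 2 * tail_exp (\<delta> * x) / x"
proof -
  let ?e = "\<lambda>\<omega>. iexp (1 / x * X \<omega>) - 1 - \<i> * (1 / x * X \<omega>)"
  let ?q = "\<lambda>\<omega>. (X \<omega>)\<^sup>2 * indicator {..\<delta> * x} (X \<omega>)"
  have ie: "integrable M ?e"
    using integrable_X by (intro Bochner_Integration.integrable_diff integrable_const_bound[where B = 1 and f = "\<lambda>\<omega>. iexp (1 / x * X \<omega>)"]) auto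
  have iq: "integrable M (\<lambda>\<omega>. complex_of_real (?q \<omega> / (2 * x\<^sup>2)))"
    by (intro integrable_of_real integrable_divide trunc_sq_integrable)
  have i0: "integrable M (\<lambda>\<omega>. ?e \<omega> + complex_of_real (?q \<omega> / (2 * x\<^sup>2)))"
    by (rule Bochner_Integration.integrable_add[OF ie iq])
  have i1: "integrable M (\<lambda>\<omega>. \<delta> / 6 * ?q \<omega> / x\<^sup>2 + 2 * (X \<omega> * indicator {\<delta> * x<..} (X \<omega>)) / x)"
    by (intro Bochner_Integration.integrable_add integrable_divide integrable_mult_right trunc_sq_integrable tail_exp_integrable)
  have pw: "norm (?e \<omega> + complex_of_real (?q \<omega> / (2 * x\<^sup>2))) \<le> \<delta> / 6 * ?q \<omega> / x\<^sup>2 + 2 * (X \<omega> * indicator {\<delta> * x<..} (X \<omega>)) / x" for \<omega>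
  proof -
    define y where "y = X \<omega> / x"
    have y: "y \<ge> 0" "X \<omega> = y * x" unfolding y_def using assms X_nonneg[of \<omega>] by simp_all
    show ?thesis
    proof (cases "y \<le> \<delta>")
      case True
      have "norm (iexp y - (\<Sum>k\<le>2. (\<i> * y) ^ k / fact k)) \<le> \<bar>y\<bar> ^ Suc 2 / fact (Suc 2)" by (rule iexp_approx1)
      also have "(\<Sum>k\<le>2. (\<i> * y) ^ k / fact k) = 1 + \<i> * y - y\<^sup>2 / 2"
        by (simp add: numeral_2_eq_2 power2_eq_square field_simps)
      also have "\<bar>y\<bar> ^ Suc 2 / fact (Suc 2) = y * y\<^sup>2 / 6" using y by (simp add: fact_numeral numeral_3_eq_3 power2_eq_square)
      also have "\<dots> \<le> \<delta> * y\<^sup>2 / 6" using True by (intro divide_right_mono mult_right_mono) auto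
      finally have "norm (iexp y - 1 - \<i> * y + y\<^sup>2 / 2) \<le> \<delta> * y\<^sup>2 / 6" by (simp add: algebra_simps)
      moreover have "X \<omega> \<le> \<delta> * x" using True y assms by simp
      ultimately show ?thesis using y assms by (simp add: power_mult_distrib)
    next
      case False
      have "norm (iexp y - (\<Sum>k\<le>1. (\<i> * y) ^ k / fact k)) \<le> 2 * \<bar>y\<bar> ^ 1 / fact 1" by (rule iexp_approx2)
      then have "norm (iexp y - 1 - \<i> * y) \<le> 2 * y" using y by (simp add: algebra_simps)
      moreover have "\<not> X \<omega> \<le> \<delta> * x" using False y assms by simp
      ultimately show ?thesis using y assms by simp
    qed
  qed
  have "\<psi> (1 / x) + of_real (trunc_sq (\<delta> * x) / (2 * x\<^sup>2)) = (CLINT \<omega>|M. ?e \<omega>) + (CLINT \<omega>|M. complex_of_real (?q \<omega> / (2 * x\<^sup>2)))"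
    unfolding \<psi>_def trunc_sq_def by (simp del: of_real_mult of_real_divide of_real_power add: integral_complex_of_real)
  also have "\<dots> = (CLINT \<omega>|M. ?e \<omega> + complex_of_real (?q \<omega> / (2 * x\<^sup>2)))"
    by (rule Bochner_Integration.integral_add[OF ie iq, symmetric])
  finally have eq: "\<psi> (1 / x) + of_real (trunc_sq (\<delta> * x) / (2 * x\<^sup>2)) = (CLINT \<omega>|M. ?e \<omega> + complex_of_real (?q \<omega> / (2 * x\<^sup>2)))" .
  have "norm (\<psi> (1 / x) + of_real (trunc_sq (\<delta> * x) / (2 * x\<^sup>2))) \<le> (LINT \<omega>|M. norm (?e \<omega> + complex_of_real (?q \<omega> / (2 * x\<^sup>2))))"
    unfolding eq by (rule integral_norm_bound)
  also have "\<dots> \<le> (LINT \<omega>|M. \<delta> / 6 * ?q \<omega> / x\<^sup>2 + 2 * (X \<omega> * indicator {\<delta> * x<..} (X \<omega>)) / x)"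
    using i0 i1 pw by (intro integral_mono integrable_norm)
  also have "\<dots> = \<delta> / 6 * trunc_sq (\<delta> * x) / x\<^sup>2 + 2 * tail_exp (\<delta> * x) / x"
    unfolding trunc_sq_def tail_exp_def
    by (subst Bochner_Integration.integral_add)
      (auto intro!: integrable_divide integrable_mult_right trunc_sq_integrable tail_exp_integrable)
  finally show ?thesis .
qed

text \<open>The cut is placed at a small fixed multiple of x, the tolerance \<open>e\<close> itself.
  Slow variation makes the truncated second moments at e x and x equivalent, so the main term is
  unaffected, while the Taylor error carries the factor \<open>e\<close>.\<close>

lemma \<psi>_asymp: "((\<lambda>s. \<psi> s / of_real (g s)) \<longlongrightarrow> - (1 / 2)) (at_right 0)"
proof -
  define G where "G x = x\<^sup>2 * g (1 / x)" for x
  \<comment> \<open>The budget for the three errors: e / 3 from the Taylor remainder, e / 4 from the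
    tail and e / 8 from the change of the truncation level, together below \<open>e\<close>.\<close>
  have gen: "p + 2 * q + a / 2 < e" if "p \<le> e / 3" "a < e / 4" "q < e / 8" "0 < e" for a e p q :: real
    using that by linarith
  have "((\<lambda>x. \<psi> (inverse x) / of_real (g (inverse x))) \<longlongrightarrow> - (1 / 2)) at_top"
  proof (rule tendstoI)
    fix e :: real assume e: "e > 0"
    have inv: "filterlim (\<lambda>x. e * x) at_top at_top"
      using e by (intro filterlim_tendsto_pos_mult_at_top[OF tendsto_const] filterlim_ident) auto
    have G1: "((\<lambda>x. trunc_sq (e * x) / trunc_sq x / (G x / trunc_sq x)) \<longlongrightarrow> 1 / 1) at_top"
      unfolding G_def by (intro tendsto_divide slow e g_trunc_sq) auto
    have "((\<lambda>x. (e * x * tail_exp (e * x) / trunc_sq (e * x)) * (trunc_sq (e * x) / trunc_sq x / (G x / trunc_sq x)) / e) \<longlongrightarrow> 0 * (1 / 1) / e) at_top"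
      using e by (intro tendsto_divide tendsto_mult G1 tendsto_const filterlim_compose[OF tail_exp_small inv]) auto
    then have G2: "((\<lambda>x. (e * x * tail_exp (e * x) / trunc_sq (e * x)) * (trunc_sq (e * x) / trunc_sq x / (G x / trunc_sq x)) / e) \<longlongrightarrow> 0) at_top" by simp
    have "eventually (\<lambda>x. \<bar>trunc_sq (e * x) / trunc_sq x / (G x / trunc_sq x) - 1\<bar> < min 1 (e / 4)) at_top"
      using tendstoD[OF G1, of "min 1 (e / 4)"] e by (simp add: dist_real_def)
    moreover have "eventually (\<lambda>x. (e * x * tail_exp (e * x) / trunc_sq (e * x)) * (trunc_sq (e * x) / trunc_sq x / (G x / trunc_sq x)) / e < e / 8) at_top"
      using G2 by (rule order_tendstoD) (use e in simp)
    ultimately show "eventually (\<lambda>x. dist (\<psi> (inverse x) / of_real (g (inverse x))) (- (1 / 2)) < e) at_top"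
      using eventually_gt_at_top[of 0] trunc_sq_gt[of 0] eventually_compose_filterlim[OF trunc_sq_gt[of 0] inv]
    proof eventually_elim
      case (elim x)
      have "g (1 / x) > 0" using elim by (intro g_pos) auto
      then have Gp: "G x > 0" using elim by (simp add: G_def)
      define r where "r = trunc_sq (e * x) / G x"
      have r1: "\<bar>r - 1\<bar> < min 1 (e / 4)" using elim by (simp add: r_def)
      define q where "q = x * tail_exp (e * x) / G x"
      have r2: "q < e / 8" using elim e by (simp add: q_def field_simps)
      have gx: "g (inverse x) = G x / x\<^sup>2" using elim by (simp add: G_def inverse_eq_divide)
      have "norm (\<psi> (1 / x) + of_real (trunc_sq (e * x) / (2 * x\<^sup>2))) \<le> e / 6 * trunc_sq (e * x) / x\<^sup>2 + 2 * tail_exp (e * x) / x"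
        using elim e by (intro \<psi>_approx) auto
      then have "norm (\<psi> (1 / x) + of_real (trunc_sq (e * x) / (2 * x\<^sup>2))) / (G x / x\<^sup>2) \<le> (e / 6 * trunc_sq (e * x) / x\<^sup>2 + 2 * tail_exp (e * x) / x) / (G x / x\<^sup>2)"
        using Gp elim by (intro divide_right_mono) auto
      also have "\<dots> = e / 6 * r + 2 * q"
        using Gp elim by (simp add: r_def q_def field_simps power2_eq_square)
      finally have b: "norm (\<psi> (1 / x) + of_real (trunc_sq (e * x) / (2 * x\<^sup>2))) / (G x / x\<^sup>2) \<le> e / 6 * r + 2 * q" .
      have "\<psi> (inverse x) / of_real (g (inverse x)) - (- (1 / 2))
          = (\<psi> (1 / x) + of_real (trunc_sq (e * x) / (2 * x\<^sup>2))) / of_real (G x / x\<^sup>2) - of_real ((r - 1) / 2)"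
        unfolding gx using Gp elim by (simp add: r_def field_simps inverse_eq_divide)
      then have "dist (\<psi> (inverse x) / of_real (g (inverse x))) (- (1 / 2))
          \<le> norm ((\<psi> (1 / x) + of_real (trunc_sq (e * x) / (2 * x\<^sup>2))) / of_real (G x / x\<^sup>2)) + norm (complex_of_real ((r - 1) / 2))"
        unfolding dist_norm by (simp only: norm_triangle_ineq4)
      also have "norm ((\<psi> (1 / x) + of_real (trunc_sq (e * x) / (2 * x\<^sup>2))) / of_real (G x / x\<^sup>2)) = norm (\<psi> (1 / x) + of_real (trunc_sq (e * x) / (2 * x\<^sup>2))) / (G x / x\<^sup>2)"
        using Gp unfolding norm_divide norm_of_real by simp
      also have "norm (complex_of_real ((r - 1) / 2)) = \<bar>r - 1\<bar> / 2" unfolding norm_of_real by simp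
      finally have "dist (\<psi> (inverse x) / of_real (g (inverse x))) (- (1 / 2)) \<le> e / 6 * r + 2 * q + \<bar>r - 1\<bar> / 2"
        using b by linarith
      also have "\<dots> < e"
      proof -
        define p where "p = e / 6 * r"
        have "p \<le> e / 6 * 2" unfolding p_def using r1 e by (intro mult_left_mono) auto
        then have "p \<le> e / 3" by simp
        moreover have "\<bar>r - 1\<bar> < e / 4" using r1 by simp
        ultimately show ?thesis unfolding p_def[symmetric] using r2 e by (intro gen)
      qed
      finally show ?case .
    qed
  qed
  then show ?thesis by (simp add: filterlim_at_right_to_top)
qed

end

section \<open>Regularly varying tails of index between 1 and 2\<close>

locale regular_tail = nonneg_rv +
  fixes \<alpha> :: real
  assumes \<alpha>: "1 < \<alpha>" "\<alpha> < 2"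
    and tail_regular: "\<And>c. c > 0 \<Longrightarrow> ((\<lambda>x. tail (c * x) / tail x) \<longlongrightarrow> c powr - \<alpha>) at_top"
    and tail_pos: "\<And>x. tail x > 0"
begin

text \<open>The midpoints between \<alpha> and the ends of the interval from 1 to 2, so 1 < q <
  \<alpha> < p < 2. Then w^(-q) is integrable at infinity and w^(1 - p) at 0.\<close>

definition p :: real where "p = (\<alpha> + 2) / 2"
definition q :: real where "q = (\<alpha> + 1) / 2"

lemma pq: "1 < q" "q < \<alpha>" "\<alpha> < p" "p < 2"
  using \<alpha> by (auto simp: p_def q_def)

text \<open>The majorant of Potter's bounds: up to a constant it dominates tail (w x) / tail x for
  all large x at once, with the steeper power below 1 and the flatter one above. At w = 1 both
  summands count, which only enlarges it.\<close>

definition potter :: "real \<Rightarrow> real" where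
  "potter w = indicator {0..1} w * w powr - p + indicator {1..} w * w powr - q"

lemma potter_measurable [measurable]: "potter \<in> borel_measurable borel"
  unfolding potter_def[abs_def] by measurable

text \<open>Iterating the dyadic ratio bounds for \<open>tail\<close> and interpolating by monotonicity.\<close>

lemma tail_potter: "\<exists>x0 A. x0 \<ge> 1 \<and> A > 0 \<and> (\<forall>x\<ge>x0. \<forall>w>0. tail (w * x) \<le> A * potter w * tail x)"
proof -
  have "eventually (\<lambda>x. tail (2 * x) / tail x < 2 powr - q) at_top"
    using tail_regular[of 2] pq by (intro order_tendstoD) auto
  moreover have "eventually (\<lambda>x. tail (2 * x) / tail x > 2 powr - p) at_top"
    using tail_regular[of 2] pq by (intro order_tendstoD) auto
  ultimately have "eventually (\<lambda>x. x \<ge> 1 \<and> tail (2 * x) \<le> 2 powr - q * tail x \<and> tail (2 * x) \<ge> 2 powr - p * tail x) at_top"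
    using eventually_ge_at_top[of 1]
    by eventually_elim (use tail_pos in \<open>auto simp: pos_divide_less_eq pos_less_divide_eq\<close>)
  then obtain x0 where x0: "\<And>x. x \<ge> x0 \<Longrightarrow> x \<ge> 1 \<and> tail (2 * x) \<le> 2 powr - q * tail x \<and> tail (2 * x) \<ge> 2 powr - p * tail x"
    by (auto simp: eventually_at_top_linorder)
  have x01: "x0 \<ge> 1" using x0[of x0] by simp
  have pow: "tail (2 ^ k * x) \<le> (2 ^ k) powr - q * tail x \<and> tail (2 ^ k * x) \<ge> (2 ^ k) powr - p * tail x" if x: "x \<ge> x0" for x k
  proof (induction k)
    case (Suc k)
    have "1 * x \<le> 2 ^ k * x" using x x01 by (intro mult_right_mono) auto
    then have k: "2 ^ k * x \<ge> x0" using x by simp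
    have "tail (2 * (2 ^ k * x)) \<le> 2 powr - q * tail (2 ^ k * x)" using x0[OF k] by simp
    also have "\<dots> \<le> 2 powr - q * ((2 ^ k) powr - q * tail x)" using Suc by (intro mult_left_mono) auto
    finally have 1: "tail (2 ^ Suc k * x) \<le> (2 ^ Suc k) powr - q * tail x" by (simp add: powr_mult mult_ac)
    have "2 powr - p * ((2 ^ k) powr - p * tail x) \<le> 2 powr - p * tail (2 ^ k * x)" using Suc by (intro mult_left_mono) auto
    also have "\<dots> \<le> tail (2 * (2 ^ k * x))" using x0[OF k] by simp
    finally have "(2 ^ Suc k) powr - p * tail x \<le> tail (2 ^ Suc k * x)" by (simp add: powr_mult mult_ac)
    with 1 show ?case ..
  qed simp
  have dyadic: "\<exists>k. 2 ^ k \<le> w \<and> w < 2 ^ Suc k" if "w \<ge> 1" for w :: real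
  proof -
    define k where "k = (LEAST k. w < 2 ^ Suc k)"
    obtain n where "w < 2 ^ n" using real_arch_pow[of 2 w] by auto
    moreover have "(2::real) ^ n \<le> 2 ^ Suc n" by simp
    ultimately have "\<exists>n. w < 2 ^ Suc n" by (intro exI[of _ n]) linarith
    then have k1: "w < 2 ^ Suc k" unfolding k_def by (rule LeastI_ex)
    have "2 ^ k \<le> w"
    proof (cases k)
      case (Suc l)
      then have "\<not> w < 2 ^ Suc l" using not_less_Least[of l "\<lambda>k. w < 2 ^ Suc k"] by (simp add: k_def)
      then show ?thesis using Suc by simp
    qed (use that in simp)
    then show ?thesis using k1 by blast
  qed
  have up: "tail (w * x) \<le> 2 powr q * w powr - q * tail x" if w: "w \<ge> 1" and x: "x \<ge> x0" for w x
  proof -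
    obtain k where k: "2 ^ k \<le> w" "w < 2 ^ Suc k" using dyadic[OF w] by blast
    have "tail (w * x) \<le> tail (2 ^ k * x)" using k x x01 by (intro tail_antimono mult_right_mono) auto
    also have "\<dots> \<le> (2 ^ k) powr - q * tail x" using pow[OF x] by simp
    also have "(2 ^ k) powr - q \<le> (w / 2) powr - q" using k w pq by (intro powr_mono2') auto
    also have "(w / 2) powr - q = 2 powr q * w powr - q" using w by (simp add: powr_divide powr_minus field_simps)
    finally show ?thesis using tail_nonneg by (simp add: mult_right_mono)
  qed
  \<comment> \<open>The argument w x is doubled until it first passes x; the lower dyadic bound then
    compares the two tails.\<close>
  have down: "tail (w * x) \<le> 2 powr p * w powr - p * tail x" if w: "0 < w" "w \<le> 1" and x: "w * x \<ge> x0" for w x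
  proof -
    have "1 / w \<ge> 1" using w by simp
    from dyadic[OF this] obtain k where k: "2 ^ k \<le> 1 / w" "1 / w < 2 ^ Suc k" by blast
    have "(2 ^ Suc k) powr - p * tail (w * x) \<le> tail (2 ^ Suc k * (w * x))" using pow[OF x, of "Suc k"] by blast
    also have "\<dots> \<le> tail x"
    proof (rule tail_antimono)
      have "x = 1 / w * (w * x)" using w by simp
      also have "\<dots> \<le> 2 ^ Suc k * (w * x)" using k x x01 by (intro mult_right_mono) auto
      finally show "x \<le> 2 ^ Suc k * (w * x)" .
    qed
    finally have "tail (w * x) \<le> (2 ^ Suc k) powr p * tail x" by (simp add: powr_minus field_simps)
    also have "(2 ^ Suc k) powr p \<le> (2 / w) powr p" using k w pq by (intro powr_mono2) (auto simp: field_simps)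
    also have "(2 / w) powr p = 2 powr p * w powr - p" using w by (simp add: powr_divide powr_minus field_simps)
    finally show ?thesis using tail_nonneg by (simp add: mult_right_mono)
  qed
  \<comment> \<open>Here w x has left the range of the dyadic bounds. The trivial bound tail \<le> 1
    is used, and the bound \<open>down\<close> at the base point \<open>x0\<close> shows that the
    right-hand side is at least 1.\<close>
  have low: "tail (w * x) \<le> 2 powr p / tail x0 * w powr - p * tail x" if w: "0 < w" "w \<le> 1" and x: "x \<ge> x0" "w * x < x0" for w x
  proof -
    have "tail (x0 / x * x) \<le> 2 powr p * (x0 / x) powr - p * tail x" using x x01 by (intro down) auto
    also have "(x0 / x) powr - p \<le> w powr - p" using x x01 w pq by (intro powr_mono2') (auto simp: pos_le_divide_eq)
    finally have "tail x0 \<le> 2 powr p * w powr - p * tail x" using x x01 tail_nonneg by (simp add: mult_right_mono mult_left_mono)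
    then have "1 \<le> 2 powr p / tail x0 * w powr - p * tail x" using tail_pos[of x0] by (simp add: field_simps)
    then show ?thesis using tail_le_1[of "w * x"] by linarith
  qed
  define A where "A = 2 powr q + 2 powr p + 2 powr p / tail x0"
  have A: "A \<ge> 2 powr q" "A \<ge> 2 powr p" "A \<ge> 2 powr p / tail x0" "A > 0"
    using tail_pos[of x0] by (auto simp: A_def add_pos_pos)
  have "tail (w * x) \<le> A * potter w * tail x" if x: "x \<ge> x0" and w: "w > 0" for w x
  proof (cases "w \<ge> 1")
    case True
    have "tail (w * x) \<le> 2 powr q * w powr - q * tail x" by (rule up[OF True x])
    also have "\<dots> \<le> A * potter w * tail x"
      using A True tail_nonneg by (intro mult_right_mono mult_mono) (auto simp: potter_def)
    finally show ?thesis .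
  next
    case False
    then have pw: "potter w = w powr - p" using w by (simp add: potter_def)
    show ?thesis
    proof (cases "w * x \<ge> x0")
      case True
      have "tail (w * x) \<le> 2 powr p * w powr - p * tail x" using False w True by (intro down) auto
      also have "\<dots> \<le> A * w powr - p * tail x" using A tail_nonneg by (intro mult_right_mono) auto
      finally show ?thesis by (simp add: pw)
    next
      case F: False
      have "tail (w * x) \<le> 2 powr p / tail x0 * w powr - p * tail x" using False w F x by (intro low) auto
      also have "\<dots> \<le> A * w powr - p * tail x" using A tail_nonneg by (intro mult_right_mono) auto
      finally show ?thesis by (simp add: pw)
    qed
  qed
  then show ?thesis using A x01 by blast
qed

text \<open>Potter's bound at the base point \<open>x0\<close> gives a tail of order y^(-q) with q >
  1, and the mean is the integral of the tail.\<close>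

lemma integrable_X: "integrable M X"
proof -
  obtain x0 A where x0: "x0 \<ge> 1" "A > 0" "\<And>x w. x \<ge> x0 \<Longrightarrow> w > 0 \<Longrightarrow> tail (w * x) \<le> A * potter w * tail x"
    using tail_potter by metis
  let ?w = "\<lambda>y. indicator {0..x0} y + A * x0 powr q * (indicator {1..} y * y powr - q) :: real"
  have int: "integrable lborel ?w" using pq
    by (intro Bochner_Integration.integrable_add integrable_mult_right integrable_powr_at_top integrable_real_indicator) (auto simp: emeasure_lborel_Icc_eq)
  have "(\<integral>\<^sup>+y. ennreal (tail y) * indicator {0..} y \<partial>lborel) \<le> (\<integral>\<^sup>+y. ennreal (?w y) \<partial>lborel)"
  proof (rule nn_integral_mono)
    fix y :: real
    consider "y < 0" | "0 \<le> y" "y \<le> x0" | "x0 < y" by linarith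
    then show "ennreal (tail y) * indicator {0..} y \<le> ennreal (?w y)"
    proof cases
      case 2
      have "tail y \<le> ?w y" using 2 tail_le_1[of y] x0 by (simp add: add_increasing2)
      then show ?thesis using 2 by (simp add: ennreal_leI)
    next
      case 3
      have "tail y = tail (y / x0 * x0)" using x0 by simp
      also have "\<dots> \<le> A * potter (y / x0) * tail x0" using 3 x0 by (intro x0(3)) auto
      also have "\<dots> \<le> A * potter (y / x0) * 1"
        using x0 tail_le_1 by (intro mult_left_mono) (auto simp: potter_def)
      also have "potter (y / x0) = (y / x0) powr - q" using 3 x0 by (simp add: potter_def pos_divide_le_eq)
      also have "(y / x0) powr - q = x0 powr q * y powr - q" using 3 x0 by (simp add: powr_divide powr_minus field_simps)
      finally show ?thesis using 3 x0 by (simp add: ennreal_leI mult.assoc)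
    qed simp
  qed
  also have "\<dots> < \<infinity>" using int x0(2) by (subst nn_integral_eq_integral) (auto intro!: AE_I2)
  finally show ?thesis unfolding nn_integral_X_eq_tail[symmetric] using X_nonneg by (intro integrableI_nonneg) auto
qed

text \<open>The version for signed bounded weights; absolute integrability, needed for Fubini's
  theorem, comes from B times the mean of \<open>X\<close>.\<close>

lemma layer_cake:
  fixes h :: "real \<Rightarrow> real"
  assumes [measurable]: "h \<in> borel_measurable borel" and B: "\<And>y. \<bar>h y\<bar> \<le> B"
  shows "expectation (\<lambda>\<omega>. LINT y|lborel. indicator {0..<X \<omega>} y * h y) = (LINT y|lborel. indicator {0..} y * (h y * tail y))"
    and "integrable lborel (\<lambda>y. indicator {0..} y * (h y * tail y))"
proof -
  interpret P: pair_sigma_finite M lborel ..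
  let ?f = "\<lambda>\<omega> y. if 0 \<le> y \<and> y < X \<omega> then h y else 0"
  have B0: "B \<ge> 0" using B[of 0] by linarith
  have fint: "integrable (M \<Otimes>\<^sub>M lborel) (\<lambda>(\<omega>, y). ?f \<omega> y)"
  proof (rule integrableI_bounded)
    have "(\<integral>\<^sup>+z. ennreal (norm (case z of (\<omega>, y) \<Rightarrow> ?f \<omega> y)) \<partial>(M \<Otimes>\<^sub>M lborel)) = (\<integral>\<^sup>+\<omega>. \<integral>\<^sup>+y. ennreal (norm (?f \<omega> y)) \<partial>lborel \<partial>M)"
      by (subst lborel.nn_integral_fst[symmetric]) auto
    also have "\<dots> \<le> (\<integral>\<^sup>+\<omega>. \<integral>\<^sup>+y. ennreal B * indicator {0..<X \<omega>} y \<partial>lborel \<partial>M)"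
      using B by (intro nn_integral_mono) (auto simp: indicator_def intro: ennreal_leI)
    also have "\<dots> = (\<integral>\<^sup>+\<omega>. ennreal (B * X \<omega>) \<partial>M)"
      using X_nonneg B0 by (intro nn_integral_cong) (simp add: nn_integral_cmult ennreal_mult)
    also have "\<dots> < \<infinity>" using integrable_X X_nonneg B0 by (subst nn_integral_eq_integral) auto
    finally show "(\<integral>\<^sup>+z. ennreal (norm (case z of (\<omega>, y) \<Rightarrow> ?f \<omega> y)) \<partial>(M \<Otimes>\<^sub>M lborel)) < \<infinity>" .
  qed measurable
  have inner: "(LINT \<omega>|M. ?f \<omega> y) = indicator {0..} y * (h y * tail y)" for y
  proof -
    have "(LINT \<omega>|M. ?f \<omega> y) = (LINT \<omega>|M. (indicator {0..} y * h y) * indicator {y<..} (X \<omega>))"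
      by (intro Bochner_Integration.integral_cong) (auto simp: indicator_def)
    then show ?thesis by (simp add: tail_eq)
  qed
  have "integrable lborel (\<lambda>y. LINT \<omega>|M. ?f \<omega> y)" using P.integrable_snd[OF fint] by simp
  then show "integrable lborel (\<lambda>y. indicator {0..} y * (h y * tail y))" unfolding inner .
  have "(LINT y|lborel. LINT \<omega>|M. ?f \<omega> y) = (LINT \<omega>|M. LINT y|lborel. ?f \<omega> y)"
    using P.Fubini_integral[OF fint] by simp
  moreover have "(LINT y|lborel. ?f \<omega> y) = (LINT y|lborel. indicator {0..<X \<omega>} y * h y)" for \<omega>
    by (intro Bochner_Integration.integral_cong) (auto simp: indicator_def)
  ultimately show "expectation (\<lambda>\<omega>. LINT y|lborel. indicator {0..<X \<omega>} y * h y) = (LINT y|lborel. indicator {0..} y * (h y * tail y))"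
    unfolding inner by simp
qed

text \<open>The scale x is moved from the weight into the tail, where regular variation and Potter's
  bound can act on tail (w x) / tail x.\<close>

lemma layer_cake_scaled:
  fixes h :: "real \<Rightarrow> real"
  assumes [measurable]: "h \<in> borel_measurable borel" and B: "\<And>y. \<bar>h y\<bar> \<le> B" and x: "x > 0"
  shows "expectation (\<lambda>\<omega>. LINT w|lborel. indicator {0..<X \<omega> / x} w * h w) = (LINT w|lborel. indicator {0..} w * (h w * tail (w * x)))"
    and "integrable lborel (\<lambda>w. indicator {0..} w * (h w * tail (w * x)))"
proof -
  note L = layer_cake[of "\<lambda>y. h (y / x)" B]
  have "(LINT y|lborel. indicator {0..} y * (h (y / x) * tail y)) = \<bar>x\<bar> *\<^sub>R (LINT w|lborel. indicator {0..} (0 + x * w) * (h ((0 + x * w) / x) * tail (0 + x * w)))"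
    using x by (intro lborel_integral_real_affine) auto
  also have "\<dots> = x * (LINT w|lborel. indicator {0..} w * (h w * tail (w * x)))"
    using x by (auto simp: indicator_def zero_le_mult_iff mult.commute intro!: Bochner_Integration.integral_cong)
  finally have 1: "(LINT y|lborel. indicator {0..} y * (h (y / x) * tail y)) = x * (LINT w|lborel. indicator {0..} w * (h w * tail (w * x)))" .
  have "(LINT y|lborel. indicator {0..<X \<omega>} y * h (y / x)) = x * (LINT w|lborel. indicator {0..<X \<omega> / x} w * h w)" for \<omega>
  proof -
    have "(LINT y|lborel. indicator {0..<X \<omega>} y * h (y / x)) = \<bar>x\<bar> *\<^sub>R (LINT w|lborel. indicator {0..<X \<omega>} (0 + x * w) * h ((0 + x * w) / x))"
      using x by (intro lborel_integral_real_affine) auto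
    also have "\<dots> = x * (LINT w|lborel. indicator {0..<X \<omega> / x} w * h w)"
      using x by (auto simp: indicator_def zero_le_mult_iff field_simps intro!: Bochner_Integration.integral_cong)
    finally show ?thesis .
  qed
  then have "x * expectation (\<lambda>\<omega>. LINT w|lborel. indicator {0..<X \<omega> / x} w * h w) = x * (LINT w|lborel. indicator {0..} w * (h w * tail (w * x)))"
    using L(1) B 1 by simp
  then show "expectation (\<lambda>\<omega>. LINT w|lborel. indicator {0..<X \<omega> / x} w * h w) = (LINT w|lborel. indicator {0..} w * (h w * tail (w * x)))"
    using x by simp
  have "integrable lborel (\<lambda>w. indicator {0..} (0 + x * w) * (h ((0 + x * w) / x) * tail (0 + x * w)))"
    using L(2) B x by (intro lborel_integrable_real_affine) auto
  also have "(\<lambda>w. indicator {0..} (0 + x * w) * (h ((0 + x * w) / x) * tail (0 + x * w))) = (\<lambda>w. indicator {0..} w * (h w * tail (w * x)))"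
    using x by (auto simp: indicator_def zero_le_mult_iff mult.commute fun_eq_iff)
  finally show "integrable lborel (\<lambda>w. indicator {0..} w * (h w * tail (w * x)))" .
qed

text \<open>The layer cake formula is applied to \<open>max 0 (X - x)\<close> and to \<open>(min X x)\<^sup>2\<close>, which dominates \<open>X\<^sup>2\<close> on \<open>X \<le> x\<close>.\<close>

lemma tail_bounds:
  "\<exists>x0 C. x0 \<ge> 1 \<and> (\<forall>x\<ge>x0. trunc_sq x \<le> C * x\<^sup>2 * tail x \<and> tail_exp x \<le> C * x * tail x)"
proof -
  obtain x0 A where x0: "x0 \<ge> 1" "A > 0" "\<And>x w. x \<ge> x0 \<Longrightarrow> w > 0 \<Longrightarrow> tail (w * x) \<le> A * potter w * tail x"
    using tail_potter by metis
  define C1 where "C1 = (LINT w|lborel. 2 * (indicator {0..1} w * w powr (1 - p)))"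
  define C2 where "C2 = (LINT w|lborel. indicator {1..} w * w powr - q)"
  have i1: "integrable lborel (\<lambda>w. 2 * (indicator {0..1} w * w powr (1 - p)))"
    using pq by (intro integrable_mult_right integrable_powr_near_0) auto
  have i2: "integrable lborel (\<lambda>w. indicator {1..} w * w powr - q)"
    using pq by (intro integrable_powr_at_top) auto
  have C12: "C1 \<ge> 0" "C2 \<ge> 0" unfolding C1_def C2_def by (auto intro!: integral_nonneg_AE)
  have V: "trunc_sq x \<le> A * C1 * x\<^sup>2 * tail x" if x: "x \<ge> x0" for x
  proof -
    \<comment> \<open>The derivative of the square of min(w, 1), so that its integral up to X / x is
      the square of min(X / x, 1).\<close>
    define h where "h w = 2 * w * indicator {0..1} w" for w :: real
    have hb: "\<bar>h y\<bar> \<le> 2" for y by (auto simp: h_def indicator_def abs_mult)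
    have hm [measurable]: "h \<in> borel_measurable borel" unfolding h_def[abs_def] by measurable
    have x_pos: "x > 0" using x x0 by linarith
    have sq: "(LINT w|lborel. indicator {0..<y} w * h w) = (min y 1)\<^sup>2" if "y \<ge> 0" for y :: real
    proof -
      have "(LINT w|lborel. indicator {0..<y} w * h w) = (LINT w|lborel. indicator {0..min y 1} w *\<^sub>R (2 * w))"
      proof (rule integral_cong_AE)
        show "AE w in lborel. indicator {0..<y} w * h w = indicator {0..min y 1} w *\<^sub>R (2 * w)"
          using AE_lborel_singleton[of y] by eventually_elim (auto simp: h_def indicator_def)
      qed (auto simp: hm)
      also have "\<dots> = (min y 1)\<^sup>2 - 0\<^sup>2"
        using that by (intro integral_FTC_atLeastAtMost)
          (auto intro!: derivative_eq_intros continuous_intros simp: has_real_derivative_iff_has_vector_derivative[symmetric])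
      finally show ?thesis by simp
    qed
    have "trunc_sq x = x\<^sup>2 * expectation (\<lambda>\<omega>. (X \<omega> / x)\<^sup>2 * indicator {..x} (X \<omega>))"
      unfolding trunc_sq_def using x_pos by (simp add: power_divide field_simps flip: integral_mult_right_zero)
    also have "\<dots> \<le> x\<^sup>2 * expectation (\<lambda>\<omega>. (min (X \<omega> / x) 1)\<^sup>2)"
    proof (intro mult_left_mono integral_mono)
      show "integrable M (\<lambda>\<omega>. (X \<omega> / x)\<^sup>2 * indicator {..x} (X \<omega>))"
        using integrable_divide[OF trunc_sq_integrable[of x], of "x\<^sup>2"] by (simp add: power_divide)
      show "integrable M (\<lambda>\<omega>. (min (X \<omega> / x) 1)\<^sup>2)"
        using X_nonneg x_pos by (intro integrable_const_bound[where B = 1]) (auto intro!: AE_I2 power_le_one)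
      show "(X \<omega> / x)\<^sup>2 * indicator {..x} (X \<omega>) \<le> (min (X \<omega> / x) 1)\<^sup>2" for \<omega>
        using x_pos by (auto simp: indicator_def min_def)
    qed auto
    also have "expectation (\<lambda>\<omega>. (min (X \<omega> / x) 1)\<^sup>2) = (LINT w|lborel. indicator {0..} w * (h w * tail (w * x)))"
      using layer_cake_scaled(1)[OF hm hb x_pos] X_nonneg x_pos by (simp add: sq)
    also have "\<dots> \<le> (LINT w|lborel. (A * tail x) * (2 * (indicator {0..1} w * w powr (1 - p))))"
    proof (intro integral_mono_AE)
      show "integrable lborel (\<lambda>w. indicator {0..} w * (h w * tail (w * x)))"
        by (rule layer_cake_scaled(2)[OF hm hb x_pos])
      show "integrable lborel (\<lambda>w. (A * tail x) * (2 * (indicator {0..1} w * w powr (1 - p))))"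
        using i1 by (rule integrable_mult_right)
      show "AE w in lborel. indicator {0..} w * (h w * tail (w * x)) \<le> (A * tail x) * (2 * (indicator {0..1} w * w powr (1 - p)))"
        using AE_lborel_singleton[of 0] AE_lborel_singleton[of 1]
      proof eventually_elim
        case (elim w)
        show ?case
        proof (cases "0 < w \<and> w < 1")
          case True
          then have "tail (w * x) \<le> A * w powr - p * tail x" using x0(3)[OF x, of w] by (simp add: potter_def)
          then have "2 * w * tail (w * x) \<le> 2 * w * (A * w powr - p * tail x)" using True by (intro mult_left_mono) auto
          also have "\<dots> = (A * tail x) * (2 * (w * w powr - p))" by simp
          also have "w * w powr - p = w powr (1 - p)" using True powr_mult_base[of w "- p"] by simp
          finally show ?thesis using True by (simp add: h_def)
        qed (use elim in \<open>auto simp: h_def indicator_def\<close>)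
      qed
    qed
    also have "\<dots> = A * tail x * C1" unfolding C1_def by (rule integral_mult_right_zero)
    finally show ?thesis using x_pos by (simp add: mult_ac mult_left_mono)
  qed
  have L: "tail_exp x \<le> (1 + A * C2) * x * tail x" if x: "x \<ge> x0" for x
  proof -
    \<comment> \<open>The derivative of max(0, w - 1), so that its integral up to X / x is the
      excess of X / x over 1.\<close>
    define h :: "real \<Rightarrow> real" where "h w = indicator {1<..} w" for w
    have hb: "\<bar>h y\<bar> \<le> 1" for y by (auto simp: h_def indicator_def)
    have hm [measurable]: "h \<in> borel_measurable borel" unfolding h_def[abs_def] by measurable
    have x_pos: "x > 0" using x x0 by linarith
    have sq: "(LINT w|lborel. indicator {0..<y} w * h w) = max 0 (y - 1)" for y :: real
    proof -
      have "(LINT w|lborel. indicator {0..<y} w * h w) = (LINT w|lborel. indicator {1<..<y} w)"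
        by (intro Bochner_Integration.integral_cong) (auto simp: h_def indicator_def)
      then show ?thesis by (cases "y \<ge> 1") auto
    qed
    have i3: "integrable M (\<lambda>\<omega>. max 0 (X \<omega> / x - 1))"
      by (rule Bochner_Integration.integrable_bound[OF integrable_divide[OF integrable_X, of x]])
        (use X_nonneg x_pos in \<open>auto intro!: AE_I2 simp: max_def\<close>)
    have i4: "integrable M (\<lambda>\<omega>. indicator {x<..} (X \<omega>) :: real)"
      by (intro integrable_const_bound[where B = 1]) (auto simp: indicator_def)
    have "X \<omega> * indicator {x<..} (X \<omega>) = x * max 0 (X \<omega> / x - 1) + x * indicator {x<..} (X \<omega>)" for \<omega>
      using x_pos by (auto simp: indicator_def max_def field_simps)
    then have "tail_exp x = expectation (\<lambda>\<omega>. x * max 0 (X \<omega> / x - 1) + x * indicator {x<..} (X \<omega>))"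
      unfolding tail_exp_def by simp
    also have "\<dots> = x * expectation (\<lambda>\<omega>. max 0 (X \<omega> / x - 1)) + x * tail x"
      using i3 i4 unfolding tail_eq by (subst Bochner_Integration.integral_add) auto
    also have "expectation (\<lambda>\<omega>. max 0 (X \<omega> / x - 1)) = (LINT w|lborel. indicator {0..} w * (h w * tail (w * x)))"
      using layer_cake_scaled(1)[OF hm hb x_pos] by (simp add: sq)
    also have "\<dots> \<le> (LINT w|lborel. (A * tail x) * (indicator {1..} w * w powr - q))"
    proof (intro integral_mono)
      show "integrable lborel (\<lambda>w. indicator {0..} w * (h w * tail (w * x)))"
        by (rule layer_cake_scaled(2)[OF hm hb x_pos])
      show "integrable lborel (\<lambda>w. (A * tail x) * (indicator {1..} w * w powr - q))"
        using i2 by (rule integrable_mult_right)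
      show "indicator {0..} w * (h w * tail (w * x)) \<le> (A * tail x) * (indicator {1..} w * w powr - q)" for w
        using x0(3)[OF x, of w] x0(2) tail_nonneg[of x] by (auto simp: h_def potter_def indicator_def mult_ac)
    qed
    also have "\<dots> = A * tail x * C2" unfolding C2_def by (rule integral_mult_right_zero)
    finally show ?thesis using x_pos by (simp add: algebra_simps mult_left_mono)
  qed
  define C where "C = A * C1 + (1 + A * C2)"
  have "trunc_sq x \<le> C * x\<^sup>2 * tail x \<and> tail_exp x \<le> C * x * tail x" if x: "x \<ge> x0" for x
  proof
    have "A * C1 * x\<^sup>2 * tail x \<le> C * x\<^sup>2 * tail x" using C12 x0 tail_nonneg by (intro mult_right_mono) (auto simp: C_def)
    then show "trunc_sq x \<le> C * x\<^sup>2 * tail x" using V[OF x] by linarith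
    have "(1 + A * C2) * x * tail x \<le> C * x * tail x" using C12 x0 x tail_nonneg by (intro mult_right_mono) (auto simp: C_def)
    then show "tail_exp x \<le> C * x * tail x" using L[OF x] by linarith
  qed
  then show ?thesis using x0(1) by blast
qed

lemma tail_small: "((\<lambda>x. x * tail x) \<longlongrightarrow> 0) at_top"
proof -
  obtain x0 A where x0: "x0 \<ge> 1" "A > 0" "\<And>x w. x \<ge> x0 \<Longrightarrow> w > 0 \<Longrightarrow> tail (w * x) \<le> A * potter w * tail x"
    using tail_potter by metis
  have "((\<lambda>x. A * x0 powr q * x powr (1 - q)) \<longlongrightarrow> A * x0 powr q * 0) at_top"
    using pq by (intro tendsto_intros tendsto_neg_powr filterlim_ident) auto
  then have lim: "((\<lambda>x. A * x0 powr q * x powr (1 - q)) \<longlongrightarrow> 0) at_top" by simp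
  show ?thesis
  proof (rule Lim_null_comparison[OF _ lim])
    show "eventually (\<lambda>x. norm (x * tail x) \<le> A * x0 powr q * x powr (1 - q)) at_top"
      using eventually_gt_at_top[of x0]
    proof eventually_elim
      case (elim x)
      have "tail x = tail (x / x0 * x0)" using x0 by simp
      also have "\<dots> \<le> A * potter (x / x0) * tail x0" using elim x0 by (intro x0(3)) auto
      also have "\<dots> \<le> A * potter (x / x0) * 1"
        using x0 tail_le_1 by (intro mult_left_mono) (auto simp: potter_def)
      also have "potter (x / x0) = (x / x0) powr - q" using elim x0 by (simp add: potter_def pos_divide_le_eq)
      also have "(x / x0) powr - q = x0 powr q * x powr - q" using elim x0 by (simp add: powr_divide powr_minus field_simps)
      finally have "x * tail x \<le> x * (A * (x0 powr q * x powr - q))" using elim x0 by (intro mult_left_mono) auto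
      also have "\<dots> = A * x0 powr q * (x * x powr - q)" by simp
      also have "x * x powr - q = x powr (1 - q)" using elim x0 powr_mult_base[of x "- q"] by simp
      finally show ?case using elim x0 tail_nonneg by simp
    qed
  qed
qed

text \<open>The value 0 for s \<le> 0 makes the function monotone on the whole line, as the theorem
  on products of characteristic functions requires.\<close>

definition g :: "real \<Rightarrow> real" where "g s = (if s \<le> 0 then 0 else tail (1 / s))"

lemma g_inverse: "x > 0 \<Longrightarrow> g (1 / x) = tail x"
  by (simp add: g_def)

lemma g_mono: "mono g"
  by (rule monoI) (auto simp: g_def tail_nonneg intro!: tail_antimono divide_left_mono)

lemma g_nonneg: "g s \<ge> 0" and g_pos: "s > 0 \<Longrightarrow> g s > 0"
  by (auto simp: g_def tail_nonneg tail_pos)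

lemma g_regular:
  assumes c: "c > 0"
  shows "((\<lambda>s. g (c * s) / g s) \<longlongrightarrow> c powr \<alpha>) (at_right 0)"
proof -
  have "((\<lambda>x. tail (inverse c * x) / tail x) \<longlongrightarrow> inverse c powr - \<alpha>) at_top"
    using c by (intro tail_regular) auto
  also have "inverse c powr - \<alpha> = c powr \<alpha>" using c by (simp add: powr_def ln_inverse)
  finally have "((\<lambda>x. tail (inverse c * x) / tail x) \<longlongrightarrow> c powr \<alpha>) at_top" .
  moreover have "eventually (\<lambda>x. tail (inverse c * x) / tail x = g (c * inverse x) / g (inverse x)) at_top"
    using eventually_gt_at_top[of 0] by eventually_elim (use c in \<open>auto simp: g_def field_simps\<close>)
  ultimately show ?thesis unfolding filterlim_at_right_to_top by (rule Lim_transform_eventually)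
qed

text \<open>Potter's bound with w = x0 / x bounds the tail from below by a multiple of x^(-p), and p
  < 2.\<close>

lemma square_over_g: "((\<lambda>s. s\<^sup>2 / g s) \<longlongrightarrow> 0) (at_right 0)"
proof -
  obtain x0 A where x0: "x0 \<ge> 1" "A > 0" "\<And>x w. x \<ge> x0 \<Longrightarrow> w > 0 \<Longrightarrow> tail (w * x) \<le> A * potter w * tail x"
    using tail_potter by metis
  define K where "K = A * x0 powr - p / tail x0"
  have "((\<lambda>x. K * x powr (p - 2)) \<longlongrightarrow> K * 0) at_top"
    using pq by (intro tendsto_intros tendsto_neg_powr filterlim_ident) auto
  then have lim: "((\<lambda>x. K * x powr (p - 2)) \<longlongrightarrow> 0) at_top" by simp
  have "((\<lambda>x. (inverse x)\<^sup>2 / g (inverse x)) \<longlongrightarrow> 0) at_top"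
  proof (rule Lim_null_comparison[OF _ lim])
    show "eventually (\<lambda>x. norm ((inverse x)\<^sup>2 / g (inverse x)) \<le> K * x powr (p - 2)) at_top"
      using eventually_gt_at_top[of x0]
    proof eventually_elim
      case (elim x)
      have xp: "x > 0" using elim x0 by simp
      have "tail x0 = tail (x0 / x * x)" using xp by simp
      also have "\<dots> \<le> A * potter (x0 / x) * tail x" using elim x0 by (intro x0(3)) auto
      also have "potter (x0 / x) = (x0 / x) powr - p" using elim x0 by (simp add: potter_def pos_divide_le_eq)
      also have "(x0 / x) powr - p = x0 powr - p * x powr p" using elim x0 by (simp add: powr_divide powr_minus field_simps)
      finally have t: "tail x0 \<le> A * (x0 powr - p * x powr p) * tail x" .
      have "1 / tail x \<le> K * x powr p"
        using t tail_pos[of x] tail_pos[of x0] by (simp add: K_def field_simps)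
      then have "inverse (x\<^sup>2) * (1 / tail x) \<le> inverse (x\<^sup>2) * (K * x powr p)" by (intro mult_left_mono) auto
      also have "inverse (x\<^sup>2) * (K * x powr p) = K * x powr (p - 2)"
        using xp by (simp add: powr_diff field_simps)
      finally show ?case using xp tail_nonneg[of x] by (simp add: g_def power_inverse divide_inverse)
    qed
  qed
  then show ?thesis by (simp add: filterlim_at_right_to_top)
qed

text \<open>Dominated convergence along the ratio tail (w x) / tail x. The linear bound on
  \<open>h\<close> improves the majorant at 0 to w^(1 - p), and the bound 2 keeps w^(-q) at
  infinity; both are integrable.\<close>

lemma integral_tail_asymp:
  fixes h :: "real \<Rightarrow> real"
  assumes [measurable]: "h \<in> borel_measurable borel" and h: "\<And>w. w \<ge> 0 \<Longrightarrow> \<bar>h w\<bar> \<le> w" "\<And>w. \<bar>h w\<bar> \<le> 2"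
  shows "((\<lambda>x. (LINT w|lborel. indicator {0..} w * (h w * tail (w * x))) / tail x)
     \<longlongrightarrow> (LINT w|lborel. indicator {0..} w * (h w * w powr - \<alpha>))) at_top"
proof -
  obtain x0 A where x0: "x0 \<ge> 1" "A > 0" "\<And>x w. x \<ge> x0 \<Longrightarrow> w > 0 \<Longrightarrow> tail (w * x) \<le> A * potter w * tail x"
    using tail_potter by metis
  let ?W = "\<lambda>w. A * (indicator {0..1} w * w powr (1 - p)) + A * 2 * (indicator {1..} w * w powr - q)"
  have "((\<lambda>x. LINT w|lborel. indicator {0..} w * (h w * (tail (w * x) / tail x))) \<longlongrightarrow> (LINT w|lborel. indicator {0..} w * (h w * w powr - \<alpha>))) at_top"
  proof (rule integral_dominated_convergence_at_top[where w = ?W])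
    show "integrable lborel ?W"
      using pq by (intro Bochner_Integration.integrable_add integrable_mult_right integrable_powr_near_0 integrable_powr_at_top) auto
    show "AE w in lborel. ((\<lambda>x. indicator {0..} w * (h w * (tail (w * x) / tail x))) \<longlongrightarrow> indicator {0..} w * (h w * w powr - \<alpha>)) at_top"
      using AE_lborel_singleton[of 0]
    proof eventually_elim
      case (elim w)
      show ?case
      proof (cases "w > 0")
        case True
        then show ?thesis by (intro tendsto_mult tendsto_const tail_regular)
      next
        case False
        then show ?thesis using elim by (simp add: indicator_def)
      qed
    qed
    show "eventually (\<lambda>x. AE w in lborel. norm (indicator {0..} w * (h w * (tail (w * x) / tail x))) \<le> ?W w) at_top"
      using eventually_ge_at_top[of x0]
    proof eventually_elim
      case (elim x)
      show ?case using AE_lborel_singleton[of 0]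
      proof eventually_elim
        case (elim w)
        show ?case
        proof (cases "w > 0")
          case w: True
          have r: "\<bar>tail (w * x) / tail x\<bar> \<le> A * potter w"
            using x0(3)[OF \<open>x0 \<le> x\<close> w] tail_pos[of x] tail_nonneg by (simp add: pos_divide_le_eq)
          show ?thesis
          proof (cases "w \<le> 1")
            case True
            have "\<bar>h w\<bar> * \<bar>tail (w * x) / tail x\<bar> \<le> w * (A * potter w)"
              using h(1)[of w] r w by (intro mult_mono) auto
            also have "\<dots> \<le> ?W w"
            proof (cases "w = 1")
              case True
              then show ?thesis using x0 by (simp add: potter_def)
            next
              case F: False
              then show ?thesis using True w x0 powr_mult_base[of w "- p"] by (simp add: potter_def mult_ac)
            qed
            finally show ?thesis using w by (simp add: abs_mult)
          next
            case False
            have "\<bar>h w\<bar> * \<bar>tail (w * x) / tail x\<bar> \<le> 2 * (A * potter w)"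
              using h(2)[of w] r w by (intro mult_mono) auto
            then show ?thesis using w False by (simp add: abs_mult potter_def mult_ac)
          qed
        qed (use elim x0 in \<open>auto simp: indicator_def\<close>)
      qed
    qed
  qed measurable
  then show ?thesis by (simp add: mult.assoc[symmetric] flip: integral_divide_zero)
qed

text \<open>The real part of \<psi> (1 / x) is minus the mean of 1 - cos (X / x), an integral of sin
  up to X / x; the imaginary part is minus the mean of an integral of 1 - cos. The layer cake
  formula turns them into \<open>I1\<close> and \<open>I2\<close>, whose limits are the two Gamma
  integrals computed above.\<close>

lemma \<psi>_asymp:
  "((\<lambda>s. \<psi> s / of_real (g s)) \<longlongrightarrow> - (of_real (Gamma (1 - \<alpha>)) * (of_real (cos (pi * \<alpha> / 2)) - \<i> * of_real (sin (pi * \<alpha> / 2))))) (at_right 0)"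
proof -
  have cos_le: "\<bar>1 - cos w\<bar> \<le> w" if "w \<ge> 0" for w :: real
  proof -
    have "1 - cos w = 2 * (\<bar>sin (w / 2)\<bar> * \<bar>sin (w / 2)\<bar>)" using cos_double_sin[of "w / 2"] by (simp add: power2_eq_square)
    also have "\<dots> \<le> 2 * (\<bar>w / 2\<bar> * 1)" using abs_sin_x_le_abs_x[of "w / 2"] by (intro mult_left_mono mult_mono) auto
    finally show ?thesis using that cos_le_one[of w] by simp
  qed
  have cos_2: "\<bar>1 - cos w\<bar> \<le> 2" for w :: real using cos_ge_minus_one[of w] cos_le_one[of w] by linarith
  have sin_le: "\<bar>sin w\<bar> \<le> w" if "w \<ge> 0" for w :: real using abs_sin_x_le_abs_x[of w] that by simp
  have sin_2: "\<bar>sin w\<bar> \<le> 2" for w :: real using abs_sin_le_one[of w] by linarith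
  define I1 where "I1 x = (LINT w|lborel. indicator {0..} w * (sin w * tail (w * x)))" for x
  define I2 where "I2 x = (LINT w|lborel. indicator {0..} w * ((1 - cos w) * tail (w * x)))" for x
  have "((\<lambda>x. I1 x / tail x) \<longlongrightarrow> (LINT w|lborel. indicator {0..} w * (sin w * w powr - \<alpha>))) at_top"
    unfolding I1_def by (intro integral_tail_asymp sin_le sin_2) auto
  then have L1: "((\<lambda>x. I1 x / tail x) \<longlongrightarrow> Gamma (1 - \<alpha>) * cos (pi * \<alpha> / 2)) at_top"
    using has_bochner_integral_sin_powr[OF \<alpha>] by (simp add: has_bochner_integral_iff)
  have "((\<lambda>x. I2 x / tail x) \<longlongrightarrow> (LINT w|lborel. indicator {0..} w * ((1 - cos w) * w powr - \<alpha>))) at_top"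
    unfolding I2_def by (intro integral_tail_asymp cos_le cos_2) auto
  then have L2: "((\<lambda>x. I2 x / tail x) \<longlongrightarrow> - Gamma (1 - \<alpha>) * sin (pi * \<alpha> / 2)) at_top"
    using has_bochner_integral_one_minus_cos_powr'[OF \<alpha>] by (simp add: has_bochner_integral_iff)
  have int_sin: "(LINT w|lborel. indicator {0..<y} w * sin w) = 1 - cos y"
    and int_cos: "(LINT w|lborel. indicator {0..<y} w * (1 - cos w)) = y - sin y" if "y \<ge> 0" for y :: real
  proof -
    have "(LINT w|lborel. indicator {0..<y} w * sin w) = (LINT w|lborel. indicator {0..y} w *\<^sub>R sin w)"
    proof (rule integral_cong_AE)
      show "AE w in lborel. indicator {0..<y} w * sin w = indicator {0..y} w *\<^sub>R sin w"
        using AE_lborel_singleton[of y] by eventually_elim (auto simp: indicator_def)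
    qed auto
    also have "\<dots> = (- cos y) - (- cos 0)"
      using that by (intro integral_FTC_atLeastAtMost)
        (auto intro!: derivative_eq_intros continuous_intros simp: has_real_derivative_iff_has_vector_derivative[symmetric])
    finally show "(LINT w|lborel. indicator {0..<y} w * sin w) = 1 - cos y" by simp
    have "(LINT w|lborel. indicator {0..<y} w * (1 - cos w)) = (LINT w|lborel. indicator {0..y} w *\<^sub>R (1 - cos w))"
    proof (rule integral_cong_AE)
      show "AE w in lborel. indicator {0..<y} w * (1 - cos w) = indicator {0..y} w *\<^sub>R (1 - cos w)"
        using AE_lborel_singleton[of y] by eventually_elim (auto simp: indicator_def)
    qed auto
    also have "\<dots> = (y - sin y) - (0 - sin 0)"
      using that by (intro integral_FTC_atLeastAtMost)
        (auto intro!: derivative_eq_intros continuous_intros simp: has_real_derivative_iff_has_vector_derivative[symmetric])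
    finally show "(LINT w|lborel. indicator {0..<y} w * (1 - cos w)) = y - sin y" by simp
  qed
  have \<psi>_eq: "\<psi> (1 / x) = - of_real (I1 x) - \<i> * of_real (I2 x)" if x: "x > 0" for x
  proof -
    have "I1 x = expectation (\<lambda>\<omega>. 1 - cos (X \<omega> / x))"
      unfolding I1_def using layer_cake_scaled(1)[of sin 2 x] sin_2 x X_nonneg by (simp add: int_sin)
    moreover have "I2 x = expectation (\<lambda>\<omega>. X \<omega> / x - sin (X \<omega> / x))"
      unfolding I2_def using layer_cake_scaled(1)[of "\<lambda>w. 1 - cos w" 2 x] cos_2 x X_nonneg by (simp add: int_cos)
    moreover have "integrable M (\<lambda>\<omega>. cos (X \<omega> / x))" by (intro integrable_const_bound[where B = 1]) auto
    moreover have "integrable M (\<lambda>\<omega>. sin (X \<omega> / x))" by (intro integrable_const_bound[where B = 1]) auto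
    moreover have "\<psi> (1 / x) = (CLINT \<omega>|M. - complex_of_real (1 - cos (X \<omega> / x)) - \<i> * complex_of_real (X \<omega> / x - sin (X \<omega> / x)))"
      unfolding \<psi>_def
      by (intro Bochner_Integration.integral_cong) (auto simp: exp_Euler cos_of_real sin_of_real algebra_simps simp flip: of_real_mult of_real_divide)
    ultimately show ?thesis using integrable_X
      by (subst (asm) Bochner_Integration.integral_diff) (auto simp del: of_real_diff of_real_divide simp: integral_complex_of_real)
  qed
  have "((\<lambda>x. - complex_of_real (I1 x / tail x) - \<i> * of_real (I2 x / tail x)) \<longlongrightarrow>
      - complex_of_real (Gamma (1 - \<alpha>) * cos (pi * \<alpha> / 2)) - \<i> * of_real (- Gamma (1 - \<alpha>) * sin (pi * \<alpha> / 2))) at_top"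
    by (intro tendsto_intros L1 L2)
  moreover have "eventually (\<lambda>x. - complex_of_real (I1 x / tail x) - \<i> * of_real (I2 x / tail x) = \<psi> (inverse x) / of_real (g (inverse x))) at_top"
    using eventually_gt_at_top[of 0]
  proof eventually_elim
    case (elim x)
    then have "g (inverse x) = tail x" by (simp add: g_def inverse_eq_divide)
    then show ?case using \<psi>_eq[OF elim] tail_pos[of x] by (simp add: inverse_eq_divide diff_divide_distrib)
  qed
  ultimately have "((\<lambda>x. \<psi> (inverse x) / of_real (g (inverse x))) \<longlongrightarrow>
      - complex_of_real (Gamma (1 - \<alpha>) * cos (pi * \<alpha> / 2)) - \<i> * of_real (- Gamma (1 - \<alpha>) * sin (pi * \<alpha> / 2))) at_top"
    by (rule Lim_transform_eventually)
  then show ?thesis unfolding filterlim_at_right_to_top by (simp add: algebra_simps)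
qed

end

section \<open>Perturbed random walks\<close>

text \<open>The pairs (\<xi> j, \<eta> j) may have dependent components. Between the two sequences
  only independence of \<eta> j from the sum of the earlier steps is postulated.\<close>

locale renewal_pairs = prob_space +
  fixes \<xi> \<eta> :: "nat \<Rightarrow> 'a \<Rightarrow> real" and \<mu> :: real
  assumes \<xi>_indep: "indep_vars (\<lambda>_. borel) \<xi> UNIV"
    and \<eta>_indep: "indep_vars (\<lambda>_. borel) \<eta> UNIV"
    and cross_indep: "\<And>j. indep_var borel (\<lambda>\<omega>. \<Sum>i<j. \<xi> i \<omega>) borel (\<eta> j)"
    and \<xi>_distr: "\<And>i. distr M borel (\<xi> i) = distr M borel (\<xi> 0)"
    and \<eta>_distr: "\<And>i. distr M borel (\<eta> i) = distr M borel (\<eta> 0)"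
    and \<xi>_nonneg: "\<And>i \<omega>. \<xi> i \<omega> \<ge> 0"
    and \<eta>_nonneg: "\<And>i \<omega>. \<eta> i \<omega> \<ge> 0"
    and \<xi>_integrable: "integrable M (\<xi> 0)"
    and \<mu>_eq: "expectation (\<xi> 0) = \<mu>"
    and \<mu>_pos: "\<mu> > 0"
begin

definition S :: "nat \<Rightarrow> 'a \<Rightarrow> real" where "S j \<omega> = (\<Sum>i<j. \<xi> i \<omega>)"

definition trunc_square :: "real \<Rightarrow> real" where
  "trunc_square x = expectation (\<lambda>\<omega>. (\<xi> 0 \<omega>)\<^sup>2 * indicator {..x} (\<xi> 0 \<omega>))"

definition tail_mean :: "real \<Rightarrow> real" where
  "tail_mean x = expectation (\<lambda>\<omega>. \<xi> 0 \<omega> * indicator {x<..} (\<xi> 0 \<omega>))"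

lemma \<xi>_measurable [measurable]: "\<xi> i \<in> borel_measurable M"
  using \<xi>_indep by (auto simp: indep_vars_def)

lemma \<eta>_measurable [measurable]: "\<eta> i \<in> borel_measurable M"
  using \<eta>_indep by (auto simp: indep_vars_def)

lemma S_measurable [measurable]: "S j \<in> borel_measurable M"
  unfolding S_def[abs_def] by measurable

lemma expectation_\<xi>:
  fixes h :: "real \<Rightarrow> real"
  assumes [measurable]: "h \<in> borel_measurable borel"
  shows "expectation (\<lambda>\<omega>. h (\<xi> i \<omega>)) = expectation (\<lambda>\<omega>. h (\<xi> 0 \<omega>))"
    and "integrable M (\<lambda>\<omega>. h (\<xi> i \<omega>)) \<longleftrightarrow> integrable M (\<lambda>\<omega>. h (\<xi> 0 \<omega>))"
  using integral_distr[of "\<xi> i" M borel h] integral_distr[of "\<xi> 0" M borel h]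
    integrable_distr_eq[of "\<xi> i" M borel h] integrable_distr_eq[of "\<xi> 0" M borel h] \<xi>_distr[of i]
  by simp_all

lemma expectation_\<eta>:
  fixes h :: "real \<Rightarrow> real"
  assumes [measurable]: "h \<in> borel_measurable borel"
  shows "expectation (\<lambda>\<omega>. h (\<eta> i \<omega>)) = expectation (\<lambda>\<omega>. h (\<eta> 0 \<omega>))"
  using integral_distr[of "\<eta> i" M borel h] integral_distr[of "\<eta> 0" M borel h] \<eta>_distr[of i]
  by simp

lemma \<xi>_integrable' [simp]: "integrable M (\<xi> i)" and \<xi>_mean: "expectation (\<xi> i) = \<mu>"
  using expectation_\<xi>[of "\<lambda>x. x" i] \<xi>_integrable \<mu>_eq by simp_all

lemma S_integrable [simp]: "integrable M (S j)"
  unfolding S_def[abs_def] by simp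

lemma S_mono: "j \<le> k \<Longrightarrow> S j \<omega> \<le> S k \<omega>"
  unfolding S_def using \<xi>_nonneg by (intro sum_mono2) auto

text \<open>The steps are cut at level x. The bounded parts are handled by their variance, at most
  the truncated second moment each; the large parts contribute at most twice their mean. The bound
  remains useful when the variance is infinite.\<close>

lemma S_L1_bound:
  assumes "x \<ge> 0"
  shows "expectation (\<lambda>\<omega>. \<bar>S j \<omega> - real j * \<mu>\<bar>) \<le> sqrt (real j * trunc_square x) + 2 * real j * tail_mean x"
proof -
  define Y where "Y i \<omega> = \<xi> i \<omega> * indicator {..x} (\<xi> i \<omega>)" for i \<omega>
  define Z where "Z i \<omega> = \<xi> i \<omega> * indicator {x<..} (\<xi> i \<omega>)" for i \<omega>
  define m where "m = expectation (Y 0)"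
  have [measurable]: "Y i \<in> borel_measurable M" "Z i \<in> borel_measurable M" for i
    unfolding Y_def[abs_def] Z_def[abs_def] by measurable
  have Yb: "\<bar>Y i \<omega>\<bar> \<le> x" for i \<omega> using assms \<xi>_nonneg[of i \<omega>] by (auto simp: Y_def indicator_def)
  have Yi [simp]: "integrable M (Y i)" for i by (rule integrable_const_bound[where B = x]) (auto simp: Yb)
  have Y2i [simp]: "integrable M (\<lambda>\<omega>. (Y i \<omega>)\<^sup>2)" for i
  proof (rule integrable_const_bound[where B = "x\<^sup>2"])
    have "(Y i \<omega>)\<^sup>2 \<le> x\<^sup>2" for \<omega> using Yb[of i \<omega>] by (rule abs_le_square_iff[THEN iffD1, OF order_trans]) simp
    then show "AE \<omega> in M. norm ((Y i \<omega>)\<^sup>2) \<le> x\<^sup>2" by simp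
  qed auto
  have Zi [simp]: "integrable M (Z i)" for i
    by (rule Bochner_Integration.integrable_bound[OF \<xi>_integrable'[of i]]) (auto simp: Z_def indicator_def)
  have Zpos: "Z i \<omega> \<ge> 0" for i \<omega> using \<xi>_nonneg by (simp add: Z_def)
  have m: "expectation (Y i) = m" for i
    unfolding m_def Y_def using expectation_\<xi>(1)[of "\<lambda>y. y * indicator {..x} y" i] by simp
  have Ze: "expectation (Z i) = tail_mean x" for i
    unfolding tail_mean_def Z_def using expectation_\<xi>(1)[of "\<lambda>y. y * indicator {x<..} y" i] by simp
  have Y2: "expectation (\<lambda>\<omega>. (Y i \<omega>)\<^sup>2) = trunc_square x" for i
  proof -
    have "(y * indicator {..x} y)\<^sup>2 = y\<^sup>2 * indicator {..x} y" for y :: real by (simp add: indicator_def)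
    then show ?thesis unfolding trunc_square_def Y_def using expectation_\<xi>(1)[of "\<lambda>y. y\<^sup>2 * indicator {..x} y" i] by simp
  qed
  have split: "\<xi> i \<omega> = Y i \<omega> + Z i \<omega>" for i \<omega> by (simp add: Y_def Z_def indicator_def)
  have \<mu>: "\<mu> = m + tail_mean x"
    using Bochner_Integration.integral_add[OF Yi[of 0] Zi[of 0]] \<xi>_mean[of 0] m[of 0] Ze[of 0] by (simp add: split[abs_def])
  let ?A = "\<lambda>\<omega>. \<Sum>i<j. Y i \<omega> - m" and ?B = "\<lambda>\<omega>. \<Sum>i<j. Z i \<omega> - tail_mean x"
  have eq: "S j \<omega> - real j * \<mu> = ?A \<omega> + ?B \<omega>" for \<omega>
    by (simp add: S_def split \<mu> sum.distrib sum_subtractf algebra_simps)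
  have [simp]: "integrable M ?A" "integrable M ?B" by auto
  have ind: "indep_vars (\<lambda>_. borel) (\<lambda>i \<omega>. Y i \<omega> - m) {..<j}"
    unfolding Y_def by (rule indep_vars_compose2[OF indep_vars_subset[OF \<xi>_indep]]) auto
  have int2: "integrable M (\<lambda>\<omega>. (Y i \<omega> - m)\<^sup>2)" for i
    by (simp add: power2_diff)
  have var: "expectation (\<lambda>\<omega>. (Y i \<omega> - m)\<^sup>2) \<le> trunc_square x" for i
    using variance_eq[OF Yi Y2i, of i] m[of i] Y2[of i] by simp
  have "integrable M (\<lambda>\<omega>. (?A \<omega>)\<^sup>2) \<and> expectation (\<lambda>\<omega>. (?A \<omega>)\<^sup>2) = (\<Sum>i<j. expectation (\<lambda>\<omega>. (Y i \<omega> - m)\<^sup>2))"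
    using int2 m by (intro expectation_square_sum_indep ind) (auto simp: prob_space)
  moreover have "(\<Sum>i<j. expectation (\<lambda>\<omega>. (Y i \<omega> - m)\<^sup>2)) \<le> real j * trunc_square x"
    using sum_bounded_above[of "{..<j}", OF var] by simp
  ultimately have A: "expectation (\<lambda>\<omega>. \<bar>?A \<omega>\<bar>) \<le> sqrt (real j * trunc_square x)"
    using expectation_abs_le_sqrt[of ?A] by (force intro: order_trans)
  have tpos: "tail_mean x \<ge> 0" unfolding Ze[of 0, symmetric] using Zpos by simp
  have "expectation (\<lambda>\<omega>. \<bar>?B \<omega>\<bar>) \<le> expectation (\<lambda>\<omega>. \<Sum>i<j. Z i \<omega> + tail_mean x)"
  proof (rule integral_mono)
    fix \<omega>
    have "\<bar>?B \<omega>\<bar> \<le> (\<Sum>i<j. \<bar>Z i \<omega> - tail_mean x\<bar>)" by (rule sum_abs)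
    also have "\<dots> \<le> (\<Sum>i<j. Z i \<omega> + tail_mean x)" using Zpos tpos by (intro sum_mono) (simp add: abs_le_iff)
    finally show "\<bar>?B \<omega>\<bar> \<le> (\<Sum>i<j. Z i \<omega> + tail_mean x)" .
  qed auto
  also have "\<dots> = 2 * real j * tail_mean x" by (simp add: Bochner_Integration.integral_sum Ze prob_space)
  finally have B: "expectation (\<lambda>\<omega>. \<bar>?B \<omega>\<bar>) \<le> 2 * real j * tail_mean x" .
  have "expectation (\<lambda>\<omega>. \<bar>S j \<omega> - real j * \<mu>\<bar>) \<le> expectation (\<lambda>\<omega>. \<bar>?A \<omega>\<bar> + \<bar>?B \<omega>\<bar>)"
    unfolding eq by (intro integral_mono integrable_abs Bochner_Integration.integrable_add) auto
  also have "\<dots> = expectation (\<lambda>\<omega>. \<bar>?A \<omega>\<bar>) + expectation (\<lambda>\<omega>. \<bar>?B \<omega>\<bar>)"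
    by (intro Bochner_Integration.integral_add integrable_abs) auto
  finally show ?thesis using A B by linarith
qed

end

text \<open>As \<open>s\<close> is increasing, the positive terms form an initial segment of length
  \<open>N\<close>. The two sums differ by the terms between \<open>N\<close> and \<open>m\<close>,
  and each of these lies between 0 and t - s m. Thus no inversion of the sequence \<open>s\<close>
  is required.\<close>

lemma sum_positive_part_diff_le:
  fixes s :: "nat \<Rightarrow> real" and t :: real
  assumes "mono s" "m \<le> J"
  defines "N \<equiv> card {j \<in> {..<J}. s j \<le> t}"
  shows "\<bar>(\<Sum>j<J. max 0 (t - s j)) - (\<Sum>j<m. t - s j)\<bar> \<le> \<bar>real N - real m\<bar> * \<bar>t - s m\<bar>"
    and "j < N \<longleftrightarrow> j < J \<and> s j \<le> t"
proof -
  let ?A = "{j \<in> {..<J}. s j \<le> t}"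
  have down: "k \<in> ?A" if "j \<in> ?A" "k \<le> j" for j k
    using that monoD[OF \<open>mono s\<close>, of k j] by auto
  have "\<exists>k. ?A = {..<k}"
  proof (cases "?A = {}")
    case False
    then have "Max ?A \<in> ?A" by (intro Max_in) auto
    have "?A = {..<Suc (Max ?A)}"
    proof (intro equalityI subsetI)
      fix j assume "j \<in> ?A"
      then have "j \<le> Max ?A" by (intro Max_ge) auto
      then show "j \<in> {..<Suc (Max ?A)}" by simp
    next
      fix j assume "j \<in> {..<Suc (Max ?A)}"
      then have "j \<le> Max ?A" by simp
      with \<open>Max ?A \<in> ?A\<close> show "j \<in> ?A" by (rule down)
    qed
    then show ?thesis by blast
  next
    case True
    then have "?A = {..<0}" by auto
    then show ?thesis by blast
  qed
  then obtain k where k: "?A = {..<k}" by blast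
  then have A: "?A = {..<N}" by (simp add: N_def)
  show N: "j < N \<longleftrightarrow> j < J \<and> s j \<le> t" for j using A by auto
  have NJ: "N \<le> J" using card_mono[of "{..<J}" ?A] by (auto simp: N_def)
  have "(\<Sum>j<J. max 0 (t - s j)) = (\<Sum>j<N. t - s j)"
  proof (rule sum.mono_neutral_cong_right)
    show "\<forall>i\<in>{..<J} - {..<N}. max 0 (t - s i) = 0"
    proof
      fix i assume "i \<in> {..<J} - {..<N}"
      then have "\<not> s i \<le> t" using N[of i] by simp
      then show "max 0 (t - s i) = 0" by simp
    qed
    show "max 0 (t - s i) = t - s i" if "i \<in> {..<N}" for i
      using that N[of i] by simp
  qed (use NJ in auto)
  moreover have "\<bar>(\<Sum>j<N. t - s j) - (\<Sum>j<m. t - s j)\<bar> \<le> \<bar>real N - real m\<bar> * \<bar>t - s m\<bar>"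
  proof (cases "m \<le> N")
    case True
    have "(\<Sum>j<N. t - s j) - (\<Sum>j<m. t - s j) = (\<Sum>j=m..<N. t - s j)"
      unfolding lessThan_atLeast0 using True by (intro sum_diff_nat_ivl) auto
    moreover have "(\<Sum>j=m..<N. t - s j) \<le> (\<Sum>j=m..<N. \<bar>t - s m\<bar>)"
    proof (rule sum_mono)
      fix j assume "j \<in> {m..<N}"
      then have "s m \<le> s j" by (intro monoD[OF \<open>mono s\<close>]) auto
      then show "t - s j \<le> \<bar>t - s m\<bar>" by linarith
    qed
    moreover have "(\<Sum>j=m..<N. t - s j) \<ge> 0"
    proof (rule sum_nonneg)
      fix j assume "j \<in> {m..<N}"
      then show "0 \<le> t - s j" using N[of j] by auto
    qed
    ultimately show ?thesis using True by simp
  next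
    case False
    have "(\<Sum>j<m. t - s j) - (\<Sum>j<N. t - s j) = (\<Sum>j=N..<m. t - s j)"
      unfolding lessThan_atLeast0 using False by (intro sum_diff_nat_ivl) auto
    moreover have "(\<Sum>j=N..<m. t - s j) = - (\<Sum>j=N..<m. s j - t)"
      by (simp add: sum_negf[symmetric])
    ultimately have "(\<Sum>j<N. t - s j) - (\<Sum>j<m. t - s j) = (\<Sum>j=N..<m. s j - t)" by simp
    moreover have "(\<Sum>j=N..<m. s j - t) \<le> (\<Sum>j=N..<m. \<bar>t - s m\<bar>)"
    proof (rule sum_mono)
      fix j assume "j \<in> {N..<m}"
      then have "s j \<le> s m" by (intro monoD[OF \<open>mono s\<close>]) auto
      then show "s j - t \<le> \<bar>t - s m\<bar>" by linarith
    qed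
    moreover have "(\<Sum>j=N..<m. s j - t) \<ge> 0"
    proof (rule sum_nonneg)
      fix j assume "j \<in> {N..<m}"
      then show "0 \<le> s j - t" using N[of j] \<open>m \<le> J\<close> by auto
    qed
    ultimately show ?thesis using False by simp
  qed
  ultimately show "\<bar>(\<Sum>j<J. max 0 (t - s j)) - (\<Sum>j<m. t - s j)\<bar> \<le> \<bar>real N - real m\<bar> * \<bar>t - s m\<bar>" by simp
qed

text \<open>What the three regimes share. By the norming condition g (1 / d) behaves like 1 / t, so
  at the truncation level d the second moment is of order at most d^2 / t and the tail mean of order
  at most d / t.\<close>

locale renewal_regime = renewal_pairs +
  fixes g :: "real \<Rightarrow> real" and C x0 :: real and t d :: "nat \<Rightarrow> real"
  assumes g_pos: "\<And>s. s > 0 \<Longrightarrow> g s > 0"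
    and trunc_square_le: "\<And>x. x \<ge> x0 \<Longrightarrow> trunc_square x \<le> C * x\<^sup>2 * g (1 / x)"
    and tail_mean_le: "\<And>x. x \<ge> x0 \<Longrightarrow> tail_mean x \<le> C * x * g (1 / x)"
    and g_small: "((\<lambda>x. x * g (1 / x)) \<longlongrightarrow> 0) at_top"
    and t_lim: "filterlim t at_top sequentially"
    and d_lim: "filterlim d at_top sequentially"
    and norming: "(\<lambda>n. t n * g (1 / d n)) \<longlonglongrightarrow> 1"
begin

lemma t_gt: "eventually (\<lambda>n. t n > B) sequentially"
  using t_lim by (simp add: filterlim_at_top_dense)

lemma d_gt: "eventually (\<lambda>n. d n > B) sequentially"
  using d_lim by (simp add: filterlim_at_top_dense)

lemma C_nonneg: "C \<ge> 0"
proof -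
  let ?x = "max x0 1"
  have "0 \<le> trunc_square ?x" unfolding trunc_square_def by (intro integral_nonneg_AE) auto
  also have "\<dots> \<le> C * (?x\<^sup>2 * g (1 / ?x))" using trunc_square_le[of ?x] by (simp add: mult.assoc)
  finally show ?thesis using g_pos[of "1 / ?x"] by (simp add: zero_le_mult_iff)
    (smt (verit) divide_pos_pos mult_pos_pos zero_less_power)
qed

text \<open>Dividing d g (1 / d), which vanishes, by t g (1 / d), which tends to 1. Fluctuations of
  order \<open>d\<close> are therefore negligible against \<open>t\<close>.\<close>

lemma d_over_t: "(\<lambda>n. d n / t n) \<longlonglongrightarrow> 0"
proof -
  have "(\<lambda>n. d n * g (1 / d n) / (t n * g (1 / d n))) \<longlonglongrightarrow> 0 / 1"
    using filterlim_compose[OF g_small d_lim] norming by (intro tendsto_divide) auto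
  moreover have "eventually (\<lambda>n. d n * g (1 / d n) / (t n * g (1 / d n)) = d n / t n) sequentially"
    using d_gt[of 0]
  proof eventually_elim
    case (elim n)
    then have "g (1 / d n) \<noteq> 0" using g_pos[of "1 / d n"] by simp
    then show ?case by simp
  qed
  ultimately show ?thesis by (simp add: tendsto_cong)
qed

lemma trunc_square_mono: "0 \<le> x \<Longrightarrow> x \<le> y \<Longrightarrow> trunc_square x \<le> trunc_square y"
proof -
  assume xy: "0 \<le> x" "x \<le> y"
  have int: "integrable M (\<lambda>\<omega>. (\<xi> 0 \<omega>)\<^sup>2 * indicator {..z} (\<xi> 0 \<omega>))" for z
  proof (rule integrable_const_bound[where B = "z\<^sup>2"])
    show "AE \<omega> in M. norm ((\<xi> 0 \<omega>)\<^sup>2 * indicator {..z} (\<xi> 0 \<omega>)) \<le> z\<^sup>2"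
      using \<xi>_nonneg[of 0] by (intro AE_I2) (auto simp: indicator_def intro: power_mono)
  qed auto
  show ?thesis unfolding trunc_square_def
    using xy by (intro integral_mono int) (auto simp: indicator_def)
qed

text \<open>A positive mean prevents the truncated second moments from vanishing at every level.
  Hence g (1 / d) is at least a constant over d^2 while being of order 1 / t. So the norming is
  never smaller than in the case of finite variance.\<close>

lemma t_le_d_square: "\<exists>K>0. eventually (\<lambda>n. t n \<le> K * (d n)\<^sup>2) sequentially"
proof -
  have "\<exists>x\<ge>0. trunc_square x > 0"
  proof (rule ccontr)
    assume "\<not> ?thesis"
    then have le: "trunc_square (real k) \<le> 0" for k :: nat by (meson not_less of_nat_0_le_iff)
    have "AE \<omega> in M. (\<xi> 0 \<omega>)\<^sup>2 * indicator {..real k} (\<xi> 0 \<omega>) = 0" for k :: nat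
    proof -
      have int: "integrable M (\<lambda>\<omega>. (\<xi> 0 \<omega>)\<^sup>2 * indicator {..real k} (\<xi> 0 \<omega>))"
      proof (rule integrable_const_bound[where B = "(real k)\<^sup>2"])
        show "AE \<omega> in M. norm ((\<xi> 0 \<omega>)\<^sup>2 * indicator {..real k} (\<xi> 0 \<omega>)) \<le> (real k)\<^sup>2"
          using \<xi>_nonneg[of 0] by (intro AE_I2) (auto simp: indicator_def intro: power_mono)
      qed auto
      have "trunc_square (real k) \<ge> 0" unfolding trunc_square_def by (intro integral_nonneg_AE) auto
      then have "trunc_square (real k) = 0" using le[of k] by simp
      then show ?thesis
        unfolding trunc_square_def by (subst (asm) integral_nonneg_eq_0_iff_AE[OF int]) auto
    qed
    then have "AE \<omega> in M. \<forall>k::nat. (\<xi> 0 \<omega>)\<^sup>2 * indicator {..real k} (\<xi> 0 \<omega>) = 0"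
      by (intro AE_all_countable[THEN iffD2] allI)
    then have "AE \<omega> in M. \<xi> 0 \<omega> = 0"
    proof eventually_elim
      case (elim \<omega>)
      obtain k where "\<xi> 0 \<omega> \<le> real k" using real_arch_simple by blast
      then show ?case using elim[rule_format, of k] by simp
    qed
    then have "expectation (\<xi> 0) = 0" by (rule integral_eq_zero_AE)
    then show False using \<mu>_eq \<mu>_pos by simp
  qed
  then obtain x where x: "x \<ge> 0" "trunc_square x > 0" by blast
  define K where "K = 2 * (C + 1) / trunc_square x"
  have "eventually (\<lambda>n. t n * g (1 / d n) < 2) sequentially" using norming by (rule order_tendstoD) simp
  then have "eventually (\<lambda>n. t n \<le> K * (d n)\<^sup>2) sequentially"
    using d_gt[of "max x x0"] d_gt[of 0] t_gt[of 0]
  proof eventually_elim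
    case (elim n)
    have "trunc_square x \<le> trunc_square (d n)" using elim x by (intro trunc_square_mono) auto
    also have "\<dots> \<le> C * (d n)\<^sup>2 * g (1 / d n)" using elim by (intro trunc_square_le) auto
    finally have "t n * trunc_square x \<le> t n * (C * (d n)\<^sup>2 * g (1 / d n))" using elim by (intro mult_left_mono) auto
    also have "\<dots> = (t n * g (1 / d n)) * (C * (d n)\<^sup>2)" by simp
    also have "\<dots> \<le> 2 * (C * (d n)\<^sup>2)" using elim C_nonneg by (intro mult_right_mono) auto
    also have "\<dots> \<le> 2 * (C + 1) * (d n)\<^sup>2" by (simp add: algebra_simps)
    finally show ?case using x by (simp add: K_def field_simps)
  qed
  moreover have "K > 0" using x C_nonneg by (simp add: K_def)
  ultimately show ?thesis by blast
qed

text \<open>Truncating the steps at \<open>d n\<close> balances both terms of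
  \<open>S_L1_bound\<close> at order \<open>d n\<close>, uniformly over O(t) indices. The constant
  results from t g (1 / d) < 2.\<close>

lemma S_L1:
  assumes "B \<ge> 0"
  shows "\<exists>K>0. eventually (\<lambda>n. \<forall>j. real j \<le> B * t n \<longrightarrow> expectation (\<lambda>\<omega>. \<bar>S j \<omega> - real j * \<mu>\<bar>) \<le> K * d n) sequentially"
proof -
  define K where "K = sqrt (2 * B * C) + 4 * B * C + 1"
  have "eventually (\<lambda>n. t n * g (1 / d n) < 2) sequentially" using norming by (rule order_tendstoD) simp
  then have "eventually (\<lambda>n. \<forall>j. real j \<le> B * t n \<longrightarrow> expectation (\<lambda>\<omega>. \<bar>S j \<omega> - real j * \<mu>\<bar>) \<le> K * d n) sequentially"
    using d_gt[of "max 0 x0"] t_gt[of 0]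
  proof eventually_elim
    case (elim n)
    show ?case
    proof (intro allI impI)
      fix j assume j: "real j \<le> B * t n"
      have gd: "g (1 / d n) > 0" using g_pos[of "1 / d n"] elim by simp
      have "real j * trunc_square (d n) \<le> (B * t n) * (C * (d n)\<^sup>2 * g (1 / d n))"
        using j elim trunc_square_le[of "d n"] C_nonneg gd assms
        by (intro mult_mono) (auto simp: trunc_square_def intro!: integral_nonneg_AE)
      also have "\<dots> = (t n * g (1 / d n)) * (B * C * (d n)\<^sup>2)" by simp
      also have "\<dots> \<le> 2 * (B * C * (d n)\<^sup>2)" using elim assms C_nonneg by (intro mult_right_mono) auto
      finally have "sqrt (real j * trunc_square (d n)) \<le> sqrt (2 * B * C * (d n)\<^sup>2)" by simp
      then have 1: "sqrt (real j * trunc_square (d n)) \<le> sqrt (2 * B * C) * d n"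
        using elim by (simp add: real_sqrt_mult)
      have "real j * tail_mean (d n) \<le> (B * t n) * (C * d n * g (1 / d n))"
        using j elim tail_mean_le[of "d n"] C_nonneg gd assms \<xi>_nonneg
        by (intro mult_mono) (auto simp: tail_mean_def intro!: integral_nonneg_AE)
      also have "\<dots> = (t n * g (1 / d n)) * (B * C * d n)" by simp
      also have "\<dots> \<le> 2 * (B * C * d n)" using elim assms C_nonneg by (intro mult_right_mono) auto
      finally have 2: "2 * real j * tail_mean (d n) \<le> 4 * B * C * d n" by simp
      have "expectation (\<lambda>\<omega>. \<bar>S j \<omega> - real j * \<mu>\<bar>) \<le> sqrt (real j * trunc_square (d n)) + 2 * real j * tail_mean (d n)"
        using elim by (intro S_L1_bound) auto
      also have "\<dots> \<le> K * d n" using 1 2 elim by (simp add: K_def algebra_simps)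
      finally show "expectation (\<lambda>\<omega>. \<bar>S j \<omega> - real j * \<mu>\<bar>) \<le> K * d n" .
    qed
  qed
  moreover have "K > 0" using assms C_nonneg by (auto simp: K_def intro!: add_nonneg_pos)
  ultimately show ?thesis by blast
qed

end

section \<open>From the perturbed walk to a weighted sum of its steps\<close>

context renewal_regime
begin

text \<open>
  About \<open>m n\<close> of the partial sums \<open>S j\<close> lie below \<open>t n\<close>; with high probability the index \<open>J n\<close> is beyond
  the last one.
\<close>

definition m :: "nat \<Rightarrow> nat" where "m n = nat \<lfloor>t n / \<mu>\<rfloor>"

definition J :: "nat \<Rightarrow> nat" where "J n = nat \<lceil>2 * t n / \<mu>\<rceil> + 2"

definition N :: "nat \<Rightarrow> 'a \<Rightarrow> nat" where "N n \<omega> = card {j \<in> {..<J n}. S j \<omega> \<le> t n}"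

text \<open>For y \<ge> 0 this is the mean of min(\<eta>, y), the expected loss that \<eta> causes
  in a summand of size y. Its integral up to \<open>t\<close> yields the double integral in
  \<open>centering\<close>.\<close>

definition f :: "real \<Rightarrow> real" where "f y = expectation (\<lambda>\<omega>. min (\<eta> 0 \<omega>) (max 0 y))"

lemma m_le_J: "m n \<le> J n"
proof (cases "t n \<ge> 0")
  case True
  then have "\<lfloor>t n / \<mu>\<rfloor> \<le> \<lceil>2 * t n / \<mu>\<rceil>" using \<mu>_pos by (intro order_trans[OF floor_mono floor_le_ceiling]) (simp add: divide_right_mono)
  then show ?thesis unfolding m_def J_def by linarith
next
  case False
  then have "t n / \<mu> < 0" using \<mu>_pos by (simp add: divide_neg_pos)
  then show ?thesis unfolding m_def by simp
qed

lemma m_bounds: "t n \<ge> 0 \<Longrightarrow> t n - \<mu> < real (m n) * \<mu> \<and> real (m n) * \<mu> \<le> t n"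
proof -
  assume "t n \<ge> 0"
  then have "t n / \<mu> - 1 < real (m n)" "real (m n) \<le> t n / \<mu>"
    using \<mu>_pos unfolding m_def by (auto intro: floor_divide_lower)
  then show ?thesis using \<mu>_pos by (simp add: field_simps)
qed

text \<open>The factor 2 in \<open>J\<close> puts the mean of S at index \<open>J n\<close> at least
  \<open>t n\<close> above the level \<open>t n\<close>, so that remaining below it would take a
  deviation of order \<open>t n\<close>.\<close>

lemma J_bounds: "t n \<ge> 1 \<Longrightarrow> 2 * t n \<le> real (J n) * \<mu> \<and> real (J n) \<le> (2 / \<mu> + 3) * t n"
proof -
  assume t: "t n \<ge> 1"
  have "2 * t n / \<mu> \<le> real (J n)" unfolding J_def by linarith
  moreover have "2 * t n / \<mu> \<ge> 0" using t \<mu>_pos by simp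
  then have "real (J n) \<le> 2 * t n / \<mu> + 3" unfolding J_def by linarith
  moreover have "(2 / \<mu> + 3) * t n = 2 * t n / \<mu> + 3 * t n" by (simp add: algebra_simps)
  ultimately show ?thesis using t \<mu>_pos by (auto simp: pos_divide_le_eq)
qed

lemma m_over_t: "(\<lambda>n. real (m n) / t n) \<longlonglongrightarrow> 1 / \<mu>"
proof (rule tendsto_sandwich)
  show "eventually (\<lambda>n. 1 / \<mu> - 1 / t n \<le> real (m n) / t n) sequentially"
    using t_gt[of 0]
  proof eventually_elim
    case (elim n)
    then have "t n / \<mu> - 1 \<le> real (m n)" using m_bounds[of n] \<mu>_pos by (simp add: field_simps)
    then have "(t n / \<mu> - 1) / t n \<le> real (m n) / t n" using elim by (intro divide_right_mono) auto
    then show ?case using elim by (simp add: diff_divide_distrib)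
  qed
  show "eventually (\<lambda>n. real (m n) / t n \<le> 1 / \<mu>) sequentially"
    using t_gt[of 0]
  proof eventually_elim
    case (elim n)
    then have "real (m n) \<le> t n / \<mu>" using m_bounds[of n] \<mu>_pos by (simp add: field_simps)
    then have "real (m n) / t n \<le> t n / \<mu> / t n" using elim by (intro divide_right_mono) auto
    then show ?case using elim by simp
  qed
  show "(\<lambda>n. 1 / \<mu> - 1 / t n) \<longlonglongrightarrow> 1 / \<mu>"
    using tendsto_diff[OF tendsto_const tendsto_divide_0[OF tendsto_const filterlim_at_top_imp_at_infinity[OF t_lim]], of "1 / \<mu>" 1] by simp
qed simp

lemma N_measurable [measurable]: "(\<lambda>\<omega>. real (N n \<omega>)) \<in> borel_measurable M"
proof -
  have "real (N n \<omega>) = (\<Sum>j<J n. indicator {..t n} (S j \<omega>))" for \<omega>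
    unfolding N_def by (simp add: indicator_def sum.If_cases Int_def)
  then show ?thesis by simp
qed

lemma prob_S_deviation:
  assumes "B \<ge> 0" "\<delta> > 0" "eventually (\<lambda>n. real (j n) \<le> B * t n) sequentially"
  shows "(\<lambda>n. prob {\<omega> \<in> space M. \<delta> * t n \<le> \<bar>S (j n) \<omega> - real (j n) * \<mu>\<bar>}) \<longlonglongrightarrow> 0"
proof -
  obtain K where K: "K > 0" "eventually (\<lambda>n. \<forall>j. real j \<le> B * t n \<longrightarrow> expectation (\<lambda>\<omega>. \<bar>S j \<omega> - real j * \<mu>\<bar>) \<le> K * d n) sequentially"
    using S_L1[OF assms(1)] by blast
  have lim: "(\<lambda>n. K / \<delta> * (d n / t n)) \<longlonglongrightarrow> 0"
    using tendsto_mult[OF tendsto_const[of "K / \<delta>"] d_over_t] by (simp only: mult_zero_right)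
  have "eventually (\<lambda>n. prob {\<omega> \<in> space M. \<delta> * t n \<le> \<bar>S (j n) \<omega> - real (j n) * \<mu>\<bar>} \<le> K / \<delta> * (d n / t n)) sequentially"
    using K(2) assms(3) t_gt[of 0]
  proof eventually_elim
    case (elim n)
    have "prob {\<omega> \<in> space M. \<delta> * t n \<le> \<bar>S (j n) \<omega> - real (j n) * \<mu>\<bar>} \<le> expectation (\<lambda>\<omega>. \<bar>S (j n) \<omega> - real (j n) * \<mu>\<bar>) / (\<delta> * t n)"
      using elim assms(2) by (intro integral_Markov_inequality_measure[where A = "{}"]) auto
    also have "\<dots> \<le> K * d n / (\<delta> * t n)" using elim assms(2) by (intro divide_right_mono) auto
    finally show ?case by simp
  qed
  then show ?thesis by (intro tendsto_sandwich[OF _ _ tendsto_const lim]) auto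
qed

text \<open>If \<open>N\<close> deviates from \<open>m\<close> by more than \<epsilon> t, then the
  walk at the index \<open>j1\<close> or \<open>j0\<close>, about \<epsilon> t away from
  \<open>m\<close>, is on the wrong side of the level t. This is a deviation of order t, whereas S
  at that index fluctuates by order d only.\<close>

lemma N_law_of_large_numbers: "prob_vanish M (\<lambda>n \<omega>. (real (N n \<omega>) - real (m n)) / t n)"
  unfolding prob_vanish_def
proof (intro conjI allI impI)
  fix \<epsilon> :: real assume \<epsilon>: "\<epsilon> > 0"
  \<comment> \<open>The gap between t and the mean of the walk at \<open>j1\<close> or
    \<open>j0\<close> is about \<epsilon> \<mu> t. Half of it is kept; the other half absorbs the
    rounding errors, at most 2 \<mu>, once \<epsilon> t > 4.\<close>
  define \<delta> where "\<delta> = \<epsilon> * \<mu> / 2"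
  have \<delta>: "\<delta> > 0" using \<epsilon> \<mu>_pos by (simp add: \<delta>_def)
  define j1 where "j1 n = m n + nat \<lfloor>\<epsilon> * t n\<rfloor>" for n
  define j0 where "j0 n = m n - nat \<lfloor>\<epsilon> * t n\<rfloor>" for n
  define A where "A j n = {\<omega> \<in> space M. \<delta> * t n \<le> \<bar>S (j n) \<omega> - real (j n) * \<mu>\<bar>}" for j n
  have [measurable]: "A j n \<in> events" for j n unfolding A_def by measurable
  have B: "eventually (\<lambda>n. real (j1 n) \<le> (1 / \<mu> + \<epsilon>) * t n \<and> real (j0 n) \<le> (1 / \<mu> + \<epsilon>) * t n) sequentially"
    using t_gt[of 0]
  proof eventually_elim
    case (elim n)
    have 1: "real (m n) \<le> t n / \<mu>" using m_bounds[of n] elim \<mu>_pos by (simp add: field_simps)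
    have 2: "real (nat \<lfloor>\<epsilon> * t n\<rfloor>) \<le> \<epsilon> * t n" "0 \<le> \<epsilon> * t n" using \<epsilon> elim by auto
    have "real (j1 n) \<le> t n / \<mu> + \<epsilon> * t n" using 1 2 unfolding j1_def of_nat_add by linarith
    moreover have "real (j0 n) \<le> real (m n)" by (simp add: j0_def)
    then have "real (j0 n) \<le> t n / \<mu> + \<epsilon> * t n" using 1 2 by linarith
    ultimately show ?case by (simp add: algebra_simps)
  qed
  have b: "1 / \<mu> + \<epsilon> \<ge> 0" using \<mu>_pos \<epsilon> by simp
  have "(\<lambda>n. prob (A j1 n) + prob (A j0 n)) \<longlonglongrightarrow> 0 + 0"
    unfolding A_def using B by (intro tendsto_add prob_S_deviation[OF b \<delta>]) (auto elim: eventually_mono)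
  then have lim: "(\<lambda>n. prob (A j1 n) + prob (A j0 n)) \<longlonglongrightarrow> 0" by simp
  have "eventually (\<lambda>n. prob {\<omega> \<in> space M. \<epsilon> < \<bar>(real (N n \<omega>) - real (m n)) / t n\<bar>} \<le> prob (A j1 n) + prob (A j0 n)) sequentially"
    using t_gt[of 0] t_gt[of "4 / \<epsilon>"]
  proof eventually_elim
    case (elim n)
    have mb: "t n - \<mu> < real (m n) * \<mu>" "real (m n) * \<mu> \<le> t n" using m_bounds[of n] elim by auto
    have et: "\<epsilon> * t n > 4" using elim \<epsilon> by (simp add: field_simps)
    then have dt: "\<delta> * t n \<ge> 2 * \<mu>" "\<epsilon> * t n * \<mu> = 2 * (\<delta> * t n)"
      using mult_strict_right_mono[OF et \<mu>_pos] by (auto simp: \<delta>_def mult_ac)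
    have fl: "\<epsilon> * t n - 1 < real (nat \<lfloor>\<epsilon> * t n\<rfloor>)" "real (nat \<lfloor>\<epsilon> * t n\<rfloor>) \<le> \<epsilon> * t n" using et by linarith+
    have "{\<omega> \<in> space M. \<epsilon> < \<bar>(real (N n \<omega>) - real (m n)) / t n\<bar>} \<subseteq> A j1 n \<union> A j0 n"
    proof
      fix \<omega> assume "\<omega> \<in> {\<omega> \<in> space M. \<epsilon> < \<bar>(real (N n \<omega>) - real (m n)) / t n\<bar>}"
      then have w: "\<omega> \<in> space M" "\<epsilon> * t n < \<bar>real (N n \<omega>) - real (m n)\<bar>"
        using elim by (auto simp: abs_divide field_simps)
      have mon: "mono (\<lambda>j. S j \<omega>)" using S_mono by (simp add: mono_def)
      note Niff = sum_positive_part_diff_le(2)[OF mon m_le_J[of n], of _ "t n", folded N_def]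
      show "\<omega> \<in> A j1 n \<union> A j0 n"
      proof (cases "real (N n \<omega>) \<ge> real (m n)")
        case True
        then have "real (j1 n) < real (N n \<omega>)" using w fl by (simp add: j1_def)
        then have S1: "S (j1 n) \<omega> \<le> t n" using Niff[of "j1 n"] by simp
        have "(\<epsilon> * t n - 1) * \<mu> \<le> real (nat \<lfloor>\<epsilon> * t n\<rfloor>) * \<mu>" using fl \<mu>_pos by (intro mult_right_mono) auto
        then have "real (j1 n) * \<mu> \<ge> t n - \<mu> + (\<epsilon> * t n * \<mu> - \<mu>)" using mb by (simp add: j1_def algebra_simps)
        then have "real (j1 n) * \<mu> - S (j1 n) \<omega> \<ge> \<delta> * t n" using S1 dt by linarith
        then show ?thesis using w by (auto simp: A_def)
      next
        case False
        then have lt: "real (N n \<omega>) + real (nat \<lfloor>\<epsilon> * t n\<rfloor>) < real (m n)" using w fl by linarith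
        then have j0: "real (j0 n) = real (m n) - real (nat \<lfloor>\<epsilon> * t n\<rfloor>)" by (simp add: j0_def of_nat_diff)
        then have Nj: "N n \<omega> \<le> j0 n" "N n \<omega> < m n" using lt by linarith+
        then have "t n < S (N n \<omega>) \<omega>" using Niff[of "N n \<omega>"] m_le_J[of n] by simp
        also have "\<dots> \<le> S (j0 n) \<omega>" using Nj by (intro S_mono)
        finally have S0: "t n < S (j0 n) \<omega>" .
        have "(\<epsilon> * t n - 1) * \<mu> \<le> real (nat \<lfloor>\<epsilon> * t n\<rfloor>) * \<mu>" using fl \<mu>_pos by (intro mult_right_mono) auto
        then have "real (j0 n) * \<mu> \<le> t n - (\<epsilon> * t n * \<mu> - \<mu>)" using mb unfolding j0 by (simp add: algebra_simps)
        then have "S (j0 n) \<omega> - real (j0 n) * \<mu> \<ge> \<delta> * t n" using S0 dt \<mu>_pos by linarith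
        then show ?thesis using w by (auto simp: A_def)
      qed
    qed
    then have "prob {\<omega> \<in> space M. \<epsilon> < \<bar>(real (N n \<omega>) - real (m n)) / t n\<bar>} \<le> prob (A j1 n \<union> A j0 n)"
      by (intro finite_measure_mono) auto
    also have "\<dots> \<le> prob (A j1 n) + prob (A j0 n)" by (rule measure_Un_le) auto
    finally show ?case .
  qed
  then show "(\<lambda>n. prob {\<omega> \<in> space M. \<epsilon> < \<bar>(real (N n \<omega>) - real (m n)) / t n\<bar>}) \<longlonglongrightarrow> 0"
    by (intro tendsto_sandwich[OF _ _ tendsto_const lim]) auto
qed measurable

text \<open>By the deterministic comparison the error is at most a product: (N - m) / t vanishes in
  probability, and (t - S m) / d is bounded in mean.\<close>

lemma positive_part_sum_vanish:
  "prob_vanish M (\<lambda>n \<omega>. ((\<Sum>j<J n. max 0 (t n - S j \<omega>)) - (\<Sum>j<m n. t n - S j \<omega>)) / (t n * d n))"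
proof -
  obtain K where K: "K > 0" "eventually (\<lambda>n. \<forall>j. real j \<le> 1 / \<mu> * t n \<longrightarrow> expectation (\<lambda>\<omega>. \<bar>S j \<omega> - real j * \<mu>\<bar>) \<le> K * d n) sequentially"
    using S_L1[of "1 / \<mu>"] \<mu>_pos by auto
  let ?Y = "\<lambda>n \<omega>. (t n - S (m n) \<omega>) / d n"
  have Y: "prob_vanish M (\<lambda>n \<omega>. (real (N n \<omega>) - real (m n)) / t n * ?Y n \<omega>)"
  proof (rule prob_vanish_mult[OF N_law_of_large_numbers, where K = "K + 1"])
    show "eventually (\<lambda>n. integrable M (?Y n) \<and> expectation (\<lambda>\<omega>. \<bar>?Y n \<omega>\<bar>) \<le> K + 1) sequentially"
      using K(2) t_gt[of 0] d_gt[of \<mu>]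
    proof eventually_elim
      case (elim n)
      have mb: "t n - \<mu> < real (m n) * \<mu>" "real (m n) * \<mu> \<le> t n" using m_bounds[of n] elim by auto
      then have "real (m n) \<le> 1 / \<mu> * t n" using \<mu>_pos by (simp add: field_simps)
      then have *: "expectation (\<lambda>\<omega>. \<bar>S (m n) \<omega> - real (m n) * \<mu>\<bar>) \<le> K * d n" using elim by blast
      have dn: "d n > 0" using elim \<mu>_pos by linarith
      have "expectation (\<lambda>\<omega>. \<bar>?Y n \<omega>\<bar>) = expectation (\<lambda>\<omega>. \<bar>t n - S (m n) \<omega>\<bar>) / d n"
        using dn by (simp add: abs_divide)
      also have "expectation (\<lambda>\<omega>. \<bar>t n - S (m n) \<omega>\<bar>) \<le> expectation (\<lambda>\<omega>. \<bar>S (m n) \<omega> - real (m n) * \<mu>\<bar> + \<mu>)"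
      proof (rule integral_mono)
        fix \<omega> show "\<bar>t n - S (m n) \<omega>\<bar> \<le> \<bar>S (m n) \<omega> - real (m n) * \<mu>\<bar> + \<mu>" using mb by linarith
      qed auto
      also have "\<dots> = expectation (\<lambda>\<omega>. \<bar>S (m n) \<omega> - real (m n) * \<mu>\<bar>) + \<mu>"
        by (subst Bochner_Integration.integral_add) (auto simp: prob_space)
      also have "\<dots> \<le> (K + 1) * d n" using * elim by (simp add: algebra_simps)
      finally have "expectation (\<lambda>\<omega>. \<bar>?Y n \<omega>\<bar>) \<le> (K + 1) * d n / d n" using dn by (simp add: divide_right_mono)
      then show ?case using dn by simp
    qed
  qed measurable
  show ?thesis
  proof (rule prob_vanish_mono[OF Y])
    show "eventually (\<lambda>n. AE \<omega> in M. \<bar>((\<Sum>j<J n. max 0 (t n - S j \<omega>)) - (\<Sum>j<m n. t n - S j \<omega>)) / (t n * d n)\<bar>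
        \<le> \<bar>(real (N n \<omega>) - real (m n)) / t n * ?Y n \<omega>\<bar>) sequentially"
    proof (intro always_eventually allI AE_I2)
      fix n \<omega>
      have "mono (\<lambda>j. S j \<omega>)" using S_mono by (simp add: mono_def)
      from sum_positive_part_diff_le(1)[OF this m_le_J[of n], of "t n", folded N_def]
      have "\<bar>(\<Sum>j<J n. max 0 (t n - S j \<omega>)) - (\<Sum>j<m n. t n - S j \<omega>)\<bar> \<le> \<bar>real (N n \<omega>) - real (m n)\<bar> * \<bar>t n - S (m n) \<omega>\<bar>" .
      from divide_right_mono[OF this, of "\<bar>t n * d n\<bar>"]
      show "\<bar>((\<Sum>j<J n. max 0 (t n - S j \<omega>)) - (\<Sum>j<m n. t n - S j \<omega>)) / (t n * d n)\<bar>
        \<le> \<bar>(real (N n \<omega>) - real (m n)) / t n * ?Y n \<omega>\<bar>"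
        by (simp add: abs_divide abs_mult)
    qed
  qed measurable
qed

lemma prob_\<eta>_gt_tendsto:
  assumes "filterlim b at_top sequentially"
  shows "(\<lambda>n. prob {\<omega> \<in> space M. b n < \<eta> 0 \<omega>}) \<longlonglongrightarrow> 0"
proof -
  interpret D: real_distribution "distr M borel (\<eta> 0)" by simp
  have "(\<lambda>n. 1 - cdf (distr M borel (\<eta> 0)) (b n)) \<longlonglongrightarrow> 1 - 1"
    by (intro tendsto_diff tendsto_const filterlim_compose[OF D.cdf_lim_at_top_prob assms])
  moreover have "1 - cdf (distr M borel (\<eta> 0)) x = prob {\<omega> \<in> space M. x < \<eta> 0 \<omega>}" for x
  proof -
    have "cdf (distr M borel (\<eta> 0)) x = prob {\<omega> \<in> space M. \<eta> 0 \<omega> \<le> x}"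
      unfolding cdf_def by (subst measure_distr) (auto intro!: arg_cong[where f = prob])
    moreover have "prob (space M - {\<omega> \<in> space M. \<eta> 0 \<omega> \<le> x}) = 1 - prob {\<omega> \<in> space M. \<eta> 0 \<omega> \<le> x}"
      by (rule prob_compl) measurable
    moreover have "space M - {\<omega> \<in> space M. \<eta> 0 \<omega> \<le> x} = {\<omega> \<in> space M. x < \<eta> 0 \<omega>}" by auto
    ultimately show ?thesis by simp
  qed
  ultimately show ?thesis by simp
qed

lemma prob_\<eta>: "prob {\<omega> \<in> space M. b < \<eta> j \<omega>} = prob {\<omega> \<in> space M. b < \<eta> 0 \<omega>}"
proof -
  have "prob {\<omega> \<in> space M. b < \<eta> i \<omega>} = measure (distr M borel (\<eta> i)) {b<..}" for i
    by (subst measure_distr) (auto intro!: arg_cong[where f = prob])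
  then show ?thesis using \<eta>_distr[of j] by simp
qed

lemma expectation_S_\<eta>:
  "integrable M (\<lambda>\<omega>. \<bar>S j \<omega> - c\<bar> * indicator {b<..} (\<eta> j \<omega>))"
  "expectation (\<lambda>\<omega>. \<bar>S j \<omega> - c\<bar> * indicator {b<..} (\<eta> j \<omega>)) = expectation (\<lambda>\<omega>. \<bar>S j \<omega> - c\<bar>) * prob {\<omega> \<in> space M. b < \<eta> 0 \<omega>}"
proof -
  have "indep_var borel ((\<lambda>x. \<bar>x - c\<bar>) \<circ> S j) borel ((indicator {b<..} :: real \<Rightarrow> real) \<circ> \<eta> j)"
    using cross_indep[of j] unfolding S_def by (rule indep_var_compose) auto
  then have ind: "indep_var borel (\<lambda>\<omega>. \<bar>S j \<omega> - c\<bar>) borel (\<lambda>\<omega>. indicator {b<..} (\<eta> j \<omega>) :: real)"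
    by (simp add: comp_def)
  have i: "integrable M (\<lambda>\<omega>. indicator {b<..} (\<eta> j \<omega>) :: real)"
    by (rule integrable_const_bound[where B = 1]) (auto simp: indicator_def)
  have "expectation (\<lambda>\<omega>. indicator {b<..} (\<eta> j \<omega>)) = expectation (indicator {\<omega> \<in> space M. b < \<eta> j \<omega>} :: 'a \<Rightarrow> real)"
    by (intro Bochner_Integration.integral_cong) (auto simp: indicator_def)
  also have "\<dots> = prob {\<omega> \<in> space M. b < \<eta> j \<omega>}" by (simp add: Int_def conj_commute)
  finally have e: "expectation (\<lambda>\<omega>. indicator {b<..} (\<eta> j \<omega>)) = prob {\<omega> \<in> space M. b < \<eta> 0 \<omega>}"
    using prob_\<eta> by simp
  show "integrable M (\<lambda>\<omega>. \<bar>S j \<omega> - c\<bar> * indicator {b<..} (\<eta> j \<omega>))"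
    by (rule indep_var_integrable[OF ind _ i]) auto
  show "expectation (\<lambda>\<omega>. \<bar>S j \<omega> - c\<bar> * indicator {b<..} (\<eta> j \<omega>)) = expectation (\<lambda>\<omega>. \<bar>S j \<omega> - c\<bar>) * prob {\<omega> \<in> space M. b < \<eta> 0 \<omega>}"
    using indep_var_lebesgue_integral[OF ind _ i] e by simp
qed

text \<open>A summand changes by at most sqrt d if \<eta> j is below that level, and by at most |S j
  - j \<mu>| otherwise. The second case has vanishing probability and is independent of S j. Over
  O(t) summands the mean error is of order t (sqrt d + d p) with p tending to 0, hence o(t
  d).\<close>

lemma \<eta>_sum_replace_vanish:
  "prob_vanish M (\<lambda>n \<omega>. ((\<Sum>j<J n. min (\<eta> j \<omega>) (max 0 (t n - S j \<omega>))) - (\<Sum>j<J n. min (\<eta> j \<omega>) (max 0 (t n - real j * \<mu>)))) / (t n * d n))"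
proof -
  define B where "B = 2 / \<mu> + 3"
  have B: "B \<ge> 0" using \<mu>_pos by (simp add: B_def)
  obtain K where K: "K > 0" "eventually (\<lambda>n. \<forall>j. real j \<le> B * t n \<longrightarrow> expectation (\<lambda>\<omega>. \<bar>S j \<omega> - real j * \<mu>\<bar>) \<le> K * d n) sequentially"
    using S_L1[OF B] by blast
  define p where "p n = prob {\<omega> \<in> space M. sqrt (d n) < \<eta> 0 \<omega>}" for n
  let ?D = "\<lambda>n \<omega>. (\<Sum>j<J n. min (\<eta> j \<omega>) (max 0 (t n - S j \<omega>))) - (\<Sum>j<J n. min (\<eta> j \<omega>) (max 0 (t n - real j * \<mu>)))"
  show ?thesis
  proof (rule prob_vanish_L1[where e = "\<lambda>n. B * (1 / sqrt (d n) + K * p n)"])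
    have "filterlim (\<lambda>n. sqrt (d n)) at_top sequentially" by (rule filterlim_compose[OF sqrt_at_top d_lim])
    then have "(\<lambda>n. B * (1 / sqrt (d n) + K * p n)) \<longlonglongrightarrow> B * (0 + K * 0)"
      unfolding p_def
      by (intro tendsto_intros prob_\<eta>_gt_tendsto tendsto_divide_0[OF tendsto_const] filterlim_at_top_imp_at_infinity)
    then show "(\<lambda>n. B * (1 / sqrt (d n) + K * p n)) \<longlonglongrightarrow> 0" by simp
    show "eventually (\<lambda>n. integrable M (\<lambda>\<omega>. ?D n \<omega> / (t n * d n)) \<and> expectation (\<lambda>\<omega>. \<bar>?D n \<omega> / (t n * d n)\<bar>) \<le> B * (1 / sqrt (d n) + K * p n)) sequentially"
      using K(2) t_gt[of 1] d_gt[of 0]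
    proof eventually_elim
      case (elim n)
      let ?b = "sqrt (d n)"
      have int: "integrable M (\<lambda>\<omega>. min (\<eta> j \<omega>) (max 0 (t n - Z \<omega>)))" if [measurable]: "Z \<in> borel_measurable M" and "\<And>\<omega>. Z \<omega> \<ge> 0" for j Z
      proof (rule integrable_const_bound[where B = "t n"])
        have "\<bar>min (\<eta> j \<omega>) (max 0 (t n - Z \<omega>))\<bar> \<le> t n" for \<omega>
          using \<eta>_nonneg[of j \<omega>] that(2)[of \<omega>] elim by auto
        then show "AE \<omega> in M. norm (min (\<eta> j \<omega>) (max 0 (t n - Z \<omega>))) \<le> t n" by simp
      qed measurable
      have Snn: "S j \<omega> \<ge> 0" for j \<omega> unfolding S_def using \<xi>_nonneg by (intro sum_nonneg) auto
      have Dint: "integrable M (?D n)" using \<mu>_pos Snn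
        by (intro Bochner_Integration.integrable_diff Bochner_Integration.integrable_sum int) auto
      let ?G = "\<lambda>\<omega>. \<Sum>j<J n. ?b + \<bar>S j \<omega> - real j * \<mu>\<bar> * indicator {?b<..} (\<eta> j \<omega>)"
      have "expectation (\<lambda>\<omega>. \<bar>?D n \<omega>\<bar>) \<le> expectation ?G"
      proof (rule integral_mono)
        show "integrable M (\<lambda>\<omega>. \<bar>?D n \<omega>\<bar>)" using Dint by (rule integrable_abs)
        show "integrable M ?G"
          by (intro Bochner_Integration.integrable_sum Bochner_Integration.integrable_add expectation_S_\<eta>) auto
        fix \<omega>
        have "\<bar>?D n \<omega>\<bar> \<le> (\<Sum>j<J n. \<bar>min (\<eta> j \<omega>) (max 0 (t n - S j \<omega>)) - min (\<eta> j \<omega>) (max 0 (t n - real j * \<mu>))\<bar>)"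
          unfolding sum_subtractf[symmetric] by (rule sum_abs)
        also have "\<dots> \<le> ?G \<omega>"
        proof (rule sum_mono)
          fix j
          have "\<bar>min e (max 0 (t n - x)) - min e (max 0 (t n - y))\<bar> \<le> ?b + \<bar>x - y\<bar> * indicator {?b<..} e"
            if "e \<ge> 0" for e x y :: real
          proof (cases "e > ?b")
            case True
            have "\<bar>min e (max 0 (t n - x)) - min e (max 0 (t n - y))\<bar> \<le> \<bar>x - y\<bar>" by linarith
            moreover have "?b \<ge> 0" using elim by simp
            ultimately have "\<bar>min e (max 0 (t n - x)) - min e (max 0 (t n - y))\<bar> \<le> ?b + \<bar>x - y\<bar>" by linarith
            then show ?thesis using True by simp
          next
            case False
            have "\<bar>min e (max 0 (t n - x)) - min e (max 0 (t n - y))\<bar> \<le> e" using that by linarith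
            then show ?thesis using False by simp
          qed
          then show "\<bar>min (\<eta> j \<omega>) (max 0 (t n - S j \<omega>)) - min (\<eta> j \<omega>) (max 0 (t n - real j * \<mu>))\<bar>
              \<le> ?b + \<bar>S j \<omega> - real j * \<mu>\<bar> * indicator {?b<..} (\<eta> j \<omega>)" using \<eta>_nonneg by blast
        qed
        finally show "\<bar>?D n \<omega>\<bar> \<le> ?G \<omega>" .
      qed
      also have "\<dots> = (\<Sum>j<J n. ?b + expectation (\<lambda>\<omega>. \<bar>S j \<omega> - real j * \<mu>\<bar>) * p n)"
        by (simp add: Bochner_Integration.integral_sum Bochner_Integration.integral_add expectation_S_\<eta> prob_space p_def)
      also have "\<dots> \<le> (\<Sum>j<J n. ?b + K * d n * p n)"
      proof (rule sum_mono)
        fix j assume "j \<in> {..<J n}"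
        then have "real j \<le> B * t n" using J_bounds[of n] elim by (simp add: B_def)
        then show "?b + expectation (\<lambda>\<omega>. \<bar>S j \<omega> - real j * \<mu>\<bar>) * p n \<le> ?b + K * d n * p n"
          using elim by (intro add_left_mono mult_right_mono) (auto simp: p_def)
      qed
      also have "\<dots> = real (J n) * (?b + K * d n * p n)" by simp
      also have "\<dots> \<le> (B * t n) * (?b + K * d n * p n)"
        using J_bounds[of n] elim K(1) by (intro mult_right_mono) (auto simp: B_def p_def)
      finally have "expectation (\<lambda>\<omega>. \<bar>?D n \<omega>\<bar>) / (t n * d n) \<le> (B * t n) * (?b + K * d n * p n) / (t n * d n)"
        using elim by (intro divide_right_mono) auto
      also have "\<dots> = B * (?b / d n + K * p n)" using elim by (simp add: field_simps)
      also have "?b / d n = 1 / ?b" using elim by (simp add: field_simps)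
      finally show ?case using Dint elim by (simp add: abs_divide)
    qed
  qed measurable
qed

text \<open>The summands are now independent with values in [0, t]. Cutting at \<eta> j > sqrt t
  bounds their second moments by t + t^2 p with p tending to 0. The variance of the sum is thus
  o(t^3), which suffices because t is O(d^2).\<close>

lemma \<eta>_sum_concentration:
  "prob_vanish M (\<lambda>n \<omega>. ((\<Sum>j<J n. min (\<eta> j \<omega>) (max 0 (t n - real j * \<mu>))) - (\<Sum>j<J n. f (t n - real j * \<mu>))) / (t n * d n))"
proof -
  define B where "B = 2 / \<mu> + 3"
  have B: "B \<ge> 0" using \<mu>_pos by (simp add: B_def)
  obtain K where K: "K > 0" "eventually (\<lambda>n. t n \<le> K * (d n)\<^sup>2) sequentially" using t_le_d_square by blast
  define p where "p n = prob {\<omega> \<in> space M. sqrt (t n) < \<eta> 0 \<omega>}" for n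
  let ?X = "\<lambda>n j \<omega>. min (\<eta> j \<omega>) (max 0 (t n - real j * \<mu>))"
  let ?D = "\<lambda>n \<omega>. (\<Sum>j<J n. ?X n j \<omega>) - (\<Sum>j<J n. f (t n - real j * \<mu>))"
  show ?thesis
  proof (rule prob_vanish_L2[where e = "\<lambda>n. B * K * (1 / t n + p n)"])
    have "filterlim (\<lambda>n. sqrt (t n)) at_top sequentially" by (rule filterlim_compose[OF sqrt_at_top t_lim])
    then have "(\<lambda>n. B * K * (1 / t n + p n)) \<longlonglongrightarrow> B * K * (0 + 0)"
      unfolding p_def
      by (intro tendsto_intros prob_\<eta>_gt_tendsto tendsto_divide_0[OF tendsto_const] filterlim_at_top_imp_at_infinity t_lim)
    then show "(\<lambda>n. B * K * (1 / t n + p n)) \<longlonglongrightarrow> 0" by simp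
    show "eventually (\<lambda>n. integrable M (\<lambda>\<omega>. (?D n \<omega> / (t n * d n))\<^sup>2) \<and> expectation (\<lambda>\<omega>. (?D n \<omega> / (t n * d n))\<^sup>2) \<le> B * K * (1 / t n + p n)) sequentially"
      using K(2) t_gt[of 1] d_gt[of 0]
    proof eventually_elim
      case (elim n)
      have X_le: "0 \<le> ?X n j \<omega> \<and> ?X n j \<omega> \<le> t n" for j \<omega>
      proof -
        have "real j * \<mu> \<ge> 0" using \<mu>_pos by simp
        then have "max 0 (t n - real j * \<mu>) \<le> t n" using elim by (auto simp: max_def)
        then show ?thesis using \<eta>_nonneg[of j \<omega>] by (auto intro: min.coboundedI2)
      qed
      have X1: "integrable M (?X n j)" for j using X_le[of j]
        by (intro integrable_const_bound[where B = "t n"]) auto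
      have X2: "integrable M (\<lambda>\<omega>. (?X n j \<omega>)\<^sup>2)" for j using X_le[of j]
        by (intro integrable_const_bound[where B = "(t n)\<^sup>2"]) (auto simp: power_mono)
      have mean: "expectation (?X n j) = f (t n - real j * \<mu>)" for j
        unfolding f_def by (rule expectation_\<eta>[of "\<lambda>x. min x (max 0 (t n - real j * \<mu>))"]) measurable
      have var: "expectation (\<lambda>\<omega>. (?X n j \<omega> - f (t n - real j * \<mu>))\<^sup>2) \<le> t n + (t n)\<^sup>2 * p n" for j
      proof -
        have "expectation (\<lambda>\<omega>. (?X n j \<omega> - f (t n - real j * \<mu>))\<^sup>2) \<le> expectation (\<lambda>\<omega>. (?X n j \<omega>)\<^sup>2)"
          using variance_eq[OF X1 X2, of j] mean[of j] by simp
        also have "\<dots> \<le> expectation (\<lambda>\<omega>. t n + (t n)\<^sup>2 * indicator {\<omega> \<in> space M. sqrt (t n) < \<eta> j \<omega>} \<omega>)"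
        proof (rule integral_mono[OF X2])
          show "integrable M (\<lambda>\<omega>. t n + (t n)\<^sup>2 * indicator {\<omega> \<in> space M. sqrt (t n) < \<eta> j \<omega>} \<omega>)"
            using elim by (intro integrable_const_bound[where B = "t n + (t n)\<^sup>2"]) (auto simp: indicator_def)
          fix \<omega> assume w: "\<omega> \<in> space M"
          show "(?X n j \<omega>)\<^sup>2 \<le> t n + (t n)\<^sup>2 * indicator {\<omega> \<in> space M. sqrt (t n) < \<eta> j \<omega>} \<omega>"
          proof (cases "sqrt (t n) < \<eta> j \<omega>")
            case True
            have "(?X n j \<omega>)\<^sup>2 \<le> (t n)\<^sup>2" using X_le[of j \<omega>] by (intro power_mono) auto
            then show ?thesis using True w elim by simp
          next
            case False
            then have "?X n j \<omega> \<le> sqrt (t n)" by auto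
            then have "(?X n j \<omega>)\<^sup>2 \<le> (sqrt (t n))\<^sup>2" using X_le[of j \<omega>] by (intro power_mono) auto
            then show ?thesis using False elim by simp
          qed
        qed
        also have "\<dots> = t n + (t n)\<^sup>2 * prob {\<omega> \<in> space M. sqrt (t n) < \<eta> j \<omega>}"
          by (subst Bochner_Integration.integral_add) (auto simp: prob_space integrable_real_indicator less_top[symmetric])
        finally show ?thesis using prob_\<eta>[of "sqrt (t n)" j] by (simp add: p_def)
      qed
      have ind: "indep_vars (\<lambda>_. borel) (\<lambda>j \<omega>. ?X n j \<omega> - f (t n - real j * \<mu>)) {..<J n}"
        by (rule indep_vars_compose2[OF indep_vars_subset[OF \<eta>_indep]]) auto
      have eq: "?D n \<omega> = (\<Sum>j<J n. ?X n j \<omega> - f (t n - real j * \<mu>))" for \<omega> by (simp add: sum_subtractf)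
      have "integrable M (\<lambda>\<omega>. (?D n \<omega>)\<^sup>2) \<and> expectation (\<lambda>\<omega>. (?D n \<omega>)\<^sup>2) = (\<Sum>j<J n. expectation (\<lambda>\<omega>. (?X n j \<omega> - f (t n - real j * \<mu>))\<^sup>2))"
        unfolding eq using X1 X2 mean
        by (intro expectation_square_sum_indep ind) (auto simp: prob_space power2_diff)
      moreover have "(\<Sum>j<J n. expectation (\<lambda>\<omega>. (?X n j \<omega> - f (t n - real j * \<mu>))\<^sup>2)) \<le> real (J n) * (t n + (t n)\<^sup>2 * p n)"
        using sum_bounded_above[of "{..<J n}", OF var] by simp
      moreover have "real (J n) * (t n + (t n)\<^sup>2 * p n) \<le> (B * t n) * (t n + (t n)\<^sup>2 * p n)"
        using J_bounds[of n] elim by (intro mult_right_mono) (auto simp: B_def p_def)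
      ultimately have D: "integrable M (\<lambda>\<omega>. (?D n \<omega>)\<^sup>2)" "expectation (\<lambda>\<omega>. (?D n \<omega>)\<^sup>2) \<le> (B * t n) * (t n + (t n)\<^sup>2 * p n)"
        by auto
      have "(B * t n) * (t n + (t n)\<^sup>2 * p n) / (t n * d n)\<^sup>2 = B * (t n / (d n)\<^sup>2) * (1 / t n + p n)"
        using elim by (simp add: field_simps power2_eq_square)
      also have "\<dots> \<le> B * K * (1 / t n + p n)"
        using elim B by (intro mult_right_mono mult_left_mono) (auto simp: field_simps p_def)
      finally have "expectation (\<lambda>\<omega>. (?D n \<omega>)\<^sup>2) / (t n * d n)\<^sup>2 \<le> B * K * (1 / t n + p n)"
        using divide_right_mono[OF D(2), of "(t n * d n)\<^sup>2"] by simp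
      then show ?case using D(1) by (simp add: power_divide)
    qed
  qed measurable
qed

lemma f_integrable: "integrable M (\<lambda>\<omega>. min (\<eta> 0 \<omega>) (max 0 z))"
proof (rule integrable_const_bound[where B = "max 0 z"])
  have "norm (min (\<eta> 0 \<omega>) (max 0 z)) \<le> max 0 z" for \<omega>
    using \<eta>_nonneg[of 0 \<omega>] by (simp add: min_def)
  then show "AE \<omega> in M. norm (min (\<eta> 0 \<omega>) (max 0 z)) \<le> max 0 z" by simp
qed measurable

lemma f_mono: "mono f"
proof (rule monoI)
  fix x y :: real assume "x \<le> y"
  then show "f x \<le> f y" unfolding f_def by (intro integral_mono f_integrable) auto
qed

lemma f_nonneg: "f y \<ge> 0"
  unfolding f_def using \<eta>_nonneg by (intro integral_nonneg_AE) auto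

lemma f_le: "f y \<le> max 0 y"
proof -
  have "f y \<le> expectation (\<lambda>\<omega>. max 0 y)" unfolding f_def
    by (intro integral_mono f_integrable) auto
  then show ?thesis by (simp add: prob_space)
qed

lemma f_nonpos: "y \<le> 0 \<Longrightarrow> f y = 0"
  using f_le[of y] f_nonneg[of y] by simp

text \<open>Summing backwards turns the decreasing summands into values of an increasing function.\<close>

lemma f_sum_integral:
  assumes "t n \<ge> 1"
  shows "\<bar>(\<Sum>j<J n. f (t n - real j * \<mu>)) - (LINT y|lborel. indicator {0..t n} y * f y) / \<mu>\<bar> \<le> t n"
proof -
  \<comment> \<open>The argument of \<open>f\<close> at the index \<open>J n\<close>. It is
    nonpositive, and \<open>f\<close> vanishes there, so starting the integral at \<open>a\<close>
    instead of 0 changes nothing.\<close>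
  define a where "a = t n - real (J n) * \<mu>"
  have a: "a \<le> 0" using J_bounds[OF assms] assms by (simp add: a_def)
  define h where "h x = f (a + \<mu> * x)" for x
  have h: "mono h" unfolding h_def using \<mu>_pos by (intro monoI monoD[OF f_mono]) auto
  have sum: "(\<Sum>j<J n. f (t n - real j * \<mu>)) = (\<Sum>k=1..J n. h (real k))"
  proof (rule sum.reindex_bij_witness[of _ "\<lambda>k. J n - k" "\<lambda>j. J n - j"])
    fix j assume "j \<in> {..<J n}"
    then have "real (J n - j) = real (J n) - real j" by (simp add: of_nat_diff)
    then show "h (real (J n - j)) = f (t n - real j * \<mu>)" by (simp add: h_def a_def algebra_simps)
  qed auto
  have [measurable]: "f \<in> borel_measurable borel" using f_mono by (rule borel_measurable_mono)
  have "(LINT y|lborel. indicator {0..t n} y * f y) = (LINT y|lborel. indicator {a..t n} y * f y)"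
    using a f_nonpos by (intro Bochner_Integration.integral_cong) (auto simp: indicator_def)
  also have "\<dots> = \<bar>\<mu>\<bar> *\<^sub>R (LINT x|lborel. indicator {a..t n} (a + \<mu> * x) * f (a + \<mu> * x))"
    using \<mu>_pos by (intro lborel_integral_real_affine) auto
  also have "(LINT x|lborel. indicator {a..t n} (a + \<mu> * x) * f (a + \<mu> * x)) = (LINT x|lborel. indicator {0..real (J n)} x * h x)"
    using \<mu>_pos by (intro Bochner_Integration.integral_cong) (auto simp: indicator_def h_def a_def algebra_simps zero_le_mult_iff mult_le_cancel_right)
  finally have int: "(LINT y|lborel. indicator {0..t n} y * f y) / \<mu> = (LINT x|lborel. indicator {0..real (J n)} x * h x)"
    using \<mu>_pos by simp
  have "h (real (J n)) \<le> t n" using f_le[of "t n"] assms by (simp add: h_def a_def mult.commute)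
  then show ?thesis unfolding sum int
    using sum_mono_integral_bounds[OF h, of "J n"] f_nonneg by (auto simp: h_def)
qed

text \<open>With t = m \<mu> + \<theta> and 0 \<le> \<theta> < \<mu>, the difference is exactly m
  \<mu> / 2 - \<theta>^2 / (2 \<mu>), which is of order t.\<close>

lemma arithmetic_sum:
  assumes "t n \<ge> 0"
  shows "\<bar>(\<Sum>j<m n. t n - real j * \<mu>) - (t n)\<^sup>2 / (2 * \<mu>)\<bar> \<le> \<mu> + t n"
proof -
  define \<theta> where "\<theta> = t n - real (m n) * \<mu>"
  have \<theta>: "0 \<le> \<theta>" "\<theta> < \<mu>" using m_bounds[OF assms] by (auto simp: \<theta>_def)
  have G: "(\<Sum>j<k. real j) = real k * (real k - 1) / 2" for k :: nat
    by (induction k) (auto simp: field_simps)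
  have "(\<Sum>j<m n. t n - real j * \<mu>) = real (m n) * t n - \<mu> * (\<Sum>j<m n. real j)"
    by (simp add: sum_subtractf sum_distrib_left mult.commute)
  also have "\<dots> = real (m n) * t n - \<mu> * (real (m n) * (real (m n) - 1) / 2)" by (simp only: G)
  also have "\<dots> - (t n)\<^sup>2 / (2 * \<mu>) = real (m n) * \<mu> / 2 - \<theta>\<^sup>2 / (2 * \<mu>)"
    using \<mu>_pos by (simp add: \<theta>_def field_simps power2_eq_square)
  finally have eq: "(\<Sum>j<m n. t n - real j * \<mu>) - (t n)\<^sup>2 / (2 * \<mu>) = real (m n) * \<mu> / 2 - \<theta>\<^sup>2 / (2 * \<mu>)" .
  have "\<theta>\<^sup>2 \<le> \<mu> * \<mu>" unfolding power2_eq_square using \<theta> by (intro mult_mono) auto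
  also have "\<dots> \<le> \<mu> * (2 * \<mu>)" using \<mu>_pos by simp
  finally have "\<theta>\<^sup>2 / (2 * \<mu>) \<le> \<mu>" using \<mu>_pos by (simp add: pos_divide_le_eq)
  moreover have "0 \<le> \<theta>\<^sup>2 / (2 * \<mu>)" using \<mu>_pos by simp
  moreover have "0 \<le> real (m n) * \<mu>" "real (m n) * \<mu> \<le> t n" using m_bounds[OF assms] \<mu>_pos by auto
  ultimately show ?thesis unfolding eq by linarith
qed

text \<open>As \<eta> is nonnegative, the positive part of t - S - \<eta> is the positive part of t
  - S minus the minimum of \<eta> and that positive part. The first yields the fluctuations, the
  second only a deterministic correction.\<close>

theorem perturbed_sum_approx:
  "prob_vanish M (\<lambda>n \<omega>. ((\<Sum>j<J n. max 0 (t n - S j \<omega> - \<eta> j \<omega>))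
     - ((t n)\<^sup>2 / 2 - (LINT y|lborel. indicator {0..t n} y * f y)) / \<mu>
     + (\<Sum>j<m n. S j \<omega> - real j * \<mu>)) / (t n * d n))"
proof -
  \<comment> \<open>All deterministic discrepancies: the arithmetic sum against its parabola, and
    the sum of \<open>f\<close> against its integral. Both are O(t), so dividing by t d leaves O(1 /
    d).\<close>
  define e where "e n = ((\<Sum>j<m n. t n - real j * \<mu>) - (t n)\<^sup>2 / (2 * \<mu>)
      - ((\<Sum>j<J n. f (t n - real j * \<mu>)) - (LINT y|lborel. indicator {0..t n} y * f y) / \<mu>)) / (t n * d n)" for n
  have "e \<longlonglongrightarrow> 0"
  proof (rule Lim_null_comparison)
    show "eventually (\<lambda>n. norm (e n) \<le> (\<mu> + 2) / d n) sequentially"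
      using t_gt[of 1] d_gt[of 0]
    proof eventually_elim
      case (elim n)
      have "\<bar>(\<Sum>j<m n. t n - real j * \<mu>) - (t n)\<^sup>2 / (2 * \<mu>)
          - ((\<Sum>j<J n. f (t n - real j * \<mu>)) - (LINT y|lborel. indicator {0..t n} y * f y) / \<mu>)\<bar> \<le> \<mu> + t n + t n"
        using arithmetic_sum[of n] f_sum_integral[of n] elim by linarith
      also have "\<dots> \<le> (\<mu> + 2) * t n" using elim \<mu>_pos by (simp add: algebra_simps)
      finally have "norm (e n) \<le> (\<mu> + 2) * t n / \<bar>t n * d n\<bar>"
        unfolding e_def real_norm_def abs_divide by (intro divide_right_mono) auto
      then show ?case using elim by simp
    qed
    show "(\<lambda>n. (\<mu> + 2) / d n) \<longlonglongrightarrow> 0"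
      by (intro tendsto_divide_0[OF tendsto_const] filterlim_at_top_imp_at_infinity d_lim)
  qed
  note V = prob_vanish_add[OF prob_vanish_add[OF positive_part_sum_vanish prob_vanish_const[OF this]]
      prob_vanish_minus[OF prob_vanish_add[OF \<eta>_sum_replace_vanish \<eta>_sum_concentration]]]
  have *: "max 0 (t n - S j \<omega> - \<eta> j \<omega>) = max 0 (t n - S j \<omega>) - min (\<eta> j \<omega>) (max 0 (t n - S j \<omega>))" for n j \<omega>
    using \<eta>_nonneg[of j \<omega>] by linarith
  show ?thesis
    by (rule back_subst[of "prob_vanish M", OF V])
      (simp add: fun_eq_iff * e_def sum_subtractf add_divide_distrib diff_divide_distrib)
qed

text \<open>The random main term. The sign is negative since larger steps reduce the summands t - S
  j.\<close>

definition Z :: "nat \<Rightarrow> 'a \<Rightarrow> real" where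
  "Z n \<omega> = - (\<Sum>j<m n. S j \<omega> - real j * \<mu>) / (t n * d n)"

lemma Z_measurable [measurable]: "Z n \<in> borel_measurable M"
  unfolding Z_def[abs_def] by measurable

text \<open>There are O(t) deviations, each of mean order d. This bound supplies the tightness from
  which the stable limit law is obtained.\<close>

lemma Z_L1: "\<exists>K. eventually (\<lambda>n. integrable M (Z n) \<and> expectation (\<lambda>\<omega>. \<bar>Z n \<omega>\<bar>) \<le> K) sequentially"
proof -
  obtain K where K: "K > 0" "eventually (\<lambda>n. \<forall>j. real j \<le> 1 / \<mu> * t n \<longrightarrow> expectation (\<lambda>\<omega>. \<bar>S j \<omega> - real j * \<mu>\<bar>) \<le> K * d n) sequentially"
    using S_L1[of "1 / \<mu>"] \<mu>_pos by auto
  have "eventually (\<lambda>n. integrable M (Z n) \<and> expectation (\<lambda>\<omega>. \<bar>Z n \<omega>\<bar>) \<le> K / \<mu>) sequentially"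
    using K(2) t_gt[of 0] d_gt[of 0]
  proof eventually_elim
    case (elim n)
    have mt: "real (m n) \<le> 1 / \<mu> * t n" using m_bounds[of n] elim \<mu>_pos by (simp add: field_simps)
    have "expectation (\<lambda>\<omega>. \<bar>\<Sum>j<m n. S j \<omega> - real j * \<mu>\<bar>) \<le> expectation (\<lambda>\<omega>. \<Sum>j<m n. \<bar>S j \<omega> - real j * \<mu>\<bar>)"
      by (intro integral_mono sum_abs) auto
    also have "\<dots> = (\<Sum>j<m n. expectation (\<lambda>\<omega>. \<bar>S j \<omega> - real j * \<mu>\<bar>))"
      by (intro Bochner_Integration.integral_sum) auto
    also have "\<dots> \<le> (\<Sum>j<m n. K * d n)"
    proof (rule sum_mono)
      fix j assume "j \<in> {..<m n}"
      then have "real j \<le> 1 / \<mu> * t n" using mt by (auto simp: less_imp_le order_trans[OF _ mt])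
      then show "expectation (\<lambda>\<omega>. \<bar>S j \<omega> - real j * \<mu>\<bar>) \<le> K * d n" using elim by blast
    qed
    also have "\<dots> = real (m n) * (K * d n)" by simp
    also have "\<dots> \<le> (1 / \<mu> * t n) * (K * d n)" using mt elim K(1) by (intro mult_right_mono) auto
    finally have "expectation (\<lambda>\<omega>. \<bar>\<Sum>j<m n. S j \<omega> - real j * \<mu>\<bar>) / (t n * d n) \<le> (1 / \<mu> * t n) * (K * d n) / (t n * d n)"
      using elim by (intro divide_right_mono) auto
    then show ?case using elim unfolding Z_def by (simp add: abs_divide)
  qed
  then show ?thesis by blast
qed

text \<open>The step with index i occurs in the partial sums S j with i < j < k, that is k - 1 - i
  times.\<close>

lemma sum_S_weights:
  "(\<Sum>j<k. S j \<omega> - real j * \<mu>) = (\<Sum>i<k. (real k - 1 - real i) * (\<xi> i \<omega> - \<mu>))"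
proof (induction k)
  case (Suc k)
  have "(\<Sum>i<Suc k. (real (Suc k) - 1 - real i) * (\<xi> i \<omega> - \<mu>)) = (\<Sum>i<k. (real k - 1 - real i) * (\<xi> i \<omega> - \<mu>) + (\<xi> i \<omega> - \<mu>))"
    by (auto simp: algebra_simps intro!: sum.cong)
  also have "\<dots> = (\<Sum>j<k. S j \<omega> - real j * \<mu>) + (S k \<omega> - real k * \<mu>)"
    using Suc by (simp add: sum.distrib S_def sum_subtractf)
  finally show ?case by simp
qed simp

section \<open>The characteristic function of the weighted sum\<close>

definition \<phi> :: "real \<Rightarrow> complex" where "\<phi> s = char (distr M borel (\<lambda>\<omega>. \<xi> 0 \<omega> - \<mu>)) s"

lemma \<phi>_minus: "\<phi> (- s) = cnj (\<phi> s)"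
  unfolding \<phi>_def char_def Bochner_Integration.integral_cnj[symmetric]
  by (rule Bochner_Integration.integral_cong) (auto simp: exp_cnj)

lemma norm_\<phi>: "norm (\<phi> s) \<le> 1"
  unfolding \<phi>_def by (rule real_distribution.cmod_char_le_1) simp

lemma char_Z: "char (distr M borel (Z n)) u = (\<Prod>k=1..m n - 1. \<phi> (- u * real k / (t n * d n)))"
proof -
  define c where "c i = - (real (m n) - 1 - real i) / (t n * d n)" for i
  have Zc: "Z n = (\<lambda>\<omega>. \<Sum>i<m n. c i * (\<xi> i \<omega> - \<mu>))"
  proof
    fix \<omega>
    have "Z n \<omega> = (\<Sum>i<m n. - ((real (m n) - 1 - real i) * (\<xi> i \<omega> - \<mu>)) / (t n * d n))"
      by (simp add: Z_def sum_S_weights sum_negf sum_divide_distrib)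
    also have "\<dots> = (\<Sum>i<m n. c i * (\<xi> i \<omega> - \<mu>))" unfolding c_def by (intro sum.cong refl) (simp only: minus_mult_left times_divide_eq_left)
    finally show "Z n \<omega> = (\<Sum>i<m n. c i * (\<xi> i \<omega> - \<mu>))" .
  qed
  have "char (distr M borel (Z n)) u = (\<Prod>i<m n. char (distr M borel (\<lambda>\<omega>. c i * (\<xi> i \<omega> - \<mu>))) u)"
    unfolding Zc by (intro char_distr_sum indep_vars_compose2[OF indep_vars_subset[OF \<xi>_indep]]) auto
  also have "\<dots> = (\<Prod>i<m n. \<phi> (u * c i))"
  proof (rule prod.cong)
    fix i
    have "char (distr M borel (\<lambda>\<omega>. c i * (\<xi> i \<omega> - \<mu>))) u = char (distr (distr M borel (\<xi> i)) borel (\<lambda>x. c i * (x - \<mu>))) u"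
      by (subst distr_distr) (auto simp: comp_def)
    also have "\<dots> = char (distr (distr M borel (\<xi> 0)) borel (\<lambda>x. c i * (x - \<mu>))) u" using \<xi>_distr[of i] by simp
    also have "\<dots> = \<phi> (u * c i)"
      unfolding \<phi>_def char_def by (simp add: integral_distr distr_distr comp_def mult.assoc)
    finally show "char (distr M borel (\<lambda>\<omega>. c i * (\<xi> i \<omega> - \<mu>))) u = \<phi> (u * c i)" .
  qed simp
  \<comment> \<open>Reversing the order turns the weights into k = 0, ..., m - 1. The last step has
    weight 0 and contributes \<phi> 0 = 1, so the product starts at 1.\<close>
  also have "\<dots> = (\<Prod>k\<in>{1..m n - 1}. \<phi> (- u * real k / (t n * d n)))"
  proof (cases "m n")
    case (Suc l)
    have "(\<Prod>i<m n. \<phi> (u * c i)) = (\<Prod>k<m n. \<phi> (- u * real k / (t n * d n)))"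
      by (rule prod.reindex_bij_witness[of _ "\<lambda>k. m n - 1 - k" "\<lambda>k. m n - 1 - k"]) (auto simp: c_def of_nat_diff Suc algebra_simps diff_divide_distrib intro!: arg_cong[where f = \<phi>])
    also have "\<dots> = \<phi> 0 * (\<Prod>k\<in>{1..m n - 1}. \<phi> (- u * real k / (t n * d n)))"
      unfolding Suc by (subst prod.lessThan_Suc_shift) (simp add: prod.atLeast1_atMost_eq)
    also have "\<phi> 0 = 1" unfolding \<phi>_def by (rule real_distribution.char_zero) simp
    finally show ?thesis by simp
  qed simp
  finally show ?thesis .
qed

text \<open>The theorem on products treats positive arguments. Because of the negative sign in
  \<open>Z\<close>, a negative u leads to positive arguments of \<phi>, while a positive u leads to
  the complex conjugate.\<close>

theorem char_Z_tendsto: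
  assumes "mono g" "\<And>s. g s \<ge> 0"
    and rv: "\<And>c. c > 0 \<Longrightarrow> ((\<lambda>s. g (c * s) / g s) \<longlongrightarrow> c powr \<alpha>) (at_right 0)"
    and \<phi>: "((\<lambda>s. (\<phi> s - 1) / of_real (g s)) \<longlongrightarrow> - \<kappa>) (at_right 0)" and "\<alpha> > 0"
  shows "(\<lambda>n. char (distr M borel (Z n)) u)
    \<longlonglongrightarrow> exp (- (if u > 0 then cnj \<kappa> else \<kappa>) * of_real (\<bar>u\<bar> powr \<alpha> * (1 / \<mu>) powr (\<alpha> + 1) / (\<alpha> + 1)))"
proof -
  have m': "(\<lambda>n. real (m n - 1) / t n) \<longlonglongrightarrow> 1 / \<mu>"
  proof -
    have "(\<lambda>n. real (m n) / t n - 1 / t n) \<longlonglongrightarrow> 1 / \<mu> - 0"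
      by (intro tendsto_diff m_over_t tendsto_divide_0[OF tendsto_const] filterlim_at_top_imp_at_infinity t_lim)
    moreover have "eventually (\<lambda>n. real (m n) / t n - 1 / t n = real (m n - 1) / t n) sequentially"
      using t_gt[of "2 * \<mu>"] t_gt[of 0]
    proof eventually_elim
      case (elim n)
      then have "1 * \<mu> < real (m n) * \<mu>" using m_bounds[of n] by linarith
      then have "m n \<ge> 1" using \<mu>_pos by (simp add: mult_less_cancel_right_disj)
      then show ?case by (simp add: of_nat_diff diff_divide_distrib)
    qed
    ultimately show ?thesis by (simp add: tendsto_cong)
  qed
  have *: "(\<lambda>n. \<Prod>k=1..m n - 1. \<phi> (v * real k / (t n * d n))) \<longlonglongrightarrow> exp (- \<kappa> * of_real (v powr \<alpha> * (1 / \<mu>) powr (\<alpha> + 1) / (\<alpha> + 1)))"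
    if "v > 0" for v
    using that assms \<mu>_pos g_pos
    by (intro tendsto_prod_char_linear_weights[OF assms(1,2) _ rv norm_\<phi> \<phi> t_lim d_lim norming m']) auto
  consider "u = 0" | "u < 0" | "u > 0" by linarith
  then show ?thesis
  proof cases
    case 1
    have "\<phi> 0 = 1" unfolding \<phi>_def by (rule real_distribution.char_zero) simp
    then show ?thesis using 1 by (simp add: char_Z)
  next
    case 2
    then show ?thesis using *[of "- u"] by (simp add: char_Z)
  next
    case 3
    have "(\<lambda>n. cnj (\<Prod>k=1..m n - 1. \<phi> (u * real k / (t n * d n)))) \<longlonglongrightarrow> cnj (exp (- \<kappa> * of_real (u powr \<alpha> * (1 / \<mu>) powr (\<alpha> + 1) / (\<alpha> + 1))))"
      using *[OF 3] by (rule tendsto_cnj)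
    then show ?thesis using 3 by (simp add: char_Z exp_cnj \<phi>_minus[symmetric])
  qed
qed

end

section \<open>Box sizes\<close>

text \<open>Conditioning on \<open>X\<close>: the joint law is a product, so a bound that holds for
  each frozen value in \<open>A\<close> survives integration over \<open>X\<close>. It serves to
  freeze the sticks and average over the sample.\<close>

lemma (in prob_space) nn_integral_indep_le:
  assumes ind: "indep_var S X T Y" and G [measurable]: "G \<in> borel_measurable (S \<Otimes>\<^sub>M T)"
    and A: "AE \<omega> in M. X \<omega> \<in> A" and [measurable]: "A \<in> sets S"
    and le: "\<And>x. x \<in> A \<Longrightarrow> (\<integral>\<^sup>+\<omega>. G (x, Y \<omega>) \<partial>M) \<le> c"
  shows "(\<integral>\<^sup>+\<omega>. G (X \<omega>, Y \<omega>) \<partial>M) \<le> c"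
proof -
  have [measurable]: "X \<in> measurable M S" "Y \<in> measurable M T"
    using indep_var_rv1[OF ind] indep_var_rv2[OF ind] by auto
  interpret DY: prob_space "distr M T Y" by (rule prob_space_distr) simp
  have "(\<integral>\<^sup>+\<omega>. G (X \<omega>, Y \<omega>) \<partial>M) = (\<integral>\<^sup>+z. G z \<partial>distr M (S \<Otimes>\<^sub>M T) (\<lambda>\<omega>. (X \<omega>, Y \<omega>)))"
    by (subst nn_integral_distr) auto
  also have "\<dots> = (\<integral>\<^sup>+z. G z \<partial>(distr M S X \<Otimes>\<^sub>M distr M T Y))"
    using ind unfolding indep_var_distribution_eq by simp
  also have "\<dots> = (\<integral>\<^sup>+x. \<integral>\<^sup>+y. G (x, y) \<partial>distr M T Y \<partial>distr M S X)"
    by (rule DY.nn_integral_fst[symmetric]) simp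
  also have "\<dots> = (\<integral>\<^sup>+\<omega>'. \<integral>\<^sup>+y. G (X \<omega>', y) \<partial>distr M T Y \<partial>M)"
    by (subst nn_integral_distr) (auto intro!: DY.borel_measurable_nn_integral)
  also have "\<dots> = (\<integral>\<^sup>+\<omega>'. \<integral>\<^sup>+\<omega>. G (X \<omega>', Y \<omega>) \<partial>M \<partial>M)"
    by (intro nn_integral_cong nn_integral_distr) auto
  also have "\<dots> \<le> (\<integral>\<^sup>+\<omega>'. c \<partial>M)"
    by (rule nn_integral_mono_AE) (use A le in auto)
  also have "\<dots> = c" by (simp add: emeasure_space_1)
  finally show ?thesis .
qed

text \<open>A box count z is compared with its conditional mean y, and the normalized square on the
  right has mean at most 1. The logarithm is harmless for z \<ge> y / 2. For smaller z the square is
  at least y^2 / 4, which is where the factor 4 originates. The convention ln 0 = 0 covers empty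
  boxes.\<close>

lemma abs_ln_diff_le:
  fixes z :: nat and y :: real
  assumes "y > 0"
  shows "\<bar>ln (real z) - max 0 (ln y)\<bar> \<le> 1 + 4 * ((real z - y)\<^sup>2 / y)"
proof (cases "y \<ge> 1")
  case True
  define D where "D = (real z - y)\<^sup>2 / y"
  have D: "D \<ge> 0" using assms by (simp add: D_def)
  have m: "max 0 (ln y) = ln y" using True by simp
  show ?thesis
  proof (cases "real z \<ge> y")
    case zy: True
    have "ln (real z) - ln y = ln (real z / y)" using zy assms by (simp add: ln_div)
    also have "\<dots> \<le> real z / y - 1" using zy assms by (intro ln_le_minus_one) auto
    also have "\<dots> = (real z - y) / y" using assms by (simp add: field_simps)
    also have "\<dots> \<le> 1 + D"
    proof (cases "real z - y \<le> 1")
      case True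
      then have "(real z - y) / y \<le> 1" using \<open>y \<ge> 1\<close> by simp
      then show ?thesis using D by simp
    next
      case False
      then have "(real z - y) * 1 \<le> (real z - y) * (real z - y)" by (intro mult_left_mono) auto
      then show ?thesis using assms by (simp add: D_def power2_eq_square divide_right_mono add_increasing)
    qed
    finally have "ln (real z) - ln y \<le> 1 + D" .
    moreover have "ln y \<le> ln (real z)" using zy assms by simp
    ultimately show ?thesis using D unfolding m D_def by simp
  next
    case zy: False
    show ?thesis
    proof (cases "real z \<ge> y / 2")
      case True
      have z0: "real z > 0" using True assms by linarith
      have "ln y - ln (real z) = ln (y / real z)" using z0 assms by (simp add: ln_div)
      also have "\<dots> \<le> y / real z - 1" using z0 assms by (intro ln_le_minus_one) auto
      also have "\<dots> \<le> 1" using True z0 by (simp add: field_simps)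
      finally have "ln y - ln (real z) \<le> 1" .
      moreover have "ln (real z) \<le> ln y" using zy z0 by simp
      ultimately show ?thesis using D unfolding m D_def by simp
    next
      case False
      have "(y / 2)\<^sup>2 \<le> (y - real z)\<^sup>2" using False assms by (intro power_mono) auto
      then have "y \<le> 4 * D" using assms by (simp add: D_def field_simps power2_eq_square)
      moreover have "ln y \<le> y" using ln_le_minus_one[of y] assms by linarith
      moreover have "0 \<le> ln (real z)" "ln (real z) \<le> ln y" using zy \<open>y \<ge> 1\<close> by (cases "z = 0"; simp)+
      ultimately show ?thesis unfolding m D_def by simp
    qed
  qed
next
  case False
  then have m: "max 0 (ln y) = 0" using assms by simp
  have "(real z - y)\<^sup>2 / 1 \<le> (real z - y)\<^sup>2 / y" using False assms by (intro divide_left_mono) auto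
  then have "(real z - y)\<^sup>2 \<le> (real z - y)\<^sup>2 / y" by simp
  moreover have "\<bar>ln (real z)\<bar> \<le> 1 + (real z - y)\<^sup>2"
  proof (cases "z = 0")
    case z: False
    then have "\<bar>ln (real z)\<bar> \<le> real z - 1" using ln_le_minus_one[of "real z"] by simp
    also have "\<dots> \<le> 1 + (real z - 1)\<^sup>2" using sum_squares_ge_zero[of "real z - 1 - 1 / 2" 0] by (simp add: power2_eq_square algebra_simps)
    also have "(real z - 1)\<^sup>2 \<le> (real z - y)\<^sup>2" using z False by (intro power_mono) auto
    finally show ?thesis by simp
  qed simp
  ultimately show ?thesis unfolding m using zero_le_power2[of "real z - y"] by linarith
qed

section \<open>The stick-breaking model and the numbers of points in its boxes\<close>

locale stick_breaking = prob_space +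
  fixes W :: "'a \<Rightarrow> real" and Ws U :: "nat \<Rightarrow> 'a \<Rightarrow> real"
  assumes W_measurable [measurable]: "W \<in> borel_measurable M"
    and W_01: "AE \<omega> in M. 0 < W \<omega> \<and> W \<omega> < 1"
    and Ws_distr: "\<And>i. i \<ge> 1 \<Longrightarrow> distr M borel (Ws i) = distr M borel W"
    and U_distr: "\<And>i. i \<ge> 1 \<Longrightarrow> distr M borel (U i) = uniform_measure lborel {0..1}"
    and indep: "indep_vars (\<lambda>_. borel) (case_sum Ws U) ({1..} <+> {1..})"
begin

text \<open>Steps are counted from 0, factors from 1. The variables \<xi> k and \<eta> k come from
  the same factor: the box with index k ends where that factor is applied.\<close>

definition \<xi> :: "nat \<Rightarrow> 'a \<Rightarrow> real" where "\<xi> k \<omega> = \<bar>ln (Ws (Suc k) \<omega>)\<bar>"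

definition \<eta> :: "nat \<Rightarrow> 'a \<Rightarrow> real" where "\<eta> k \<omega> = \<bar>ln (1 - Ws (Suc k) \<omega>)\<bar>"

lemma Ws_measurable [measurable]: "i \<ge> 1 \<Longrightarrow> Ws i \<in> borel_measurable M"
  using indep_vars_def[of "\<lambda>_. borel" "case_sum Ws U" "{1..} <+> {1..}"] indep by (auto dest!: bspec[where x = "Inl i"])

lemma U_measurable [measurable]: "i \<ge> 1 \<Longrightarrow> U i \<in> borel_measurable M"
  using indep_vars_def[of "\<lambda>_. borel" "case_sum Ws U" "{1..} <+> {1..}"] indep by (auto dest!: bspec[where x = "Inr i"])

lemma Ws_Suc_measurable [measurable]: "Ws (Suc k) \<in> borel_measurable M"
  by (rule Ws_measurable) simp

lemma U_Suc_measurable [measurable]: "U (Suc k) \<in> borel_measurable M"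
  by (rule U_measurable) simp

lemma \<xi>_rv [measurable]: "\<xi> k \<in> borel_measurable M" and \<eta>_rv [measurable]: "\<eta> k \<in> borel_measurable M"
  unfolding \<xi>_def[abs_def] \<eta>_def[abs_def] by measurable

lemma indep_vars_Ws:
  assumes [measurable]: "h \<in> borel_measurable borel"
  shows "indep_vars (\<lambda>_. borel) (\<lambda>k \<omega>. h (Ws (Suc k) \<omega>) :: real) UNIV"
proof -
  have "indep_vars (\<lambda>j. PiM {Inl (Suc j)} (\<lambda>_. borel)) (\<lambda>j \<omega>. restrict (\<lambda>i. case_sum Ws U i \<omega>) {Inl (Suc j)}) UNIV"
    by (rule indep_vars_restrict[OF indep]) (auto simp: disjoint_family_on_def)
  then have "indep_vars (\<lambda>_. borel) (\<lambda>j \<omega>. h ((restrict (\<lambda>i. case_sum Ws U i \<omega>) {Inl (Suc j)}) (Inl (Suc j)))) UNIV"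
    by (rule indep_vars_compose2) measurable
  then show ?thesis by simp
qed

lemma indep_vars_U:
  assumes [measurable]: "h \<in> borel_measurable borel"
  shows "indep_vars (\<lambda>_. borel) (\<lambda>k \<omega>. h (U k \<omega>) :: real) {1..n}"
proof -
  have "indep_vars (\<lambda>j. PiM {Inr j} (\<lambda>_. borel)) (\<lambda>j \<omega>. restrict (\<lambda>i. case_sum Ws U i \<omega>) {Inr j}) {1..n}"
    by (rule indep_vars_restrict[OF indep]) (auto simp: disjoint_family_on_def)
  then have "indep_vars (\<lambda>_. borel) (\<lambda>j \<omega>. h ((restrict (\<lambda>i. case_sum Ws U i \<omega>) {Inr j}) (Inr j))) {1..n}"
    by (rule indep_vars_compose2) measurable
  then show ?thesis by simp
qed

lemma AE_Ws: "AE \<omega> in M. \<forall>i\<ge>1. 0 < Ws i \<omega> \<and> Ws i \<omega> < 1"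
proof -
  have "AE \<omega> in M. 0 < Ws i \<omega> \<and> Ws i \<omega> < 1" if i: "i \<ge> 1" for i
  proof -
    have "AE w in distr M borel W. 0 < w \<and> w < 1" by (subst AE_distr_iff) (use W_01 in auto)
    then have "AE w in distr M borel (Ws i). 0 < w \<and> w < 1" unfolding Ws_distr[OF i] .
    then show ?thesis using i by (subst (asm) AE_distr_iff) auto
  qed
  then have "AE \<omega> in M. \<forall>i. i \<ge> 1 \<longrightarrow> 0 < Ws i \<omega> \<and> Ws i \<omega> < 1"
    by (intro AE_all_countable[THEN iffD2] allI) (auto intro: AE_impI)
  then show ?thesis by simp
qed

text \<open>Given one sample point, another one coincides with it with probability 0, since the
  uniform law has no atoms.\<close>

lemma AE_U_inj: "AE \<omega> in M. inj_on (\<lambda>i. U i \<omega>) {1..n}"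
proof -
  have "AE \<omega> in M. U i \<omega> \<noteq> U k \<omega>" if ik: "i \<ge> 1" "k \<ge> 1" "i \<noteq> k" for i k
  proof -
    have "indep_var borel ((\<lambda>f. f (Inr i)) \<circ> (\<lambda>\<omega>. restrict (\<lambda>i. case_sum Ws U i \<omega>) {Inr i}))
        borel ((\<lambda>f. f (Inr k)) \<circ> (\<lambda>\<omega>. restrict (\<lambda>i. case_sum Ws U i \<omega>) {Inr k}))"
      using ik by (intro indep_var_compose[OF indep_var_restrict[OF indep]]) auto
    then have ind: "indep_var borel (U i) borel (U k)" by (simp add: comp_def)
    have "(\<integral>\<^sup>+\<omega>. (\<lambda>(x, y). if x = y then 1 else 0) (U i \<omega>, U k \<omega>) \<partial>M) \<le> 0"
    proof (rule nn_integral_indep_le[OF ind])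
      show "(\<lambda>(x :: real, y). if x = y then 1 else 0) \<in> borel_measurable (borel \<Otimes>\<^sub>M borel)" by measurable
      fix x :: real
      have "(\<integral>\<^sup>+\<omega>. (case (x, U k \<omega>) of (x, y) \<Rightarrow> if x = y then 1 else 0) \<partial>M) = (\<integral>\<^sup>+y. indicator {x} y \<partial>distr M borel (U k))"
        using ik by (subst nn_integral_distr) (auto simp: indicator_def intro!: nn_integral_cong)
      also have "\<dots> = 0"
      proof -
        have "emeasure lborel ({0..1} \<inter> {x}) \<le> emeasure lborel {x}" by (intro emeasure_mono) auto
        then show ?thesis using ik by (simp add: U_distr emeasure_uniform_measure)
      qed
      finally show "(\<integral>\<^sup>+\<omega>. (case (x, U k \<omega>) of (x, y) \<Rightarrow> if x = y then 1 else 0) \<partial>M) \<le> 0" by simp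
    qed (auto simp: U_measurable)
    then have "(\<integral>\<^sup>+\<omega>. (if U i \<omega> = U k \<omega> then 1 else 0) \<partial>M) = 0" by simp
    then have "AE \<omega> in M. (if U i \<omega> = U k \<omega> then 1 else (0::ennreal)) = 0"
      using ik by (subst (asm) nn_integral_0_iff_AE) auto
    then show ?thesis by eventually_elim (auto split: if_splits)
  qed
  then have "AE \<omega> in M. \<forall>i\<in>{1..n}. \<forall>k\<in>{1..n}. i \<noteq> k \<longrightarrow> U i \<omega> \<noteq> U k \<omega>"
    by (intro AE_finite_all[THEN iffD2] ballI) (auto intro: AE_impI)
  then show ?thesis by eventually_elim (auto simp: inj_on_def)
qed

text \<open>The sum involves the factors 1, ..., j, and \<eta> j involves the factor j + 1.\<close>

lemma cross_indep': "indep_var borel (\<lambda>\<omega>. \<Sum>i<j. \<xi> i \<omega>) borel (\<eta> j)"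
proof -
  have "indep_var borel ((\<lambda>f. \<Sum>i<j. \<bar>ln (f (Inl (Suc i)))\<bar>) \<circ> (\<lambda>\<omega>. restrict (\<lambda>i. case_sum Ws U i \<omega>) (Inl ` {1..j})))
      borel ((\<lambda>f. \<bar>ln (1 - f (Inl (Suc j)))\<bar>) \<circ> (\<lambda>\<omega>. restrict (\<lambda>i. case_sum Ws U i \<omega>) {Inl (Suc j)}))"
  proof (rule indep_var_compose[OF indep_var_restrict[OF indep]])
    have [measurable]: "(\<lambda>f. f (Inl (Suc i))) \<in> borel_measurable (PiM (Inl ` {1..j}) (\<lambda>_. borel :: real measure))" if "i < j" for i
      using that by (intro measurable_component_singleton) auto
    show "(\<lambda>f. \<Sum>i<j. \<bar>ln (f (Inl (Suc i)))\<bar>) \<in> borel_measurable (PiM (Inl ` {1..j}) (\<lambda>_. borel :: real measure))"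
      by (intro borel_measurable_sum borel_measurable_abs borel_measurable_ln) auto
    show "(\<lambda>f. \<bar>ln (1 - f (Inl (Suc j)))\<bar>) \<in> borel_measurable (PiM {Inl (Suc j)} (\<lambda>_. borel :: real measure))"
      by measurable
  qed auto
  moreover have "(\<lambda>f. \<Sum>i<j. \<bar>ln (f (Inl (Suc i)))\<bar>) \<circ> (\<lambda>\<omega>. restrict (\<lambda>i. case_sum Ws U i \<omega>) (Inl ` {1..j})) = (\<lambda>\<omega>. \<Sum>i<j. \<xi> i \<omega>)"
    by (auto simp: fun_eq_iff \<xi>_def intro!: sum.cong)
  moreover have "(\<lambda>f. \<bar>ln (1 - f (Inl (Suc j)))\<bar>) \<circ> (\<lambda>\<omega>. restrict (\<lambda>i. case_sum Ws U i \<omega>) {Inl (Suc j)}) = \<eta> j"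
    by (auto simp: fun_eq_iff \<eta>_def)
  ultimately show ?thesis by simp
qed

lemma distr_Ws_Suc:
  assumes [measurable]: "h \<in> borel_measurable borel"
  shows "distr M borel (\<lambda>\<omega>. h (Ws (Suc i) \<omega>) :: real) = distr M borel (\<lambda>\<omega>. h (W \<omega>))"
proof -
  have "distr M borel (\<lambda>\<omega>. h (Ws (Suc i) \<omega>)) = distr (distr M borel (Ws (Suc i))) borel h"
    by (subst distr_distr) (auto simp: comp_def)
  also have "\<dots> = distr M borel (\<lambda>\<omega>. h (W \<omega>))"
    by (subst Ws_distr, simp, subst distr_distr) (auto simp: comp_def)
  finally show ?thesis .
qed

lemma renewal_pairsI:
  assumes "integrable M (\<lambda>\<omega>. \<bar>ln (W \<omega>)\<bar>)"
  shows "renewal_pairs M \<xi> \<eta> (mean_abs_log M W)"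
proof unfold_locales
  show "indep_vars (\<lambda>_. borel) \<xi> UNIV"
    unfolding \<xi>_def[abs_def] by (rule indep_vars_Ws) measurable
  show "indep_vars (\<lambda>_. borel) \<eta> UNIV"
    unfolding \<eta>_def[abs_def] by (rule indep_vars_Ws) measurable
  show "indep_var borel (\<lambda>\<omega>. \<Sum>i<j. \<xi> i \<omega>) borel (\<eta> j)" for j by (rule cross_indep')
  have D1: "distr M borel (\<xi> i) = distr M borel (\<lambda>\<omega>. \<bar>ln (W \<omega>)\<bar>)" for i
    unfolding \<xi>_def[abs_def] by (rule distr_Ws_Suc) measurable
  have D2: "distr M borel (\<eta> i) = distr M borel (\<lambda>\<omega>. \<bar>ln (1 - W \<omega>)\<bar>)" for i
    unfolding \<eta>_def[abs_def] by (rule distr_Ws_Suc) measurable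
  show "distr M borel (\<xi> i) = distr M borel (\<xi> 0)" "distr M borel (\<eta> i) = distr M borel (\<eta> 0)" for i
    using D1 D2 by simp_all
  show "\<xi> i \<omega> \<ge> 0" "\<eta> i \<omega> \<ge> 0" for i \<omega> by (auto simp: \<xi>_def \<eta>_def)
  show "integrable M (\<xi> 0)"
  proof -
    have "integrable (distr M borel (\<lambda>\<omega>. \<bar>ln (W \<omega>)\<bar>)) (\<lambda>x. x)"
      using assms by (subst integrable_distr_eq) auto
    then have "integrable (distr M borel (\<xi> 0)) (\<lambda>x. x)" unfolding D1 .
    then show ?thesis by (subst (asm) integrable_distr_eq) auto
  qed
  show "expectation (\<xi> 0) = mean_abs_log M W"
  proof -
    have "expectation (\<xi> 0) = (LINT x|distr M borel (\<xi> 0). x)" by (rule integral_distr[symmetric]) auto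
    also have "\<dots> = (LINT x|distr M borel (\<lambda>\<omega>. \<bar>ln (W \<omega>)\<bar>). x)" unfolding D1 ..
    also have "\<dots> = mean_abs_log M W" unfolding mean_abs_log_def by (rule integral_distr) auto
    finally show ?thesis .
  qed
  show "mean_abs_log M W > 0"
  proof -
    have "mean_abs_log M W \<ge> 0" unfolding mean_abs_log_def by simp
    moreover have "mean_abs_log M W \<noteq> 0"
    proof
      assume "mean_abs_log M W = 0"
      then have "AE \<omega> in M. \<bar>ln (W \<omega>)\<bar> = 0"
        unfolding mean_abs_log_def using assms by (subst (asm) integral_nonneg_eq_0_iff_AE) auto
      then have "AE \<omega> in M. False" using W_01 by eventually_elim (auto simp: ln_eq_zero_iff)
      then show False by simp
    qed
    ultimately show ?thesis by simp
  qed
qed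

lemma indicator_U:
  assumes "0 \<le> a" "a \<le> b" "b \<le> 1" "i \<ge> 1"
  shows "expectation (\<lambda>\<omega>. if a < U i \<omega> \<and> U i \<omega> \<le> b then 1 else 0) = b - a"
proof -
  have [measurable]: "U i \<in> borel_measurable M" using assms by simp
  have "expectation (\<lambda>\<omega>. if a < U i \<omega> \<and> U i \<omega> \<le> b then 1 else 0) = expectation (indicator (U i -` {a<..b} \<inter> space M))"
    by (intro Bochner_Integration.integral_cong) (auto simp: indicator_def)
  also have "\<dots> = measure (distr M borel (U i)) {a<..b}"
    by (subst measure_distr) auto
  also have "\<dots> = measure (uniform_measure lborel {0..1}) {a<..b}"
    using assms by (simp add: U_distr)
  also have "\<dots> = b - a"
  proof -
    have "{0..1} \<inter> {a<..b} = {a<..b}" using assms by auto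
    then show ?thesis using assms by (simp add: measure_uniform_measure)
  qed
  finally show ?thesis .
qed

text \<open>The count is binomial with variance n p (1 - p) \<le> n p, where p = b - a.\<close>

lemma binomial_variance:
  assumes "0 \<le> a" "a < b" "b \<le> 1" "n \<ge> 1"
  shows "(\<integral>\<^sup>+\<omega>. ennreal (((\<Sum>i=1..n. if a < U i \<omega> \<and> U i \<omega> \<le> b then 1 else 0) - real n * (b - a))\<^sup>2 / (real n * (b - a))) \<partial>M) \<le> 1"
proof -
  let ?I = "\<lambda>i \<omega>. if a < U i \<omega> \<and> U i \<omega> \<le> b then 1 else (0::real)"
  let ?p = "b - a"
  have [measurable]: "?I i \<in> borel_measurable M" if "i \<ge> 1" for i
    using U_measurable[OF that] by measurable
  have int: "integrable M (?I i)" if "i \<ge> 1" for i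
    using that by (intro integrable_const_bound[where B = 1]) auto
  have sq: "(?I i \<omega> - ?p)\<^sup>2 = (1 - 2 * ?p) * ?I i \<omega> + ?p\<^sup>2" for i \<omega> by (auto simp: power2_eq_square algebra_simps)
  have ind: "indep_vars (\<lambda>_. borel) (\<lambda>i \<omega>. ?I i \<omega> - ?p) {1..n}"
    by (rule indep_vars_U[of "\<lambda>x. (if a < x \<and> x \<le> b then 1 else 0) - ?p"]) measurable
  have E: "expectation (\<lambda>\<omega>. (?I i \<omega> - ?p)\<^sup>2) \<le> ?p" if "i \<in> {1..n}" for i
  proof -
    have "expectation (\<lambda>\<omega>. (?I i \<omega> - ?p)\<^sup>2) = (1 - 2 * ?p) * ?p + ?p\<^sup>2"
      unfolding sq using int[of i] indicator_U[of a b i] that assms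
      by (subst Bochner_Integration.integral_add) (auto simp: prob_space)
    also have "\<dots> \<le> ?p" by (simp add: power2_eq_square algebra_simps) (smt (verit) zero_le_square power2_eq_square power2_diff mult.commute)
    finally show ?thesis .
  qed
  have V: "integrable M (\<lambda>\<omega>. (\<Sum>i=1..n. ?I i \<omega> - ?p)\<^sup>2) \<and> expectation (\<lambda>\<omega>. (\<Sum>i=1..n. ?I i \<omega> - ?p)\<^sup>2) = (\<Sum>i=1..n. expectation (\<lambda>\<omega>. (?I i \<omega> - ?p)\<^sup>2))"
  proof (rule expectation_square_sum_indep[OF _ ind])
    fix i assume i: "i \<in> {1..n}"
    show "integrable M (\<lambda>\<omega>. (?I i \<omega> - ?p)\<^sup>2)" unfolding sq using int[of i] i by auto
    show "expectation (\<lambda>\<omega>. ?I i \<omega> - ?p) = 0"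
      using int[of i] indicator_U[of a b i] i assms by (subst Bochner_Integration.integral_diff) (auto simp: prob_space)
  qed simp
  have "(\<Sum>i=1..n. expectation (\<lambda>\<omega>. (?I i \<omega> - ?p)\<^sup>2)) \<le> real n * ?p"
    using sum_bounded_above[of "{1..n}" _ ?p, OF E] by simp
  then have le: "expectation (\<lambda>\<omega>. (\<Sum>i=1..n. ?I i \<omega> - ?p)\<^sup>2 / (real n * ?p)) \<le> 1"
    using V assms by (simp add: pos_divide_le_eq)
  have eq: "(\<Sum>i=1..n. ?I i \<omega>) - real n * ?p = (\<Sum>i=1..n. ?I i \<omega> - ?p)" for \<omega> by (simp add: sum_subtractf)
  have "(\<integral>\<^sup>+\<omega>. ennreal (((\<Sum>i=1..n. ?I i \<omega>) - real n * ?p)\<^sup>2 / (real n * ?p)) \<partial>M) = ennreal (expectation (\<lambda>\<omega>. (\<Sum>i=1..n. ?I i \<omega> - ?p)\<^sup>2 / (real n * ?p)))"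
    unfolding eq using V assms by (intro nn_integral_eq_integral) auto
  also have "\<dots> \<le> 1" using le by simp
  finally show ?thesis .
qed

definition box_card :: "nat \<Rightarrow> nat \<Rightarrow> 'a \<Rightarrow> nat" where
  "box_card n j \<omega> = card (stick_box (\<lambda>i. Ws i \<omega>) (\<lambda>i. U i \<omega>) n j)"

definition Q :: "nat \<Rightarrow> 'a \<Rightarrow> real" where "Q j \<omega> = stick_Q (\<lambda>i. Ws i \<omega>) j"

lemma box_card_eq: "real (box_card n j \<omega>) = (\<Sum>i=1..n. if Q (Suc j) \<omega> < U i \<omega> \<and> U i \<omega> \<le> Q j \<omega> then 1 else 0)"
  unfolding box_card_def stick_box_def stick_interval_def Q_def
  by (simp add: sum.If_cases Int_def)

lemma Q_measurable [measurable]: "Q j \<in> borel_measurable M"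
  unfolding Q_def[abs_def] stick_Q_def by (intro borel_measurable_prod) auto

lemma box_card_measurable [measurable]: "(\<lambda>\<omega>. real (box_card n j \<omega>)) \<in> borel_measurable M"
  unfolding box_card_eq
proof (rule borel_measurable_sum)
  fix i assume "i \<in> {1..n}"
  then have [measurable]: "U i \<in> borel_measurable M" by simp
  show "(\<lambda>\<omega>. if Q (Suc j) \<omega> < U i \<omega> \<and> U i \<omega> \<le> Q j \<omega> then 1 else 0) \<in> borel_measurable M" by measurable
qed

lemma Q_eq:
  assumes "\<forall>i\<ge>1. 0 < Ws i \<omega> \<and> Ws i \<omega> < 1"
  shows "Q j \<omega> = exp (- (\<Sum>i<j. \<xi> i \<omega>))"
    and "Q j \<omega> - Q (Suc j) \<omega> = exp (- (\<Sum>i<j. \<xi> i \<omega>) - \<eta> j \<omega>)"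
proof -
  have w: "0 < Ws (Suc k) \<omega>" "Ws (Suc k) \<omega> < 1" for k using assms by auto
  have e: "exp (- \<xi> k \<omega>) = Ws (Suc k) \<omega>" for k
    using w[of k] by (simp add: \<xi>_def abs_of_neg)
  show Q: "Q j \<omega> = exp (- (\<Sum>i<j. \<xi> i \<omega>))" for j
  proof (induction j)
    case (Suc j)
    have "Q (Suc j) \<omega> = Q j \<omega> * Ws (Suc j) \<omega>" by (simp add: Q_def stick_Q_Suc)
    also have "\<dots> = exp (- (\<Sum>i<j. \<xi> i \<omega>)) * exp (- \<xi> j \<omega>)" using Suc e by simp
    finally show ?case by (simp add: exp_add[symmetric])
  qed (simp add: Q_def)
  let ?A = "\<Sum>i<j. \<xi> i \<omega>"
  have "exp (- \<eta> j \<omega>) = 1 - Ws (Suc j) \<omega>"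
    using w[of j] by (simp add: \<eta>_def abs_of_neg)
  then have "exp (- ?A - \<eta> j \<omega>) = exp (- ?A) * (1 - exp (- \<xi> j \<omega>))"
    using exp_add[of "- ?A" "- \<eta> j \<omega>"] e[of j] by simp
  moreover have "exp (- (?A + \<xi> j \<omega>)) = exp (- ?A) * exp (- \<xi> j \<omega>)"
    using exp_add[of "- ?A" "- \<xi> j \<omega>"] by simp
  ultimately show "Q j \<omega> - Q (Suc j) \<omega> = exp (- ?A - \<eta> j \<omega>)"
    unfolding Q by (simp add: right_diff_distrib)
qed

text \<open>Given the sticks, the count is binomial with success probability equal to the length of
  the interval. The sticks and the sample form independent blocks, so
  \<open>binomial_variance\<close> holds conditionally and hence on average.\<close>

lemma box_card_deviation:
  assumes n: "n \<ge> 1"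
  shows "(\<integral>\<^sup>+\<omega>. ennreal ((real (box_card n j \<omega>) - real n * (Q j \<omega> - Q (Suc j) \<omega>))\<^sup>2 / (real n * (Q j \<omega> - Q (Suc j) \<omega>))) \<partial>M) \<le> 1"
proof -
  let ?A = "Inl ` {1..Suc j} :: (nat + nat) set" and ?B = "Inr ` {1..n} :: (nat + nat) set"
  let ?q = "\<lambda>k f. \<Prod>i=1..k. f (Inl i) :: real"
  have comp: "(\<lambda>f. f (Inl i)) \<in> borel_measurable (PiM ?A (\<lambda>_. borel :: real measure))" if "i \<in> {1..Suc j}" for i
    using that by (intro measurable_component_singleton) auto
  let ?P = "PiM ?A (\<lambda>_. borel :: real measure)"
  let ?X = "\<lambda>\<omega>. restrict (\<lambda>i. case_sum Ws U i \<omega>) ?A"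
  have ind: "indep_var ?P ?X (PiM ?B (\<lambda>_. borel)) (\<lambda>\<omega>. restrict (\<lambda>i. case_sum Ws U i \<omega>) ?B)"
    by (rule indep_var_restrict[OF indep]) auto
  have q: "?q (Suc j) (?X \<omega>) = Q (Suc j) \<omega>" "?q j (?X \<omega>) = Q j \<omega>" for \<omega>
    by (auto simp: Q_def stick_Q_def intro!: prod.cong)
  have qm [measurable]: "(\<lambda>f. ?q (Suc j) f) \<in> borel_measurable ?P" "(\<lambda>f. ?q j f) \<in> borel_measurable ?P"
    by (intro borel_measurable_prod comp; simp)+
  define G where "G z = (let a = ?q (Suc j) (fst z); b = ?q j (fst z) in
      ennreal (((\<Sum>i=1..n. if a < snd z (Inr i) \<and> snd z (Inr i) \<le> b then 1 else 0) - real n * (b - a))\<^sup>2 / (real n * (b - a))))"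
    for z :: "(nat + nat \<Rightarrow> real) \<times> (nat + nat \<Rightarrow> real)"
  have Gm: "G \<in> borel_measurable (?P \<Otimes>\<^sub>M PiM ?B (\<lambda>_. borel))"
  proof -
    have [measurable]: "(\<lambda>z. snd z (Inr i)) \<in> borel_measurable (?P \<Otimes>\<^sub>M PiM ?B (\<lambda>_. borel :: real measure))" if "i \<in> {1..n}" for i
      using that by (intro measurable_compose[OF measurable_snd measurable_component_singleton]) auto
    have [measurable]: "(\<lambda>z. ?q (Suc j) (fst z)) \<in> borel_measurable (?P \<Otimes>\<^sub>M PiM ?B (\<lambda>_. borel :: real measure))"
      by (rule measurable_compose[OF measurable_fst qm(1)])
    have [measurable]: "(\<lambda>z. ?q j (fst z)) \<in> borel_measurable (?P \<Otimes>\<^sub>M PiM ?B (\<lambda>_. borel :: real measure))"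
      by (rule measurable_compose[OF measurable_fst qm(2)])
    have "(\<lambda>z. \<Sum>i=1..n. if ?q (Suc j) (fst z) < snd z (Inr i) \<and> snd z (Inr i) \<le> ?q j (fst z) then 1 else (0::real))
        \<in> borel_measurable (?P \<Otimes>\<^sub>M PiM ?B (\<lambda>_. borel))"
      by (rule borel_measurable_sum) measurable
    then show ?thesis unfolding G_def Let_def by measurable
  qed
  \<comment> \<open>The values of the factors for which the box is a nondegenerate subinterval of
    [0, 1], as \<open>binomial_variance\<close> requires; almost surely the factors take such
    values.\<close>
  define A where "A = {f \<in> space ?P. 0 \<le> ?q (Suc j) f \<and> ?q (Suc j) f < ?q j f \<and> ?q j f \<le> 1}"
  have A_sets: "A \<in> sets ?P" unfolding A_def by measurable
  have AE: "AE \<omega> in M. ?X \<omega> \<in> A"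
    using AE_Ws
  proof eventually_elim
    case (elim \<omega>)
    have "Q j \<omega> - Q (Suc j) \<omega> > 0" unfolding Q_eq(2)[OF elim] by simp
    moreover have "Q j \<omega> \<le> 1" unfolding Q_eq(1)[OF elim] by (simp add: sum_nonneg \<xi>_def)
    moreover have "Q (Suc j) \<omega> \<ge> 0" unfolding Q_eq(1)[OF elim] by simp
    moreover have "?X \<omega> \<in> space ?P" by (simp add: space_PiM)
    ultimately show ?case unfolding A_def mem_Collect_eq q by simp
  qed
  have "(\<integral>\<^sup>+\<omega>. G (?X \<omega>, restrict (\<lambda>i. case_sum Ws U i \<omega>) ?B) \<partial>M) \<le> 1"
  proof (rule nn_integral_indep_le[OF ind Gm AE A_sets])
    fix f assume f: "f \<in> A"
    define a b where "a = ?q (Suc j) f" and "b = ?q j f"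
    have ab: "0 \<le> a" "a < b" "b \<le> 1" using f by (auto simp: A_def a_def b_def)
    have "G (f, restrict (\<lambda>i. case_sum Ws U i \<omega>) ?B) = ennreal (((\<Sum>i=1..n. if a < U i \<omega> \<and> U i \<omega> \<le> b then 1 else 0) - real n * (b - a))\<^sup>2 / (real n * (b - a)))" for \<omega>
    proof -
      have "(\<Sum>i=1..n. if a < restrict (\<lambda>i. case_sum Ws U i \<omega>) ?B (Inr i) \<and> restrict (\<lambda>i. case_sum Ws U i \<omega>) ?B (Inr i) \<le> b then 1 else (0::real))
          = (\<Sum>i=1..n. if a < U i \<omega> \<and> U i \<omega> \<le> b then 1 else 0)" by (intro sum.cong) auto
      then show ?thesis unfolding G_def Let_def fst_conv snd_conv a_def[symmetric] b_def[symmetric] by simp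
    qed
    then show "(\<integral>\<^sup>+\<omega>. G (f, restrict (\<lambda>i. case_sum Ws U i \<omega>) ?B) \<partial>M) \<le> 1"
      using binomial_variance[OF ab n] by simp
  qed
  also have "(\<lambda>\<omega>. G (?X \<omega>, restrict (\<lambda>i. case_sum Ws U i \<omega>) ?B))
      = (\<lambda>\<omega>. ennreal ((real (box_card n j \<omega>) - real n * (Q j \<omega> - Q (Suc j) \<omega>))\<^sup>2 / (real n * (Q j \<omega> - Q (Suc j) \<omega>))))"
  proof
    fix \<omega>
    have "(\<Sum>i=1..n. if Q (Suc j) \<omega> < restrict (\<lambda>i. case_sum Ws U i \<omega>) ?B (Inr i) \<and> restrict (\<lambda>i. case_sum Ws U i \<omega>) ?B (Inr i) \<le> Q j \<omega> then 1 else (0::real))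
        = real (box_card n j \<omega>)" unfolding box_card_eq by (intro sum.cong) auto
    then show "G (?X \<omega>, restrict (\<lambda>i. case_sum Ws U i \<omega>) ?B)
      = ennreal ((real (box_card n j \<omega>) - real n * (Q j \<omega> - Q (Suc j) \<omega>))\<^sup>2 / (real n * (Q j \<omega> - Q (Suc j) \<omega>)))"
      unfolding G_def Let_def fst_conv snd_conv q by simp
  qed
  finally show ?thesis .
qed

text \<open>The conditional mean n (Q j - Q (j + 1)) equals exp (ln n - S j - \<eta> j), so
  \<open>abs_ln_diff_le\<close> applies; the constant is 1 + 4 times the bound 1 for the normalized
  squared deviation.\<close>

lemma box_card_ln_L1:
  fixes n j :: nat
  assumes n: "n \<ge> 1"
  defines "E \<equiv> \<lambda>\<omega>. ln (real (box_card n j \<omega>)) - max 0 (ln (real n) - (\<Sum>i<j. \<xi> i \<omega>) - \<eta> j \<omega>)"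
  shows "integrable M E" and "expectation (\<lambda>\<omega>. \<bar>E \<omega>\<bar>) \<le> 5"
proof -
  have [measurable]: "E \<in> borel_measurable M" unfolding E_def by measurable
  let ?D = "\<lambda>\<omega>. (real (box_card n j \<omega>) - real n * (Q j \<omega> - Q (Suc j) \<omega>))\<^sup>2 / (real n * (Q j \<omega> - Q (Suc j) \<omega>))"
  have gen: "ennreal (1 + 4 * D) = 1 + 4 * ennreal D" if "0 \<le> D" for D
    using that by (simp add: ennreal_mult')
  have "AE \<omega> in M. ennreal \<bar>E \<omega>\<bar> \<le> 1 + 4 * ennreal (?D \<omega>)"
    using AE_Ws
  proof eventually_elim
    case (elim \<omega>)
    define y where "y = real n * (Q j \<omega> - Q (Suc j) \<omega>)"
    have y: "y = exp (ln (real n) - (\<Sum>i<j. \<xi> i \<omega>) - \<eta> j \<omega>)"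
      using n exp_add[of "ln (real n)" "- (\<Sum>i<j. \<xi> i \<omega>) - \<eta> j \<omega>"] unfolding y_def Q_eq(2)[OF elim]
      by (simp add: algebra_simps)
    have yp: "y > 0" unfolding y by simp
    have "\<bar>E \<omega>\<bar> = \<bar>ln (real (box_card n j \<omega>)) - max 0 (ln y)\<bar>" unfolding y E_def by simp
    also have "\<dots> \<le> 1 + 4 * ((real (box_card n j \<omega>) - y)\<^sup>2 / y)" by (rule abs_ln_diff_le[OF yp])
    finally have "ennreal \<bar>E \<omega>\<bar> \<le> ennreal (1 + 4 * ?D \<omega>)" unfolding y_def by (rule ennreal_leI)
    also have "\<dots> = 1 + 4 * ennreal (?D \<omega>)"
    proof (rule gen)
      show "0 \<le> ?D \<omega>" using yp unfolding y_def by (intro divide_nonneg_nonneg) auto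
    qed
    finally show ?case .
  qed
  then have "(\<integral>\<^sup>+\<omega>. ennreal \<bar>E \<omega>\<bar> \<partial>M) \<le> (\<integral>\<^sup>+\<omega>. 1 + 4 * ennreal (?D \<omega>) \<partial>M)" by (rule nn_integral_mono_AE)
  also have "\<dots> = 1 + 4 * (\<integral>\<^sup>+\<omega>. ennreal (?D \<omega>) \<partial>M)"
    by (subst nn_integral_add) (auto simp: nn_integral_cmult emeasure_space_1)
  also have "\<dots> \<le> 1 + 4 * 1" by (intro add_left_mono mult_left_mono box_card_deviation n) auto
  finally have le: "(\<integral>\<^sup>+\<omega>. ennreal \<bar>E \<omega>\<bar> \<partial>M) \<le> ennreal 5" by simp
  then show i: "integrable M E" by (intro integrableI_bounded) (auto intro: le_less_trans)
  have "ennreal (expectation (\<lambda>\<omega>. \<bar>E \<omega>\<bar>)) = (\<integral>\<^sup>+\<omega>. ennreal \<bar>E \<omega>\<bar> \<partial>M)"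
    using i by (intro nn_integral_eq_integral[symmetric]) auto
  also have "\<dots> \<le> ennreal 5" by (rule le)
  finally show "expectation (\<lambda>\<omega>. \<bar>E \<omega>\<bar>) \<le> 5" by (subst (asm) ennreal_le_iff) auto
qed

text \<open>Once Q at the truncation index is at most 1 / n, this count bounds what the truncation
  discards.\<close>

lemma small_points_L1:
  fixes n :: nat
  assumes n: "n \<ge> 1"
  defines "R \<equiv> \<lambda>\<omega>. real (card {i \<in> {1..n}. U i \<omega> \<le> 1 / real n})"
  shows "integrable M R" and "expectation R \<le> 1"
proof -
  have R: "R \<omega> = (\<Sum>i=1..n. indicator {..1 / real n} (U i \<omega>))" for \<omega>
    unfolding R_def by (simp add: indicator_def sum.If_cases Int_def)
  have int: "integrable M (\<lambda>\<omega>. indicator {..1 / real n} (U i \<omega>) :: real)" if "i \<in> {1..n}" for i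
  proof -
    have [measurable]: "U i \<in> borel_measurable M" using that by simp
    show ?thesis by (intro integrable_const_bound[where B = 1]) (auto simp: indicator_def)
  qed
  have E: "expectation (\<lambda>\<omega>. indicator {..1 / real n} (U i \<omega>) :: real) = 1 / real n" if "i \<in> {1..n}" for i
  proof -
    have [measurable]: "U i \<in> borel_measurable M" using that by simp
    have "expectation (\<lambda>\<omega>. indicator {..1 / real n} (U i \<omega>) :: real) = (LINT x|distr M borel (U i). indicator {..1 / real n} x)"
      by (rule integral_distr[symmetric]) auto
    also have "\<dots> = measure (uniform_measure lborel {0..1}) {..1 / real n}"
      using that by (simp add: U_distr)
    also have "\<dots> = 1 / real n"
    proof -
      have "{0..1} \<inter> {..1 / real n} = {0..1 / real n}" using n by (auto simp: field_simps)
      then show ?thesis using n by (simp add: measure_uniform_measure)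
    qed
    finally show ?thesis .
  qed
  show "integrable M R" unfolding R using int by auto
  have "expectation R = (\<Sum>i=1..n. 1 / real n)" unfolding R using int E by (simp add: Bochner_Integration.integral_sum)
  then show "expectation R \<le> 1" using n by simp
qed

end

lemma tight_if_L1_bounded:
  assumes "prob_space M" and m: "\<And>n. Y n \<in> borel_measurable M"
    and b: "\<And>n. integrable M (Y n) \<and> (\<integral>\<omega>. \<bar>Y n \<omega>\<bar> \<partial>M) \<le> (K::real)"
  shows "tight (\<lambda>n. distr M borel (Y n))"
  unfolding tight_def
proof (intro conjI allI impI)
  interpret prob_space M by fact
  note [measurable] = m
  show "real_distribution (distr M borel (Y n))" for n by simp
  fix \<epsilon> :: real assume \<epsilon>: "\<epsilon> > 0"
  define B where "B = (\<bar>K\<bar> + 1) / \<epsilon>"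
  have B: "B > 0" using \<epsilon> by (simp add: B_def)
  have "measure (distr M borel (Y n)) {-B<..B} > 1 - \<epsilon>" for n
  proof -
    have "prob {\<omega> \<in> space M. B \<le> \<bar>Y n \<omega>\<bar>} \<le> expectation (\<lambda>\<omega>. \<bar>Y n \<omega>\<bar>) / B"
      using b B by (intro integral_Markov_inequality_measure[where A = "{}"]) auto
    also have "\<dots> \<le> K / B" using b B by (intro divide_right_mono) auto
    also have "\<dots> < \<epsilon>"
    proof -
      have "K < \<epsilon> * B" using \<epsilon> by (simp add: B_def)
      then show ?thesis using B by (simp add: pos_divide_less_eq)
    qed
    finally have 1: "prob {\<omega> \<in> space M. B \<le> \<bar>Y n \<omega>\<bar>} < \<epsilon>" .
    have "1 - prob {\<omega> \<in> space M. B \<le> \<bar>Y n \<omega>\<bar>} = prob (space M - {\<omega> \<in> space M. B \<le> \<bar>Y n \<omega>\<bar>})"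
      by (rule prob_compl[symmetric]) measurable
    also have "\<dots> \<le> prob (Y n -` {-B<..B} \<inter> space M)" by (rule finite_measure_mono) auto
    also have "\<dots> = measure (distr M borel (Y n)) {-B<..B}" by (rule measure_distr[symmetric]) auto
    finally show ?thesis using 1 by linarith
  qed
  then show "\<exists>a b. a < b \<and> (\<forall>n. 1 - \<epsilon> < measure (distr M borel (Y n)) {a<..b})"
    using B by (intro exI[of _ "-B"] exI[of _ B]) auto
qed

lemma char_distr_divide:
  assumes [measurable]: "Y \<in> borel_measurable M"
  shows "char (distr M borel (\<lambda>\<omega>. Y \<omega> / K)) u = char (distr M borel Y) (u / K)"
  unfolding char_def by (subst (1 2) integral_distr) (auto simp: mult_ac)

section \<open>From the product of cycle lengths to the weighted sum\<close>

context stick_breaking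
begin

abbreviation (input) lnT :: "nat \<Rightarrow> 'a \<Rightarrow> real" where
  "lnT n \<omega> \<equiv> ln (real (cycle_length_prod (stick_perm (\<lambda>i. Ws i \<omega>) (\<lambda>i. U i \<omega>) n) n))"

lemma lnT_measurable [measurable]: "(\<lambda>\<omega>. lnT n \<omega>) \<in> borel_measurable M"
  by (intro borel_measurable_ln measurable_cycle_length_prod) auto

lemma prob_\<eta>_W: "prob {\<omega> \<in> space M. x < \<eta> 0 \<omega>} = measure M {\<omega> \<in> space M. \<bar>ln (1 - W \<omega>)\<bar> > x}"
proof -
  have D: "distr M borel (\<eta> 0) = distr M borel (\<lambda>\<omega>. \<bar>ln (1 - W \<omega>)\<bar>)"
    unfolding \<eta>_def[abs_def] by (rule distr_Ws_Suc) measurable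
  have "prob {\<omega> \<in> space M. x < \<eta> 0 \<omega>} = measure (distr M borel (\<eta> 0)) {x<..}"
    by (subst measure_distr) (auto intro!: arg_cong[where f = prob])
  also have "\<dots> = prob {\<omega> \<in> space M. x < \<bar>ln (1 - W \<omega>)\<bar>}"
    unfolding D by (subst measure_distr) (auto intro!: arg_cong[where f = prob])
  finally show ?thesis .
qed

context
  fixes g :: "real \<Rightarrow> real" and C x0 :: real and d :: "nat \<Rightarrow> real"
  assumes reg: "renewal_regime M \<xi> \<eta> (mean_abs_log M W) g C x0 (\<lambda>n. ln (real n)) d"
begin

interpretation R: renewal_regime M \<xi> \<eta> "mean_abs_log M W" g C x0 "\<lambda>n. ln (real n)" d
  by (rule reg)

lemma centering_eq:
  assumes "n \<ge> 1"
  shows "centering M W n = ((ln (real n))\<^sup>2 / 2 - (LINT y|lborel. indicator {0..ln (real n)} y * R.f y)) / mean_abs_log M W"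
proof -
  interpret Y: nonneg_rv M "\<eta> 0" by unfold_locales (auto simp: \<eta>_def)
  have "(LBINT x:{0..z}. measure M {\<omega> \<in> space M. \<bar>ln (1 - W \<omega>)\<bar> > x}) = R.f z" if "z \<ge> 0" for z
  proof -
    have "R.f z = (LINT x|lborel. indicator {0..z} x * Y.tail x)"
      unfolding R.f_def using Y.expectation_min_eq_tail[OF that] that by simp
    then show ?thesis unfolding set_lebesgue_integral_def Y.tail_def by (simp add: prob_\<eta>_W)
  qed
  then have "(LBINT z:{0..ln (real n)}. LBINT x:{0..z}. measure M {\<omega> \<in> space M. \<bar>ln (1 - W \<omega>)\<bar> > x}) = (LBINT z:{0..ln (real n)}. R.f z)"
    by (intro set_lebesgue_integral_cong) auto
  then show ?thesis unfolding centering_def by (simp add: set_lebesgue_integral_def)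
qed

text \<open>Each of the O(ln n) boxes contributes a mean error of at most 5, and the normalization
  has the additional factor \<open>d n\<close>.\<close>

lemma box_sum_vanish:
  "prob_vanish M (\<lambda>n \<omega>. ((\<Sum>j<R.J n. ln (real (box_card n j \<omega>))) - (\<Sum>j<R.J n. max 0 (ln (real n) - R.S j \<omega> - \<eta> j \<omega>))) / (ln (real n) * d n))"
proof -
  let ?B = "2 / mean_abs_log M W + 3"
  let ?E = "\<lambda>n j \<omega>. ln (real (box_card n j \<omega>)) - max 0 (ln (real n) - (\<Sum>i<j. \<xi> i \<omega>) - \<eta> j \<omega>)"
  have eq: "(\<Sum>j<R.J n. ln (real (box_card n j \<omega>))) - (\<Sum>j<R.J n. max 0 (ln (real n) - R.S j \<omega> - \<eta> j \<omega>)) = (\<Sum>j<R.J n. ?E n j \<omega>)" for n \<omega>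
    by (simp add: sum_subtractf R.S_def)
  show ?thesis
    unfolding eq
  proof (rule prob_vanish_L1[where e = "\<lambda>n. ?B * 5 / d n"])
    show "(\<lambda>n. ?B * 5 / d n) \<longlonglongrightarrow> 0"
      by (intro tendsto_divide_0[OF tendsto_const] filterlim_at_top_imp_at_infinity R.d_lim)
    show "eventually (\<lambda>n. integrable M (\<lambda>\<omega>. (\<Sum>j<R.J n. ?E n j \<omega>) / (ln (real n) * d n))
        \<and> expectation (\<lambda>\<omega>. \<bar>(\<Sum>j<R.J n. ?E n j \<omega>) / (ln (real n) * d n)\<bar>) \<le> ?B * 5 / d n) sequentially"
      using eventually_ge_at_top[of "1::nat"] R.t_gt[of 1] R.d_gt[of 0]
    proof eventually_elim
      case (elim n)
      have L: "ln (real n) > 0" and dn: "d n > 0" using elim by linarith+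
      have int: "integrable M (?E n j)" for j using box_card_ln_L1(1)[OF elim(1)] .
      have "expectation (\<lambda>\<omega>. \<bar>\<Sum>j<R.J n. ?E n j \<omega>\<bar>) \<le> expectation (\<lambda>\<omega>. \<Sum>j<R.J n. \<bar>?E n j \<omega>\<bar>)"
        using int by (intro integral_mono sum_abs integrable_abs Bochner_Integration.integrable_sum) auto
      also have "\<dots> = (\<Sum>j<R.J n. expectation (\<lambda>\<omega>. \<bar>?E n j \<omega>\<bar>))"
        using int by (intro Bochner_Integration.integral_sum integrable_abs)
      also have "\<dots> \<le> (\<Sum>j<R.J n. 5)" by (intro sum_mono box_card_ln_L1(2) elim)
      also have "\<dots> = real (R.J n) * 5" by simp
      also have "\<dots> \<le> (?B * ln (real n)) * 5" using R.J_bounds[of n] elim by (intro mult_right_mono) auto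
      finally have "expectation (\<lambda>\<omega>. \<bar>\<Sum>j<R.J n. ?E n j \<omega>\<bar>) / (ln (real n) * d n) \<le> (?B * ln (real n)) * 5 / (ln (real n) * d n)"
        using L dn by (intro divide_right_mono) auto
      also have "\<dots> = ?B * 5 / d n" using L by (simp only: mult.commute mult.left_commute mult_divide_mult_cancel_left_if) simp
      finally have "expectation (\<lambda>\<omega>. \<bar>(\<Sum>j<R.J n. ?E n j \<omega>) / (ln (real n) * d n)\<bar>) \<le> ?B * 5 / d n"
        using L dn by (simp add: abs_divide abs_mult)
      moreover have "integrable M (\<lambda>\<omega>. (\<Sum>j<R.J n. ?E n j \<omega>) / (ln (real n) * d n))"
        using int by (intro integrable_divide Bochner_Integration.integrable_sum)
      ultimately show ?case by blast
    qed
  qed measurable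
qed

text \<open>Outside the event \<open>A n\<close> the walk at index \<open>J n\<close> has passed ln
  n, so Q there is at most 1 / n. The discarded boxes then contribute no more than the number of
  sample points below 1 / n, which has mean at most 1.\<close>

lemma lnT_box_sum_vanish:
  "prob_vanish M (\<lambda>n \<omega>. (lnT n \<omega> - (\<Sum>j<R.J n. ln (real (box_card n j \<omega>)))) / (ln (real n) * d n))"
proof -
  define A where "A n = {\<omega> \<in> space M. 1 * ln (real n) \<le> \<bar>R.S (R.J n) \<omega> - real (R.J n) * mean_abs_log M W\<bar>}" for n
  have A: "(\<lambda>n. prob (A n)) \<longlonglongrightarrow> 0" unfolding A_def
  proof (rule R.prob_S_deviation[of "2 / mean_abs_log M W + 3"])
    show "eventually (\<lambda>n. real (R.J n) \<le> (2 / mean_abs_log M W + 3) * ln (real n)) sequentially"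
      using R.t_gt[of 1] by eventually_elim (use R.J_bounds in auto)
  qed (use R.\<mu>_pos in auto)
  let ?R = "\<lambda>n \<omega>. real (card {i \<in> {1..n}. U i \<omega> \<le> 1 / real n})"
  have Rm: "(\<lambda>\<omega>. ?R n \<omega>) \<in> borel_measurable M" for n
  proof (cases "n \<ge> 1")
    case True
    then show ?thesis using small_points_L1(1) by (auto dest: borel_measurable_integrable)
  qed simp
  have D: "prob_vanish M (\<lambda>n \<omega>. ?R n \<omega> / (ln (real n) * d n))"
  proof (rule prob_vanish_L1[where e = "\<lambda>n. 1 / d n"])
    show "(\<lambda>\<omega>. ?R n \<omega> / (ln (real n) * d n)) \<in> borel_measurable M" for n using Rm by (rule borel_measurable_divide) simp
    show "(\<lambda>n. 1 / d n) \<longlonglongrightarrow> 0"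
      by (intro tendsto_divide_0[OF tendsto_const] filterlim_at_top_imp_at_infinity R.d_lim)
    show "eventually (\<lambda>n. integrable M (\<lambda>\<omega>. ?R n \<omega> / (ln (real n) * d n)) \<and> expectation (\<lambda>\<omega>. \<bar>?R n \<omega> / (ln (real n) * d n)\<bar>) \<le> 1 / d n) sequentially"
      using eventually_ge_at_top[of "1::nat"] R.t_gt[of 1] R.d_gt[of 0]
    proof eventually_elim
      case (elim n)
      have L: "ln (real n) > 0" and dn: "d n > 0" using elim by linarith+
      have "expectation (?R n) / (ln (real n) * d n) \<le> 1 / (ln (real n) * d n)"
        using small_points_L1(2)[OF elim(1)] L dn by (intro divide_right_mono) auto
      also have "\<dots> \<le> 1 / (1 * d n)"
        using less_imp_le[OF elim(2)] L dn by (intro divide_left_mono mult_right_mono mult_pos_pos) (assumption | simp)+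
      finally have "expectation (\<lambda>\<omega>. \<bar>?R n \<omega> / (ln (real n) * d n)\<bar>) \<le> 1 / d n"
        using L dn by (simp add: abs_mult)
      moreover have "integrable M (\<lambda>\<omega>. ?R n \<omega> / (ln (real n) * d n))" using small_points_L1(1)[OF elim(1)] by simp
      ultimately show ?case by blast
    qed
  qed
  show ?thesis
  proof (rule prob_vanish_dominated[OF D _ A])
    show "A n \<in> events" for n unfolding A_def by measurable
    show "(\<lambda>\<omega>. (lnT n \<omega> - (\<Sum>j<R.J n. ln (real (box_card n j \<omega>)))) / (ln (real n) * d n)) \<in> borel_measurable M" for n
      by (intro borel_measurable_divide borel_measurable_diff lnT_measurable borel_measurable_sum borel_measurable_ln box_card_measurable) auto
    show "eventually (\<lambda>n. AE \<omega> in M. \<omega> \<notin> A n \<longrightarrow> \<bar>(lnT n \<omega> - (\<Sum>j<R.J n. ln (real (box_card n j \<omega>)))) / (ln (real n) * d n)\<bar>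
        \<le> \<bar>?R n \<omega> / (ln (real n) * d n)\<bar>) sequentially"
      using eventually_ge_at_top[of "1::nat"] R.t_gt[of 1]
    proof eventually_elim
      case (elim n)
      show ?case using AE_Ws AE_U_inj[of n] AE_space
      proof eventually_elim
        case (elim \<omega>)
        show ?case
        proof
          assume nA: "\<omega> \<notin> A n"
          have "\<bar>R.S (R.J n) \<omega> - real (R.J n) * mean_abs_log M W\<bar> < ln (real n)"
            using nA elim by (auto simp: A_def)
          then have S: "R.S (R.J n) \<omega> > ln (real n)" using R.J_bounds[of n] \<open>1 < ln (real n)\<close> by simp linarith
          have "Q (R.J n) \<omega> = exp (- R.S (R.J n) \<omega>)" unfolding Q_eq(1)[OF elim(1)] R.S_def ..
          also have "\<dots> \<le> exp (- ln (real n))" using S by simp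
          also have "\<dots> = 1 / real n" using \<open>1 \<le> n\<close> by (simp add: exp_minus inverse_eq_divide)
          finally have Q: "Q (R.J n) \<omega> \<le> 1 / real n" .
          have "\<bar>lnT n \<omega> - (\<Sum>j<R.J n. ln (real (box_card n j \<omega>)))\<bar> \<le> real (card {i \<in> {1..n}. U i \<omega> \<le> Q (R.J n) \<omega>})"
            unfolding box_card_def Q_def using elim(1,2) by (intro ln_cycle_length_prod_truncate) auto
          also have "\<dots> \<le> ?R n \<omega>" using Q by (intro of_nat_mono card_mono) auto
          finally have "\<bar>lnT n \<omega> - (\<Sum>j<R.J n. ln (real (box_card n j \<omega>)))\<bar> \<le> \<bar>?R n \<omega>\<bar>" by simp
          from divide_right_mono[OF this, of "\<bar>ln (real n) * d n\<bar>"]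
          show "\<bar>(lnT n \<omega> - (\<Sum>j<R.J n. ln (real (box_card n j \<omega>)))) / (ln (real n) * d n)\<bar> \<le> \<bar>?R n \<omega> / (ln (real n) * d n)\<bar>"
            unfolding abs_divide by simp
        qed
      qed
    qed
  qed
qed

lemma lnT_approx: "prob_vanish M (\<lambda>n \<omega>. (lnT n \<omega> - centering M W n) / (ln (real n) * d n) - R.Z n \<omega>)"
proof (rule prob_vanish_mono[OF prob_vanish_add[OF prob_vanish_add[OF lnT_box_sum_vanish box_sum_vanish] R.perturbed_sum_approx]])
  show "eventually (\<lambda>n. AE \<omega> in M. \<bar>(lnT n \<omega> - centering M W n) / (ln (real n) * d n) - R.Z n \<omega>\<bar>
     \<le> \<bar>(lnT n \<omega> - (\<Sum>j<R.J n. ln (real (box_card n j \<omega>)))) / (ln (real n) * d n) +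
         ((\<Sum>j<R.J n. ln (real (box_card n j \<omega>))) - (\<Sum>j<R.J n. max 0 (ln (real n) - R.S j \<omega> - \<eta> j \<omega>))) / (ln (real n) * d n) +
         ((\<Sum>j<R.J n. max 0 (ln (real n) - R.S j \<omega> - \<eta> j \<omega>))
     - ((ln (real n))\<^sup>2 / 2 - (LINT y|lborel. indicator {0..ln (real n)} y * R.f y)) / mean_abs_log M W
     + (\<Sum>j<R.m n. R.S j \<omega> - real j * mean_abs_log M W)) / (ln (real n) * d n)\<bar>) sequentially"
    using eventually_ge_at_top[of "1::nat"]
  proof eventually_elim
    case (elim n)
    show ?case unfolding centering_eq[OF elim] R.Z_def
      by (intro AE_I2 eq_refl arg_cong[where f = abs]) (simp add: add_divide_distrib diff_divide_distrib)
  qed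
qed measurable

theorem char_lnT_tendsto:
  assumes g: "mono g" "\<And>s. g s \<ge> 0"
    and rv: "\<And>c. c > 0 \<Longrightarrow> ((\<lambda>s. g (c * s) / g s) \<longlongrightarrow> c powr \<alpha>) (at_right 0)"
    and \<phi>: "((\<lambda>s. (char (distr M borel (\<lambda>\<omega>. \<xi> 0 \<omega> - mean_abs_log M W)) s - 1) / of_real (g s)) \<longlongrightarrow> - \<kappa>) (at_right 0)"
    and \<alpha>: "\<alpha> > 0" and K: "K > 0"
  shows "(\<lambda>n. char (distr M borel (\<lambda>\<omega>. (lnT n \<omega> - centering M W n) / (K * ln (real n) * d n))) u)
    \<longlonglongrightarrow> exp (- (if u > 0 then cnj \<kappa> else \<kappa>) * of_real ((\<bar>u\<bar> / K) powr \<alpha> * (1 / mean_abs_log M W) powr (\<alpha> + 1) / (\<alpha> + 1)))" (is "_ \<longlonglongrightarrow> ?L")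
proof -
  let ?Y = "\<lambda>n \<omega>. (lnT n \<omega> - centering M W n) / (ln (real n) * d n)"
  have "(\<lambda>n. char (distr M borel (R.Z n)) (u / K)) \<longlonglongrightarrow> exp (- (if u / K > 0 then cnj \<kappa> else \<kappa>) * of_real (\<bar>u / K\<bar> powr \<alpha> * (1 / mean_abs_log M W) powr (\<alpha> + 1) / (\<alpha> + 1)))"
    using \<phi> unfolding R.\<phi>_def[symmetric] by (intro R.char_Z_tendsto g rv \<alpha>)
  then have Z: "(\<lambda>n. char (distr M borel (R.Z n)) (u / K)) \<longlonglongrightarrow> ?L"
    using K by (simp add: zero_less_divide_iff)
  have D: "(\<lambda>n. char (distr M borel (?Y n)) (u / K) - char (distr M borel (R.Z n)) (u / K)) \<longlonglongrightarrow> 0"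
    by (rule char_diff_tendsto_0[OF _ _ lnT_approx]) measurable
  have "(\<lambda>n. char (distr M borel (?Y n)) (u / K)) \<longlonglongrightarrow> ?L"
    using tendsto_add[OF D Z] by simp
  moreover have "char (distr M borel (\<lambda>\<omega>. (lnT n \<omega> - centering M W n) / (K * ln (real n) * d n))) u = char (distr M borel (?Y n)) (u / K)" for n
    using char_distr_divide[of "?Y n" M K u] by (simp add: mult_ac)
  ultimately show ?thesis by simp
qed

text \<open>The approximating weighted sums are bounded in \<open>L\<^sup>1\<close>, so a subsequence converges weakly.\<close>

lemma ex_limit_law:
  assumes K: "K > 0"
    and lim: "\<And>u. (\<lambda>n. char (distr M borel (\<lambda>\<omega>. (lnT n \<omega> - centering M W n) / (K * ln (real n) * d n))) u) \<longlonglongrightarrow> \<Phi> u"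
  shows "\<exists>\<nu>. real_distribution \<nu> \<and> (\<forall>u. char \<nu> u = \<Phi> u) \<and>
    weak_conv_m (\<lambda>n. distr M borel (\<lambda>\<omega>. (lnT n \<omega> - centering M W n) / (K * ln (real n) * d n))) \<nu>"
proof -
  let ?Y = "\<lambda>n \<omega>. (lnT n \<omega> - centering M W n) / (ln (real n) * d n)"
  have char_eq: "char (distr M borel (\<lambda>\<omega>. (lnT n \<omega> - centering M W n) / (K * ln (real n) * d n))) u = char (distr M borel (?Y n)) (u / K)" for n u
    using char_distr_divide[of "?Y n" M K u] by (simp add: mult_ac)
  have D: "(\<lambda>n. char (distr M borel (?Y n)) v - char (distr M borel (R.Z n)) v) \<longlonglongrightarrow> 0" for v
    by (rule char_diff_tendsto_0[OF _ _ lnT_approx]) measurable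
  obtain B where "eventually (\<lambda>n. integrable M (R.Z n) \<and> expectation (\<lambda>\<omega>. \<bar>R.Z n \<omega>\<bar>) \<le> B) sequentially"
    using R.Z_L1 by blast
  then obtain n0 where n0: "\<And>n. n \<ge> n0 \<Longrightarrow> integrable M (R.Z n) \<and> expectation (\<lambda>\<omega>. \<bar>R.Z n \<omega>\<bar>) \<le> B"
    by (auto simp: eventually_sequentially)
  \<comment> \<open>Tightness concerns all members of the sequence, whereas the bound in mean holds
    only from \<open>n0\<close> on; hence the shift of the index.\<close>
  let ?X = "\<lambda>n \<omega>. R.Z (n + n0) \<omega> / K"
  have tight: "tight (\<lambda>n. distr M borel (?X n))"
  proof (rule tight_if_L1_bounded[where K = "B / K"])
    show "prob_space M" by unfold_locales
    show "integrable M (?X n) \<and> expectation (\<lambda>\<omega>. \<bar>?X n \<omega>\<bar>) \<le> B / K" for n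
      using n0[of "n + n0"] K by (auto simp: abs_divide divide_right_mono)
  qed measurable
  obtain r \<nu> where r: "strict_mono (r :: nat \<Rightarrow> nat)" "real_distribution \<nu>" "weak_conv_m ((\<lambda>n. distr M borel (?X n)) \<circ> id \<circ> r) \<nu>"
    using tight_imp_convergent_subsubsequence[OF tight strict_mono_id] by blast
  have \<nu>: "char \<nu> u = \<Phi> u" for u
  proof (rule LIMSEQ_unique)
    have w: "weak_conv_m (\<lambda>n. distr M borel (?X (r n))) \<nu>" using r(3) by (simp add: comp_def)
    show "(\<lambda>n. char (distr M borel (?X (r n))) u) \<longlonglongrightarrow> char \<nu> u"
      by (rule levy_continuity1[OF _ r(2) w]) simp
    have "(\<lambda>n. char (distr M borel (R.Z n)) (u / K)) \<longlonglongrightarrow> \<Phi> u"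
      using tendsto_diff[OF lim[of u] D[of "u / K"]] unfolding char_eq by simp
    then have "(\<lambda>n. char (distr M borel (R.Z (n + n0))) (u / K)) \<longlonglongrightarrow> \<Phi> u" by (rule LIMSEQ_ignore_initial_segment)
    then have "(\<lambda>n. char (distr M borel (?X n)) u) \<longlonglongrightarrow> \<Phi> u" by (simp add: char_distr_divide)
    from LIMSEQ_subseq_LIMSEQ[OF this r(1)]
    show "(\<lambda>n. char (distr M borel (?X (r n))) u) \<longlonglongrightarrow> \<Phi> u" by (simp add: comp_def)
  qed
  \<comment> \<open>The subsequence served only to show that \<Phi> is a characteristic function;
    pointwise convergence along the full sequence now gives weak convergence.\<close>
  have "weak_conv_m (\<lambda>n. distr M borel (\<lambda>\<omega>. (lnT n \<omega> - centering M W n) / (K * ln (real n) * d n))) \<nu>"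
    by (rule levy_continuity[OF _ r(2)]) (use lim \<nu> in auto)
  then show ?thesis using r(2) \<nu> by blast
qed

end

end

section \<open>The limit laws\<close>

text \<open>The remainder of the second-order expansion is controlled by the mean of min(6 X^2, |s|
  |X|^3), which vanishes with s by dominated convergence without a third moment. To use convergence
  at infinity, s is written as 1 / x.\<close>

lemma (in prob_space) char_square_integrable_asymp:
  assumes [measurable]: "X \<in> borel_measurable M"
    and X: "integrable M X" "integrable M (\<lambda>\<omega>. (X \<omega>)\<^sup>2)" "expectation X = 0"
  shows "((\<lambda>s. (char (distr M borel X) s - 1) / of_real (s\<^sup>2)) \<longlongrightarrow> - of_real (expectation (\<lambda>\<omega>. (X \<omega>)\<^sup>2) / 2)) (at_right 0)"
proof -
  define v where "v = expectation (\<lambda>\<omega>. (X \<omega>)\<^sup>2)"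
  define e where "e s = expectation (\<lambda>\<omega>. min (6 * (X \<omega>)\<^sup>2) (\<bar>s\<bar> * \<bar>X \<omega>\<bar> ^ 3))" for s
  have "((\<lambda>x. e (inverse x)) \<longlongrightarrow> expectation (\<lambda>\<omega>. 0)) at_top"
    unfolding e_def
  proof (rule integral_dominated_convergence_at_top[where w = "\<lambda>\<omega>. 6 * (X \<omega>)\<^sup>2"])
    show "AE \<omega> in M. ((\<lambda>x. min (6 * (X \<omega>)\<^sup>2) (\<bar>inverse x\<bar> * \<bar>X \<omega>\<bar> ^ 3)) \<longlongrightarrow> 0) at_top"
    proof (rule AE_I2)
      fix \<omega>
      have "((\<lambda>x. min (6 * (X \<omega>)\<^sup>2) (\<bar>inverse x\<bar> * \<bar>X \<omega>\<bar> ^ 3)) \<longlongrightarrow> min (6 * (X \<omega>)\<^sup>2) (\<bar>0\<bar> * \<bar>X \<omega>\<bar> ^ 3)) at_top"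
        by (intro tendsto_intros tendsto_inverse_0_at_top filterlim_ident)
      then show "((\<lambda>x. min (6 * (X \<omega>)\<^sup>2) (\<bar>inverse x\<bar> * \<bar>X \<omega>\<bar> ^ 3)) \<longlongrightarrow> 0) at_top" by simp
    qed
    show "eventually (\<lambda>x. AE \<omega> in M. norm (min (6 * (X \<omega>)\<^sup>2) (\<bar>inverse x\<bar> * \<bar>X \<omega>\<bar> ^ 3)) \<le> 6 * (X \<omega>)\<^sup>2) at_top"
      by (intro always_eventually allI AE_I2) (auto simp: abs_le_iff min_def)
  qed (use X in auto)
  then have e: "((\<lambda>x. e (inverse x) / 6) \<longlongrightarrow> 0) at_top" using tendsto_divide[OF _ tendsto_const[of 6]] by fastforce
  have "((\<lambda>x. (char (distr M borel X) (inverse x) - 1) / of_real ((inverse x)\<^sup>2) - (- of_real (v / 2))) \<longlongrightarrow> 0) at_top"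
  proof (rule Lim_null_comparison[OF _ e])
    show "eventually (\<lambda>x. norm ((char (distr M borel X) (inverse x) - 1) / of_real ((inverse x)\<^sup>2) - (- of_real (v / 2))) \<le> e (inverse x) / 6) at_top"
      using eventually_gt_at_top[of 0]
    proof eventually_elim
      case (elim x)
      define s where "s = inverse x"
      have s: "s > 0" using elim by (simp add: s_def)
      have var: "expectation (\<lambda>\<omega>. (X \<omega> - expectation X)\<^sup>2) = v" using X by (simp add: v_def)
      have c: "cmod (char (distr M borel X) s - (1 - s\<^sup>2 * v / 2)) \<le> s\<^sup>2 / 6 * e s"
        unfolding e_def using X var by (intro char_approx3') auto
      have "(char (distr M borel X) s - 1) / of_real (s\<^sup>2) - (- of_real (v / 2)) = (char (distr M borel X) s - (1 - s\<^sup>2 * v / 2)) / of_real (s\<^sup>2)"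
        using s by (simp add: field_simps)
      then have "norm ((char (distr M borel X) s - 1) / of_real (s\<^sup>2) - (- of_real (v / 2))) = cmod (char (distr M borel X) s - (1 - s\<^sup>2 * v / 2)) / s\<^sup>2"
        by (simp add: norm_divide norm_power)
      also have "cmod (char (distr M borel X) s - (1 - s\<^sup>2 * v / 2)) / s\<^sup>2 \<le> (s\<^sup>2 / 6 * e s) / s\<^sup>2"
        using c by (intro divide_right_mono) auto
      also have "(s\<^sup>2 / 6 * e s) / s\<^sup>2 = e s / 6" using s by simp
      finally show ?case unfolding s_def .
    qed
  qed
  then have "((\<lambda>x. (char (distr M borel X) (inverse x) - 1) / of_real ((inverse x)\<^sup>2)) \<longlongrightarrow> - of_real (v / 2)) at_top"
    by (rule LIM_zero_cancel)
  then show ?thesis unfolding v_def by (simp add: filterlim_at_right_to_top)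
qed

lemma filterlim_ln_nat: "filterlim (\<lambda>n. ln (real n)) at_top sequentially"
  by (rule filterlim_compose[OF ln_at_top filterlim_real_sequentially])

lemma filterlim_nat_floor_ln: "filterlim (\<lambda>n. nat \<lfloor>ln (real n)\<rfloor>) at_top sequentially"
  by (intro filterlim_compose[OF filterlim_nat_sequentially] filterlim_compose[OF filterlim_floor_sequentially filterlim_ln_nat])

text \<open>Sampling the norming sequence at the integer part of ln n is harmless, since ln n
  divided by its integer part tends to 1.\<close>

lemma tendsto_floor_norming:
  fixes h :: "real \<Rightarrow> real"
  assumes "(\<lambda>k. real k * h (c k)) \<longlonglongrightarrow> 1"
  shows "(\<lambda>n. ln (real n) * h (c (nat \<lfloor>ln (real n)\<rfloor>))) \<longlonglongrightarrow> 1"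
proof -
  let ?k = "\<lambda>n. nat \<lfloor>ln (real n)\<rfloor>"
  note k = filterlim_nat_floor_ln
  have "((\<lambda>x::real. x / real (nat \<lfloor>x\<rfloor>)) \<longlongrightarrow> 1) at_top" by real_asymp
  from filterlim_compose[OF this filterlim_ln_nat] have "(\<lambda>n. ln (real n) / real (?k n)) \<longlonglongrightarrow> 1" .
  moreover have "(\<lambda>n. real (?k n) * h (c (?k n))) \<longlonglongrightarrow> 1" using filterlim_compose[OF assms k] .
  ultimately have "(\<lambda>n. (ln (real n) / real (?k n)) * (real (?k n) * h (c (?k n)))) \<longlonglongrightarrow> 1 * 1" by (intro tendsto_mult)
  moreover have "eventually (\<lambda>n. (ln (real n) / real (?k n)) * (real (?k n) * h (c (?k n))) = ln (real n) * h (c (?k n))) sequentially"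
    using eventually_compose_filterlim[OF eventually_gt_at_top[of 0] k]
  proof eventually_elim
    case (elim n)
    have "a / b * (b * z) = a * z" if "b \<noteq> 0" for a b z :: real using that by simp
    from this[of "real (?k n)"] show ?case using elim by (metis of_nat_0_less_iff order_less_irrefl)
  qed
  ultimately show ?thesis by (simp cong: filterlim_cong)
qed

lemma tendsto_ratio_asymp_equiv:
  fixes f h :: "real \<Rightarrow> real"
  assumes "f \<sim>[at_top] h" "c > 0" "((\<lambda>x. h (c * x) / h x) \<longlongrightarrow> L) at_top"
  shows "((\<lambda>x. f (c * x) / f x) \<longlongrightarrow> L) at_top"
proof -
  have c: "filterlim (\<lambda>x. c * x) at_top at_top"
    using assms(2) by (intro filterlim_tendsto_pos_mult_at_top[OF tendsto_const] filterlim_ident)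
  have "(\<lambda>x. f (c * x) / f x) \<sim>[at_top] (\<lambda>x. h (c * x) / h x)"
    by (intro asymp_equiv_divide asymp_equiv_compose'[OF assms(1) c] assms(1))
  then have "(\<lambda>x. h (c * x) / h x) \<sim>[at_top] (\<lambda>x. f (c * x) / f x)" by (rule asymp_equiv_symI)
  then show ?thesis using assms(3) by (rule asymp_equiv_tendsto_transfer)
qed

section \<open>The three regimes\<close>

context stick_breaking
begin

sublocale X: nonneg_rv M "\<lambda>\<omega>. \<bar>ln (W \<omega>)\<bar>"
  by unfold_locales auto

lemma distr_\<xi>:
  assumes [measurable]: "h \<in> borel_measurable borel"
  shows "distr M borel (\<lambda>\<omega>. h (\<xi> 0 \<omega>) :: real) = distr M borel (\<lambda>\<omega>. h \<bar>ln (W \<omega>)\<bar>)"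
  unfolding \<xi>_def by (rule distr_Ws_Suc) measurable

lemma expectation_\<xi>_W:
  assumes [measurable]: "h \<in> borel_measurable borel"
  shows "expectation (\<lambda>\<omega>. h (\<xi> 0 \<omega>) :: real) = expectation (\<lambda>\<omega>. h \<bar>ln (W \<omega>)\<bar>)"
proof -
  have [measurable]: "\<xi> 0 \<in> borel_measurable M" unfolding \<xi>_def[abs_def] by simp
  have "expectation (\<lambda>\<omega>. h (\<xi> 0 \<omega>)) = (LINT x|distr M borel (\<lambda>\<omega>. h (\<xi> 0 \<omega>)). x)" by (subst integral_distr) auto
  also have "\<dots> = expectation (\<lambda>\<omega>. h \<bar>ln (W \<omega>)\<bar>)" unfolding distr_\<xi>[OF assms] by (subst integral_distr) auto
  finally show ?thesis .
qed

lemma renewal_regimeI: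
  assumes "integrable M (\<lambda>\<omega>. \<bar>ln (W \<omega>)\<bar>)" "\<And>s. s > 0 \<Longrightarrow> g s > 0"
    and "\<And>x. x \<ge> x0 \<Longrightarrow> X.trunc_sq x \<le> C * x\<^sup>2 * g (1 / x)"
    and "\<And>x. x \<ge> x0 \<Longrightarrow> X.tail_exp x \<le> C * x * g (1 / x)"
    and "((\<lambda>x. x * g (1 / x)) \<longlongrightarrow> 0) at_top" "filterlim d at_top sequentially"
      "(\<lambda>n. ln (real n) * g (1 / d n)) \<longlonglongrightarrow> 1"
  shows "renewal_regime M \<xi> \<eta> (mean_abs_log M W) g C x0 (\<lambda>n. ln (real n)) d"
proof -
  interpret P: renewal_pairs M \<xi> \<eta> "mean_abs_log M W" by (rule renewal_pairsI) fact
  have "P.trunc_square x = X.trunc_sq x" for x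
    unfolding P.trunc_square_def X.trunc_sq_def using expectation_\<xi>_W[of "\<lambda>y. y\<^sup>2 * indicator {..x} y"] by simp
  moreover have "P.tail_mean x = X.tail_exp x" for x
    unfolding P.tail_mean_def X.tail_exp_def using expectation_\<xi>_W[of "\<lambda>y. y * indicator {x<..} y"] by simp
  ultimately show ?thesis using assms filterlim_ln_nat by unfold_locales auto
qed

text \<open>The constant \<open>K\<close> solves K^\<alpha> (\<alpha> + 1) \<mu>^(\<alpha> + 1) = r,
  which removes the factor left by the integral of the linear weights. The parameter
  \<open>r\<close> is the variance in the first regime, where it cancels against \<kappa>, and 1 in
  the others.\<close>

lemma char_lnT_limit:
  assumes reg: "renewal_regime M \<xi> \<eta> (mean_abs_log M W) g C x0 (\<lambda>n. ln (real n)) d"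
    and g: "mono g" "\<And>s. g s \<ge> 0"
    and rv: "\<And>c. c > 0 \<Longrightarrow> ((\<lambda>s. g (c * s) / g s) \<longlongrightarrow> c powr \<alpha>) (at_right 0)"
    and \<phi>: "((\<lambda>s. (char (distr M borel (\<lambda>\<omega>. \<bar>ln (W \<omega>)\<bar> - mean_abs_log M W)) s - 1) / of_real (g s)) \<longlongrightarrow> - \<kappa>) (at_right 0)"
    and \<alpha>: "\<alpha> > 0" and K: "K = ((\<alpha> + 1) * mean_abs_log M W powr (\<alpha> + 1) / r) powr (- (1 / \<alpha>))" "r > 0"
  shows "(\<lambda>n. char (distr M borel (\<lambda>\<omega>. (lnT n \<omega> - centering M W n) / (K * ln (real n) * d n))) u)
    \<longlonglongrightarrow> exp (- (if u > 0 then cnj \<kappa> else \<kappa>) * of_real (\<bar>u\<bar> powr \<alpha> / r))"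
proof -
  interpret R: renewal_regime M \<xi> \<eta> "mean_abs_log M W" g C x0 "\<lambda>n. ln (real n)" d by (rule reg)
  define B where "B = (\<alpha> + 1) * mean_abs_log M W powr (\<alpha> + 1)"
  have B: "B > 0" using \<alpha> R.\<mu>_pos by (simp add: B_def)
  have Kpos: "K > 0" unfolding K(1) B_def[symmetric] using B K(2) by simp
  have "K powr \<alpha> = (B / r) powr - 1" using \<alpha> by (simp add: K B_def powr_powr)
  then have K\<alpha>: "K powr \<alpha> = r / B" using B K by (simp add: powr_minus_divide)
  have "(\<bar>u\<bar> / K) powr \<alpha> * (1 / mean_abs_log M W) powr (\<alpha> + 1) / (\<alpha> + 1) = \<bar>u\<bar> powr \<alpha> / K powr \<alpha> / B"
    using Kpos R.\<mu>_pos by (simp add: powr_divide B_def)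
  also have "\<dots> = \<bar>u\<bar> powr \<alpha> / r" unfolding K\<alpha> using B K by simp
  finally have eq: "(\<bar>u\<bar> / K) powr \<alpha> * (1 / mean_abs_log M W) powr (\<alpha> + 1) / (\<alpha> + 1) = \<bar>u\<bar> powr \<alpha> / r" .
  have "((\<lambda>s. (char (distr M borel (\<lambda>\<omega>. \<xi> 0 \<omega> - mean_abs_log M W)) s - 1) / of_real (g s)) \<longlongrightarrow> - \<kappa>) (at_right 0)"
    using \<phi> distr_\<xi>[of "\<lambda>x. x - mean_abs_log M W"] by simp
  from char_lnT_tendsto[OF reg g rv this \<alpha> Kpos, of u] show ?thesis unfolding eq .
qed

lemma weak_conv_std_normalI:
  assumes "\<And>u. (\<lambda>n. char (distr M borel (\<lambda>\<omega>. (lnT n \<omega> - centering M W n) / a n)) u) \<longlonglongrightarrow> exp (- of_real (u\<^sup>2 / 2))"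
  shows "weak_conv_m (\<lambda>n. distr M borel (\<lambda>\<omega>. (lnT n \<omega> - centering M W n) / a n)) std_normal_distribution"
proof (rule levy_continuity)
  show "real_distribution (distr M borel (\<lambda>\<omega>. (lnT n \<omega> - centering M W n) / a n))" for n
    by (rule real_distribution_distr) measurable
  show "real_distribution std_normal_distribution" by (rule real_dist_normal_dist)
  show "(\<lambda>n. char (distr M borel (\<lambda>\<omega>. (lnT n \<omega> - centering M W n) / a n)) u) \<longlonglongrightarrow> char std_normal_distribution u" for u
    using assms[of u] by (simp add: char_std_normal_distribution exp_of_real[symmetric])
qed

text \<open>A finite value of \<open>var_log\<close> means that ln W is square integrable around
  some real number m, the default value of a divergent integral not being excluded at first. This
  already makes ln W integrable, so m is the mean. A variance of 0 would make W constant almost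
  surely.\<close>

lemma finite_variance:
  assumes "var_log M W < \<infinity>" and nondeg: "\<not> (\<exists>w. AE \<omega> in M. W \<omega> = w)"
  shows "integrable M (\<lambda>\<omega>. \<bar>ln (W \<omega>)\<bar>)" "integrable M (\<lambda>\<omega>. \<bar>ln (W \<omega>)\<bar>\<^sup>2)"
    and "expectation (\<lambda>\<omega>. (\<bar>ln (W \<omega>)\<bar> - mean_abs_log M W)\<^sup>2) = enn2real (var_log M W)"
    and "enn2real (var_log M W) > 0"
proof -
  define m where "m = expectation (\<lambda>\<omega>. ln (W \<omega>))"
  have i2: "integrable M (\<lambda>\<omega>. (ln (W \<omega>) - m)\<^sup>2)"
    using assms(1) unfolding var_log_def m_def by (intro integrableI_nonneg) auto
  have i1: "integrable M (\<lambda>\<omega>. ln (W \<omega>) - m)" by (rule square_integrable_imp_integrable[OF _ i2]) simp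
  have "integrable M (\<lambda>\<omega>. (ln (W \<omega>) - m) + m)" using i1 by (intro Bochner_Integration.integrable_add) auto
  then have i: "integrable M (\<lambda>\<omega>. ln (W \<omega>))" by simp
  then show "integrable M (\<lambda>\<omega>. \<bar>ln (W \<omega>)\<bar>)" by simp
  have "integrable M (\<lambda>\<omega>. (ln (W \<omega>) - m)\<^sup>2 + 2 * m * ln (W \<omega>) - m\<^sup>2)" using i i2 by simp
  moreover have "(y - m)\<^sup>2 + 2 * m * y - m\<^sup>2 = \<bar>y\<bar>\<^sup>2" for y by (simp add: power2_eq_square algebra_simps)
  ultimately show "integrable M (\<lambda>\<omega>. \<bar>ln (W \<omega>)\<bar>\<^sup>2)" by simp
  have neg: "AE \<omega> in M. \<bar>ln (W \<omega>)\<bar> = - ln (W \<omega>)" using W_01 by eventually_elim auto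
  have \<mu>: "mean_abs_log M W = - m"
  proof -
    have "mean_abs_log M W = expectation (\<lambda>\<omega>. - ln (W \<omega>))"
      unfolding mean_abs_log_def using neg by (intro integral_cong_AE) auto
    then show ?thesis by (simp add: m_def)
  qed
  have v: "var_log M W = ennreal (expectation (\<lambda>\<omega>. (ln (W \<omega>) - m)\<^sup>2))"
    unfolding var_log_def m_def[symmetric] by (rule nn_integral_eq_integral[OF i2]) simp
  have "expectation (\<lambda>\<omega>. (\<bar>ln (W \<omega>)\<bar> - mean_abs_log M W)\<^sup>2) = expectation (\<lambda>\<omega>. (ln (W \<omega>) - m)\<^sup>2)"
    using neg unfolding \<mu> by (intro integral_cong_AE) (auto simp: power2_eq_square algebra_simps)
  then show "expectation (\<lambda>\<omega>. (\<bar>ln (W \<omega>)\<bar> - mean_abs_log M W)\<^sup>2) = enn2real (var_log M W)"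
    unfolding v by simp
  have "expectation (\<lambda>\<omega>. (ln (W \<omega>) - m)\<^sup>2) \<noteq> 0"
  proof
    assume "expectation (\<lambda>\<omega>. (ln (W \<omega>) - m)\<^sup>2) = 0"
    then have "AE \<omega> in M. (ln (W \<omega>) - m)\<^sup>2 = 0" using i2 by (subst (asm) integral_nonneg_eq_0_iff_AE) auto
    then have "AE \<omega> in M. W \<omega> = exp m" using W_01 by eventually_elim (metis diff_eq_diff_eq diff_self exp_ln zero_eq_power2)
    then show False using nondeg by blast
  qed
  moreover have "expectation (\<lambda>\<omega>. (ln (W \<omega>) - m)\<^sup>2) \<ge> 0" by simp
  ultimately have "expectation (\<lambda>\<omega>. (ln (W \<omega>) - m)\<^sup>2) > 0" by linarith
  then show "enn2real (var_log M W) > 0" unfolding v by simp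
qed

text \<open>Here g is s^2 for s > 0 and \<open>d\<close> is the square root of ln n, so the norming
  condition holds with equality for n > 1. The tail mean is bounded using y \<le> y^2 / x for y >
  x.\<close>

theorem finite_variance_limit:
  assumes fin: "var_log M W < \<infinity>" and nondeg: "\<not> (\<exists>w. AE \<omega> in M. W \<omega> = w)"
  shows "weak_conv_m (\<lambda>n. distr M borel (\<lambda>\<omega>. (lnT n \<omega> - centering M W n) /
      sqrt (enn2real (var_log M W) * (ln (real n)) ^ 3 / (3 * mean_abs_log M W ^ 3)))) std_normal_distribution"
proof -
  define v where "v = enn2real (var_log M W)"
  define \<mu> where "\<mu> = mean_abs_log M W"
  note * = finite_variance[OF fin nondeg, folded v_def \<mu>_def]
  interpret P: renewal_pairs M \<xi> \<eta> "mean_abs_log M W" by (rule renewal_pairsI) fact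
  have \<mu>: "\<mu> > 0" using P.\<mu>_pos by (simp add: \<mu>_def)
  define g :: "real \<Rightarrow> real" where "g s = (max 0 s)\<^sup>2" for s
  define C where "C = expectation (\<lambda>\<omega>. \<bar>ln (W \<omega>)\<bar>\<^sup>2)"
  have g1: "x\<^sup>2 * g (1 / x) = 1" "x * g (1 / x) = 1 / x" if "x > 0" for x
    using that by (simp_all add: g_def power2_eq_square)
  have reg: "renewal_regime M \<xi> \<eta> (mean_abs_log M W) g C 1 (\<lambda>n. ln (real n)) (\<lambda>n. sqrt (ln (real n)))"
  proof (rule renewal_regimeI)
    show "integrable M (\<lambda>\<omega>. \<bar>ln (W \<omega>)\<bar>)" by fact
    show "g s > 0" if "s > 0" for s using that by (simp add: g_def)
    show "X.trunc_sq x \<le> C * x\<^sup>2 * g (1 / x)" if "x \<ge> 1" for x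
    proof -
      have "X.trunc_sq x \<le> C" unfolding X.trunc_sq_def C_def
        by (intro integral_mono X.trunc_sq_integrable *) (auto simp: indicator_def)
      then show ?thesis using g1(1)[of x] that by (simp add: mult.assoc)
    qed
    show "X.tail_exp x \<le> C * x * g (1 / x)" if "x \<ge> 1" for x
    proof -
      have "X.tail_exp x \<le> expectation (\<lambda>\<omega>. \<bar>ln (W \<omega>)\<bar>\<^sup>2 / x)" unfolding X.tail_exp_def
      proof (rule integral_mono)
        show "integrable M (\<lambda>\<omega>. \<bar>ln (W \<omega>)\<bar> * indicator {x<..} \<bar>ln (W \<omega>)\<bar>)"
          by (rule Bochner_Integration.integrable_bound[OF *(1)]) (auto simp: indicator_def)
        show "integrable M (\<lambda>\<omega>. \<bar>ln (W \<omega>)\<bar>\<^sup>2 / x)" using *(2) by simp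
        have "y * indicator {x<..} y \<le> y\<^sup>2 / x" for y :: real
          using that by (auto simp: indicator_def power2_eq_square field_simps)
        then show "\<bar>ln (W \<omega>)\<bar> * indicator {x<..} \<bar>ln (W \<omega>)\<bar> \<le> \<bar>ln (W \<omega>)\<bar>\<^sup>2 / x" for \<omega> .
      qed
      also have "\<dots> = C / x" unfolding C_def by simp
      finally show ?thesis using g1(2)[of x] that by (simp add: mult.assoc)
    qed
    have "((\<lambda>x::real. 1 / x) \<longlongrightarrow> 0) at_top" by real_asymp
    moreover have "eventually (\<lambda>x. 1 / x = x * g (1 / x)) at_top"
      using eventually_gt_at_top[of 0] by eventually_elim (simp add: g1)
    ultimately show "((\<lambda>x. x * g (1 / x)) \<longlongrightarrow> 0) at_top" by (rule Lim_transform_eventually)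
    show "filterlim (\<lambda>n. sqrt (ln (real n))) at_top sequentially"
      by (rule filterlim_compose[OF sqrt_at_top filterlim_ln_nat])
    have "eventually (\<lambda>n. 1 = ln (real n) * g (1 / sqrt (ln (real n)))) sequentially"
      using eventually_gt_at_top[of 1]
    proof eventually_elim
      case (elim n)
      then have "ln (real n) > 0" by simp
      then show ?case by (simp add: g_def power_divide)
    qed
    then show "(\<lambda>n. ln (real n) * g (1 / sqrt (ln (real n)))) \<longlonglongrightarrow> 1"
      by (rule Lim_transform_eventually[OF tendsto_const])
  qed
  define K where "K = ((2 + 1) * mean_abs_log M W powr (2 + 1) / v) powr (- (1 / 2))"
  have K: "sqrt (v * (ln (real n)) ^ 3 / (3 * \<mu> ^ 3)) = K * ln (real n) * sqrt (ln (real n))" for n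
  proof -
    have "K = inverse (sqrt (3 * \<mu> ^ 3 / v))"
      using \<mu> * unfolding K_def \<mu>_def[symmetric] powr_minus by (subst powr_half_sqrt) (auto simp: powr_numeral)
    then have "K = sqrt (v / (3 * \<mu> ^ 3))" by (simp add: real_sqrt_inverse[symmetric])
    moreover have "sqrt (y ^ 3) = y * sqrt y" if "y \<ge> 0" for y :: real
      using that by (simp add: power3_eq_cube real_sqrt_mult)
    moreover have "ln (real n) \<ge> 0" by (cases "n = 0") auto
    ultimately show ?thesis by (simp add: real_sqrt_mult[symmetric] real_sqrt_divide[symmetric]) (simp add: real_sqrt_mult real_sqrt_divide)
  qed
  have "(\<lambda>n. char (distr M borel (\<lambda>\<omega>. (lnT n \<omega> - centering M W n) / (K * ln (real n) * sqrt (ln (real n))))) u)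
    \<longlonglongrightarrow> exp (- (if u > 0 then cnj (of_real (v / 2)) else of_real (v / 2)) * of_real (\<bar>u\<bar> powr 2 / v))" for u
  proof (rule char_lnT_limit[OF reg])
    show "mono g" by (auto simp: g_def intro!: monoI power_mono)
    show "g s \<ge> 0" for s by (simp add: g_def)
    have scale: "g (c * s) / g s = c\<^sup>2" if "c > 0" "s > 0" for c s
      using that by (simp add: g_def power_mult_distrib)
    show "((\<lambda>s. g (c * s) / g s) \<longlongrightarrow> c powr 2) (at_right 0)" if c: "c > 0" for c
    proof (rule Lim_transform_eventually[OF tendsto_const])
      show "eventually (\<lambda>s. c powr 2 = g (c * s) / g s) (at_right 0)"
        using eventually_at_right_less[of 0] by eventually_elim (use c scale in auto)
    qed
    have "((\<lambda>s. (char (distr M borel (\<lambda>\<omega>. \<bar>ln (W \<omega>)\<bar> - \<mu>)) s - 1) / of_real (s\<^sup>2)) \<longlongrightarrow> - of_real (expectation (\<lambda>\<omega>. (\<bar>ln (W \<omega>)\<bar> - \<mu>)\<^sup>2) / 2)) (at_right 0)"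
    proof (rule char_square_integrable_asymp)
      show "integrable M (\<lambda>\<omega>. \<bar>ln (W \<omega>)\<bar> - \<mu>)" using *(1) by simp
      show "integrable M (\<lambda>\<omega>. (\<bar>ln (W \<omega>)\<bar> - \<mu>)\<^sup>2)" using *(1,2) by (simp add: power2_diff del: power2_abs)
      show "expectation (\<lambda>\<omega>. \<bar>ln (W \<omega>)\<bar> - \<mu>) = 0" using *(1) by (simp add: \<mu>_def mean_abs_log_def prob_space)
    qed simp
    moreover have "eventually (\<lambda>s. (char (distr M borel (\<lambda>\<omega>. \<bar>ln (W \<omega>)\<bar> - \<mu>)) s - 1) / of_real (s\<^sup>2)
        = (char (distr M borel (\<lambda>\<omega>. \<bar>ln (W \<omega>)\<bar> - \<mu>)) s - 1) / of_real (g s)) (at_right 0)"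
      using eventually_at_right_less[of 0] by eventually_elim (simp add: g_def)
    ultimately show "((\<lambda>s. (char (distr M borel (\<lambda>\<omega>. \<bar>ln (W \<omega>)\<bar> - mean_abs_log M W)) s - 1) / of_real (g s)) \<longlongrightarrow> - of_real (v / 2)) (at_right 0)"
      unfolding *(3) \<mu>_def[symmetric] by (rule Lim_transform_eventually)
  qed (use * in \<open>auto simp: K_def\<close>)
  moreover have "exp (- (if u > 0 then cnj (of_real (v / 2)) else of_real (v / 2)) * of_real (\<bar>u\<bar> powr 2 / v)) = exp (- complex_of_real (u\<^sup>2 / 2))" for u
  proof -
    have "- (if u > 0 then cnj (of_real (v / 2)) else of_real (v / 2)) * of_real (\<bar>u\<bar> powr 2 / v) = - complex_of_real ((v / 2) * (\<bar>u\<bar> powr 2 / v))" by simp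
    also have "(v / 2) * (\<bar>u\<bar> powr 2 / v) = u\<^sup>2 / 2" using * by simp
    finally show ?thesis by (simp only:)
  qed
  ultimately have "(\<lambda>n. char (distr M borel (\<lambda>\<omega>. (lnT n \<omega> - centering M W n) / (K * ln (real n) * sqrt (ln (real n))))) u)
    \<longlonglongrightarrow> exp (- of_real (u\<^sup>2 / 2))" for u by (simp only:)
  then show ?thesis unfolding v_def[symmetric] \<mu>_def[symmetric] K by (rule weak_conv_std_normalI)
qed

text \<open>The link is that x^2 g (1 / x) is equivalent to the truncated second moment and thus to
  l x. It turns the condition on \<open>c\<close> into n g (1 / c n) tending to 1. With \<alpha> = 2
  and \<kappa> = 1/2 the limit exponent is - u^2 / 2.\<close>

theorem slowly_varying_trunc_square_limit:
  assumes inf: "var_log M W = \<infinity>" and l: "slowly_varying l"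
    and V: "(\<lambda>x. LINT y:{0..x}|distr M borel (\<lambda>\<omega>. \<bar>ln (W \<omega>)\<bar>). y\<^sup>2) \<sim>[at_top] l"
    and c: "filterlim c at_top sequentially" "(\<lambda>n. real n * l (c n) / (c n)\<^sup>2) \<longlonglongrightarrow> 1"
  shows "weak_conv_m (\<lambda>n. distr M borel (\<lambda>\<omega>. (lnT n \<omega> - centering M W n) /
      ((3 * mean_abs_log M W ^ 3) powr (- (1 / 2)) * c (nat \<lfloor>ln (real n)\<rfloor>) * ln (real n)))) std_normal_distribution"
proof -
  have Veq: "(LINT y:{0..x}|distr M borel (\<lambda>\<omega>. \<bar>ln (W \<omega>)\<bar>). y\<^sup>2) = X.trunc_sq x" for x
  proof -
    have "(LINT y:{0..x}|distr M borel (\<lambda>\<omega>. \<bar>ln (W \<omega>)\<bar>). y\<^sup>2) = expectation (\<lambda>\<omega>. indicator {0..x} \<bar>ln (W \<omega>)\<bar> *\<^sub>R \<bar>ln (W \<omega>)\<bar>\<^sup>2)"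
      unfolding set_lebesgue_integral_def by (rule integral_distr) auto
    also have "\<dots> = X.trunc_sq x" unfolding X.trunc_sq_def
      by (intro Bochner_Integration.integral_cong) (auto simp: indicator_def)
    finally show ?thesis .
  qed
  have Vl: "X.trunc_sq \<sim>[at_top] l" using V unfolding Veq .
  have lpos: "l x > 0" if "x > 0" for x using l that by (simp add: slowly_varying_def)
  interpret S: slow_trunc_sq M "\<lambda>\<omega>. \<bar>ln (W \<omega>)\<bar>"
  proof unfold_locales
    show "((\<lambda>x. X.trunc_sq (c * x) / X.trunc_sq x) \<longlongrightarrow> 1) at_top" if "c > 0" for c
      using l that by (intro tendsto_ratio_asymp_equiv[OF Vl]) (auto simp: slowly_varying_def)
    show "\<not> integrable M (\<lambda>\<omega>. \<bar>ln (W \<omega>)\<bar>\<^sup>2)"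
    proof
      assume "integrable M (\<lambda>\<omega>. \<bar>ln (W \<omega>)\<bar>\<^sup>2)"
      then have i2: "integrable M (\<lambda>\<omega>. (ln (W \<omega>))\<^sup>2)" by simp
      moreover have "integrable M (\<lambda>\<omega>. ln (W \<omega>))" by (rule square_integrable_imp_integrable[OF _ i2]) simp
      ultimately have "integrable M (\<lambda>\<omega>. (ln (W \<omega>) - expectation (\<lambda>\<omega>. ln (W \<omega>)))\<^sup>2)" by (simp add: power2_diff)
      then have "var_log M W < \<infinity>" unfolding var_log_def by (subst nn_integral_eq_integral) auto
      then show False using inf by simp
    qed
  qed
  have trunc_pos: "eventually (\<lambda>x. X.trunc_sq x > 0) at_top" by (rule S.trunc_sq_gt)
  define d where "d n = c (nat \<lfloor>ln (real n)\<rfloor>)" for n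
  have "((\<lambda>x. X.trunc_sq x / l x) \<longlongrightarrow> 1) at_top"
    by (rule asymp_equivD_strong[OF Vl]) (use trunc_pos in eventually_elim, simp)
  with S.g_trunc_sq have "((\<lambda>x. (x\<^sup>2 * S.g (1 / x) / X.trunc_sq x) * (X.trunc_sq x / l x)) \<longlongrightarrow> 1 * 1) at_top"
    by (rule tendsto_mult)
  from tendsto_mult[OF c(2) filterlim_compose[OF this c(1)]]
  have "(\<lambda>n. (real n * l (c n) / (c n)\<^sup>2) * (((c n)\<^sup>2 * S.g (1 / c n) / X.trunc_sq (c n)) * (X.trunc_sq (c n) / l (c n)))) \<longlonglongrightarrow> 1 * (1 * 1)" .
  moreover have "eventually (\<lambda>n. (real n * l (c n) / (c n)\<^sup>2) * (((c n)\<^sup>2 * S.g (1 / c n) / X.trunc_sq (c n)) * (X.trunc_sq (c n) / l (c n)))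
      = real n * S.g (1 / c n)) sequentially"
    using eventually_compose_filterlim[OF eventually_gt_at_top[of 0] c(1)] eventually_compose_filterlim[OF trunc_pos c(1)]
  proof eventually_elim
    case (elim n)
    then show ?case using lpos[of "c n"] by simp
  qed
  ultimately have "(\<lambda>n. real n * S.g (1 / c n)) \<longlonglongrightarrow> 1 * (1 * 1)" by (rule Lim_transform_eventually)
  then have norm: "(\<lambda>n. real n * S.g (1 / c n)) \<longlonglongrightarrow> 1" by simp
  obtain x0 where x0: "\<And>x. x \<ge> x0 \<Longrightarrow> X.tail_exp x \<le> x * S.g (1 / x)"
    using S.tail_exp_le_g unfolding eventually_at_top_linorder by blast
  have reg: "renewal_regime M \<xi> \<eta> (mean_abs_log M W) S.g 1 (max x0 1) (\<lambda>n. ln (real n)) d"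
  proof (rule renewal_regimeI)
    show "X.trunc_sq x \<le> 1 * x\<^sup>2 * S.g (1 / x)" if "x \<ge> max x0 1" for x using S.trunc_sq_le_g[of x] that by simp
    show "X.tail_exp x \<le> 1 * x * S.g (1 / x)" if "x \<ge> max x0 1" for x using x0[of x] that by simp
    show "filterlim d at_top sequentially" unfolding d_def
      by (rule filterlim_compose[OF c(1) filterlim_nat_floor_ln])
    show "(\<lambda>n. ln (real n) * S.g (1 / d n)) \<longlonglongrightarrow> 1" unfolding d_def
      by (rule tendsto_floor_norming[of "\<lambda>x. S.g (1 / x)" c, OF norm])
  qed (use S.integrable_X S.g_pos S.g_small in auto)
  interpret R: renewal_regime M \<xi> \<eta> "mean_abs_log M W" S.g 1 "max x0 1" "\<lambda>n. ln (real n)" d by (rule reg)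
  define K where "K = ((2 + 1) * mean_abs_log M W powr (2 + 1) / 1) powr (- (1 / 2))"
  have K: "(3 * mean_abs_log M W ^ 3) powr (- (1 / 2)) * c (nat \<lfloor>ln (real n)\<rfloor>) * ln (real n) = K * ln (real n) * d n" for n
    using R.\<mu>_pos by (simp add: K_def d_def powr_numeral)
  have "(\<lambda>n. char (distr M borel (\<lambda>\<omega>. (lnT n \<omega> - centering M W n) / (K * ln (real n) * d n))) u)
    \<longlonglongrightarrow> exp (- (if u > 0 then cnj (1 / 2) else 1 / 2) * of_real (\<bar>u\<bar> powr 2 / 1))" for u
  proof (rule char_lnT_limit[OF reg S.g_mono S.g_nonneg S.g_regular])
    show "((\<lambda>s. (char (distr M borel (\<lambda>\<omega>. \<bar>ln (W \<omega>)\<bar> - mean_abs_log M W)) s - 1) / of_real (S.g s)) \<longlongrightarrow> - (1 / 2)) (at_right 0)"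
      unfolding mean_abs_log_def by (rule X.char_centered_asymp[OF S.integrable_X S.\<psi>_asymp S.square_over_g])
  qed (auto simp: K_def)
  moreover have "- (if u > 0 then cnj (1 / 2) else 1 / 2) * of_real (\<bar>u\<bar> powr 2 / 1) = - complex_of_real (u\<^sup>2 / 2)" for u
    by simp
  ultimately have "(\<lambda>n. char (distr M borel (\<lambda>\<omega>. (lnT n \<omega> - centering M W n) / (K * ln (real n) * d n))) u)
    \<longlonglongrightarrow> exp (- of_real (u\<^sup>2 / 2))" for u by (simp only:)
  then show ?thesis unfolding K by (rule weak_conv_std_normalI)
qed

text \<open>As g (1 / x) is the tail at x, the condition on \<open>c\<close> becomes n g (1 / c n)
  tending to 1. The limit law is provided by \<open>ex_limit_law\<close>.\<close>

theorem regularly_varying_tail_limit: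
  assumes \<alpha>: "1 < \<alpha>" "\<alpha> < 2" and l: "slowly_varying l"
    and tail: "(\<lambda>x. prob {\<omega> \<in> space M. \<bar>ln (W \<omega>)\<bar> > x}) \<sim>[at_top] (\<lambda>x. x powr (- \<alpha>) * l x)"
    and c: "filterlim c at_top sequentially" "(\<lambda>n. real n * l (c n) / c n powr \<alpha>) \<longlonglongrightarrow> 1"
  shows "\<exists>\<nu>. real_distribution \<nu> \<and>
    (\<forall>u. char \<nu> u = exp (- (complex_of_real (\<bar>u\<bar> powr \<alpha> * Gamma (1 - \<alpha>)) *
      (complex_of_real (cos (pi * \<alpha> / 2)) + \<i> * complex_of_real (sin (pi * \<alpha> / 2) * sgn u))))) \<and>
    weak_conv_m (\<lambda>n. distr M borel (\<lambda>\<omega>. (lnT n \<omega> - centering M W n) /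
      (((\<alpha> + 1) * mean_abs_log M W powr (\<alpha> + 1)) powr (- (1 / \<alpha>)) * c (nat \<lfloor>ln (real n)\<rfloor>) * ln (real n)))) \<nu>"
proof -
  have tl: "X.tail \<sim>[at_top] (\<lambda>x. x powr (- \<alpha>) * l x)" using tail unfolding X.tail_def .
  have lpos: "l x > 0" if "x > 0" for x using l that by (simp add: slowly_varying_def)
  have "eventually (\<lambda>x. x powr (- \<alpha>) * l x > 0) at_top"
    using eventually_gt_at_top[of 0] by eventually_elim (use lpos in auto)
  then have ev_pos: "eventually (\<lambda>x. X.tail x > 0) at_top"
    using asymp_equiv_eventually_pos_iff[OF tl] by eventually_elim auto
  interpret S: regular_tail M "\<lambda>\<omega>. \<bar>ln (W \<omega>)\<bar>" \<alpha>
  proof unfold_locales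
    show "((\<lambda>x. X.tail (c * x) / X.tail x) \<longlongrightarrow> c powr - \<alpha>) at_top" if "c > 0" for c
    proof (rule tendsto_ratio_asymp_equiv[OF tl that])
      have "((\<lambda>x. c powr - \<alpha> * (l (c * x) / l x)) \<longlongrightarrow> c powr - \<alpha> * 1) at_top"
        using l that by (intro tendsto_intros) (auto simp: slowly_varying_def)
      moreover have "eventually (\<lambda>x. c powr - \<alpha> * (l (c * x) / l x) = (c * x) powr - \<alpha> * l (c * x) / (x powr - \<alpha> * l x)) at_top"
        using eventually_gt_at_top[of 0] by eventually_elim (use that in \<open>simp add: powr_mult\<close>)
      ultimately show "((\<lambda>x. (c * x) powr - \<alpha> * l (c * x) / (x powr - \<alpha> * l x)) \<longlongrightarrow> c powr - \<alpha>) at_top"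
        by (simp add: Lim_transform_eventually)
    qed
    \<comment> \<open>Positivity is known for large arguments only; it spreads to all smaller ones
      because the tail is decreasing.\<close>
    show "X.tail x > 0" for x
    proof -
      obtain y where "y \<ge> x" "X.tail y > 0"
        using eventually_conj[OF ev_pos eventually_ge_at_top[of x]] by (auto simp: eventually_at_top_linorder)
      then show ?thesis using X.tail_antimono[of x y] by linarith
    qed
  qed (use \<alpha> in auto)
  define d where "d n = c (nat \<lfloor>ln (real n)\<rfloor>)" for n
  have "((\<lambda>x. X.tail x / (x powr (- \<alpha>) * l x)) \<longlongrightarrow> 1) at_top"
    by (rule asymp_equivD_strong[OF tl]) (use ev_pos in eventually_elim, simp)
  from tendsto_mult[OF c(2) filterlim_compose[OF this c(1)]]
  have "(\<lambda>n. (real n * l (c n) / c n powr \<alpha>) * (X.tail (c n) / (c n powr (- \<alpha>) * l (c n)))) \<longlonglongrightarrow> 1 * 1" .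
  moreover have "eventually (\<lambda>n. (real n * l (c n) / c n powr \<alpha>) * (X.tail (c n) / (c n powr (- \<alpha>) * l (c n))) = real n * S.g (1 / c n)) sequentially"
    using eventually_compose_filterlim[OF eventually_gt_at_top[of 0] c(1)]
  proof eventually_elim
    case (elim n)
    then show ?case using lpos[of "c n"] by (simp add: S.g_inverse powr_minus field_simps)
  qed
  ultimately have "(\<lambda>n. real n * S.g (1 / c n)) \<longlonglongrightarrow> 1 * 1" by (rule Lim_transform_eventually)
  then have norm: "(\<lambda>n. real n * S.g (1 / c n)) \<longlonglongrightarrow> 1" by simp
  obtain x0 C where x0: "x0 \<ge> 1" "\<And>x. x \<ge> x0 \<Longrightarrow> X.trunc_sq x \<le> C * x\<^sup>2 * X.tail x \<and> X.tail_exp x \<le> C * x * X.tail x"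
    using S.tail_bounds by blast
  have reg: "renewal_regime M \<xi> \<eta> (mean_abs_log M W) S.g C x0 (\<lambda>n. ln (real n)) d"
  proof (rule renewal_regimeI)
    show "X.trunc_sq x \<le> C * x\<^sup>2 * S.g (1 / x)" if "x \<ge> x0" for x using x0(1) x0(2)[OF that] that by (simp add: S.g_inverse)
    show "X.tail_exp x \<le> C * x * S.g (1 / x)" if "x \<ge> x0" for x using x0(1) x0(2)[OF that] that by (simp add: S.g_inverse)
    have "eventually (\<lambda>x. x * X.tail x = x * S.g (1 / x)) at_top"
      using eventually_gt_at_top[of 0] by eventually_elim (simp add: S.g_inverse)
    with S.tail_small show "((\<lambda>x. x * S.g (1 / x)) \<longlongrightarrow> 0) at_top" by (rule Lim_transform_eventually)
    show "filterlim d at_top sequentially" unfolding d_def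
      by (rule filterlim_compose[OF c(1) filterlim_nat_floor_ln])
    show "(\<lambda>n. ln (real n) * S.g (1 / d n)) \<longlonglongrightarrow> 1" unfolding d_def
      by (rule tendsto_floor_norming[of "\<lambda>x. S.g (1 / x)" c, OF norm])
  qed (use S.integrable_X S.g_pos in auto)
  interpret R: renewal_regime M \<xi> \<eta> "mean_abs_log M W" S.g C x0 "\<lambda>n. ln (real n)" d by (rule reg)
  define K where "K = ((\<alpha> + 1) * mean_abs_log M W powr (\<alpha> + 1) / 1) powr (- (1 / \<alpha>))"
  have K: "((\<alpha> + 1) * mean_abs_log M W powr (\<alpha> + 1)) powr (- (1 / \<alpha>)) * c (nat \<lfloor>ln (real n)\<rfloor>) * ln (real n) = K * ln (real n) * d n" for n
    by (simp add: K_def d_def)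
  have Kpos: "K > 0" using R.\<mu>_pos \<alpha> by (simp add: K_def)
  define \<kappa> where "\<kappa> = complex_of_real (Gamma (1 - \<alpha>)) * (of_real (cos (pi * \<alpha> / 2)) - \<i> * of_real (sin (pi * \<alpha> / 2)))"
  have lim: "(\<lambda>n. char (distr M borel (\<lambda>\<omega>. (lnT n \<omega> - centering M W n) / (K * ln (real n) * d n))) u)
    \<longlonglongrightarrow> exp (- (if u > 0 then cnj \<kappa> else \<kappa>) * of_real (\<bar>u\<bar> powr \<alpha> / 1))" for u
  proof (rule char_lnT_limit[OF reg S.g_mono S.g_nonneg S.g_regular])
    show "((\<lambda>s. (char (distr M borel (\<lambda>\<omega>. \<bar>ln (W \<omega>)\<bar> - mean_abs_log M W)) s - 1) / of_real (S.g s)) \<longlongrightarrow> - \<kappa>) (at_right 0)"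
      unfolding mean_abs_log_def \<kappa>_def by (rule X.char_centered_asymp[OF S.integrable_X S.\<psi>_asymp S.square_over_g])
  qed (use \<alpha> in \<open>auto simp: K_def\<close>)
  \<comment> \<open>Conjugating \<kappa> for u > 0 flips the sign of its imaginary part, which
    produces the factor \<open>sgn u\<close>; at u = 0 both exponents vanish.\<close>
  have "exp (- (if u > 0 then cnj \<kappa> else \<kappa>) * of_real (\<bar>u\<bar> powr \<alpha> / 1)) = exp (- (complex_of_real (\<bar>u\<bar> powr \<alpha> * Gamma (1 - \<alpha>)) *
      (complex_of_real (cos (pi * \<alpha> / 2)) + \<i> * complex_of_real (sin (pi * \<alpha> / 2) * sgn u))))" for u
    by (cases u "0 :: real" rule: linorder_cases) (simp_all add: \<kappa>_def algebra_simps)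
  then show ?thesis using ex_limit_law[OF reg Kpos lim] unfolding K by (simp only:)
qed

end

theorem theorem3p2:
  fixes M :: "'a measure"
    and W :: "'a \<Rightarrow> real"
    and Ws U :: "nat \<Rightarrow> 'a \<Rightarrow> real"
    and T :: "nat \<Rightarrow> 'a \<Rightarrow> real"
    and \<mu> :: real and \<sigma>2 :: ennreal and b :: "nat \<Rightarrow> real"
  assumes "prob_space M"
    and "W \<in> borel_measurable M"
    and "AE \<omega> in M. 0 < W \<omega> \<and> W \<omega> < 1"
    and "\<not> (\<exists>w. AE \<omega> in M. W \<omega> = w)"
    and "\<And>i. i \<ge> 1 \<Longrightarrow> distr M borel (Ws i) = distr M borel W"
    and "\<And>i. i \<ge> 1 \<Longrightarrow> distr M borel (U i) = uniform_measure lborel {0..1}"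
    and "prob_space.indep_vars M (\<lambda>_. borel) (case_sum Ws U) ({1..} <+> {1..})"
  defines "T \<equiv> \<lambda>n \<omega>. real (cycle_length_prod (stick_perm (\<lambda>i. Ws i \<omega>) (\<lambda>i. U i \<omega>) n) n)"
    and "\<mu> \<equiv> mean_abs_log M W"
    and "\<sigma>2 \<equiv> var_log M W"
    and "b \<equiv> centering M W"
  shows
    "(\<sigma>2 < \<infinity> \<longrightarrow>
       (let a = (\<lambda>n. sqrt (enn2real \<sigma>2 * (ln (real n)) ^ 3 / (3 * \<mu> ^ 3)))
        in weak_conv_m (\<lambda>n. distr M borel (\<lambda>\<omega>. (ln (T n \<omega>) - b n) / a n))
             std_normal_distribution)) \<and>
     (\<forall>l c. \<sigma>2 = \<infinity> \<and> slowly_varying l \<and>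
        (\<lambda>x. LINT y:{0..x}|distr M borel (\<lambda>\<omega>. \<bar>ln (W \<omega>)\<bar>). y\<^sup>2) \<sim>[at_top] l \<and>
        (\<forall>n\<ge>1. c n > 0) \<and> filterlim c at_top sequentially \<and>
        (\<lambda>n. real n * l (c n) / (c n)\<^sup>2) \<longlonglongrightarrow> 1 \<longrightarrow>
       (let a = (\<lambda>n. (3 * \<mu> ^ 3) powr (- (1 / 2)) * c (nat \<lfloor>ln (real n)\<rfloor>) * ln (real n))
        in weak_conv_m (\<lambda>n. distr M borel (\<lambda>\<omega>. (ln (T n \<omega>) - b n) / a n))
             std_normal_distribution)) \<and>
     (\<forall>l c \<alpha>. slowly_varying l \<and> 1 < \<alpha> \<and> \<alpha> < 2 \<and>
        (\<lambda>x. measure M {\<omega> \<in> space M. \<bar>ln (W \<omega>)\<bar> > x}) \<sim>[at_top] (\<lambda>x. x powr (- \<alpha>) * l x) \<and>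
        (\<forall>n\<ge>1. c n > 0) \<and> filterlim c at_top sequentially \<and>
        (\<lambda>n. real n * l (c n) / c n powr \<alpha>) \<longlonglongrightarrow> 1 \<longrightarrow>
       (let a = (\<lambda>n. ((\<alpha> + 1) * \<mu> powr (\<alpha> + 1)) powr (- (1 / \<alpha>))
                        * c (nat \<lfloor>ln (real n)\<rfloor>) * ln (real n))
        in \<exists>\<nu>. real_distribution \<nu> \<and>
             (\<forall>u. char \<nu> u =
                exp (- (complex_of_real (\<bar>u\<bar> powr \<alpha> * Gamma (1 - \<alpha>)) *
                        (complex_of_real (cos (pi * \<alpha> / 2)) +
                         \<i> * complex_of_real (sin (pi * \<alpha> / 2) * sgn u))))) \<and>
             weak_conv_m (\<lambda>n. distr M borel (\<lambda>\<omega>. (ln (T n \<omega>) - b n) / a n)) \<nu>))"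
proof -
  interpret prob_space M by fact
  interpret stick_breaking M W Ws U
    using assms(2-7) by unfold_locales
  show ?thesis
    unfolding T_def \<mu>_def \<sigma>2_def b_def Let_def
    using finite_variance_limit[OF _ assms(4)] slowly_varying_trunc_square_limit regularly_varying_tail_limit
    by (intro conjI allI impI) (elim conjE, assumption | blast)+
qed

end
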